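(* Consider the closed-loop perturbation equation $$\partial_t y=\mathcal L y+\sum_{j=1}^m u_j(t)\,\nabla\cdot(y\nabla\alpha_j)+\mathcal B u(t)+\nabla\cdot(y\,\nabla W*y),\qquad u(t)=-\mathcal B^*\Pi y(t),\qquad y(0)=\mathcal P\mu_0 .$$ There exist $\varepsilon>0$ and $C>0$ such that, provided $\|y(0)\|_{\bar\mu^{-1}}\le\varepsilon$, $$\|y(t)\|_{\bar\mu^{-1}}\le C e^{-\delta t}\qquad\text{for all }t\ge0 .$$
   Context: Setting: $\Omega=\mathbb T^d=(\mathbb R/2\pi\mathbb Z)^d$, $\sigma>0$; $V\in W^{1,\infty}(\Omega)\cap W^{2,p}(\Omega)$ with $p=\max\{d,2+\epsilon\}$ for some $\epsilon>0$; $W\in W^{2,\infty}(\Omega)$ is even in each coordinate; moreover $V,W\in C^2(\Omega)$ and either $W$ is $H$-stable, i.e. $\int_{\Omega\times\Omega}W(x-y)\nu(x)\nu(y)\,dx\,dy\ge0$ for all $\nu\in L^2(\Omega)$, or $\|W\|_\infty<\sigma$. All functions are periodic. $\bar\mu$ is a fixed stationary state: a probability density with $\bar\mu=\frac1Z\exp(-\frac1\sigma(V+W*\bar\mu))$, $Z$ the normalizing constant (so $\bar\mu$ is continuous and bounded above and below by positive constants). $\mu_0$ is a probability density on $\Omega$ (the initial datum), and $\mu=\bar\mu+y$ is the controlled McKean-Vlasov density. $\mathcal X=L^2(\Omega,\bar\mu^{-1})$ with norm $\|\cdot\|_{\bar\mu^{-1}}$ and inner product $\langle f,g\rangle_{\bar\mu^{-1}}=\int_\Omega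 fg\,\bar\mu^{-1}dx$; $\mathcal X_0=\{y\in\mathcal X:\int_\Omega y=0\}$; $\mathcal P y=y-(\int_\Omega y\,dx)\bar\mu$, so that $\mathcal P\mu_0=\mu_0-\bar\mu$. On $\mathcal X_0$, $\mathcal L y=\nabla\cdot(\sigma\nabla y+y\nabla V)+\nabla\cdot(y\,\nabla W*\bar\mu+\bar\mu\,\nabla W*y)$ with domain $H^2(\Omega)\cap\mathcal X_0$. Fix $\delta>0$; $\{(\lambda_j,\psi_j)\}_{j=1}^m$ are all the eigenpairs of $\mathcal L$ with $\Re\lambda_j\ge-\delta$ (counted with multiplicity; finitely many); $\alpha_j\in W^{1,\infty}(\Omega)\cap W^{2,p}(\Omega)$ solve $\nabla\cdot(\bar\mu\nabla\alpha_j)=\psi_j$ on $\Omega$; $\mathcal B u=\sum_j u_j\nabla\cdot(\bar\mu\nabla\alpha_j)$. $\mathcal M$ is a bounded self-adjoint positive definite operator on $\mathcal X_0$ and $\Pi$ is the unique bounded self-adjoint nonnegative solution on $\mathcal X_0$ of $(\mathcal L^*+\delta I)\Pi+\Pi(\mathcal L+\delta I)-\Pi\mathcal B\mathcal B^*\Pi+\mathcal M=0$; then $\mathcal L+\delta I-\mathcal B\mathcal B^*\Pi$ generates an exponentially stable semigroup on $\mathcal X_0$. The solution $y$ is the (mild) solution with $e^{\delta t}y/\sqrt{\bar\mu}$ in $L^2(0,\infty;H^1_\sharp)\cap H^1(0,\infty;[H^1_\sharp]^* )$, where $H^1_\sharp=H^1(\Omega)\cap\{\sqrt{\bar\mu}\}^\perp$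 (orthogonality in $L^2(\Omega)$); its existence for small initial data is part of the closed-loop theory. *)

theory Defs
  imports "HOL-Probability.Probability"
begin

text \<open>
  Functions on the torus \<open>(\<real>/2\<pi>\<int>)\<^sup>d\<close> are \<open>2\<pi>\<close>-periodic Borel functions on \<open>real ^ 'd\<close>, integrated over
  the cell \<open>[0, 2\<pi>]\<^sup>d\<close>.  Elements of Lebesgue and Sobolev spaces are represented by functions;
  identities between such elements are stated almost everywhere, and operators on these spaces are
  maps on representatives.
\<close>

section \<open>Function spaces on the torus\<close>

definition torus :: "(real ^ 'd) measure" where
  "torus = restrict_space lborel (cbox 0 (\<chi> i. 2 * pi))"

definition periodic :: "(real ^ 'd \<Rightarrow> 'b) \<Rightarrow> bool" where
  "periodic f \<longleftrightarrow> (\<forall>x i. f (x + axis i (2 * pi)) = f x)"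

definition Lp :: "real \<Rightarrow> (real ^ 'd \<Rightarrow> real) set" where
  "Lp p = {f. periodic f \<and> f \<in> borel_measurable borel \<and> integrable torus (\<lambda>x. \<bar>f x\<bar> powr p)}"

definition L1 :: "(real ^ 'd \<Rightarrow> real) set" where
  "L1 = {f. periodic f \<and> f \<in> borel_measurable borel \<and> integrable torus f}"

definition L2 :: "(real ^ 'd \<Rightarrow> real) set" where
  "L2 = {f. periodic f \<and> f \<in> borel_measurable borel \<and> integrable torus (\<lambda>x. (f x)\<^sup>2)}"

definition Linf :: "(real ^ 'd \<Rightarrow> real) set" where
  "Linf = {f. periodic f \<and> f \<in> borel_measurable borel \<and> esssup torus (\<lambda>x. ereal \<bar>f x\<bar>) < \<infinity>}"

definition C1 :: "(real ^ 'd \<Rightarrow> real) \<Rightarrow> bool" where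
  "C1 f \<longleftrightarrow> (\<exists>G. (\<forall>x. GDERIV f x :> G x) \<and> continuous_on UNIV G)"

definition C2 :: "(real ^ 'd \<Rightarrow> real) \<Rightarrow> bool" where
  "C2 f \<longleftrightarrow> (\<exists>G. (\<forall>x. GDERIV f x :> G x) \<and> (\<forall>i. C1 (\<lambda>x. G x $ i)))"

definition grad :: "(real ^ 'd \<Rightarrow> real) \<Rightarrow> real ^ 'd \<Rightarrow> real ^ 'd" where
  "grad f x = (THE D. GDERIV f x :> D)"

text \<open>Weak derivatives are tested with periodic \<open>C\<^sup>1\<close> functions, which is equivalent to testing with
  periodic \<open>C\<^sup>\<infinity>\<close> functions.\<close>

definition has_weak_partial :: "'d \<Rightarrow> (real ^ 'd \<Rightarrow> real) \<Rightarrow> (real ^ 'd \<Rightarrow> real) \<Rightarrow> bool" where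
  "has_weak_partial i f g \<longleftrightarrow> f \<in> L1 \<and> g \<in> L1 \<and>
     (\<forall>\<phi>. periodic \<phi> \<and> C1 \<phi> \<longrightarrow>
        (\<integral>x. f x * grad \<phi> x $ i \<partial>torus) = - (\<integral>x. g x * \<phi> x \<partial>torus))"

definition has_weak_div :: "(real ^ 'd \<Rightarrow> real ^ 'd) \<Rightarrow> (real ^ 'd \<Rightarrow> real) \<Rightarrow> bool" where
  "has_weak_div F g \<longleftrightarrow> (\<forall>i. (\<lambda>x. F x $ i) \<in> L1) \<and> g \<in> L1 \<and>
     (\<forall>\<phi>. periodic \<phi> \<and> C1 \<phi> \<longrightarrow>
        (\<integral>x. F x \<bullet> grad \<phi> x \<partial>torus) = - (\<integral>x. g x * \<phi> x \<partial>torus))"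

text \<open>Representatives of the weak gradient and the weak divergence, which are unique almost everywhere;
  meaningful only where these exist.\<close>

definition weak_grad :: "(real ^ 'd \<Rightarrow> real) \<Rightarrow> real ^ 'd \<Rightarrow> real ^ 'd" where
  "weak_grad f = (SOME G. \<forall>i. has_weak_partial i f (\<lambda>x. G x $ i))"

definition weak_div :: "(real ^ 'd \<Rightarrow> real ^ 'd) \<Rightarrow> real ^ 'd \<Rightarrow> real" where
  "weak_div F = (SOME g. has_weak_div F g)"

text \<open>\<open>W1 A\<close> and \<open>W2 A\<close> are the first and second order Sobolev spaces over the Lebesgue space \<open>A\<close>.\<close>

definition W1 :: "(real ^ 'd \<Rightarrow> real) set \<Rightarrow> (real ^ 'd \<Rightarrow> real) set" where
  "W1 A = {f \<in> A. \<forall>i. \<exists>g \<in> A. has_weak_partial i f g}"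

definition W2 :: "(real ^ 'd \<Rightarrow> real) set \<Rightarrow> (real ^ 'd \<Rightarrow> real) set" where
  "W2 A = {f \<in> A. \<forall>i. \<exists>g \<in> W1 A. has_weak_partial i f g}"

abbreviation H1 :: "(real ^ 'd \<Rightarrow> real) set" where "H1 \<equiv> W1 L2"

abbreviation H2 :: "(real ^ 'd \<Rightarrow> real) set" where "H2 \<equiv> W2 L2"

definition H1_inner :: "(real ^ 'd \<Rightarrow> real) \<Rightarrow> (real ^ 'd \<Rightarrow> real) \<Rightarrow> real" where
  "H1_inner f g = (\<integral>x. f x * g x + weak_grad f x \<bullet> weak_grad g x \<partial>torus)"

definition H1_norm :: "(real ^ 'd \<Rightarrow> real) \<Rightarrow> real" where
  "H1_norm f = sqrt (H1_inner f f)"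


section \<open>Potentials and the stationary state\<close>

definition conv :: "(real ^ 'd \<Rightarrow> real) \<Rightarrow> (real ^ 'd \<Rightarrow> real) \<Rightarrow> real ^ 'd \<Rightarrow> real" where
  "conv W f x = (\<integral>y. W (x - y) * f y \<partial>torus)"

definition grad_conv :: "(real ^ 'd \<Rightarrow> real) \<Rightarrow> (real ^ 'd \<Rightarrow> real) \<Rightarrow> real ^ 'd \<Rightarrow> real ^ 'd" where
  "grad_conv W f x = (\<integral>y. f y *\<^sub>R grad W (x - y) \<partial>torus)"

definition even_each_coordinate :: "(real ^ 'd \<Rightarrow> real) \<Rightarrow> bool" where
  "even_each_coordinate W \<longleftrightarrow> (\<forall>x i. W (\<chi> k. if k = i then - (x $ k) else x $ k) = W x)"

definition H_stable :: "(real ^ 'd \<Rightarrow> real) \<Rightarrow> bool" where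
  "H_stable W \<longleftrightarrow>
     (\<forall>\<nu> \<in> L2. 0 \<le> (\<integral>(x, y). W (x - y) * \<nu> x * \<nu> y \<partial>(torus \<Otimes>\<^sub>M torus)))"

definition probability_density :: "(real ^ 'd \<Rightarrow> real) \<Rightarrow> bool" where
  "probability_density f \<longleftrightarrow>
     f \<in> L1 \<and> (AE x in torus. 0 \<le> f x) \<and> (\<integral>x. f x \<partial>torus) = 1"

definition stationary_state ::
  "real \<Rightarrow> (real ^ 'd \<Rightarrow> real) \<Rightarrow> (real ^ 'd \<Rightarrow> real) \<Rightarrow> (real ^ 'd \<Rightarrow> real) \<Rightarrow> bool" where
  "stationary_state \<sigma> V W \<rho> \<longleftrightarrow> probability_density \<rho> \<and>
     (\<forall>x. \<rho> x = exp (- (V x + conv W \<rho> x) / \<sigma>)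
              / (\<integral>z. exp (- (V z + conv W \<rho> z) / \<sigma>) \<partial>torus))"


section \<open>The weighted space; below, \<open>\<rho>\<close> is the stationary state\<close>

definition X :: "(real ^ 'd \<Rightarrow> real) \<Rightarrow> (real ^ 'd \<Rightarrow> real) set" where
  "X \<rho> = {f. periodic f \<and> f \<in> borel_measurable borel \<and> integrable torus (\<lambda>x. (f x)\<^sup>2 / \<rho> x)}"

definition X0 :: "(real ^ 'd \<Rightarrow> real) \<Rightarrow> (real ^ 'd \<Rightarrow> real) set" where
  "X0 \<rho> = {f \<in> X \<rho>. (\<integral>x. f x \<partial>torus) = 0}"

definition X_inner ::
  "(real ^ 'd \<Rightarrow> real) \<Rightarrow> (real ^ 'd \<Rightarrow> real) \<Rightarrow> (real ^ 'd \<Rightarrow> real) \<Rightarrow> real" where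
  "X_inner \<rho> f g = (\<integral>x. f x * g x / \<rho> x \<partial>torus)"

definition X_norm :: "(real ^ 'd \<Rightarrow> real) \<Rightarrow> (real ^ 'd \<Rightarrow> real) \<Rightarrow> real" where
  "X_norm \<rho> f = sqrt (X_inner \<rho> f f)"

definition proj :: "(real ^ 'd \<Rightarrow> real) \<Rightarrow> (real ^ 'd \<Rightarrow> real) \<Rightarrow> real ^ 'd \<Rightarrow> real" where
  "proj \<rho> f x = f x - (\<integral>z. f z \<partial>torus) * \<rho> x"

type_synonym 'd operator = "(real ^ 'd \<Rightarrow> real) \<Rightarrow> real ^ 'd \<Rightarrow> real"

text \<open>Linearity and boundedness together imply that the operator respects equality almost everywhere.\<close>

definition bounded_operator :: "(real ^ 'd \<Rightarrow> real) \<Rightarrow> 'd operator \<Rightarrow> bool" where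
  "bounded_operator \<rho> T \<longleftrightarrow>
     (\<forall>f \<in> X0 \<rho>. T f \<in> X0 \<rho>) \<and>
     (\<forall>f \<in> X0 \<rho>. \<forall>g \<in> X0 \<rho>. \<forall>a b.
        AE x in torus. T (\<lambda>x. a * f x + b * g x) x = a * T f x + b * T g x) \<and>
     (\<exists>C. \<forall>f \<in> X0 \<rho>. X_norm \<rho> (T f) \<le> C * X_norm \<rho> f)"

definition self_adjoint :: "(real ^ 'd \<Rightarrow> real) \<Rightarrow> 'd operator \<Rightarrow> bool" where
  "self_adjoint \<rho> T \<longleftrightarrow> (\<forall>f \<in> X0 \<rho>. \<forall>g \<in> X0 \<rho>. X_inner \<rho> (T f) g = X_inner \<rho> f (T g))"

definition nonnegative :: "(real ^ 'd \<Rightarrow> real) \<Rightarrow> 'd operator \<Rightarrow> bool" where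
  "nonnegative \<rho> T \<longleftrightarrow> (\<forall>f \<in> X0 \<rho>. 0 \<le> X_inner \<rho> (T f) f)"

definition positive_definite :: "(real ^ 'd \<Rightarrow> real) \<Rightarrow> 'd operator \<Rightarrow> bool" where
  "positive_definite \<rho> T \<longleftrightarrow>
     (\<forall>f \<in> X0 \<rho>. \<not> (AE x in torus. f x = 0) \<longrightarrow> 0 < X_inner \<rho> (T f) f)"


section \<open>The linearised operator\<close>

definition diffusion_drift_flux ::
  "real \<Rightarrow> (real ^ 'd \<Rightarrow> real) \<Rightarrow> (real ^ 'd \<Rightarrow> real) \<Rightarrow> real ^ 'd \<Rightarrow> real ^ 'd" where
  "diffusion_drift_flux \<sigma> V y x = \<sigma> *\<^sub>R weak_grad y x + y x *\<^sub>R grad V x"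

definition interaction_flux ::
  "(real ^ 'd \<Rightarrow> real) \<Rightarrow> (real ^ 'd \<Rightarrow> real) \<Rightarrow> (real ^ 'd \<Rightarrow> real) \<Rightarrow> real ^ 'd \<Rightarrow> real ^ 'd" where
  "interaction_flux W \<rho> y x = y x *\<^sub>R grad_conv W \<rho> x + \<rho> x *\<^sub>R grad_conv W y x"

definition dom_L :: "(real ^ 'd \<Rightarrow> real) \<Rightarrow> (real ^ 'd \<Rightarrow> real) set" where
  "dom_L \<rho> = H2 \<inter> X0 \<rho>"

definition op_L ::
  "real \<Rightarrow> (real ^ 'd \<Rightarrow> real) \<Rightarrow> (real ^ 'd \<Rightarrow> real) \<Rightarrow> (real ^ 'd \<Rightarrow> real) \<Rightarrow> 'd operator" where
  "op_L \<sigma> V W \<rho> y x =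
     weak_div (diffusion_drift_flux \<sigma> V y) x + weak_div (interaction_flux W \<rho> y) x"

text \<open>\<open>adjoint_graph \<rho> D A h k\<close>: \<open>h\<close> lies in the domain of the adjoint in \<open>X0 \<rho>\<close> of the densely defined
  operator \<open>A\<close> with domain \<open>D\<close>, and the adjoint maps \<open>h\<close> to \<open>k\<close>.\<close>

definition adjoint_graph ::
  "(real ^ 'd \<Rightarrow> real) \<Rightarrow> (real ^ 'd \<Rightarrow> real) set \<Rightarrow> 'd operator \<Rightarrow>
     (real ^ 'd \<Rightarrow> real) \<Rightarrow> (real ^ 'd \<Rightarrow> real) \<Rightarrow> bool" where
  "adjoint_graph \<rho> D A h k \<longleftrightarrow> h \<in> X0 \<rho> \<and> k \<in> X0 \<rho> \<and>
     (\<forall>g \<in> D. X_inner \<rho> (A g) h = X_inner \<rho> g k)"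

text \<open>Eigenpairs of the complexification of \<open>op_L\<close>.\<close>

definition eigenpair ::
  "real \<Rightarrow> (real ^ 'd \<Rightarrow> real) \<Rightarrow> (real ^ 'd \<Rightarrow> real) \<Rightarrow> (real ^ 'd \<Rightarrow> real) \<Rightarrow>
     complex \<Rightarrow> (real ^ 'd \<Rightarrow> complex) \<Rightarrow> bool" where
  "eigenpair \<sigma> V W \<rho> l \<psi> \<longleftrightarrow>
     (\<lambda>x. Re (\<psi> x)) \<in> dom_L \<rho> \<and> (\<lambda>x. Im (\<psi> x)) \<in> dom_L \<rho> \<and>
     \<not> (AE x in torus. \<psi> x = 0) \<and>
     (AE x in torus.
        Complex (op_L \<sigma> V W \<rho> (\<lambda>x. Re (\<psi> x)) x) (op_L \<sigma> V W \<rho> (\<lambda>x. Im (\<psi> x)) x) = l * \<psi> x)"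

text \<open>\<open>(l j, \<psi> j)\<close>, \<open>j < m\<close>, are all eigenpairs with \<open>Re (l j) \<ge> - \<delta>\<close>, counted with multiplicity: the
  \<open>\<psi> j\<close> are linearly independent, and those with \<open>l j = z\<close> span the eigenspace of \<open>z\<close>.  The \<open>\<psi> j\<close> are
  real because they are the divergences of real vector fields; completeness refers to all complex
  eigenpairs.\<close>

definition all_eigenpairs ::
  "real \<Rightarrow> (real ^ 'd \<Rightarrow> real) \<Rightarrow> (real ^ 'd \<Rightarrow> real) \<Rightarrow> (real ^ 'd \<Rightarrow> real) \<Rightarrow> real \<Rightarrow>
     nat \<Rightarrow> (nat \<Rightarrow> complex) \<Rightarrow> (nat \<Rightarrow> real ^ 'd \<Rightarrow> real) \<Rightarrow> bool" where
  "all_eigenpairs \<sigma> V W \<rho> \<delta> m l \<psi> \<longleftrightarrow>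
     (\<forall>j<m. eigenpair \<sigma> V W \<rho> (l j) (\<lambda>x. complex_of_real (\<psi> j x)) \<and> - \<delta> \<le> Re (l j)) \<and>
     (\<forall>c :: nat \<Rightarrow> real. (AE x in torus. (\<Sum>j<m. c j * \<psi> j x) = 0) \<longrightarrow> (\<forall>j<m. c j = 0)) \<and>
     (\<forall>z f. eigenpair \<sigma> V W \<rho> z f \<and> - \<delta> \<le> Re z \<longrightarrow>
        (\<exists>c :: nat \<Rightarrow> complex.
           AE x in torus. f x = (\<Sum>j | j < m \<and> l j = z. c j * complex_of_real (\<psi> j x))))"


section \<open>Control operator, Riccati equation and closed-loop semigroup\<close>

text \<open>Controls in \<open>\<real>\<^sup>m\<close> are functions on \<open>nat\<close> of which only the values below \<open>m\<close> matter.\<close>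

definition op_B ::
  "(real ^ 'd \<Rightarrow> real) \<Rightarrow> nat \<Rightarrow> (nat \<Rightarrow> real ^ 'd \<Rightarrow> real) \<Rightarrow> (nat \<Rightarrow> real) \<Rightarrow> real ^ 'd \<Rightarrow> real" where
  "op_B \<rho> m \<alpha> u x = (\<Sum>j<m. u j * weak_div (\<lambda>z. \<rho> z *\<^sub>R weak_grad (\<alpha> j) z) x)"

text \<open>The \<open>j\<close>-th component of \<open>B* f\<close> is the inner product of \<open>B e\<^sub>j\<close> and \<open>f\<close>.\<close>

definition op_B_adj ::
  "(real ^ 'd \<Rightarrow> real) \<Rightarrow> nat \<Rightarrow> (nat \<Rightarrow> real ^ 'd \<Rightarrow> real) \<Rightarrow> (real ^ 'd \<Rightarrow> real) \<Rightarrow> nat \<Rightarrow> real" where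
  "op_B_adj \<rho> m \<alpha> f j = X_inner \<rho> (op_B \<rho> m \<alpha> (\<lambda>i. if i = j then 1 else 0)) f"

text \<open>The Riccati equation is an operator identity on the domain of \<open>L\<close>, which includes that \<open>P\<close> maps this
  domain into the domain of \<open>L*\<close>; \<open>k\<close> below is \<open>L* (P f)\<close>.\<close>

definition riccati_solution ::
  "real \<Rightarrow> (real ^ 'd \<Rightarrow> real) \<Rightarrow> (real ^ 'd \<Rightarrow> real) \<Rightarrow> (real ^ 'd \<Rightarrow> real) \<Rightarrow> real \<Rightarrow>
     nat \<Rightarrow> (nat \<Rightarrow> real ^ 'd \<Rightarrow> real) \<Rightarrow> 'd operator \<Rightarrow> 'd operator \<Rightarrow> bool" where
  "riccati_solution \<sigma> V W \<rho> \<delta> m \<alpha> M P \<longleftrightarrow>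
     bounded_operator \<rho> P \<and> self_adjoint \<rho> P \<and> nonnegative \<rho> P \<and>
     (\<forall>f \<in> dom_L \<rho>. \<exists>k. adjoint_graph \<rho> (dom_L \<rho>) (op_L \<sigma> V W \<rho>) (P f) k \<and>
        (AE x in torus.
           (k x + \<delta> * P f x) + P (\<lambda>z. op_L \<sigma> V W \<rho> f z + \<delta> * f z) x
             - P (op_B \<rho> m \<alpha> (op_B_adj \<rho> m \<alpha> (P f))) x + M f x = 0))"

definition C0_semigroup :: "(real ^ 'd \<Rightarrow> real) \<Rightarrow> (real \<Rightarrow> 'd operator) \<Rightarrow> bool" where
  "C0_semigroup \<rho> S \<longleftrightarrow>
     (\<forall>t\<ge>0. bounded_operator \<rho> (S t)) \<and>
     (\<forall>f \<in> X0 \<rho>. AE x in torus. S 0 f x = f x) \<and>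
     (\<forall>f \<in> X0 \<rho>. \<forall>s\<ge>0. \<forall>t\<ge>0. AE x in torus. S (s + t) f x = S s (S t f) x) \<and>
     (\<forall>f \<in> X0 \<rho>. ((\<lambda>t. X_norm \<rho> (\<lambda>x. S t f x - f x)) \<longlongrightarrow> 0) (at_right 0))"

definition generator_graph ::
  "(real ^ 'd \<Rightarrow> real) \<Rightarrow> (real \<Rightarrow> 'd operator) \<Rightarrow>
     (real ^ 'd \<Rightarrow> real) \<Rightarrow> (real ^ 'd \<Rightarrow> real) \<Rightarrow> bool" where
  "generator_graph \<rho> S f g \<longleftrightarrow> f \<in> X0 \<rho> \<and> g \<in> X0 \<rho> \<and>
     ((\<lambda>h. X_norm \<rho> (\<lambda>x. (S h f x - f x) / h - g x)) \<longlongrightarrow> 0) (at_right 0)"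

definition generates_exp_stable_semigroup ::
  "(real ^ 'd \<Rightarrow> real) \<Rightarrow> (real ^ 'd \<Rightarrow> real) set \<Rightarrow> 'd operator \<Rightarrow> bool" where
  "generates_exp_stable_semigroup \<rho> D A \<longleftrightarrow>
     (\<exists>S. C0_semigroup \<rho> S \<and>
        (\<forall>f \<in> X0 \<rho>. \<forall>g \<in> X0 \<rho>.
           generator_graph \<rho> S f g \<longleftrightarrow> f \<in> D \<and> (AE x in torus. g x = A f x)) \<and>
        (\<exists>K \<omega>. 0 < \<omega> \<and>
           (\<forall>t\<ge>0. \<forall>f \<in> X0 \<rho>. X_norm \<rho> (S t f) \<le> K * exp (- \<omega> * t) * X_norm \<rho> f)))"

definition closed_loop ::
  "real \<Rightarrow> (real ^ 'd \<Rightarrow> real) \<Rightarrow> (real ^ 'd \<Rightarrow> real) \<Rightarrow> (real ^ 'd \<Rightarrow> real) \<Rightarrow> real \<Rightarrow>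
     nat \<Rightarrow> (nat \<Rightarrow> real ^ 'd \<Rightarrow> real) \<Rightarrow> 'd operator \<Rightarrow> 'd operator" where
  "closed_loop \<sigma> V W \<rho> \<delta> m \<alpha> P f x =
     op_L \<sigma> V W \<rho> f x + \<delta> * f x - op_B \<rho> m \<alpha> (op_B_adj \<rho> m \<alpha> (P f)) x"


section \<open>Solutions of the nonlinear closed-loop equation\<close>

definition H1_sharp :: "(real ^ 'd \<Rightarrow> real) \<Rightarrow> (real ^ 'd \<Rightarrow> real) set" where
  "H1_sharp \<rho> = {f \<in> H1. (\<integral>x. f x * sqrt (\<rho> x) \<partial>torus) = 0}"

definition H1_sharp_dual ::
  "(real ^ 'd \<Rightarrow> real) \<Rightarrow> ((real ^ 'd \<Rightarrow> real) \<Rightarrow> real) set" where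
  "H1_sharp_dual \<rho> = {G.
     (\<forall>\<phi> \<in> H1_sharp \<rho>. \<forall>\<theta> \<in> H1_sharp \<rho>. \<forall>a b. G (\<lambda>x. a * \<phi> x + b * \<theta> x) = a * G \<phi> + b * G \<theta>) \<and>
     (\<exists>C. \<forall>\<phi> \<in> H1_sharp \<rho>. \<bar>G \<phi>\<bar> \<le> C * H1_norm \<phi>)}"

definition dual_norm :: "(real ^ 'd \<Rightarrow> real) \<Rightarrow> ((real ^ 'd \<Rightarrow> real) \<Rightarrow> real) \<Rightarrow> real" where
  "dual_norm \<rho> G = (SUP \<phi> \<in> {\<phi> \<in> H1_sharp \<rho>. H1_norm \<phi> \<le> 1}. \<bar>G \<phi>\<bar>)"

text \<open>Bochner spaces over \<open>(0, \<infinity>)\<close>.  As \<open>H1_sharp \<rho>\<close> is a separable Hilbert space, strong measurability is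
  the same as weak measurability (Pettis).\<close>

abbreviation halfline :: "real measure" where
  "halfline \<equiv> lebesgue_on {0<..}"

definition L2_time_H1_sharp ::
  "(real ^ 'd \<Rightarrow> real) \<Rightarrow> (real \<Rightarrow> real ^ 'd \<Rightarrow> real) \<Rightarrow> bool" where
  "L2_time_H1_sharp \<rho> z \<longleftrightarrow>
     (AE t in halfline. z t \<in> H1_sharp \<rho>) \<and>
     (\<forall>\<phi> \<in> H1_sharp \<rho>. (\<lambda>t. H1_inner (z t) \<phi>) \<in> borel_measurable halfline) \<and>
     integrable halfline (\<lambda>t. (H1_norm (z t))\<^sup>2)"

definition L2_time_H1_sharp_dual ::
  "(real ^ 'd \<Rightarrow> real) \<Rightarrow> (real \<Rightarrow> (real ^ 'd \<Rightarrow> real) \<Rightarrow> real) \<Rightarrow> bool" where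
  "L2_time_H1_sharp_dual \<rho> G \<longleftrightarrow>
     (AE t in halfline. G t \<in> H1_sharp_dual \<rho>) \<and>
     (\<forall>\<phi> \<in> H1_sharp \<rho>. (\<lambda>t. G t \<phi>) \<in> borel_measurable halfline) \<and>
     integrable halfline (\<lambda>t. (dual_norm \<rho> (G t))\<^sup>2)"

definition weak_time_deriv :: "(real \<Rightarrow> real) \<Rightarrow> (real \<Rightarrow> real) \<Rightarrow> bool" where
  "weak_time_deriv f g \<longleftrightarrow>
     (\<forall>\<eta> \<eta>'. (\<forall>t. (\<eta> has_real_derivative \<eta>' t) (at t)) \<and> continuous_on UNIV \<eta>' \<and>
        (\<exists>a b. 0 < a \<and> (\<forall>t. t \<notin> {a..b} \<longrightarrow> \<eta> t = 0)) \<longrightarrow>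
        integrable halfline (\<lambda>t. f t * \<eta>' t) \<and> integrable halfline (\<lambda>t. g t * \<eta> t) \<and>
        (\<integral>t. f t * \<eta>' t \<partial>halfline) = - (\<integral>t. g t * \<eta> t \<partial>halfline))"

text \<open>\<open>z \<in> L\<^sup>2(0,\<infinity>; H1_sharp) \<inter> H\<^sup>1(0,\<infinity>; H1_sharp*)\<close>, where \<open>z t\<close> is identified with the functional
  \<open>\<phi> \<mapsto> \<integral> z t \<phi>\<close> (Gelfand triple with pivot space \<open>L\<^sup>2\<close>).  Such a \<open>z\<close> with \<open>z \<in> L\<^sup>2(0,\<infinity>; H1_sharp)\<close> is
  automatically in \<open>L\<^sup>2(0,\<infinity>; H1_sharp*)\<close>, so only the derivative has to be required.\<close>

definition solution_class ::
  "(real ^ 'd \<Rightarrow> real) \<Rightarrow> (real \<Rightarrow> real ^ 'd \<Rightarrow> real) \<Rightarrow> bool" where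
  "solution_class \<rho> z \<longleftrightarrow> L2_time_H1_sharp \<rho> z \<and>
     (\<exists>G. L2_time_H1_sharp_dual \<rho> G \<and>
        (\<forall>\<phi> \<in> H1_sharp \<rho>. weak_time_deriv (\<lambda>t. \<integral>x. z t x * \<phi> x \<partial>torus) (\<lambda>t. G t \<phi>)))"

text \<open>The right-hand side of the equation for the state \<open>y\<close> and the control \<open>u\<close>, as a functional on \<open>H\<^sup>1\<close>:
  the divergence of a flux \<open>F\<close> acts as \<open>\<phi> \<mapsto> - \<integral> F \<bullet> \<nabla>\<phi>\<close>.\<close>

definition rhs ::
  "real \<Rightarrow> (real ^ 'd \<Rightarrow> real) \<Rightarrow> (real ^ 'd \<Rightarrow> real) \<Rightarrow> (real ^ 'd \<Rightarrow> real) \<Rightarrow>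
     nat \<Rightarrow> (nat \<Rightarrow> real ^ 'd \<Rightarrow> real) \<Rightarrow> (nat \<Rightarrow> real) \<Rightarrow> (real ^ 'd \<Rightarrow> real) \<Rightarrow> (real ^ 'd \<Rightarrow> real) \<Rightarrow> real"
  where
  "rhs \<sigma> V W \<rho> m \<alpha> u y \<phi> =
     - (\<integral>x. (diffusion_drift_flux \<sigma> V y x + interaction_flux W \<rho> y x) \<bullet> weak_grad \<phi> x \<partial>torus)
     - (\<Sum>j<m. u j * (\<integral>x. (y x *\<^sub>R weak_grad (\<alpha> j) x) \<bullet> weak_grad \<phi> x \<partial>torus))
     + (\<integral>x. op_B \<rho> m \<alpha> u x * \<phi> x \<partial>torus)
     - (\<integral>x. (y x *\<^sub>R grad_conv W y x) \<bullet> weak_grad \<phi> x \<partial>torus)"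

text \<open>Solutions with initial value \<open>y\<^sub>0\<close>: the state is the representative that is continuous in time with
  values in \<open>X0 \<rho>\<close>, and the equation holds in the sense of distributions in time with values in the
  dual of \<open>H\<^sup>1\<close>.\<close>

definition closed_loop_solution ::
  "real \<Rightarrow> (real ^ 'd \<Rightarrow> real) \<Rightarrow> (real ^ 'd \<Rightarrow> real) \<Rightarrow> (real ^ 'd \<Rightarrow> real) \<Rightarrow> real \<Rightarrow>
     nat \<Rightarrow> (nat \<Rightarrow> real ^ 'd \<Rightarrow> real) \<Rightarrow> 'd operator \<Rightarrow>
     (real ^ 'd \<Rightarrow> real) \<Rightarrow> (real \<Rightarrow> real ^ 'd \<Rightarrow> real) \<Rightarrow> bool" where
  "closed_loop_solution \<sigma> V W \<rho> \<delta> m \<alpha> P y\<^sub>0 y \<longleftrightarrow>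
     (\<forall>t\<ge>0. y t \<in> X0 \<rho>) \<and>
     (\<forall>s\<ge>0. ((\<lambda>t. X_norm \<rho> (\<lambda>x. y t x - y s x)) \<longlongrightarrow> 0) (at s within {0..})) \<and>
     (AE x in torus. y 0 x = y\<^sub>0 x) \<and>
     solution_class \<rho> (\<lambda>t x. exp (\<delta> * t) * y t x / sqrt (\<rho> x)) \<and>
     (\<forall>\<phi> \<in> H1. weak_time_deriv (\<lambda>t. \<integral>x. y t x * \<phi> x \<partial>torus)
        (\<lambda>t. rhs \<sigma> V W \<rho> m \<alpha> (\<lambda>j. - op_B_adj \<rho> m \<alpha> (P (y t)) j) (y t) \<phi>))"

end

theory Submission
  imports Defs
begin

text \<open>Measured in the weighted space, the closed-loop equation has the form
  \<open>z' = A z + N(z)\<close> with a bilinear form \<open>A\<close> satisfying a Garding inequality and a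
  nonlinearity that is quadratic: \<open>\<bar>N(z) \<phi>\<bar> \<le> N \<parallel>z\<parallel>\<^sup>2 \<parallel>\<phi>\<parallel>\<close> with the
  Sobolev norm only on the test function \<open>\<phi>\<close>.  Averaging a weak solution over short time intervals
  gives a differentiable path, so that energy estimates hold without any theory of Lions-Magenes
  type.  They are applied to the difference of a solution and an orbit of the exponentially stable
  linear semigroup \<open>S\<close> over a fixed time \<open>T\<close>, and yield
  \<open>\<parallel>z(a + T) - exp (- \<delta> T) S(T) z(a)\<parallel> \<le> \<Gamma> \<parallel>z(a)\<parallel>\<^sup>2\<close>.  If \<open>T\<close> is large and \<open>z(0)\<close> is small,
  iterating this at the times \<open>n T\<close> gives decay with rate \<open>\<delta>\<close>, because the linear rate is strictly
  larger.\<close>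

section \<open>Square integrable functions on the torus\<close>

text \<open>Dividing the state by \<open>sqrt (\<rho> x)\<close> turns the weighted space into plain
  L2 and zero mean into orthogonality to the root of \<rho>; test functions are multiplied by the
  same factor, so pairings are unchanged. H1 is carried as the closed subspace of pairs (function,
  gradient) in a product of L2 spaces, where Riesz representation supplies time averages of merely
  weakly measurable paths. The nonlinearity is quadratic in the L2 norm alone because control
  amplitudes are bounded functionals of the state, the gradients of \<alpha> are bounded, and
  convolution with a C1 kernel maps L2 to bounded functions; the norm of the test function is then
  absorbed by coercivity. The iteration in discrete time takes the place of a Lyapunov functional:
  the semigroup bound has a constant K that may exceed 1, and a long time step defeats it. Two
  features of the weak formulation dictate the bookkeeping. Test functions in time vanish near 0, so
  estimates start at some a > 0 and continuity at 0 closes the gap. Averages over [t, t + h] look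
  ahead, so bounds are required on slightly longer intervals.\<close>

lemma space_torus: "space torus = cbox 0 (\<chi> i. 2 * pi)"
  by (simp add: torus_def space_restrict_space)

lemma finite_measure_torus: "finite_measure (torus :: (real ^ 'd) measure)"
proof
  have "emeasure (torus :: (real ^ 'd) measure) (space torus) = emeasure lborel (cbox 0 (\<chi> i. 2 * pi) :: (real ^ 'd) set)"
    unfolding space_torus by (simp add: torus_def emeasure_restrict_space)
  then show "emeasure (torus :: (real ^ 'd) measure) (space torus) \<noteq> \<infinity>"
    using emeasure_lborel_cbox_finite[of "0 :: real ^ 'd" "\<chi> i. 2 * pi"]
    by (simp add: less_top)
qed

interpretation torus: finite_measure torus
  by (rule finite_measure_torus)

lemma borel_measurable_torus [measurable (raw)]:
  "f \<in> borel_measurable borel \<Longrightarrow> f \<in> borel_measurable torus"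
  unfolding torus_def by (intro measurable_restrict_space1) auto

lemma integral_torus:
  fixes f :: "real ^ 'd \<Rightarrow> real"
  shows "(\<integral>x. f x \<partial>torus) = (\<integral>x. indicator (cbox 0 (\<chi> i. 2 * pi)) x * f x \<partial>lborel)"
  unfolding torus_def by (subst integral_restrict_space) auto

lemma integrable_torus_bounded:
  fixes f :: "real ^ 'd \<Rightarrow> real"
  assumes "f \<in> borel_measurable borel" "\<And>x. \<bar>f x\<bar> \<le> K"
  shows "integrable torus f"
  by (rule torus.integrable_const_bound[where B = K]) (use assms in auto)

lemma L2_integrable_mult:
  assumes "f \<in> L2" "g \<in> L2"
  shows "integrable torus (\<lambda>x. f x * g x)"
proof (rule Bochner_Integration.integrable_bound[of _ "\<lambda>x. (f x)\<^sup>2 + (g x)\<^sup>2"])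
  show "integrable torus (\<lambda>x. (f x)\<^sup>2 + (g x)\<^sup>2)"
    using assms by (auto simp: L2_def)
  show "(\<lambda>x. f x * g x) \<in> borel_measurable torus"
    using assms by (auto simp: L2_def)
  have "\<bar>a * b\<bar> \<le> a\<^sup>2 + b\<^sup>2" for a b :: real
  proof -
    have "2 * (\<bar>a\<bar> * \<bar>b\<bar>) \<le> a\<^sup>2 + b\<^sup>2"
      using sum_squares_bound[of "\<bar>a\<bar>" "\<bar>b\<bar>"] by simp
    moreover have "0 \<le> \<bar>a\<bar> * \<bar>b\<bar>" by simp
    ultimately show ?thesis unfolding abs_mult by linarith
  qed
  then show "AE x in torus. norm (f x * g x) \<le> norm ((f x)\<^sup>2 + (g x)\<^sup>2)"
    by simp
qed

lemma periodic_const: "periodic (\<lambda>x. c)"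
  by (simp add: periodic_def)

lemma L2_bounded:
  fixes f :: "real ^ 'd \<Rightarrow> real"
  assumes "periodic f" "f \<in> borel_measurable borel" "\<And>x. \<bar>f x\<bar> \<le> K"
  shows "f \<in> L2"
proof -
  have "(f x)\<^sup>2 \<le> K\<^sup>2" for x
    using power_mono[OF assms(3), of x 2] by simp
  then have "integrable torus (\<lambda>x. (f x)\<^sup>2)"
    using assms(2) by (intro integrable_torus_bounded[where K = "K\<^sup>2"]) auto
  then show ?thesis
    using assms by (simp add: L2_def)
qed

lemma L2_const: "(\<lambda>x. c) \<in> L2"
  by (rule L2_bounded[where K = "\<bar>c\<bar>"]) (auto simp: periodic_const)

lemma L2_imp_L1:
  assumes "f \<in> L2"
  shows "f \<in> L1"
  using L2_integrable_mult[OF assms L2_const[of 1]] assms by (simp add: L1_def L2_def)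

lemma L2_integrable: "f \<in> L2 \<Longrightarrow> integrable torus f"
  using L2_imp_L1 by (auto simp: L1_def)

lemma L2_measurable: "f \<in> L2 \<Longrightarrow> f \<in> borel_measurable borel"
  by (auto simp: L2_def)

lemma L1_measurable: "f \<in> L1 \<Longrightarrow> f \<in> borel_measurable borel"
  by (auto simp: L1_def)

lemma L2_add:
  assumes "f \<in> L2" "g \<in> L2"
  shows "(\<lambda>x. f x + g x) \<in> L2"
proof -
  have "integrable torus (\<lambda>x. (f x)\<^sup>2 + 2 * (f x * g x) + (g x)\<^sup>2)"
    using L2_integrable_mult[OF assms] assms by (intro Bochner_Integration.integrable_add) (auto simp: L2_def)
  then have "integrable torus (\<lambda>x. (f x + g x)\<^sup>2)"
    by (simp add: power2_sum algebra_simps)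
  then show ?thesis
    using assms by (auto simp: L2_def periodic_def)
qed

lemma L2_mult_bounded:
  assumes f: "f \<in> L2" and g: "periodic g" "g \<in> borel_measurable borel" "\<And>x. \<bar>g x\<bar> \<le> K"
  shows "(\<lambda>x. g x * f x) \<in> L2"
proof -
  have "integrable torus (\<lambda>x. (g x * f x)\<^sup>2)"
  proof (rule Bochner_Integration.integrable_bound[of _ "\<lambda>x. K\<^sup>2 * (f x)\<^sup>2"])
    show "integrable torus (\<lambda>x. K\<^sup>2 * (f x)\<^sup>2)"
      using f by (auto simp: L2_def)
    show "(\<lambda>x. (g x * f x)\<^sup>2) \<in> borel_measurable torus"
      using f g by (auto simp: L2_def)
    have "(g x)\<^sup>2 \<le> K\<^sup>2" for x
      using power_mono[OF g(3), of x 2] by simp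
    then show "AE x in torus. norm ((g x * f x)\<^sup>2) \<le> norm (K\<^sup>2 * (f x)\<^sup>2)"
      by (auto simp: power_mult_distrib intro!: mult_right_mono)
  qed
  then show ?thesis
    using f g by (auto simp: L2_def periodic_def)
qed

lemma L2_scale:
  assumes "f \<in> L2"
  shows "(\<lambda>x. c * f x) \<in> L2"
  using L2_mult_bounded[OF assms periodic_const, of c "\<bar>c\<bar>"] by simp

lemma L2_minus:
  assumes "f \<in> L2"
  shows "(\<lambda>x. - f x) \<in> L2"
  using L2_scale[OF assms, of "-1"] by simp

lemma L2_diff:
  assumes "f \<in> L2" "g \<in> L2"
  shows "(\<lambda>x. f x - g x) \<in> L2"
  using L2_add[OF assms(1) L2_scale[OF assms(2), of "-1"]] by simp

lemma L2_sum:
  assumes "\<And>i. i \<in> I \<Longrightarrow> f i \<in> L2"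
  shows "(\<lambda>x. \<Sum>i\<in>I. f i x) \<in> L2"
  using assms by (induction I rule: infinite_finite_induct) (auto intro: L2_const L2_add)

lemma L2_cong_AE:
  assumes "f \<in> L2" "AE x in torus. f x = g x" "periodic g" "g \<in> borel_measurable borel"
  shows "g \<in> L2"
proof -
  have "integrable torus (\<lambda>x. (f x)\<^sup>2) \<longleftrightarrow> integrable torus (\<lambda>x. (g x)\<^sup>2)"
    using assms by (intro integrable_cong_AE) (auto simp: L2_def)
  then show ?thesis
    using assms by (simp add: L2_def)
qed

subsection \<open>The Hilbert space of square integrable functions\<close>

\<comment> \<open>A type of its own makes L2 an instance of the classes \<open>real_inner\<close>
  and \<open>banach\<close>, on which Riesz representation and the abstract evolution theory rest.
  The relation is partial, so that every representative \<open>rep F\<close> is square integrable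
  without side conditions.\<close>
quotient_type 'd l2 =
  "real ^ ('d :: finite) \<Rightarrow> real" / partial: "\<lambda>f g. f \<in> L2 \<and> g \<in> L2 \<and> (AE x in torus. f x = g x)"
  morphisms rep cls
proof (rule part_equivpI)
  show "\<exists>f :: real ^ 'd \<Rightarrow> real. f \<in> L2 \<and> f \<in> L2 \<and> (AE x in torus. f x = f x)"
    using L2_const[of 0] by auto
qed (auto simp: symp_def transp_def elim!: AE_mp)

lemma rep_L2 [simp]: "rep F \<in> L2"
  using Quotient_rep_reflp[OF Quotient_l2] by blast

lemma cls_rep [simp]: "cls (rep F) = F"
  by (rule Quotient_abs_rep[OF Quotient_l2])

lemma cls_eq_iff: "f \<in> L2 \<Longrightarrow> g \<in> L2 \<Longrightarrow> cls f = cls g \<longleftrightarrow> (AE x in torus. f x = g x)"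
  using Quotient_rel[OF Quotient_l2, of f g] by auto

lemma rep_cls: "f \<in> L2 \<Longrightarrow> AE x in torus. rep (cls f) x = f x"
  using cls_eq_iff[of "rep (cls f)" f] by simp

instantiation l2 :: (finite) real_inner
begin

lift_definition zero_l2 :: "'a l2" is "\<lambda>x. 0"
  using L2_const[of 0] by auto

lift_definition plus_l2 :: "'a l2 \<Rightarrow> 'a l2 \<Rightarrow> 'a l2" is "\<lambda>f g x. f x + g x"
  by (auto intro: L2_add)

lift_definition uminus_l2 :: "'a l2 \<Rightarrow> 'a l2" is "\<lambda>f x. - f x"
  by (auto intro: L2_minus)

lift_definition minus_l2 :: "'a l2 \<Rightarrow> 'a l2 \<Rightarrow> 'a l2" is "\<lambda>f g x. f x - g x"
  by (auto intro: L2_diff)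

lift_definition scaleR_l2 :: "real \<Rightarrow> 'a l2 \<Rightarrow> 'a l2" is "\<lambda>c f x. c * f x"
  by (auto intro: L2_scale)

lift_definition inner_l2 :: "'a l2 \<Rightarrow> 'a l2 \<Rightarrow> real" is "\<lambda>f g. \<integral>x. f x * g x \<partial>torus"
  by (rule integral_cong_AE) (auto dest!: L2_measurable)

definition norm_l2 :: "'a l2 \<Rightarrow> real" where "norm_l2 F = sqrt (inner F F)"

definition sgn_l2 :: "'a l2 \<Rightarrow> 'a l2" where "sgn_l2 F = scaleR (inverse (norm F)) F"

definition dist_l2 :: "'a l2 \<Rightarrow> 'a l2 \<Rightarrow> real" where "dist_l2 F G = norm (F - G)"

definition uniformity_l2 :: "('a l2 \<times> 'a l2) filter" where
  "uniformity_l2 = (INF e\<in>{0<..}. principal {(F, G). dist F G < e})"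

definition open_l2 :: "'a l2 set \<Rightarrow> bool" where
  "open_l2 U = (\<forall>F\<in>U. eventually (\<lambda>(F', G). F' = F \<longrightarrow> G \<in> U) uniformity)"

instance
proof
  fix a b :: real and F G H :: "'a l2"
  show "F + G + H = F + (G + H)" by transfer (auto intro!: L2_add simp: algebra_simps)
  show "F + G = G + F" by transfer (auto intro!: L2_add simp: algebra_simps)
  show "0 + F = F" by transfer (auto)
  show "- F + F = 0" by transfer (auto intro: L2_const)
  show "F - G = F + - G" by transfer (auto intro!: L2_add L2_diff L2_minus)
  show "a *\<^sub>R (F + G) = a *\<^sub>R F + a *\<^sub>R G" by transfer (auto intro!: L2_add L2_scale simp: algebra_simps)
  show "(a + b) *\<^sub>R F = a *\<^sub>R F + b *\<^sub>R F" by transfer (auto intro!: L2_add L2_scale simp: algebra_simps)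
  show "a *\<^sub>R b *\<^sub>R F = (a * b) *\<^sub>R F" by transfer (auto intro!: L2_add L2_scale simp: algebra_simps)
  show "1 *\<^sub>R F = F" by transfer auto
  show "dist F G = norm (F - G)" by (rule dist_l2_def)
  show "sgn F = inverse (norm F) *\<^sub>R F" by (rule sgn_l2_def)
  show "uniformity = (INF e\<in>{0<..}. principal {(F, G). dist (F :: 'a l2) G < e})" by (rule uniformity_l2_def)
  show "open U = (\<forall>F\<in>U. eventually (\<lambda>(F', G). F' = F \<longrightarrow> G \<in> U) uniformity)" for U :: "'a l2 set"
    by (rule open_l2_def)
  show "inner F G = inner G F" by transfer (simp add: mult.commute)
  show "inner (F + G) H = inner F H + inner G H"
    by transfer (auto simp: algebra_simps L2_integrable_mult)
  show "inner (a *\<^sub>R F) G = a * inner F G" by transfer (auto simp: mult.assoc)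
  show "0 \<le> inner F F" by transfer auto
  show "inner F F = 0 \<longleftrightarrow> F = 0"
  proof transfer
    fix f :: "real ^ 'a \<Rightarrow> real" assume f: "f \<in> L2 \<and> f \<in> L2 \<and> (AE x in torus. f x = f x)"
    then have "integrable torus (\<lambda>x. f x * f x)" by (auto intro: L2_integrable_mult)
    then have "(\<integral>x. f x * f x \<partial>torus) = 0 \<longleftrightarrow> (AE x in torus. f x * f x = 0)"
      by (rule integral_nonneg_eq_0_iff_AE) auto
    then show "(\<integral>x. f x * f x \<partial>torus) = 0 \<longleftrightarrow> f \<in> L2 \<and> (\<lambda>x. 0) \<in> L2 \<and> (AE x in torus. f x = 0)"
      using f by (auto intro: L2_const)
  qed
  show "norm F = sqrt (inner F F)" by (rule norm_l2_def)
qed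

end

lemma cls_add: "f \<in> L2 \<Longrightarrow> g \<in> L2 \<Longrightarrow> cls (\<lambda>x. f x + g x) = cls f + cls g"
  by (rule plus_l2.abs_eq[symmetric]) auto

lemma cls_diff: "f \<in> L2 \<Longrightarrow> g \<in> L2 \<Longrightarrow> cls (\<lambda>x. f x - g x) = cls f - cls g"
  by (rule minus_l2.abs_eq[symmetric]) auto

lemma cls_scaleR: "f \<in> L2 \<Longrightarrow> cls (\<lambda>x. c * f x) = c *\<^sub>R cls f"
  by (rule scaleR_l2.abs_eq[symmetric]) auto

lemma cls_zero: "cls (\<lambda>x. 0) = 0"
  by (rule zero_l2.abs_eq[symmetric])

lemma cls_inner: "f \<in> L2 \<Longrightarrow> g \<in> L2 \<Longrightarrow> cls f \<bullet> cls g = (\<integral>x. f x * g x \<partial>torus)"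
  by (rule inner_l2.abs_eq) auto

lemma norm_cls: "f \<in> L2 \<Longrightarrow> norm (cls f) = sqrt (\<integral>x. (f x)\<^sup>2 \<partial>torus)"
  by (simp add: norm_eq_sqrt_inner cls_inner power2_eq_square)

lemma abs_integral_mult_le:
  assumes "f \<in> L2" "g \<in> L2"
  shows "\<bar>\<integral>x. f x * g x \<partial>torus\<bar> \<le> norm (cls f) * norm (cls g)"
  using Cauchy_Schwarz_ineq2[of "cls f" "cls g"] by (simp add: cls_inner assms)

lemma L1_norm_le:
  fixes f :: "real ^ 'd \<Rightarrow> real"
  assumes "f \<in> L2"
  shows "(\<integral>x. \<bar>f x\<bar> \<partial>torus) \<le> norm (cls f) * norm (cls (\<lambda>x :: real ^ 'd. 1))"
proof -
  have m: "(\<lambda>x. \<bar>f x\<bar>) \<in> L2" using assms by (auto simp: L2_def periodic_def)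
  have "norm (cls (\<lambda>x. \<bar>f x\<bar>)) = norm (cls f)" by (simp add: norm_cls m assms)
  then show ?thesis
    using abs_integral_mult_le[OF m L2_const[of 1]] by simp
qed

text \<open>Riesz-Fischer. On a space of finite measure an L2 Cauchy sequence is Cauchy in L1, which
  yields an almost everywhere convergent subsequence; Fatou's lemma then bounds the L2 distance from
  the limit to every late term.\<close>

instance l2 :: (finite) complete_space
proof
  fix X :: "nat \<Rightarrow> 'a l2" assume X: "Cauchy X"
  define f where "f n = rep (X n)" for n
  have f: "f n \<in> L2" for n by (simp add: f_def)
  have cf: "cls (f n) = X n" for n by (simp add: f_def)
  have fm [measurable]: "f n \<in> borel_measurable borel" for n using f L2_measurable by blast
  define c where "c = norm (cls (\<lambda>x :: real ^ 'a. 1)) + 1"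
  have c: "c > 0" by (simp add: c_def add_nonneg_pos)
  have bd: "(\<integral>x. norm (f i x - f j x) \<partial>torus) \<le> norm (X i - X j) * c" for i j
  proof -
    have "(\<integral>x. norm (f i x - f j x) \<partial>torus) \<le> norm (cls (\<lambda>x. f i x - f j x)) * norm (cls (\<lambda>x :: real ^ 'a. 1))"
      using L1_norm_le[OF L2_diff[OF f f]] by simp
    also have "\<dots> \<le> norm (X i - X j) * c"
      by (simp add: cls_diff f cf c_def mult_left_mono)
    finally show ?thesis .
  qed
  obtain r where r: "strict_mono r" "AE x in torus. Cauchy (\<lambda>i. f (r i) x)"
  proof (rule cauchy_L1_AE_cauchy_subseq[of torus f])
    show "integrable torus (f n)" for n by (rule L2_integrable[OF f])
    fix e :: real assume "e > 0"
    then have "e / c > 0" using c by simp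
    then obtain N where N: "\<And>i j. i \<ge> N \<Longrightarrow> j \<ge> N \<Longrightarrow> dist (X i) (X j) < e / c"
      using X unfolding Cauchy_def by blast
    show "\<exists>N. \<forall>i\<ge>N. \<forall>j\<ge>N. (\<integral>x. norm (f i x - f j x) \<partial>torus) < e"
      using N c order_le_less_trans[OF bd] by (intro exI[of _ N]) (auto simp: dist_norm field_simps)
  qed auto
  define g where "g x = lim (\<lambda>i. f (r i) x)" for x
  have lim: "AE x in torus. (\<lambda>i. f (r i) x) \<longlonglongrightarrow> g x"
    using r(2)
  proof eventually_elim
    case (elim x)
    then show ?case
      unfolding g_def using Cauchy_convergent convergent_LIMSEQ_iff by blast
  qed
  have gm [measurable]: "g \<in> borel_measurable borel"
    unfolding g_def by (rule borel_measurable_lim_metric) measurable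
  \<comment> \<open>Holds also at points where the subsequence diverges: \<open>lim\<close> depends
    only on the sequence of values, which is the same at translates.\<close>
  have gp: "periodic g"
    using f unfolding g_def by (simp add: L2_def periodic_def)
  have key: "\<exists>N. \<forall>n\<ge>N. integrable torus (\<lambda>x. (g x - f n x)\<^sup>2) \<and> (\<integral>x. (g x - f n x)\<^sup>2 \<partial>torus) \<le> e\<^sup>2"
    if e: "e > 0" for e :: real
  proof -
    obtain N where N: "\<And>i j. i \<ge> N \<Longrightarrow> j \<ge> N \<Longrightarrow> dist (X i) (X j) < e"
      using X e unfolding Cauchy_def by blast
    have "integrable torus (\<lambda>x. (g x - f n x)\<^sup>2) \<and> (\<integral>x. (g x - f n x)\<^sup>2 \<partial>torus) \<le> e\<^sup>2" if n: "n \<ge> N" for n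
    proof -
      have "(\<integral>\<^sup>+x. ennreal ((g x - f n x)\<^sup>2) \<partial>torus) = (\<integral>\<^sup>+x. liminf (\<lambda>i. ennreal ((f (r i) x - f n x)\<^sup>2)) \<partial>torus)"
      proof (rule nn_integral_cong_AE)
        show "AE x in torus. ennreal ((g x - f n x)\<^sup>2) = liminf (\<lambda>i. ennreal ((f (r i) x - f n x)\<^sup>2))"
          using lim
        proof eventually_elim
          case (elim x)
          then have "(\<lambda>i. ennreal ((f (r i) x - f n x)\<^sup>2)) \<longlonglongrightarrow> ennreal ((g x - f n x)\<^sup>2)"
            by (intro tendsto_ennrealI tendsto_intros)
          then show ?case
            by (rule lim_imp_Liminf[OF sequentially_bot, symmetric])
        qed
      qed
      also have "\<dots> \<le> liminf (\<lambda>i. \<integral>\<^sup>+x. ennreal ((f (r i) x - f n x)\<^sup>2) \<partial>torus)"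
        by (rule nn_integral_liminf) measurable
      also have "\<dots> \<le> ennreal (e\<^sup>2)"
      proof (rule order_trans[OF Liminf_le_Limsup Limsup_bounded])
        show "\<forall>\<^sub>F i in sequentially. (\<integral>\<^sup>+x. ennreal ((f (r i) x - f n x)\<^sup>2) \<partial>torus) \<le> ennreal (e\<^sup>2)"
          using eventually_ge_at_top[of N]
        proof eventually_elim
          case (elim i)
          then have ri: "r i \<ge> N" using seq_suble[OF r(1), of i] by simp
          have d: "(\<lambda>x. f (r i) x - f n x) \<in> L2" by (rule L2_diff[OF f f])
          have "(\<integral>x. (f (r i) x - f n x)\<^sup>2 \<partial>torus) = (norm (X (r i) - X n))\<^sup>2"
            using norm_cls[OF d] by (simp add: cls_diff f cf)
          also have "\<dots> \<le> e\<^sup>2" using N[OF ri n] by (intro power_mono) (auto simp: dist_norm)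
          finally show ?case
            using d by (subst nn_integral_eq_integral) (auto simp: L2_def)
        qed
      qed simp
      finally have le: "(\<integral>\<^sup>+x. ennreal ((g x - f n x)\<^sup>2) \<partial>torus) \<le> ennreal (e\<^sup>2)" .
      have i: "integrable torus (\<lambda>x. (g x - f n x)\<^sup>2)"
      proof (rule integrableI_bounded)
        show "(\<integral>\<^sup>+x. ennreal (norm ((g x - f n x)\<^sup>2)) \<partial>torus) < \<infinity>"
          using order_le_less_trans[OF le ennreal_less_top] by simp
      qed measurable
      then have "ennreal (\<integral>x. (g x - f n x)\<^sup>2 \<partial>torus) \<le> ennreal (e\<^sup>2)"
        using le by (subst (asm) nn_integral_eq_integral) auto
      with i show ?thesis by simp
    qed
    then show ?thesis by blast
  qed
  obtain N where "integrable torus (\<lambda>x. (g x - f N x)\<^sup>2)" using key[of 1] by auto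
  then have "(\<lambda>x. g x - f N x) \<in> L2" using gp f[of N] by (auto simp: L2_def periodic_def)
  from L2_add[OF this f[of N]] have g: "g \<in> L2" by simp
  have "X \<longlonglongrightarrow> cls g"
    unfolding lim_sequentially
  proof (intro allI impI)
    fix e :: real assume e: "e > 0"
    obtain N where N: "\<forall>n\<ge>N. (\<integral>x. (g x - f n x)\<^sup>2 \<partial>torus) \<le> (e/2)\<^sup>2" using key[of "e/2"] e by auto
    have "dist (X n) (cls g) < e" if "n \<ge> N" for n
    proof -
      have "dist (X n) (cls g) = norm (cls (\<lambda>x. g x - f n x))"
        by (simp add: cls_diff f g cf dist_norm norm_minus_commute)
      also have "\<dots> \<le> e / 2"
        using real_sqrt_le_mono[of _ "(e/2)\<^sup>2"] N that e unfolding norm_cls[OF L2_diff[OF g f]] by fastforce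
      finally show ?thesis using e by simp
    qed
    then show "\<exists>no. \<forall>n\<ge>no. dist (X n) (cls g) < e" by blast
  qed
  then show "convergent X" by (rule convergentI)
qed

instance l2 :: (finite) banach ..

section \<open>Weakly measurable paths in Hilbert spaces\<close>

text \<open>The minimiser of \<open>(norm u)\<^sup>2 - 2 * l u\<close> over \<open>V\<close>
  represents \<open>l\<close>; the parallelogram law makes a minimising sequence Cauchy. The version
  for a subspace is needed because functionals such as the form \<open>A\<close> in its first
  argument are assumed linear and bounded only there.\<close>

lemma riesz_representation_subspace:
  fixes V :: "'a :: {real_inner, complete_space} set" and l :: "'a \<Rightarrow> real"
  assumes V: "subspace V" "closed V"
    and add: "\<And>u v. u \<in> V \<Longrightarrow> v \<in> V \<Longrightarrow> l (u + v) = l u + l v"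
    and scale: "\<And>c u. u \<in> V \<Longrightarrow> l (c *\<^sub>R u) = c * l u"
    and bd: "\<And>u. u \<in> V \<Longrightarrow> \<bar>l u\<bar> \<le> C * norm u"
  obtains w where "w \<in> V" "\<And>v. v \<in> V \<Longrightarrow> l v = w \<bullet> v"
proof -
  define J where "J u = (norm u)\<^sup>2 - 2 * l u" for u
  have lower: "J u \<ge> - C\<^sup>2" if "u \<in> V" for u
  proof -
    have "0 \<le> (norm u - C)\<^sup>2" by simp
    then have "2 * C * norm u \<le> (norm u)\<^sup>2 + C\<^sup>2" by (simp add: power2_diff algebra_simps)
    with bd[OF that] show ?thesis unfolding J_def by linarith
  qed
  define m where "m = Inf (J ` V)"
  have ne: "J ` V \<noteq> {}" using subspace_0[OF V(1)] by auto
  have bdd: "bdd_below (J ` V)" using lower by (auto intro!: bdd_belowI)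
  have m: "m \<le> J u" if "u \<in> V" for u
    unfolding m_def using that bdd by (intro cInf_lower) auto
  have "\<exists>u. u \<in> V \<and> J u < m + 1 / real (Suc n)" for n
    using cInf_lessD[OF ne, of "m + 1 / real (Suc n)"] unfolding m_def by auto
  then obtain u where u: "\<And>n. u n \<in> V" "\<And>n. J (u n) < m + 1 / real (Suc n)" by metis
  define q where "q n = 1 / real (Suc n)" for n
  have uq: "J (u n) < m + q n" for n using u(2) by (simp add: q_def)
  have par: "(norm (x - y))\<^sup>2 \<le> 2 * (J x - m) + 2 * (J y - m)" if "x \<in> V" "y \<in> V" for x y
  proof -
    let ?z = "(1/2) *\<^sub>R (x + y)"
    have z: "?z \<in> V" using V that by (intro subspace_scale subspace_add)
    have "(norm (x - y))\<^sup>2 = 2 * (norm x)\<^sup>2 + 2 * (norm y)\<^sup>2 - 4 * (norm ?z)\<^sup>2"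
      by (simp add: power2_norm_eq_inner inner_simps inner_commute algebra_simps)
    moreover have "l ?z = (l x + l y) / 2" using that V by (simp add: scale subspace_add add)
    ultimately have "(norm (x - y))\<^sup>2 = 2 * J x + 2 * J y - 4 * J ?z" unfolding J_def by simp
    with m[OF z] show ?thesis by simp
  qed
  have "Cauchy u"
  proof (rule CauchyI)
    fix e :: real assume e: "e > 0"
    obtain N :: nat where N: "4 / e\<^sup>2 < real N" using reals_Archimedean2 by blast
    have "norm (u i - u j) < e" if "i \<ge> N" "j \<ge> N" for i j
    proof -
      have "q i \<le> q N" "q j \<le> q N"
        using that by (auto simp: q_def field_simps)
      then have "(norm (u i - u j))\<^sup>2 \<le> 4 * q N"
        using par[OF u(1)[of i] u(1)[of j]] uq[of i] uq[of j] by argo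
      also have "\<dots> < e\<^sup>2" 
      proof -
        have "4 < real N * e\<^sup>2" using N e by (simp add: field_simps)
        also have "\<dots> \<le> real (Suc N) * e\<^sup>2" by (intro mult_right_mono) auto
        finally show ?thesis unfolding q_def by (simp add: pos_divide_less_eq mult.commute)
      qed
      finally show ?thesis using e by (simp add: power_less_imp_less_base)
    qed
    then show "\<exists>M. \<forall>m\<ge>M. \<forall>n\<ge>M. norm (u m - u n) < e" by blast
  qed
  then obtain w where w: "u \<longlonglongrightarrow> w" using Cauchy_convergent convergent_def by blast
  have wV: "w \<in> V" using closed_sequentially[OF V(2)] u(1) w by blast
  have lw: "(\<lambda>n. l (u n)) \<longlonglongrightarrow> l w"
  proof (rule tendsto_sandwich[of "\<lambda>n. l w - C * norm (u n - w)" _ _ "\<lambda>n. l w + C * norm (u n - w)"])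
    have "\<bar>l (u n) - l w\<bar> \<le> C * norm (u n - w)" for n
    proof -
      have d: "u n - w \<in> V" using V u wV by (intro subspace_diff)
      have "l (u n) = l (u n - w) + l w" using add[OF d wV] by simp
      then show ?thesis using bd[OF d] by simp
    qed
    note * = this
    show "\<forall>\<^sub>F n in sequentially. l w - C * norm (u n - w) \<le> l (u n)"
    proof (rule always_eventually, rule allI)
      fix n show "l w - C * norm (u n - w) \<le> l (u n)" using *[of n] by linarith
    qed
    show "\<forall>\<^sub>F n in sequentially. l (u n) \<le> l w + C * norm (u n - w)"
    proof (rule always_eventually, rule allI)
      fix n show "l (u n) \<le> l w + C * norm (u n - w)" using *[of n] by linarith
    qed
    have n0: "(\<lambda>n. norm (u n - w)) \<longlonglongrightarrow> 0" using w by (simp add: tendsto_norm_zero LIM_zero)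
    show "(\<lambda>n. l w - C * norm (u n - w)) \<longlonglongrightarrow> l w" "(\<lambda>n. l w + C * norm (u n - w)) \<longlonglongrightarrow> l w"
      using tendsto_diff[OF tendsto_const tendsto_mult_left[OF n0]] tendsto_add[OF tendsto_const tendsto_mult_left[OF n0]]
      by fastforce+
  qed
  have "J w \<le> m"
  proof (rule LIMSEQ_le)
    show "(\<lambda>n. J (u n)) \<longlonglongrightarrow> J w" unfolding J_def by (intro tendsto_intros w lw)
    show "(\<lambda>n. m + 1 / real (Suc n)) \<longlonglongrightarrow> m"
      using tendsto_add[OF tendsto_const LIMSEQ_inverse_real_of_nat, of m] by (simp add: inverse_eq_divide)
    show "\<exists>N. \<forall>n\<ge>N. J (u n) \<le> m + 1 / real (Suc n)" using u(2) less_imp_le by blast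
  qed
  have "l v = w \<bullet> v" if v: "v \<in> V" for v
  proof -
    define a where "a = w \<bullet> v - l v"
    define n where "n = (norm v)\<^sup>2"
    \<comment> \<open>A step against the sign of the first variation \<open>a\<close>. Using
      \<open>n + 1\<close> instead of \<open>n\<close> avoids a case distinction for
      \<open>v = 0\<close> and still gives an increment of \<open>J\<close> that is negative unless
      \<open>a = 0\<close>.\<close>
    define t where "t = - a / (n + 1)"
    have n: "n \<ge> 0" by (simp add: n_def)
    have "J w \<le> J (w + t *\<^sub>R v)"
      using \<open>J w \<le> m\<close> m[of "w + t *\<^sub>R v"] V v wV by (simp add: subspace_add subspace_scale)
    also have "J (w + t *\<^sub>R v) = J w + 2 * t * a + t\<^sup>2 * n"
    proof -
      have "(norm (w + t *\<^sub>R v))\<^sup>2 = (norm w)\<^sup>2 + 2 * t * (w \<bullet> v) + t\<^sup>2 * n"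
        unfolding n_def power2_norm_eq_inner
        by (simp add: inner_simps inner_commute algebra_simps power2_eq_square)
      moreover have "l (w + t *\<^sub>R v) = l w + t * l v"
        using v V wV by (simp add: add scale subspace_scale)
      ultimately show ?thesis by (simp add: J_def a_def algebra_simps)
    qed
    finally have "0 \<le> (2 * t * a + t\<^sup>2 * n) * (n + 1)\<^sup>2" by simp
    also have "\<dots> = 2 * (t * (n + 1)) * a * (n + 1) + (t * (n + 1))\<^sup>2 * n"
      by (simp add: power2_eq_square algebra_simps)
    also have "t * (n + 1) = - a" using n by (simp add: t_def)
    also have "2 * (- a) * a * (n + 1) + (- a)\<^sup>2 * n = - (a\<^sup>2 * (n + 2))"
      by (simp add: power2_eq_square algebra_simps)
    finally have "a\<^sup>2 * (n + 2) \<le> 0" by simp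
    then have "a = 0" using n by (simp add: mult_le_0_iff)
    then show ?thesis by (simp add: a_def)
  qed
  with wV show thesis by (rule that)
qed

text \<open>The Pettis integral: integrating \<open>v \<bullet> f s\<close> gives a functional
  bounded by the integral of \<open>n\<close>, to which Riesz representation applies. Only scalar
  measurability enters, so \<open>f\<close> is never approximated by simple functions.\<close>

lemma weak_integral_exists:
  fixes V :: "'a :: {real_inner, complete_space} set" and f :: "'s \<Rightarrow> 'a"
  assumes V: "subspace V" "closed V"
    and f: "\<And>v. v \<in> V \<Longrightarrow> (\<lambda>s. v \<bullet> f s) \<in> borel_measurable M"
    and n: "integrable M n" "AE s in M. norm (f s) \<le> n s"
  obtains y where "y \<in> V" "\<And>v. v \<in> V \<Longrightarrow> integrable M (\<lambda>s. v \<bullet> f s) \<and> v \<bullet> y = (\<integral>s. v \<bullet> f s \<partial>M)"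
proof -
  have int: "integrable M (\<lambda>s. v \<bullet> f s)" if "v \<in> V" for v
  proof (rule Bochner_Integration.integrable_bound)
    show "integrable M (\<lambda>s. norm v * n s)" using n by simp
    show "AE s in M. norm (v \<bullet> f s) \<le> norm (norm v * n s)"
      using n(2)
    proof eventually_elim
      case (elim s)
      have "\<bar>v \<bullet> f s\<bar> \<le> norm v * norm (f s)" by (rule Cauchy_Schwarz_ineq2)
      also have "\<dots> \<le> norm v * n s" using elim by (intro mult_left_mono) auto
      finally show ?case by simp
    qed
  qed (rule f[OF that])
  define l where "l v = (\<integral>s. v \<bullet> f s \<partial>M)" for v
  have "\<bar>l v\<bar> \<le> (\<integral>s. n s \<partial>M) * norm v" if v: "v \<in> V" for v
  proof -
    have "\<bar>l v\<bar> \<le> (\<integral>s. \<bar>v \<bullet> f s\<bar> \<partial>M)" unfolding l_def by (rule integral_abs_bound)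
    also have "\<dots> \<le> (\<integral>s. norm v * n s \<partial>M)"
    proof (rule integral_mono_AE)
      show "AE s in M. \<bar>v \<bullet> f s\<bar> \<le> norm v * n s"
        using n(2)
      proof eventually_elim
        case (elim s)
        have "\<bar>v \<bullet> f s\<bar> \<le> norm v * norm (f s)" by (rule Cauchy_Schwarz_ineq2)
        also have "\<dots> \<le> norm v * n s" using elim by (intro mult_left_mono) auto
        finally show ?case .
      qed
    qed (use int[OF v] n in auto)
    finally show ?thesis by (simp add: mult.commute)
  qed
  moreover have "l (u + v) = l u + l v" if "u \<in> V" "v \<in> V" for u v
    unfolding l_def inner_add_left using int that by simp
  moreover have "l (c *\<^sub>R u) = c * l u" for c u
    unfolding l_def by simp
  ultimately obtain y where "y \<in> V" "\<And>v. v \<in> V \<Longrightarrow> l v = y \<bullet> v"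
    using riesz_representation_subspace[OF V, of l] by metis
  with int show thesis by (intro that[of y]) (auto simp: l_def inner_commute)
qed

subsection \<open>Distributional time derivatives of continuous functions\<close>

lemma DERIV_max_zero_power2:
  "((\<lambda>u :: real. (max 0 u)\<^sup>2) has_real_derivative 2 * max 0 u) (at u)"
proof -
  consider "u < 0" | "u = 0" | "u > 0" by linarith
  then show ?thesis
  proof cases
    case 1
    have "((\<lambda>u :: real. 0) has_real_derivative 2 * max 0 u) (at u)" using 1 by simp
    then show ?thesis
      by (rule has_field_derivative_transform_within_open[of _ _ _ "{..<0}"]) (use 1 in auto)
  next
    case 2
    have "((\<lambda>h :: real. (max 0 h)\<^sup>2 / h) \<longlongrightarrow> 0) (at 0)"
    proof (rule Lim_null_comparison)
      show "\<forall>\<^sub>F h in at 0. norm ((max 0 h)\<^sup>2 / h) \<le> \<bar>h\<bar>"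
        by (rule always_eventually) (auto simp: max_def power2_eq_square)
      show "((\<lambda>h :: real. \<bar>h\<bar>) \<longlongrightarrow> 0) (at 0)" using tendsto_rabs[OF tendsto_ident_at, of "0::real" UNIV] by simp
    qed
    then show ?thesis using 2 by (simp add: DERIV_def)
  next
    case 3
    have "((\<lambda>u :: real. u\<^sup>2) has_real_derivative 2 * max 0 u) (at u)"
      using 3 by (auto intro!: derivative_eq_intros)
    then show ?thesis
      by (rule has_field_derivative_transform_within_open[of _ _ _ "{0<..}"]) (use 3 in auto)
  qed
qed

text \<open>The primitive of the tent function of height 2 on the unit interval: a C1 transition
  from 0 to 1, which is the regularity that \<open>weak_time_deriv\<close> asks of test
  functions.\<close>

definition smooth_step :: "real \<Rightarrow> real" where
  "smooth_step u = 2 * (max 0 u)\<^sup>2 - 4 * (max 0 (u - 1/2))\<^sup>2 + 2 * (max 0 (u - 1))\<^sup>2"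

definition smooth_step' :: "real \<Rightarrow> real" where
  "smooth_step' u = 4 * max 0 u - 8 * max 0 (u - 1/2) + 4 * max 0 (u - 1)"

lemma DERIV_smooth_step: "(smooth_step has_real_derivative smooth_step' u) (at u)"
proof -
  have *: "((\<lambda>u. (max 0 (u - c))\<^sup>2) has_real_derivative 2 * max 0 (u - c)) (at u)" for c :: real
  proof -
    have "((\<lambda>u. u - c) has_real_derivative 1) (at u)" by (auto intro!: derivative_eq_intros)
    from DERIV_chain2[where f = "\<lambda>u. (max 0 u)\<^sup>2" and g = "\<lambda>u. u - c", OF DERIV_max_zero_power2 this]
    show ?thesis by simp
  qed
  have "smooth_step = (\<lambda>u. 2 * (max 0 (u - 0))\<^sup>2 - 4 * (max 0 (u - 1/2))\<^sup>2 + 2 * (max 0 (u - 1))\<^sup>2)"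
    by (simp add: smooth_step_def fun_eq_iff)
  then show ?thesis
    using DERIV_add[OF DERIV_diff[OF DERIV_cmult[OF *[of 0], of 2] DERIV_cmult[OF *[of
      "1/2"], of 4]] DERIV_cmult[OF *[of 1], of 2]]
    by (simp add: smooth_step'_def algebra_simps)
qed

lemma DERIV_smooth_step_affine:
  "((\<lambda>x. smooth_step (k * (x - s))) has_real_derivative k * smooth_step' (k * (x - s))) (at x)"
proof -
  have "((\<lambda>x. k * (x - s)) has_real_derivative k) (at x)" by (auto intro!: derivative_eq_intros)
  from DERIV_chain2[OF DERIV_smooth_step this] show ?thesis by (simp add: mult.commute)
qed

lemma continuous_smooth_step': "continuous_on S f \<Longrightarrow> continuous_on S (\<lambda>x. smooth_step' (f x))"
  unfolding smooth_step'_def by (intro continuous_intros)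

lemma smooth_step_le_0: "u \<le> 0 \<Longrightarrow> smooth_step u = 0"
  by (simp add: smooth_step_def)

lemma smooth_step_ge_1: "u \<ge> 1 \<Longrightarrow> smooth_step u = 1"
  by (simp add: smooth_step_def power2_eq_square algebra_simps)

lemma smooth_step'_outside: "u \<notin> {0..1} \<Longrightarrow> smooth_step' u = 0"
  by (auto simp: smooth_step'_def)

lemma smooth_step'_nonneg: "0 \<le> smooth_step' u"
  by (auto simp: smooth_step'_def max_def)

lemma smooth_step'_le: "smooth_step' u \<le> 4"
  by (auto simp: smooth_step'_def max_def)

lemma smooth_step_mono: "u \<le> v \<Longrightarrow> smooth_step u \<le> smooth_step v"
  by (rule DERIV_nonneg_imp_nondecreasing) (use DERIV_smooth_step smooth_step'_nonneg in blast)+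

lemma smooth_step_bounds: "0 \<le> smooth_step u" "smooth_step u \<le> 1"
  using smooth_step_mono[of "min u 0" u] smooth_step_le_0[of "min u 0"]
    smooth_step_mono[of u "max u 1"] smooth_step_ge_1[of "max u 1"] by auto

lemma smooth_step'_integral: "(\<integral>u. smooth_step' u \<partial>lborel) = 1"
proof -
  have "(\<integral>u. smooth_step' u * indicator {0..1} u \<partial>lborel) = smooth_step 1 - smooth_step 0"
  proof (rule integral_FTC_Icc_real)
    show "isCont smooth_step' x" for x :: real
      using continuous_smooth_step'[of UNIV "\<lambda>x. x"] by (auto simp: continuous_on_eq_continuous_at)
  qed (auto intro: DERIV_smooth_step)
  moreover have "smooth_step' u * indicator {0..1} u = smooth_step' u" for u
    using smooth_step'_outside[of u] by (auto simp: indicator_def)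
  ultimately show ?thesis by (simp add: smooth_step_le_0 smooth_step_ge_1)
qed

text \<open>The kernels have mass 1 and live just to the right of \<open>s\<close>, so they form a
  one-sided approximate identity; rescaling moves the parameter into the argument of
  \<open>f\<close>, where dominated convergence applies.\<close>

lemma smooth_step_kernel_tendsto:
  fixes f :: "real \<Rightarrow> real"
  assumes f: "continuous_on UNIV f" "\<And>x. \<bar>f x\<bar> \<le> K"
  shows "(\<lambda>k. \<integral>x. f x * (real (Suc k) * smooth_step' (real (Suc k) * (x - s))) \<partial>lborel) \<longlonglongrightarrow> f s"
proof -
  have fm [measurable]: "f \<in> borel_measurable borel" using f by (intro borel_measurable_continuous_onI)
  have sm [measurable]: "smooth_step' \<in> borel_measurable borel"
    using continuous_smooth_step'[of UNIV "\<lambda>x. x"] by (intro borel_measurable_continuous_onI) auto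
  have eq: "(\<integral>x. f x * (real (Suc k) * smooth_step' (real (Suc k) * (x - s))) \<partial>lborel)
      = (\<integral>v. f (s + v / real (Suc k)) * smooth_step' v \<partial>lborel)" for k
    by (subst lborel_integral_real_affine[where c = "1 / real (Suc k)" and t = s])
       (auto simp: field_simps simp flip: integral_mult_right_zero simp del: of_nat_Suc intro!: Bochner_Integration.integral_cong)
  have "(\<lambda>k. \<integral>v. f (s + v / real (Suc k)) * smooth_step' v \<partial>lborel) \<longlonglongrightarrow> (\<integral>v. f s * smooth_step' v \<partial>lborel)"
  proof (rule integral_dominated_convergence[where w = "\<lambda>v. K * (4 * indicator {0..1} v)"])
    show "integrable lborel (\<lambda>v :: real. K * (4 * indicator {0..1} v))" by simp
    show "AE v in lborel. (\<lambda>k. f (s + v / real (Suc k)) * smooth_step' v) \<longlonglongrightarrow> f s * smooth_step' v"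
    proof (rule AE_I2)
      fix v :: real
      have "(\<lambda>k. s + v * inverse (real (Suc k))) \<longlonglongrightarrow> s + v * 0"
        by (intro tendsto_intros LIMSEQ_inverse_real_of_nat)
      then have "(\<lambda>k. s + v / real (Suc k)) \<longlonglongrightarrow> s" by (simp add: divide_inverse)
      moreover have "isCont f s" using f(1) by (simp add: continuous_on_eq_continuous_at)
      ultimately show "(\<lambda>k. f (s + v / real (Suc k)) * smooth_step' v) \<longlonglongrightarrow> f s * smooth_step' v"
        by (intro tendsto_intros) (rule isCont_tendsto_compose)
    qed
    show "AE v in lborel. norm (f (s + v / real (Suc k)) * smooth_step' v) \<le> K * (4 * indicator {0..1} v)" for k
    proof (rule AE_I2)
      fix v :: real
      have "\<bar>smooth_step' v\<bar> \<le> 4 * indicator {0..1} v"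
        using smooth_step'_outside[of v] smooth_step'_nonneg[of v] smooth_step'_le[of v] by (auto simp: indicator_def)
      then show "norm (f (s + v / real (Suc k)) * smooth_step' v) \<le> K * (4 * indicator {0..1} v)"
        unfolding real_norm_def abs_mult using f(2) by (intro mult_mono) (auto intro: order_trans[OF abs_ge_zero])
    qed
  qed measurable
  then show ?thesis unfolding eq by (simp add: smooth_step'_integral)
qed

lemma halfline_integrable_iff:
  fixes f :: "real \<Rightarrow> real"
  shows "integrable halfline f \<longleftrightarrow> integrable lebesgue (\<lambda>x. indicator {0<..} x * f x)"
  by (subst integrable_restrict_space) (auto simp: mult.commute)

lemma halfline_integral:
  fixes f :: "real \<Rightarrow> real"
  shows "(\<integral>x. f x \<partial>halfline) = (\<integral>x. indicator {0<..} x * f x \<partial>lebesgue)"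
  by (subst integral_restrict_space) auto

text \<open>Testing with a plateau that rises just after \<open>s\<close> and falls just after
  \<open>t\<close> turns the derivative of the test function into two approximate identities, at
  \<open>s\<close> and at \<open>t\<close>; the plateau itself tends to the indicator of
  \<open>{s..t}\<close> almost everywhere.\<close>

lemma weak_time_deriv_integral:
  assumes w: "weak_time_deriv f g" and f: "continuous_on {0..} f" and st: "0 < s" "s \<le> t"
  shows "integrable (lebesgue_on {s..t}) g \<and> f t - f s = (\<integral>x. g x \<partial>lebesgue_on {s..t})"
proof -
  define \<eta> where "\<eta> k x = smooth_step (k * (x - s)) - smooth_step (k * (x - t))" for k x
  define \<eta>' where "\<eta>' k x = k * smooth_step' (k * (x - s)) - k * smooth_step' (k * (x - t))" for k x
  have test: "integrable halfline (\<lambda>x. g x * \<theta> x)" "(\<integral>x. f x * \<theta>' x \<partial>halfline) = - (\<integral>x. g x * \<theta> x \<partial>halfline)"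
    if "\<And>x. (\<theta> has_real_derivative \<theta>' x) (at x)" "continuous_on UNIV \<theta>'" "0 < a" "\<And>x. x \<notin> {a..b} \<Longrightarrow> \<theta> x = 0"
    for \<theta> \<theta>' a b
    using w that unfolding weak_time_deriv_def by blast+
  \<comment> \<open>Integrability of \<open>g\<close> is only known after multiplication by a test
    function. A fixed one that equals 1 on \<open>{s..t+1}\<close> and vanishes outside
    \<open>{s/2..t+2}\<close> removes the factor and provides a common majorant for all
    \<open>k\<close>.\<close>
  have gi: "integrable lebesgue (\<lambda>x. indicator {s..t+1} x * g x)"
  proof -
    define \<theta> where "\<theta> x = smooth_step ((2/s) * (x - s/2)) - smooth_step (1 * (x - (t+1)))" for x
    define \<theta>' where "\<theta>' x = (2/s) * smooth_step' ((2/s) * (x - s/2)) - 1 * smooth_step' (1 * (x - (t+1)))" for x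
    have "integrable halfline (\<lambda>x. g x * \<theta> x)"
    proof (rule test(1)[of _ _ "s/2" "t+2"])
      show "(\<theta> has_real_derivative \<theta>' x) (at x)" for x
        unfolding \<theta>_def \<theta>'_def by (intro DERIV_diff DERIV_smooth_step_affine)
      show "continuous_on UNIV \<theta>'"
        unfolding \<theta>'_def by (intro continuous_intros continuous_smooth_step')
      show "\<theta> x = 0" if "x \<notin> {s/2..t+2}" for x
      proof (cases "x < s/2")
        case True
        then have "(2/s) * (x - s/2) \<le> 0" "1 * (x - (t+1)) \<le> 0"
          using st by (auto intro!: mult_nonneg_nonpos simp del: times_divide_eq_left)
        then show ?thesis unfolding \<theta>_def by (simp add: smooth_step_le_0)
      next
        case False
        then have "x > t + 2" using that by auto
        moreover then have "(2/s) * (x - s/2) \<ge> 1" using st by (simp add: field_simps)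
        ultimately show ?thesis unfolding \<theta>_def by (simp add: smooth_step_ge_1)
      qed
    qed (use st in auto)
    then have "integrable lebesgue (\<lambda>x. indicator {0<..} x * (g x * \<theta> x))"
      by (simp add: halfline_integrable_iff)
    then have "integrable lebesgue (\<lambda>x. (indicator {0<..} x * (g x * \<theta> x)) * indicator {s..t+1} x)"
      by (intro integrable_real_mult_indicator) auto
    moreover have "(indicator {0<..} x * (g x * \<theta> x)) * indicator {s..t+1} x = indicator {s..t+1} x * g x" for x :: real
    proof (cases "x \<in> {s..t+1}")
      case True
      then have "(2/s) * (x - s/2) \<ge> 1" using st by (simp add: field_simps)
      then have "\<theta> x = 1" using True unfolding \<theta>_def by (simp add: smooth_step_ge_1 smooth_step_le_0)
      then show ?thesis using True st by (auto simp: indicator_def)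
    qed auto
    ultimately show ?thesis by simp
  qed
  have eta: "\<eta> (real (Suc k)) x = 0" if "x \<notin> {s..t+1}" for x k
  proof (cases "x < s")
    case True
    then have "real (Suc k) * (x - s) \<le> 0" "real (Suc k) * (x - t) \<le> 0" using st
      by (auto simp: mult_le_0_iff zero_le_mult_iff)
    then show ?thesis unfolding \<eta>_def by (simp add: smooth_step_le_0)
  next
    case False
    then have x: "x - t \<ge> 1" "x - s \<ge> 1" using that st by auto
    have "real (Suc k) * (x - s) \<ge> 1 * 1" "real (Suc k) * (x - t) \<ge> 1 * 1"
      using x by (intro mult_mono; simp)+
    then show ?thesis unfolding \<eta>_def by (simp add: smooth_step_ge_1)
  qed
  have eta': "\<eta>' (real (Suc k)) x = 0" if "x \<notin> {s..t+1}" for x k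
  proof (cases "x < s")
    case True
    then have "real (Suc k) * (x - s) < 0" "real (Suc k) * (x - t) < 0" using st
      by (auto simp: mult_less_0_iff zero_less_mult_iff)
    then show ?thesis unfolding \<eta>'_def by (simp add: smooth_step'_outside)
  next
    case False
    then have x: "x - t > 1" "x - s > 1" using that st by auto
    have "1 * (x - s) \<le> real (Suc k) * (x - s)" "1 * (x - t) \<le> real (Suc k) * (x - t)"
      using x by (intro mult_right_mono; simp)+
    then have "real (Suc k) * (x - s) > 1" "real (Suc k) * (x - t) > 1"
      using x by (metis mult_1 order_less_le_trans)+
    then show ?thesis unfolding \<eta>'_def by (simp add: smooth_step'_outside)
  qed
  have main: "(\<integral>x. f x * \<eta>' (real (Suc k)) x \<partial>halfline) = - (\<integral>x. g x * \<eta> (real (Suc k)) x \<partial>halfline)" for k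
  proof (rule test(2)[of _ _ s "t+1"])
    show "(\<eta> (real (Suc k)) has_real_derivative \<eta>' (real (Suc k)) x) (at x)" for x
      unfolding \<eta>_def \<eta>'_def by (intro DERIV_diff DERIV_smooth_step_affine)
    show "continuous_on UNIV (\<eta>' (real (Suc k)))"
      unfolding \<eta>'_def by (intro continuous_intros continuous_smooth_step')
  qed (use eta st in auto)
  \<comment> \<open>Freezing \<open>f\<close> outside \<open>{s..t+1}\<close> makes it bounded and
    continuous on the whole line; the derivatives \<open>\<eta>'\<close> vanish there, so the
    integrals are unaffected.\<close>
  define F where "F x = f (max s (min (t+1) x))" for x
  have Fc: "continuous_on UNIV F"
    unfolding F_def by (rule continuous_on_compose2[OF f]) (use st in \<open>auto intro!: continuous_intros\<close>)
  have "bounded (f ` {s..t+1})"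
    by (intro compact_imp_bounded compact_continuous_image continuous_on_subset[OF f]) (use st in auto)
  then obtain K where "\<forall>y\<in>f ` {s..t+1}. \<bar>y\<bar> \<le> K" unfolding bounded_real by blast
  then have K: "\<bar>f x\<bar> \<le> K" if "x \<in> {s..t+1}" for x using that by blast
  have FK: "\<bar>F x\<bar> \<le> K" for x unfolding F_def by (rule K) (use st in auto)
  have Fm [measurable]: "F \<in> borel_measurable borel" using Fc by (intro borel_measurable_continuous_onI)
  have sm [measurable]: "smooth_step' \<in> borel_measurable borel"
    using continuous_smooth_step'[of UNIV "\<lambda>x. x"] by (intro borel_measurable_continuous_onI) auto
  have ki: "integrable lborel (\<lambda>x. F x * (real (Suc k) * smooth_step' (real (Suc k) * (x - r))))" for k r
  proof (rule Bochner_Integration.integrable_bound)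
    show "integrable lborel (\<lambda>x :: real. K * (real (Suc k) * 4) * indicator {r..r+1} x)" by simp
    show "AE x in lborel. norm (F x * (real (Suc k) * smooth_step' (real (Suc k) * (x - r)))) \<le> norm (K * (real (Suc k) * 4) * indicator {r..r+1} x)"
    proof (rule AE_I2)
      fix x :: real
      show "norm (F x * (real (Suc k) * smooth_step' (real (Suc k) * (x - r)))) \<le> norm (K * (real (Suc k) * 4) * indicator {r..r+1} x)"
      proof (cases "real (Suc k) * (x - r) \<in> {0..1}")
        case True
        have "0 \<le> x - r" using True by (auto simp: zero_le_mult_iff)
        moreover then have "1 * (x - r) \<le> real (Suc k) * (x - r)" by (intro mult_right_mono) auto
        ultimately have "x \<in> {r..r+1}" using True by auto
        moreover have "\<bar>F x\<bar> * (real (Suc k) * \<bar>smooth_step' (real (Suc k) * (x - r))\<bar>) \<le> K * (real (Suc k) * 4)"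
          using FK smooth_step'_le smooth_step'_nonneg by (intro mult_mono) (auto intro: order_trans[OF abs_ge_zero])
        moreover have "0 \<le> K" using FK[of 0] by linarith
        ultimately show ?thesis by (simp add: abs_mult)
      qed (simp add: smooth_step'_outside)
    qed
  qed measurable
  have lhs: "(\<integral>x. f x * \<eta>' (real (Suc k)) x \<partial>halfline) =
      (\<integral>x. F x * (real (Suc k) * smooth_step' (real (Suc k) * (x - s))) \<partial>lborel) -
      (\<integral>x. F x * (real (Suc k) * smooth_step' (real (Suc k) * (x - t))) \<partial>lborel)" for k
  proof -
    have "indicator {0<..} x * (f x * \<eta>' (real (Suc k)) x) = F x * \<eta>' (real (Suc k)) x" for x
      using eta'[of x k] st unfolding F_def by (cases "x \<in> {s..t+1}") (auto simp: indicator_def max_def min_def)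
    then have "(\<integral>x. f x * \<eta>' (real (Suc k)) x \<partial>halfline) = (\<integral>x. F x * \<eta>' (real (Suc k)) x \<partial>lebesgue)"
      unfolding halfline_integral by (rule Bochner_Integration.integral_cong[OF refl])
    also have "\<dots> = (\<integral>x. F x * \<eta>' (real (Suc k)) x \<partial>lborel)"
      unfolding \<eta>'_def by (intro integral_completion) measurable
    also have "\<dots> = (\<integral>x. F x * (real (Suc k) * smooth_step' (real (Suc k) * (x - s)))
        - F x * (real (Suc k) * smooth_step' (real (Suc k) * (x - t))) \<partial>lborel)"
      by (simp add: \<eta>'_def algebra_simps)
    also have "\<dots> = (\<integral>x. F x * (real (Suc k) * smooth_step' (real (Suc k) * (x - s))) \<partial>lborel) -
      (\<integral>x. F x * (real (Suc k) * smooth_step' (real (Suc k) * (x - t))) \<partial>lborel)"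
      by (rule Bochner_Integration.integral_diff[OF ki ki])
    finally show ?thesis .
  qed
  have "(\<lambda>k. \<integral>x. f x * \<eta>' (real (Suc k)) x \<partial>halfline) \<longlonglongrightarrow> F s - F t"
    unfolding lhs by (intro tendsto_diff smooth_step_kernel_tendsto[OF Fc FK])
  moreover have "F s = f s" "F t = f t" using st by (auto simp: F_def)
  ultimately have lim1: "(\<lambda>k. - (\<integral>x. g x * \<eta> (real (Suc k)) x \<partial>halfline)) \<longlonglongrightarrow> f s - f t"
    unfolding main by simp
  have gi': "integrable lebesgue (\<lambda>x. indicator {s..t} x * g x)"
  proof -
    have "integrable lebesgue (\<lambda>x. (indicator {s..t+1} x * g x) * indicator {s..t} x)"
      using gi by (intro integrable_real_mult_indicator) auto
    moreover have "(indicator {s..t+1} x * g x) * indicator {s..t} x = indicator {s..t} x * g x" for x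
      by (auto simp: indicator_def)
    ultimately show ?thesis by simp
  qed
  have lim2: "(\<lambda>k. \<integral>x. g x * \<eta> (real (Suc k)) x \<partial>halfline) \<longlonglongrightarrow> (\<integral>x. indicator {s..t} x * g x \<partial>lebesgue)"
  proof -
    have "(\<integral>x. g x * \<eta> (real (Suc k)) x \<partial>halfline) = (\<integral>x. (indicator {s..t+1} x * g x) * \<eta> (real (Suc k)) x \<partial>lebesgue)" for k
      unfolding halfline_integral using eta st
      by (intro Bochner_Integration.integral_cong) (auto simp: indicator_def)
    moreover have "(\<lambda>k. \<integral>x. (indicator {s..t+1} x * g x) * \<eta> (real (Suc k)) x \<partial>lebesgue) \<longlonglongrightarrow> (\<integral>x. indicator {s..t} x * g x \<partial>lebesgue)"
    proof (rule integral_dominated_convergence[where w = "\<lambda>x. \<bar>indicator {s..t+1} x * g x\<bar>"])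
      show "(\<lambda>x. indicator {s..t} x * g x) \<in> borel_measurable lebesgue" using gi' by (rule borel_measurable_integrable)
      have "smooth_step \<in> borel_measurable borel"
        using DERIV_smooth_step
          by (intro borel_measurable_continuous_onI) (meson DERIV_continuous_on has_field_derivative_at_within)
      then have "\<eta> k \<in> borel_measurable borel" for k unfolding \<eta>_def by measurable
      then have \<eta>_meas: "\<eta> k \<in> borel_measurable lebesgue" for k :: real by (intro measurable_completion) simp
      show "(\<lambda>x. (indicator {s..t+1} x * g x) * \<eta> (real (Suc k)) x) \<in> borel_measurable lebesgue" for k
        by (rule borel_measurable_times[OF borel_measurable_integrable[OF gi] \<eta>_meas])
      show "integrable lebesgue (\<lambda>x. \<bar>indicator {s..t+1} x * g x\<bar>)" using gi by (rule integrable_abs)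
      show "AE x in lebesgue. norm ((indicator {s..t+1} x * g x) * \<eta> (real (Suc k)) x) \<le> \<bar>indicator {s..t+1} x * g x\<bar>" for k
      proof (rule AE_I2)
        fix x :: real
        have "\<bar>\<eta> (real (Suc k)) x\<bar> \<le> 1"
          unfolding \<eta>_def using smooth_step_bounds[of "real (Suc k) * (x - s)"] smooth_step_bounds[of
            "real (Suc k) * (x - t)"] by linarith
        then show "norm ((indicator {s..t+1} x * g x) * \<eta> (real (Suc k)) x) \<le> \<bar>indicator {s..t+1} x * g x\<bar>"
          by (simp add: abs_mult mult_left_le)
      qed
      \<comment> \<open>The point \<open>s\<close> is excluded because every \<open>\<eta>\<close>
        vanishes there while the indicator of the closed interval does not.\<close>
      have "(\<lambda>k. (indicator {s..t+1} x * g x) * \<eta> (real (Suc k)) x) \<longlonglongrightarrow> indicator {s..t} x * g x" if xs: "x \<noteq> s" for x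
      proof -
        have ev: "\<forall>\<^sub>F k in sequentially. real (Suc k) * d \<ge> 1" if "d > 0" for d :: real
        proof -
          obtain N :: nat where "1 / d < real N" using reals_Archimedean2 by blast
          then have N: "1 < real N * d" using that by (simp add: field_simps)
          have "real (Suc k) * d \<ge> 1" if "k \<ge> N" for k
          proof -
            have "real N * d \<le> real (Suc k) * d" using that \<open>d > 0\<close> by (intro mult_right_mono) auto
            with N show ?thesis by (rule less_imp_le[OF order_less_le_trans])
          qed
          then show ?thesis using eventually_sequentially by blast
        qed
        have "\<forall>\<^sub>F k in sequentially. (indicator {s..t+1} x * g x) * \<eta> (real (Suc k)) x = indicator {s..t} x * g x"
        proof -
          consider "x < s" | "s < x" "x \<le> t" | "x > t" using xs by linarith
          then show ?thesis
          proof cases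
            case 1 then show ?thesis by simp
          next
            case 2
            from ev[of "x - s"] 2 have "\<forall>\<^sub>F k in sequentially. real (Suc k) * (x - s) \<ge> 1" by simp
            then show ?thesis
            proof eventually_elim
              case (elim k)
              have "real (Suc k) * (x - t) \<le> 0" using 2 by (simp add: mult_le_0_iff)
              with elim 2 show ?case by (simp add: \<eta>_def smooth_step_ge_1 smooth_step_le_0)
            qed
          next
            case 3
            from ev[of "x - t"] 3 have "\<forall>\<^sub>F k in sequentially. real (Suc k) * (x - t) \<ge> 1" by simp
            then show ?thesis
            proof eventually_elim
              case (elim k)
              have "real (Suc k) * (x - t) \<le> real (Suc k) * (x - s)" using st by (intro mult_left_mono) auto
              with elim have "real (Suc k) * (x - s) \<ge> 1" by linarith
              with elim 3 show ?case by (simp add: \<eta>_def smooth_step_ge_1)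
            qed
          qed
        qed
        then show ?thesis by (rule tendsto_eventually)
      qed
      moreover have "AE x in lebesgue. x \<noteq> s"
        by (intro AE_completion) (rule AE_lborel_singleton)
      ultimately show "AE x in lebesgue. (\<lambda>k. (indicator {s..t+1} x * g x) * \<eta> (real (Suc k)) x) \<longlonglongrightarrow> indicator {s..t} x * g x"
        by (auto elim: AE_mp)
    qed
    ultimately show ?thesis by simp
  qed
  have "f s - f t = - (\<integral>x. indicator {s..t} x * g x \<partial>lebesgue)"
    using LIMSEQ_unique[OF lim1 tendsto_minus[OF lim2]] .
  moreover have "(\<integral>x. g x \<partial>lebesgue_on {s..t}) = (\<integral>x. indicator {s..t} x * g x \<partial>lebesgue)"
    by (subst integral_restrict_space) auto
  moreover have "integrable (lebesgue_on {s..t}) g"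
    using gi' by (subst integrable_restrict_space) (auto simp: mult.commute)
  ultimately show ?thesis by simp
qed

section \<open>Energy estimates and exponential decay\<close>

lemma gronwall_linear:
  fixes f :: "real \<Rightarrow> real"
  assumes ab: "a \<le> b" and q: "q \<ge> 0" and k: "k \<ge> 0"
    and d: "\<And>t. a \<le> t \<Longrightarrow> t \<le> b \<Longrightarrow> (f has_real_derivative f' t) (at t within {a..b})"
    and le: "\<And>t. a \<le> t \<Longrightarrow> t \<le> b \<Longrightarrow> f' t \<le> k * f t + q"
  shows "f b \<le> exp (k * (b - a)) * (f a + q * (b - a))"
proof (cases "a = b")
  case False
  then have ab': "a < b" using ab by simp
  define F where "F t = f t * exp (- k * (t - a)) - q * (t - a)" for t
  have "F b \<le> F a"
  proof (rule DERIV_nonpos_imp_decreasing_open[OF ab'[THEN less_imp_le]])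
    fix t assume t: "a < t" "t < b"
    have "(f has_real_derivative f' t) (at t)"
      using d[of t] t at_within_Icc_at[of a t b] by simp
    then have "(F has_real_derivative f' t * exp (- k * (t - a)) + f t * (exp (- k * (t - a)) * (- k)) - q) (at t)"
      unfolding F_def by (auto intro!: derivative_eq_intros)
    moreover have "f' t * exp (- k * (t - a)) + f t * (exp (- k * (t - a)) * (- k)) - q \<le> 0"
    proof -
      have "f' t * exp (- k * (t - a)) + f t * (exp (- k * (t - a)) * (- k)) = (f' t - k * f t) * exp (- k * (t - a))"
        by (simp add: algebra_simps)
      also have "\<dots> \<le> q * 1"
      proof (cases "f' t - k * f t \<ge> 0")
        case True
        then show ?thesis using le[of t] t k q by (intro mult_mono) auto
      next
        case False
        then have "(f' t - k * f t) * exp (- k * (t - a)) \<le> 0" by (intro mult_nonpos_nonneg) auto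
        then show ?thesis using q by simp
      qed
      finally show ?thesis by simp
    qed
    ultimately show "\<exists>y. DERIV F t :> y \<and> y \<le> 0" by blast
  next
    have "continuous_on {a..b} f" by (rule DERIV_continuous_on) (use d in auto)
    then show "continuous_on {a..b} F" unfolding F_def by (intro continuous_intros)
  qed
  then have "f b * exp (- k * (b - a)) \<le> f a + q * (b - a)" by (simp add: F_def)
  then have "exp (k * (b - a)) * (f b * exp (- k * (b - a))) \<le> exp (k * (b - a)) * (f a + q * (b - a))"
    by (intro mult_left_mono) auto
  also have "exp (k * (b - a)) * (f b * exp (- k * (b - a))) = f b"
    using exp_minus_inverse[of "k * (b - a)"] by (simp add: mult.left_commute)
  finally show ?thesis .
qed simp

lemma has_vector_derivative_slope_right:
  fixes f :: "real \<Rightarrow> 'a :: real_normed_vector"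
  assumes "(f has_vector_derivative f') (at_right t)"
  shows "((\<lambda>h. (1 / h) *\<^sub>R (f (t + h) - f t)) \<longlongrightarrow> f') (at_right 0)"
proof -
  have "((\<lambda>y. (1 / norm (y - t)) *\<^sub>R (f y - (f t + (y - t) *\<^sub>R f'))) \<longlongrightarrow> 0) (at_right t)"
    using assms unfolding has_vector_derivative_def has_derivative_within by (rule conjunct2)
  then have "((\<lambda>y. (1 / norm (y - t)) *\<^sub>R (f y - (f t + (y - t) *\<^sub>R f')) + f') \<longlongrightarrow> 0 + f') (at_right t)"
    by (intro tendsto_add tendsto_const)
  moreover have "\<forall>\<^sub>F y in at_right t. (1 / norm (y - t)) *\<^sub>R (f y - (f t + (y - t) *\<^sub>R f')) + f' = (1 / (y - t)) *\<^sub>R (f y - f t)"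
    using eventually_at_right_less[of t]
  proof eventually_elim
    case (elim y)
    have "f y - (f t + (y - t) *\<^sub>R f') = (f y - f t) - (y - t) *\<^sub>R f'" by simp
    then show ?case using elim by (simp only: scaleR_diff_right) simp
  qed
  ultimately have "((\<lambda>y. (1 / (y - t)) *\<^sub>R (f y - f t)) \<longlongrightarrow> f') (at_right t)"
    by (simp add: tendsto_cong)
  then have "((\<lambda>h. (1 / (h + t - t)) *\<^sub>R (f (h + t) - f t)) \<longlongrightarrow> f') (at_right 0)"
    by (subst (asm) filterlim_at_right_to_0)
  then show ?thesis by (simp add: add.commute)
qed

text \<open>A Gelfand triple in concrete form: \<open>V\<close> is the energy space,
  \<open>pr\<close> its map into the pivot space, \<open>A\<close> a form that is coercive up to the
  term with \<kappa>, and \<open>N\<close> the constant of the quadratic nonlinearity. The dual of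
  \<open>V\<close> is never formed; values of \<open>A\<close> and inner products with
  \<open>pr u\<close> stand for its elements.\<close>

locale evolution =
  fixes V :: "'b :: {real_inner, complete_space} set"
    and pr :: "'b \<Rightarrow> 'a :: {real_inner, banach}"
    and A :: "'b \<Rightarrow> 'b \<Rightarrow> real"
    and c \<kappa> B N :: real
  assumes V: "subspace V" "closed V"
    and pr: "bounded_linear pr"
    and A_add: "\<And>x y u. x \<in> V \<Longrightarrow> y \<in> V \<Longrightarrow> u \<in> V \<Longrightarrow> A (x + y) u = A x u + A y u"
    and A_scale: "\<And>r x u. x \<in> V \<Longrightarrow> u \<in> V \<Longrightarrow> A (r *\<^sub>R x) u = r * A x u"
    and A_bound: "\<And>x u. x \<in> V \<Longrightarrow> u \<in> V \<Longrightarrow> \<bar>A x u\<bar> \<le> B * norm x * norm u"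
    and garding: "\<And>u. u \<in> V \<Longrightarrow> A u u \<le> - c * (norm u)\<^sup>2 + \<kappa> * (norm (pr u))\<^sup>2"
    and c: "c > 0" and \<kappa>: "\<kappa> \<ge> 0" and N: "N \<ge> 0"
begin

text \<open>\<open>w t\<close> is the state regarded as an element of the energy space; it is a
  separate witness because \<open>V\<close> is not a subset of the pivot space.\<close>

definition strong_solution :: "real \<Rightarrow> (real \<Rightarrow> 'a) \<Rightarrow> bool" where
  "strong_solution a v \<longleftrightarrow> (\<exists>v' w. \<forall>t\<ge>a. (v has_vector_derivative v' t) (at t within {a..}) \<and>
     w t \<in> V \<and> pr (w t) = v t \<and> (\<forall>u\<in>V. v' t \<bullet> pr u = A (w t) u))"

text \<open>The nonlinearity appears only through its bound: \<open>g u\<close> is the time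
  derivative of \<open>z\<close> against \<open>u\<close> and may deviate from the linear equation
  by a quadratic amount. The majorant \<open>n\<close> makes the lifted path \<open>w\<close>
  integrable on intervals away from 0 without asking for measurability of its norm.\<close>

definition weak_solution :: "(real \<Rightarrow> 'a) \<Rightarrow> bool" where
  "weak_solution z \<longleftrightarrow> continuous_on {0..} z \<and>
     (\<exists>w n g. (AE s in halfline. w s \<in> V \<and> pr (w s) = z s \<and> norm (w s) \<le> n s) \<and>
        (\<forall>u\<in>V. (\<lambda>s. u \<bullet> w s) \<in> borel_measurable halfline) \<and>
        (\<forall>a b. 0 < a \<longrightarrow> integrable (lebesgue_on {a..b}) n) \<and>
        (\<forall>u\<in>V. weak_time_deriv (\<lambda>t. z t \<bullet> pr u) (g u) \<and>
           (AE s in halfline. \<bar>g u s - A (w s) u\<bar> \<le> N * (norm (z s))\<^sup>2 * norm u)))"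

lemma strong_solution_shift:
  assumes "strong_solution 0 v"
  shows "strong_solution a (\<lambda>t. v (t - a))"
proof -
  obtain v' w where v: "\<And>t. t \<ge> 0 \<Longrightarrow> (v has_vector_derivative v' t) (at t within {0..})"
    "\<And>t. t \<ge> 0 \<Longrightarrow> w t \<in> V \<and> pr (w t) = v t \<and> (\<forall>u\<in>V. v' t \<bullet> pr u = A (w t) u)"
    using assms unfolding strong_solution_def by blast
  have "((\<lambda>t. v (t - a)) has_vector_derivative v' (t - a)) (at t within {a..})" if "t \<ge> a" for t
  proof -
    have im: "(\<lambda>t. t - a) ` {a..} = {0..}"
    proof (intro equalityI subsetI)
      fix s :: real assume "s \<in> {0..}"
      then show "s \<in> (\<lambda>t. t - a) ` {a..}" by (intro image_eqI[of _ _ "s + a"]) auto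
    qed auto
    have "((\<lambda>t. t - a) has_vector_derivative 1) (at t within {a..})"
      by (auto intro!: derivative_eq_intros simp: has_vector_derivative_def)
    from vector_diff_chain_within[OF this, of v "v' (t - a)"] v(1)[of "t - a"] that im
    show ?thesis by (simp add: o_def)
  qed
  then show ?thesis
    unfolding strong_solution_def using v(2)
    by (intro exI[of _ "\<lambda>t. v' (t - a)"] exI[of _ "\<lambda>t. w (t - a)"]) auto
qed

lemma AE_halfline_imp_Icc:
  assumes "AE s in halfline. P s" "0 < a"
  shows "AE s in lebesgue_on {a..b}. P s"
proof -
  have "AE s in lebesgue. s \<in> {0<..} \<longrightarrow> P s" using assms by (simp add: AE_restrict_space_iff)
  then have "AE s in lebesgue. s \<in> {a..b} \<longrightarrow> P s"
    by eventually_elim (use assms(2) in auto)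
  then show ?thesis by (simp add: AE_restrict_space_iff)
qed

lemma measurable_halfline_imp_Icc:
  fixes f :: "real \<Rightarrow> real"
  assumes "f \<in> borel_measurable halfline" "0 < a"
  shows "f \<in> borel_measurable (lebesgue_on {a..b})"
proof -
  have "f \<in> borel_measurable (restrict_space halfline {a..b})"
    using assms(1) by (rule measurable_restrict_space1)
  moreover have "restrict_space halfline {a..b} = lebesgue_on {a..b}"
    using assms(2) by (subst restrict_restrict_space) (auto intro!: arg_cong[where f = "restrict_space lebesgue"])
  ultimately show ?thesis by simp
qed

text \<open>Averaging over short time intervals turns the weak equation into a differential equation for a
  differentiable path, so that the energy can be differentiated.\<close>

lemma time_average:
  assumes z: "weak_solution z" and a: "0 < a" and h: "0 < h" and M: "\<And>t. a \<le> t \<Longrightarrow> t \<le> a + h \<Longrightarrow> norm (z t) \<le> M"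
  obtains W where "W \<in> V" "pr W = (1 / h) *\<^sub>R integral {a..a+h} z"
    "\<And>u. u \<in> V \<Longrightarrow> \<bar>((1 / h) *\<^sub>R (z (a + h) - z a)) \<bullet> pr u - A W u\<bar> \<le> N * M\<^sup>2 * norm u"
proof -
  let ?L = "lebesgue_on {a..a+h}"
  have zc: "continuous_on {0..} z" using z by (simp add: weak_solution_def)
  obtain w n g where w: "AE s in halfline. w s \<in> V \<and> pr (w s) = z s \<and> norm (w s) \<le> n s"
    and wm: "\<And>u. u \<in> V \<Longrightarrow> (\<lambda>s. u \<bullet> w s) \<in> borel_measurable halfline"
    and n: "\<And>a b. 0 < a \<Longrightarrow> integrable (lebesgue_on {a..b}) n"
    and g: "\<And>u. u \<in> V \<Longrightarrow> weak_time_deriv (\<lambda>t. z t \<bullet> pr u) (g u)"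
    and gA: "\<And>u. u \<in> V \<Longrightarrow> AE s in halfline. \<bar>g u s - A (w s) u\<bar> \<le> N * (norm (z s))\<^sup>2 * norm u"
    using z unfolding weak_solution_def by blast
  note AEw = AE_halfline_imp_Icc[OF w a, of "a+h"]
  obtain y where y: "y \<in> V" "\<And>v. v \<in> V \<Longrightarrow> integrable ?L (\<lambda>s. v \<bullet> w s) \<and> v \<bullet> y = (\<integral>s. v \<bullet> w s \<partial>?L)"
  proof (rule weak_integral_exists[OF V, of w ?L n])
    show "(\<lambda>s. v \<bullet> w s) \<in> borel_measurable ?L" if "v \<in> V" for v
      by (rule measurable_halfline_imp_Icc[OF wm[OF that] a])
    show "integrable ?L n" by (rule n[OF a])
    show "AE s in ?L. norm (w s) \<le> n s" using AEw by eventually_elim blast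
  qed blast
  define W where "W = (1 / h) *\<^sub>R y"
  interpret pr: bounded_linear pr by (rule pr)
  have zc': "continuous_on {a..a+h} z" using a by (intro continuous_on_subset[OF zc]) auto
  have pry: "pr y = integral {a..a+h} z"
  proof (rule vector_eq_ldot[THEN iffD1], rule allI)
    fix x :: 'a
    \<comment> \<open>\<open>w'\<close> is the adjoint of \<open>pr\<close> applied to
      \<open>x\<close>; moving \<open>pr\<close> to the other side lets the weak integral of
      \<open>w\<close> be compared with the ordinary integral of \<open>z\<close>.\<close>
    obtain w' where w': "w' \<in> V" "\<And>v. v \<in> V \<Longrightarrow> x \<bullet> pr v = w' \<bullet> v"
    proof (rule riesz_representation_subspace[OF V, of "\<lambda>v. x \<bullet> pr v" "norm x * onorm pr"])
      show "\<bar>x \<bullet> pr u\<bar> \<le> norm x * onorm pr * norm u" for u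
        using Cauchy_Schwarz_ineq2[of x "pr u"] mult_left_mono[OF onorm[OF pr, of u], of "norm x"] by simp
    qed (auto simp: pr.add pr.scale inner_add_right)
    have "x \<bullet> pr y = (\<integral>s. w' \<bullet> w s \<partial>?L)" using w'(2)[OF y(1)] y(2)[OF w'(1)] by simp
    also have "\<dots> = (\<integral>s. x \<bullet> z s \<partial>?L)"
    proof (rule integral_cong_AE)
      show "(\<lambda>s. w' \<bullet> w s) \<in> borel_measurable ?L" using y(2)[OF w'(1)] by auto
      show "(\<lambda>s. x \<bullet> z s) \<in> borel_measurable ?L"
        using zc' by (intro continuous_imp_measurable_on_sets_lebesgue continuous_intros) auto
      show "AE s in ?L. w' \<bullet> w s = x \<bullet> z s" using AEw by eventually_elim (simp flip: w'(2))
    qed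
    also have "\<dots> = integral {a..a+h} (\<lambda>s. x \<bullet> z s)"
      by (intro integral_unique[OF has_integral_integral_lebesgue_on, symmetric] continuous_imp_integrable_real
          continuous_intros zc') auto
    also have "\<dots> = x \<bullet> integral {a..a+h} z"
      using integral_linear[OF integrable_continuous_interval[OF zc'] bounded_linear_inner_right[of x]]
      by (simp add: o_def)
    finally show "x \<bullet> pr y = x \<bullet> integral {a..a+h} z" .
  qed
  have "\<bar>((1 / h) *\<^sub>R (z (a + h) - z a)) \<bullet> pr u - A W u\<bar> \<le> N * M\<^sup>2 * norm u" if u: "u \<in> V" for u
  proof -
    \<comment> \<open>With \<open>u\<close> fixed, Riesz representation writes \<open>A v u\<close>
      as an inner product with \<open>w'\<close>, so \<open>A\<close> can be evaluated on the weak
      integral by integrating \<open>A (w s) u\<close>.\<close>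
    obtain w' where w': "w' \<in> V" "\<And>v. v \<in> V \<Longrightarrow> A v u = w' \<bullet> v"
    proof (rule riesz_representation_subspace[OF V, of "\<lambda>v. A v u" "B * norm u"])
      show "\<bar>A v u\<bar> \<le> B * norm u * norm v" if "v \<in> V" for v
        using A_bound[OF that u] by (simp add: mult_ac)
    qed (use u in \<open>auto simp: A_add A_scale\<close>)
    have gi: "integrable ?L (g u)" "z (a + h) \<bullet> pr u - z a \<bullet> pr u = (\<integral>s. g u s \<partial>?L)"
    proof -
      have "continuous_on {0..} (\<lambda>t. z t \<bullet> pr u)" by (intro continuous_intros zc)
      from weak_time_deriv_integral[OF g[OF u] this a, of "a+h"] h
      show "integrable ?L (g u)" "z (a + h) \<bullet> pr u - z a \<bullet> pr u = (\<integral>s. g u s \<partial>?L)" by auto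
    qed
    have wi: "integrable ?L (\<lambda>s. w' \<bullet> w s)" "w' \<bullet> y = (\<integral>s. w' \<bullet> w s \<partial>?L)" using y(2)[OF w'(1)] by auto
    have "\<bar>(\<integral>s. g u s \<partial>?L) - w' \<bullet> y\<bar> = \<bar>\<integral>s. g u s - w' \<bullet> w s \<partial>?L\<bar>"
      using gi(1) wi by simp
    also have "\<dots> \<le> (\<integral>s. \<bar>g u s - w' \<bullet> w s\<bar> \<partial>?L)" by (rule integral_abs_bound)
    also have "\<dots> \<le> (\<integral>s. N * M\<^sup>2 * norm u \<partial>?L)"
    proof (rule integral_mono_AE)
      show "integrable ?L (\<lambda>s. \<bar>g u s - w' \<bullet> w s\<bar>)" using gi(1) wi by auto
      show "integrable ?L (\<lambda>s. N * M\<^sup>2 * norm u)" by (intro continuous_imp_integrable_real) auto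
      have "AE s in ?L. s \<in> {a..a+h}" by (rule AE_I2) (simp add: space_restrict_space)
      then show "AE s in ?L. \<bar>g u s - w' \<bullet> w s\<bar> \<le> N * M\<^sup>2 * norm u"
        using AEw AE_halfline_imp_Icc[OF gA[OF u] a, of "a+h"]
      proof eventually_elim
        case (elim s)
        have "N * (norm (z s))\<^sup>2 * norm u \<le> N * M\<^sup>2 * norm u"
          using M[of s] elim(1) N by (intro mult_right_mono mult_left_mono power_mono) auto
        with elim w'(2)[of "w s"] show ?case by simp
      qed
    qed
    also have "\<dots> = h * (N * M\<^sup>2 * norm u)"
      using h by (simp add: lebesgue_integral_const measure_restrict_space)
    finally have *: "\<bar>z (a + h) \<bullet> pr u - z a \<bullet> pr u - w' \<bullet> y\<bar> \<le> h * (N * M\<^sup>2 * norm u)"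
      using gi(2) by simp
    have "((1 / h) *\<^sub>R (z (a + h) - z a)) \<bullet> pr u - A W u = (1 / h) * (z (a + h) \<bullet> pr u - z a \<bullet> pr u - w' \<bullet> y)"
      using y(1) u w'(2)[OF y(1)] by (simp add: W_def A_scale inner_diff_left algebra_simps)
    then have "\<bar>((1 / h) *\<^sub>R (z (a + h) - z a)) \<bullet> pr u - A W u\<bar> = (1 / h) * \<bar>z (a + h) \<bullet> pr u - z a \<bullet> pr u - w' \<bullet> y\<bar>"
      using h by (simp add: abs_mult)
    also have "\<dots> \<le> (1 / h) * (h * (N * M\<^sup>2 * norm u))" using * h by (intro mult_left_mono) auto
    finally show ?thesis using h by simp
  qed
  moreover have "W \<in> V" unfolding W_def using V y(1) by (intro subspace_scale)
  moreover have "pr W = (1 / h) *\<^sub>R integral {a..a+h} z" by (simp add: W_def pr.scale pry)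
  ultimately show thesis using that by blast
qed

text \<open>Both \<open>Z\<close> and \<open>v\<close> are differentiable and have lifts in
  \<open>V\<close>, so the equation for their difference may be tested with its own lift
  \<open>u\<close>. Coercivity beats the forcing term \<open>Q * norm u\<close>, and Gronwall's
  inequality handles the term with \<kappa>. The bound \<open>M\<close> is assumed up to
  \<open>b + h\<close> because the average at \<open>b\<close> looks ahead by
  \<open>h\<close>.\<close>

lemma energy_estimate_average:
  assumes z: "weak_solution z" and v: "strong_solution a v" and ab: "0 < a" "a \<le> b" and h: "0 < h"
    and M: "\<And>t. a \<le> t \<Longrightarrow> t \<le> b + h \<Longrightarrow> norm (z t) \<le> M"
  defines "Z \<equiv> \<lambda>t. (1 / h) *\<^sub>R integral {t..t+h} z"
  shows "(norm (Z b - v b))\<^sup>2 \<le> exp (2 * \<kappa> * (b - a)) * ((norm (Z a - v a))\<^sup>2 + (N * M\<^sup>2)\<^sup>2 / (2 * c) * (b - a))"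
proof -
  interpret pr: bounded_linear pr by (rule pr)
  define Q where "Q = N * M\<^sup>2"
  have Q: "Q \<ge> 0" using N by (simp add: Q_def)
  have zc: "continuous_on {0..} z" using z by (simp add: weak_solution_def)
  obtain v' w where v: "\<And>t. t \<ge> a \<Longrightarrow> (v has_vector_derivative v' t) (at t within {a..})"
    "\<And>t. t \<ge> a \<Longrightarrow> w t \<in> V" "\<And>t. t \<ge> a \<Longrightarrow> pr (w t) = v t"
    "\<And>t u. t \<ge> a \<Longrightarrow> u \<in> V \<Longrightarrow> v' t \<bullet> pr u = A (w t) u"
    using v unfolding strong_solution_def by blast
  define I where "I t = integral {0..t} z" for t
  have Id: "(I has_vector_derivative z t) (at t within {0..b+h})" if "t \<in> {0..b+h}" for t
    unfolding I_def using that by (intro integral_has_vector_derivative continuous_on_subset[OF zc]) auto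
  have ZI: "Z t = (1 / h) *\<^sub>R (I (t + h) - I t)" if "t \<in> {a..b}" for t
  proof -
    have "integral {0..t} z + integral {t..t+h} z = integral {0..t+h} z"
      using that ab h by (intro Henstock_Kurzweil_Integration.integral_combine integrable_continuous_interval continuous_on_subset[OF zc]) auto
    then have "integral {t..t+h} z = I (t + h) - I t" unfolding I_def by (simp add: algebra_simps)
    then show ?thesis by (simp add: Z_def)
  qed
  define Z' where "Z' t = (1 / h) *\<^sub>R (z (t + h) - z t)" for t
  have Zd: "(Z has_vector_derivative Z' t) (at t within {a..b})" if t: "t \<in> {a..b}" for t
  proof -
    have "((\<lambda>t. t + h) has_vector_derivative 1) (at t within {a..b})"
      by (auto intro!: derivative_eq_intros simp: has_vector_derivative_def)
    moreover have "(I has_vector_derivative z (t + h)) (at (t + h) within (\<lambda>t. t + h) ` {a..b})"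
      using t ab h by (intro has_vector_derivative_within_subset[OF Id]) auto
    ultimately have "((\<lambda>t. I (t + h)) has_vector_derivative z (t + h)) (at t within {a..b})"
      using vector_diff_chain_within[of "\<lambda>t. t + h" 1 t "{a..b}" I "z (t+h)"] by (simp add: o_def)
    moreover have "(I has_vector_derivative z t) (at t within {a..b})"
      using t ab h by (intro has_vector_derivative_within_subset[OF Id]) auto
    ultimately have "((\<lambda>t. (1 / h) *\<^sub>R (I (t + h) - I t)) has_vector_derivative Z' t) (at t within {a..b})"
      unfolding Z'_def
      using bounded_linear.has_vector_derivative[OF bounded_linear_scaleR_right has_vector_derivative_diff] by blast
    then show ?thesis by (rule has_vector_derivative_transform[OF t, rotated]) (simp add: ZI)
  qed
  define e where "e t = (norm (Z t - v t))\<^sup>2" for t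
  define e' where "e' t = 2 * ((Z t - v t) \<bullet> (Z' t - v' t))" for t
  have "e b \<le> exp (2 * \<kappa> * (b - a)) * (e a + Q\<^sup>2 / (2 * c) * (b - a))"
  proof (rule gronwall_linear[OF ab(2)])
    fix t assume t: "a \<le> t" "t \<le> b"
    have d: "((\<lambda>t. Z t - v t) has_vector_derivative Z' t - v' t) (at t within {a..b})"
      using t by (intro has_vector_derivative_diff Zd has_vector_derivative_within_subset[OF v(1)]) auto
    then have "((\<lambda>t. (Z t - v t) \<bullet> (Z t - v t)) has_derivative
        (\<lambda>x. (Z t - v t) \<bullet> (x *\<^sub>R (Z' t - v' t)) + (x *\<^sub>R (Z' t - v' t)) \<bullet> (Z t - v t))) (at t within {a..b})"
      unfolding has_vector_derivative_def by (intro has_derivative_inner)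
    then show "(e has_real_derivative e' t) (at t within {a..b})"
      unfolding e_def e'_def has_field_derivative_def power2_norm_eq_inner
      by (rule has_derivative_eq_rhs) (auto simp: inner_commute algebra_simps fun_eq_iff)
    obtain W where W: "W \<in> V" "pr W = Z t" "\<And>u. u \<in> V \<Longrightarrow> \<bar>Z' t \<bullet> pr u - A W u\<bar> \<le> Q * norm u"
    proof (rule time_average[OF z _ h, of t M])
      show "0 < t" using t ab by simp
      show "norm (z s) \<le> M" if "t \<le> s" "s \<le> t + h" for s using M[of s] that t by simp
    qed (auto simp: Z_def Z'_def Q_def)
    define u where "u = W - w t"
    have uV: "u \<in> V" using W(1) v(2) t V unfolding u_def by (intro subspace_diff) auto
    have wu: "A W u = A (w t) u + A u u"
      using A_add[of "w t" u u] v(2)[of t] t uV by (simp add: u_def)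
    have "(Z t - v t) \<bullet> (Z' t - v' t) = Z' t \<bullet> pr u - v' t \<bullet> pr u"
      using W v t by (simp add: u_def pr.diff inner_commute inner_diff_left inner_diff_right)
    also have "\<dots> \<le> A u u + Q * norm u"
      using W(3)[OF uV] v(4)[of t u] t uV wu by simp
    also have "\<dots> \<le> - c * (norm u)\<^sup>2 + \<kappa> * (norm (pr u))\<^sup>2 + Q * norm u"
      using garding[OF uV] by simp
    also have "\<dots> \<le> \<kappa> * (norm (pr u))\<^sup>2 + Q\<^sup>2 / (4 * c)"
    proof -
      \<comment> \<open>Young's inequality as a completed square; the resulting
        \<open>Q\<^sup>2 / (4 * c)\<close> doubles in \<open>e'\<close> because a squared norm is
        differentiated.\<close>
      have "0 \<le> c * (norm u - Q / (2 * c))\<^sup>2" using c by simp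
      also have "\<dots> = c * (norm u)\<^sup>2 - Q * norm u + Q\<^sup>2 / (4 * c)"
        using c by (simp add: power2_eq_square field_simps)
      finally show ?thesis by simp
    qed
    also have "norm (pr u) = norm (Z t - v t)" using W v t by (simp add: u_def pr.diff)
    finally show "e' t \<le> 2 * \<kappa> * e t + Q\<^sup>2 / (2 * c)"
      unfolding e'_def e_def using c by (simp add: field_simps)
  qed (use \<kappa> c in auto)
  then show ?thesis by (simp add: e_def Q_def)
qed

text \<open>Continuity of \<open>z\<close> makes the averages converge to \<open>z\<close> at both
  ends as the window shrinks; the room between \<open>b\<close> and \<open>b'\<close> accommodates
  the windows.\<close>

lemma energy_estimate:
  assumes z: "weak_solution z" and v: "strong_solution a v" and ab: "0 < a" "a \<le> b" "b < b'"
    and M: "\<And>t. a \<le> t \<Longrightarrow> t \<le> b' \<Longrightarrow> norm (z t) \<le> M"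
  shows "(norm (z b - v b))\<^sup>2 \<le> exp (2 * \<kappa> * (b - a)) * ((norm (z a - v a))\<^sup>2 + (N * M\<^sup>2)\<^sup>2 / (2 * c) * (b - a))"
proof -
  have zc: "continuous_on {0..} z" using z by (simp add: weak_solution_def)
  have lim: "((\<lambda>h. (1 / h) *\<^sub>R integral {t..t+h} z) \<longlongrightarrow> z t) (at_right 0)" if t: "t \<ge> a" for t
  proof -
    define J where "J x = integral {t..x} z" for x
    have "(J has_vector_derivative z t) (at t within {t..t+1})"
      unfolding J_def using t ab by (intro integral_has_vector_derivative continuous_on_subset[OF zc]) auto
    then have "(J has_vector_derivative z t) (at_right t)"
      unfolding at_within_Icc_at_right[of t "t+1", simplified] .
    from has_vector_derivative_slope_right[OF this] show ?thesis by (simp add: J_def)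
  qed
  have ev: "\<forall>\<^sub>F h in at_right 0. (norm ((1 / h) *\<^sub>R integral {b..b+h} z - v b))\<^sup>2 \<le>
      exp (2 * \<kappa> * (b - a)) * ((norm ((1 / h) *\<^sub>R integral {a..a+h} z - v a))\<^sup>2 + (N * M\<^sup>2)\<^sup>2 / (2 * c) * (b - a))"
    using eventually_at_right_real[of 0 "b' - b", unfolded diff_gt_0_iff_gt, OF ab(3)]
  proof eventually_elim
    case (elim h)
    then show ?case using energy_estimate_average[OF z v ab(1,2), of h M] M by auto
  qed
  show ?thesis
  proof (rule tendsto_le[OF _ _ _ ev])
    show "((\<lambda>h. exp (2 * \<kappa> * (b - a)) * ((norm ((1 / h) *\<^sub>R integral {a..a+h} z - v a))\<^sup>2 + (N * M\<^sup>2)\<^sup>2 / (2 * c) * (b - a)))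
      \<longlongrightarrow> exp (2 * \<kappa> * (b - a)) * ((norm (z a - v a))\<^sup>2 + (N * M\<^sup>2)\<^sup>2 / (2 * c) * (b - a))) (at_right 0)"
      by (intro tendsto_mult tendsto_add tendsto_power tendsto_norm tendsto_diff tendsto_const lim) simp
    show "((\<lambda>h. (norm ((1 / h) *\<^sub>R integral {b..b+h} z - v b))\<^sup>2) \<longlongrightarrow> (norm (z b - v b))\<^sup>2) (at_right 0)"
      using ab by (intro tendsto_power tendsto_norm tendsto_diff tendsto_const lim)
  qed simp
qed

lemma zero_strong_solution: "strong_solution a (\<lambda>t. 0)"
  unfolding strong_solution_def
proof (intro exI allI impI conjI ballI)
  fix t u assume "u \<in> V"
  then show "0 \<bullet> pr u = A ((\<lambda>t. 0) t) u"
    using A_scale[of 0 u 0] subspace_0[OF V(1)] by simp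
qed (use subspace_0[OF V(1)] linear_0[OF bounded_linear.linear[OF pr]] in auto)

text \<open>A continuation argument by comparison with the zero solution. Before the first time at
  which the norm reaches \<open>M\<close>, the nonlinearity is controlled by \<open>M\<close>, and
  the smallness condition keeps the squared norm at or below three quarters of
  \<open>M\<^sup>2\<close>, which contradicts continuity at that time.\<close>

lemma a_priori_bound:
  assumes z: "weak_solution z" and a: "0 < a" and T: "0 < T" and r: "0 < r" "norm (z a) \<le> r"
    and small: "(N * (2 * exp (\<kappa> * T) * r)\<^sup>2)\<^sup>2 / (2 * c) * T \<le> 2 * r\<^sup>2"
    and t: "t \<in> {a..a+T}"
  shows "norm (z t) \<le> 2 * exp (\<kappa> * T) * r"
proof (rule ccontr)
  define M where "M = 2 * exp (\<kappa> * T) * r"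
  assume "\<not> norm (z t) \<le> 2 * exp (\<kappa> * T) * r"
  then have t': "norm (z t) > M" by (simp add: M_def)
  have E: "exp (\<kappa> * T) \<ge> 1" using \<kappa> T by simp
  then have rM: "r < M" using r mult_right_mono[OF E, of r] unfolding M_def by linarith
  have zc: "continuous_on {a..a+T} z" using z a by (auto simp: weak_solution_def intro: continuous_on_subset)
  define S where "S = {s \<in> {a..a+T}. M \<le> norm (z s)}"
  have "S = {a..a+T} \<inter> (\<lambda>s. norm (z s)) -` {M..}" by (auto simp: S_def)
  then have "closed S"
    using continuous_closed_preimage[OF continuous_on_norm[OF zc] closed_real_atLeastAtMost, of "{M..}"] by simp
  then have "compact S" unfolding S_def compact_eq_bounded_closed
    by (auto intro: bounded_subset[OF bounded_closed_interval[of a "a+T"]])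
  moreover have "t \<in> S" using t t' by (simp add: S_def)
  ultimately obtain s where s: "s \<in> S" "\<And>x. x \<in> S \<Longrightarrow> s \<le> x"
    using compact_attains_inf[of S] by blast
  have below: "norm (z x) < M" if "a \<le> x" "x < s" for x
    using s(2)[of x] that s(1) by (force simp: S_def)
  have "s \<noteq> a" using s(1) r rM by (auto simp: S_def)
  then have as: "a < s" using s(1) by (auto simp: S_def)
  have "(z \<longlongrightarrow> z s) (at s within {a..s})"
  proof -
    have "continuous_on {a..s} z" by (rule continuous_on_subset[OF zc]) (use s(1) in \<open>auto simp: S_def\<close>)
    then show ?thesis unfolding continuous_on_def by (rule bspec) (use as in simp)
  qed
  then have "(z \<longlongrightarrow> z s) (at_left s)"
    by (simp add: at_within_Icc_at_left[OF as])
  then have "((\<lambda>x. (norm (z x))\<^sup>2) \<longlongrightarrow> (norm (z s))\<^sup>2) (at_left s)" by (intro tendsto_intros)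
  \<comment> \<open>3 is what the energy estimate yields below: \<open>r\<^sup>2\<close> from the
    start plus at most \<open>2 * r\<^sup>2\<close> from the nonlinearity. 4 is the square of the
    factor 2 in \<open>M\<close>.\<close>
  moreover have "3 * (exp (\<kappa> * T) * r)\<^sup>2 < (norm (z s))\<^sup>2"
  proof -
    have "3 * (exp (\<kappa> * T) * r)\<^sup>2 < 4 * (exp (\<kappa> * T) * r)\<^sup>2" using r by simp
    also have "\<dots> = M\<^sup>2" by (simp add: M_def power_mult_distrib)
    also have "\<dots> \<le> (norm (z s))\<^sup>2" using s(1) r rM by (intro power_mono) (auto simp: S_def)
    finally show ?thesis .
  qed
  ultimately have "\<forall>\<^sub>F x in at_left s. 3 * (exp (\<kappa> * T) * r)\<^sup>2 < (norm (z x))\<^sup>2"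
    by (rule order_tendstoD)
  then have "\<forall>\<^sub>F x in at_left s. 3 * (exp (\<kappa> * T) * r)\<^sup>2 < (norm (z x))\<^sup>2 \<and> x \<in> {a<..<s}"
    using eventually_at_left_real[OF as] by (rule eventually_conj)
  from eventually_happens'[OF trivial_limit_at_left_real this]
  obtain b where b: "3 * (exp (\<kappa> * T) * r)\<^sup>2 < (norm (z b))\<^sup>2" "a < b" "b < s" by auto
  \<comment> \<open>The energy estimate at \<open>b\<close> uses the bound slightly beyond
    \<open>b\<close>, so a second point before \<open>s\<close> is inserted.\<close>
  obtain b' where b': "b < b'" "b' < s" using dense[OF b(3)] by blast
  have "(norm (z b - 0))\<^sup>2 \<le> exp (2 * \<kappa> * (b - a)) * ((norm (z a - 0))\<^sup>2 + (N * M\<^sup>2)\<^sup>2 / (2 * c) * (b - a))"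
    by (rule energy_estimate[OF z zero_strong_solution a _ b'(1)]) (use b b' below in \<open>auto intro: less_imp_le\<close>)
  also have "\<dots> \<le> exp (2 * \<kappa> * T) * (r\<^sup>2 + (N * M\<^sup>2)\<^sup>2 / (2 * c) * T)"
  proof (rule mult_mono)
    have bT: "b - a \<le> T" using s(1) b by (auto simp: S_def)
    have "2 * \<kappa> * (b - a) \<le> 2 * \<kappa> * T" using \<kappa> by (intro mult_left_mono[OF bT]) simp
    then show "exp (2 * \<kappa> * (b - a)) \<le> exp (2 * \<kappa> * T)" by (simp only: exp_le_cancel_iff)
    show "(norm (z a - 0))\<^sup>2 + (N * M\<^sup>2)\<^sup>2 / (2 * c) * (b - a) \<le> r\<^sup>2 + (N * M\<^sup>2)\<^sup>2 / (2 * c) * T"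
    proof (rule add_mono)
      show "(norm (z a - 0))\<^sup>2 \<le> r\<^sup>2" using r by (intro power_mono) simp_all
      show "(N * M\<^sup>2)\<^sup>2 / (2 * c) * (b - a) \<le> (N * M\<^sup>2)\<^sup>2 / (2 * c) * T"
        using c by (intro mult_left_mono[OF bT] divide_nonneg_pos) simp_all
    qed
    show "0 \<le> (norm (z a - 0))\<^sup>2 + (N * M\<^sup>2)\<^sup>2 / (2 * c) * (b - a)"
      using b c by (intro add_nonneg_nonneg mult_nonneg_nonneg divide_nonneg_pos) simp_all
  qed simp
  also have "\<dots> \<le> exp (2 * \<kappa> * T) * (r\<^sup>2 + 2 * r\<^sup>2)"
    using small by (intro mult_left_mono add_left_mono) (auto simp: M_def)
  also have "\<dots> = 3 * (exp (\<kappa> * T) * r)\<^sup>2"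
    by (simp add: power_mult_distrib exp_double[symmetric] mult.assoc)
  finally show False using b(1) by simp
qed

text \<open>Linear decay plus a quadratic error, from comparison with a linear orbit that starts
  within \<open>e\<close> of \<open>z a\<close>. The a priori bound is applied on
  \<open>{a..a+(T+1)}\<close>, one unit too long, because the energy estimate needs room behind the
  endpoint. \<open>Y\<close> is chosen so that with \<open>M = 2 * E * r\<close> the nonlinear
  contribution over that time is \<open>r^4 * Y\<close>, whose root is quadratic in
  \<open>r\<close>.\<close>

lemma one_step:
  assumes z: "weak_solution z" and a: "0 < a" and T: "0 < T" and r: "0 < r" "norm (z a) \<le> r"
    and K: "0 \<le> K"
  defines "E \<equiv> exp (\<kappa> * (T + 1))"
  defines "Y \<equiv> (4 * N * E\<^sup>2)\<^sup>2 * (T + 1) / (2 * c)"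
  assumes small: "r\<^sup>2 * Y \<le> 2"
    and lin: "\<And>e. 0 < e \<Longrightarrow> \<exists>v. strong_solution 0 v \<and> norm (v 0 - z a) \<le> e \<and>
       (\<forall>t\<ge>0. norm (v t) \<le> K * exp (- \<gamma> * t) * (norm (z a) + e))"
  shows "norm (z (a + T)) \<le> K * exp (- \<gamma> * T) * r + E * sqrt Y * r\<^sup>2"
    and "\<And>t. t \<in> {a..a+T} \<Longrightarrow> norm (z t) \<le> 2 * E * r"
proof -
  have E: "E \<ge> 1" unfolding E_def using \<kappa> T by simp
  have Y: "Y \<ge> 0" unfolding Y_def using c T by simp
  define M where "M = 2 * E * r"
  have X: "(N * M\<^sup>2)\<^sup>2 / (2 * c) * (T + 1) = r^4 * Y"
  proof -
    have "(N * M\<^sup>2)\<^sup>2 = (4 * N * E\<^sup>2)\<^sup>2 * r^4"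
      by (simp add: M_def power_mult_distrib flip: power_mult)
    then show ?thesis by (simp add: Y_def)
  qed
  have "r^4 * Y \<le> r\<^sup>2 * 2"
    using mult_left_mono[OF small, of "r\<^sup>2"] by (simp add: power2_eq_square power4_eq_xxxx mult.assoc)
  then have bd: "norm (z t) \<le> M" if "t \<in> {a..a+(T+1)}" for t
    unfolding M_def E_def
    by (intro a_priori_bound[OF z a _ r _ that]) (use T X in \<open>auto simp: M_def E_def\<close>)
  then show "norm (z t) \<le> 2 * E * r" if "t \<in> {a..a+T}" for t using that by (auto simp: M_def)
  show "norm (z (a + T)) \<le> K * exp (- \<gamma> * T) * r + E * sqrt Y * r\<^sup>2"
  proof (rule field_le_epsilon)
    fix d :: real assume d: "d > 0"
    define k where "k = K * exp (- \<gamma> * T)"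
    have k: "k \<ge> 0" using K by (simp add: k_def)
    \<comment> \<open>The initial mismatch enters the final bound with total factor
      \<open>k + E\<close>, so this choice makes its contribution exactly \<open>d\<close>.\<close>
    define e where "e = d / (k + E)"
    have e: "e > 0" using d k E by (simp add: e_def)
    obtain v where v: "strong_solution 0 v" "norm (v 0 - z a) \<le> e"
      "\<And>t. t \<ge> 0 \<Longrightarrow> norm (v t) \<le> K * exp (- \<gamma> * t) * (norm (z a) + e)"
      using lin[OF e] by blast
    have "(norm (z (a + T) - v (a + T - a)))\<^sup>2 \<le> exp (2 * \<kappa> * (a + T - a)) * ((norm (z a - v (a - a)))\<^sup>2 + (N * M\<^sup>2)\<^sup>2 / (2 * c) * (a + T - a))"
      by (rule energy_estimate[OF z strong_solution_shift[OF v(1)] a, of _ "a+T+1"]) (use T bd in auto)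
    also have "\<dots> \<le> E\<^sup>2 * (e\<^sup>2 + r^4 * Y)"
    proof (rule mult_mono)
      have "exp (2 * \<kappa> * (a + T - a)) \<le> exp (2 * (\<kappa> * (T + 1)))" using \<kappa> by (simp add: algebra_simps)
      also have "\<dots> = E\<^sup>2" unfolding E_def by (rule exp_double)
      finally show "exp (2 * \<kappa> * (a + T - a)) \<le> E\<^sup>2" .
      have "(norm (z a - v (a - a)))\<^sup>2 \<le> e\<^sup>2" using v(2) by (intro power_mono) (auto simp: norm_minus_commute)
      moreover have "(N * M\<^sup>2)\<^sup>2 / (2 * c) * (a + T - a) \<le> r^4 * Y"
        unfolding X[symmetric] using c by (intro mult_left_mono) auto
      ultimately show "(norm (z a - v (a - a)))\<^sup>2 + (N * M\<^sup>2)\<^sup>2 / (2 * c) * (a + T - a) \<le> e\<^sup>2 + r^4 * Y"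
        by (rule add_mono)
      show "0 \<le> E\<^sup>2" by simp
      show "0 \<le> (norm (z a - v (a - a)))\<^sup>2 + (N * M\<^sup>2)\<^sup>2 / (2 * c) * (a + T - a)"
        using c T by (intro add_nonneg_nonneg mult_nonneg_nonneg divide_nonneg_pos) simp_all
    qed
    also have "\<dots> \<le> (E * (e + r\<^sup>2 * sqrt Y))\<^sup>2"
    proof -
      have "(r\<^sup>2 * sqrt Y)\<^sup>2 = r^4 * Y" using Y by (simp add: power_mult_distrib flip: power_mult)
      moreover have "0 \<le> 2 * e * (r\<^sup>2 * sqrt Y)" using e Y by simp
      ultimately have "e\<^sup>2 + r^4 * Y \<le> (e + r\<^sup>2 * sqrt Y)\<^sup>2" by (simp add: power2_sum)
      then show ?thesis by (simp add: power_mult_distrib mult_left_mono)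
    qed
    finally have le: "(norm (z (a + T) - v T))\<^sup>2 \<le> (E * (e + r\<^sup>2 * sqrt Y))\<^sup>2" by simp
    have "norm (z (a + T) - v T) \<le> E * (e + r\<^sup>2 * sqrt Y)"
      by (rule power2_le_imp_le[OF le]) (use e E Y in simp)
    moreover have "norm (v T) \<le> k * (r + e)"
      using v(3)[of T] T r k mult_left_mono[of "norm (z a) + e" "r + e" k] by (simp add: k_def)
    moreover have "norm (z (a + T)) \<le> norm (z (a + T) - v T) + norm (v T)"
      using norm_triangle_sub[of "z (a + T)" "v T"] by simp
    moreover have "E * (e + r\<^sup>2 * sqrt Y) + k * (r + e) = k * r + E * sqrt Y * r\<^sup>2 + (k + E) * e"
      by (simp add: algebra_simps)
    moreover have "(k + E) * e = d" using k E by (simp add: e_def)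
    ultimately show "norm (z (a + T)) \<le> K * exp (- \<gamma> * T) * r + E * sqrt Y * r\<^sup>2 + d"
      unfolding k_def by linarith
  qed
qed

text \<open>Over a time \<open>T\<close> the linear part contracts by less than \<open>q / 2\<close>
  with \<open>q = exp (- \<delta> * T)\<close>, since its rate exceeds \<delta> and \<open>T\<close>
  is long enough to absorb \<open>K\<close>; for norms up to \<open>r\<close> the quadratic error
  costs at most another \<open>q / 2\<close>. Hence each step gains the factor \<open>q\<close>,
  which is decay with rate exactly \<delta>.\<close>

theorem exponential_decay:
  assumes \<delta>: "0 < \<delta>" "\<delta> < \<gamma>" and K: "0 \<le> K"
    and lin: "\<And>x e. x \<in> S \<Longrightarrow> 0 < e \<Longrightarrow> \<exists>v. strong_solution 0 v \<and> norm (v 0 - x) \<le> e \<and>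
       (\<forall>t\<ge>0. norm (v t) \<le> K * exp (- \<gamma> * t) * (norm x + e))"
  shows "\<exists>\<epsilon>>0. \<exists>C>0. \<forall>z. weak_solution z \<and> (\<forall>t\<ge>0. z t \<in> S) \<and> norm (z 0) \<le> \<epsilon> \<longrightarrow>
           (\<forall>t\<ge>0. norm (z t) \<le> C * exp (- \<delta> * t))"
proof -
  \<comment> \<open>Chosen so that \<open>2 * K < 1 + (\<gamma> - \<delta>) * T\<close>, which the
    inequality \<open>1 + x \<le> exp x\<close> turns into a linear contraction below one half
    relative to \<open>q\<close>.\<close>
  define T where "T = (2 * K + 1) / (\<gamma> - \<delta>)"
  have "T > 0" using K \<delta> by (simp add: T_def)
  have "2 * K < 1 + (\<gamma> - \<delta>) * T" using \<delta> by (simp add: T_def)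
  also have "\<dots> \<le> exp ((\<gamma> - \<delta>) * T)" by (rule exp_ge_add_one_self)
  finally have "K * exp (- ((\<gamma> - \<delta>) * T)) < 1/2" 
    unfolding exp_minus using exp_gt_zero[of "(\<gamma> - \<delta>) * T"]
      by (simp only: inverse_eq_divide times_divide_eq_right pos_divide_less_eq)
  then have T: "K * exp (- (\<gamma> - \<delta>) * T) < 1/2" "T > 0" using \<open>T > 0\<close> by (simp_all only: mult_minus_left)
  define E where "E = exp (\<kappa> * (T + 1))"
  define Y where "Y = (4 * N * E\<^sup>2)\<^sup>2 * (T + 1) / (2 * c)"
  have E: "E \<ge> 1" unfolding E_def using \<kappa> T by simp
  have Y: "Y \<ge> 0" unfolding Y_def using c T by simp
  define q where "q = exp (- \<delta> * T)"
  have q: "0 < q" "q < 1" using \<delta> T by (auto simp: q_def)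
  \<comment> \<open>Makes \<open>E * sqrt Y * r\<close> at most \<open>q / 2\<close>; the
    \<open>+ 1\<close> keeps the denominator positive when the nonlinear constant vanishes.\<close>
  define r where "r = q / (2 * (E * sqrt Y + 1))"
  have d0: "E * sqrt Y \<ge> 0" using E Y by simp
  then have r: "r > 0" using q by (simp add: r_def add_nonneg_pos)
  have rE: "E * sqrt Y * r \<le> q / 2"
  proof -
    have "E * sqrt Y * r \<le> (E * sqrt Y + 1) * r" using r by (intro mult_right_mono) auto
    also have "\<dots> = q / 2" using d0 by (simp add: r_def field_simps)
    finally show ?thesis .
  qed
  have rY: "s\<^sup>2 * Y \<le> 2" if s: "0 \<le> s" "s \<le> r" for s
  proof -
    have "1 * sqrt Y \<le> E * sqrt Y" using E Y by (intro mult_right_mono) simp_all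
    then have "sqrt Y * s \<le> E * sqrt Y * r" using d0 s by (intro mult_mono) simp_all
    also have "\<dots> \<le> 1" using rE q by linarith
    finally have "(sqrt Y * s)\<^sup>2 \<le> 1\<^sup>2" using Y s by (intro power_mono) auto
    then show ?thesis using Y by (simp add: power_mult_distrib mult.commute)
  qed
  \<comment> \<open>\<open>2 * E\<close> covers growth inside one step,
    \<open>exp (\<delta> * T)\<close> the rounding of \<open>t\<close> down to a whole number of
    steps, and \<open>exp \<delta>\<close> the delayed start \<open>a < 1\<close>.\<close>
  define C where "C = 2 * E * exp (\<delta> * T) * exp \<delta> * r"
  have eT: "exp (\<delta> * T) \<ge> 1" "exp \<delta> \<ge> 1" using \<delta> T by auto
  have Cr: "C \<ge> r"
  proof -
    have "1 * 1 \<le> E * exp (\<delta> * T)" using E eT(1) by (rule mult_mono) (use E in simp_all)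
    then have "1 * 1 * 1 \<le> E * exp (\<delta> * T) * exp \<delta>" using eT(2) by (rule mult_mono) (use E in simp_all)
    then have "1 * 1 * 1 * r \<le> E * exp (\<delta> * T) * exp \<delta> * r" using r by (intro mult_right_mono) simp_all
    then show ?thesis using r unfolding C_def by linarith
  qed
  have "norm (z t) \<le> C * exp (- \<delta> * t)"
    if z: "weak_solution z" "\<And>t. t \<ge> 0 \<Longrightarrow> z t \<in> S" "norm (z 0) \<le> r / 2" and t: "t \<ge> 0" for z t
  proof (cases "t = 0")
    case True
    then show ?thesis using z(3) Cr r by simp
  next
    case False
    with t have t: "t > 0" by simp
    \<comment> \<open>The one-step estimate starts at positive times. Continuity at 0 and the margin
      between \<open>r / 2\<close> and \<open>r\<close> provide a start \<open>a\<close>, earlier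
      than \<open>t\<close> and than 1, at which the norm is still below \<open>r\<close>.\<close>
    have "continuous_on {0..1} z" using z(1) by (auto simp: weak_solution_def intro: continuous_on_subset)
    then have "(z \<longlongrightarrow> z 0) (at_right 0)" by (auto simp: continuous_on_def at_within_Icc_at_right dest!: bspec[of _ _ 0])
    then have "((\<lambda>s. norm (z s)) \<longlongrightarrow> norm (z 0)) (at_right 0)" by (intro tendsto_intros)
    then have "\<forall>\<^sub>F s in at_right 0. norm (z s) < r"
    proof (rule order_tendstoD(2))
      show "norm (z 0) < r" using z(3) r by simp
    qed
    then have "\<forall>\<^sub>F s in at_right 0. norm (z s) < r \<and> s \<in> {0<..<min t 1}"
      using eventually_at_right_real[of 0 "min t 1"] t by (intro eventually_conj) auto
    from eventually_happens'[OF trivial_limit_at_right_real this]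
    obtain a where a: "norm (z a) < r" "0 < a" "a < t" "a < 1" by auto
    have step: "norm (z (b + T)) \<le> q * s \<and> (\<forall>t\<in>{b..b+T}. norm (z t) \<le> 2 * E * s)"
      if b: "b > 0" "norm (z b) \<le> s" "0 < s" "s \<le> r" for b s
    proof
      note os = one_step[OF z(1) b(1) T(2) b(3,2) K _ lin[OF z(2)], folded E_def, folded Y_def]
      have "norm (z (b + T)) \<le> K * exp (- \<gamma> * T) * s + E * sqrt Y * s\<^sup>2"
        by (rule os(1)) (use rY b in auto)
      also have "K * exp (- \<gamma> * T) = K * exp (- (\<gamma> - \<delta>) * T) * q"
        by (simp add: q_def algebra_simps flip: exp_add)
      also have "K * exp (- (\<gamma> - \<delta>) * T) * q * s \<le> 1/2 * q * s" using T q b by (intro mult_right_mono) auto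
      also have "E * sqrt Y * s\<^sup>2 \<le> (E * sqrt Y * r) * s"
        unfolding power2_eq_square mult.assoc[symmetric]
        by (rule mult_right_mono[OF mult_left_mono[OF b(4) d0] less_imp_le[OF b(3)]])
      also have "\<dots> \<le> (q / 2) * s" using rE b by (intro mult_right_mono) auto
      finally show "norm (z (b + T)) \<le> q * s" by simp
      show "\<forall>t\<in>{b..b+T}. norm (z t) \<le> 2 * E * s"
      proof
        fix t assume "t \<in> {b..b+T}"
        then show "norm (z t) \<le> 2 * E * s" by (intro os(2)) (use rY b in auto)
      qed
    qed
    have qn: "0 < q ^ n * r" "q ^ n * r \<le> r" for n
      using q r power_le_one[of q n] by (auto simp: mult_le_cancel_right1)
    have iter: "norm (z (a + real n * T)) \<le> q ^ n * r" for n
    proof (induction n)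
      case 0 then show ?case using a by simp
    next
      case (Suc n)
      have "a + real n * T > 0" using a T by (simp add: add_pos_nonneg)
      from step[OF this Suc qn] show ?case by (simp add: algebra_simps)
    qed
    define n where "n = nat \<lfloor>(t - a) / T\<rfloor>"
    have "real n = of_int \<lfloor>(t - a) / T\<rfloor>" using a T by (simp add: n_def)
    then have n: "real n \<le> (t - a) / T" "(t - a) / T < real n + 1" by linarith+
    then have n': "real n * T \<le> t - a" "t - a \<le> real n * T + T" using T by (auto simp: field_simps)
    have "a + real n * T > 0" using a T by (simp add: add_pos_nonneg)
    from step[OF this iter qn] n' have "norm (z t) \<le> 2 * E * (q ^ n * r)" by auto
    also have "q ^ n = exp (- \<delta> * (real n * T))" by (simp add: q_def exp_of_nat_mult[symmetric] mult_ac)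
    also have "\<dots> \<le> exp (\<delta> * T + \<delta> + - \<delta> * t)"
    proof -
      have "\<delta> * t \<le> \<delta> * (real n * T + T + 1)" using n' a \<delta> by (intro mult_left_mono) auto
      then show ?thesis by (simp add: algebra_simps)
    qed
    also have "\<dots> = exp (\<delta> * T) * exp \<delta> * exp (- \<delta> * t)" by (simp only: exp_add)
    finally have "norm (z t) \<le> 2 * E * (exp (\<delta> * T) * exp \<delta> * exp (- \<delta> * t) * r)"
      using E r by (simp add: mult_left_mono mult_right_mono)
    then show ?thesis by (simp add: C_def mult_ac)
  qed
  moreover have "C > 0" "r / 2 > 0" using Cr r by auto
  ultimately show ?thesis by meson
qed

end

section \<open>Calculus of periodic functions\<close>

lemma periodic_shift_ints:
  fixes f :: "real ^ 'd \<Rightarrow> 'b" and k :: "'d \<Rightarrow> int"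
  assumes "periodic f"
  shows "f (x + (\<chi> i. 2 * pi * of_int (k i))) = f x"
proof -
  have p: "f (x + axis i (2 * pi)) = f x" for x i using assms by (simp add: periodic_def)
  have m: "f (x - axis i (2 * pi)) = f x" for x i using p[of "x - axis i (2 * pi)" i] by simp
  have one: "f (x + axis i (2 * pi * of_int n)) = f x" for x i n
  proof (induction n rule: int_induct[of _ 0])
    case base
    have "x + axis i (2 * pi * of_int 0) = x" by (simp add: axis_def vec_eq_iff)
    then show ?case by (rule arg_cong)
  next
    case (step1 n)
    have "x + axis i (2 * pi * of_int (n + 1)) = (x + axis i (2 * pi * of_int n)) + axis i (2 * pi)"
      by (simp add: axis_def vec_eq_iff algebra_simps)
    then show ?case using step1(2) by (simp only: p)
  next
    case (step2 n)
    have "x + axis i (2 * pi * of_int (n - 1)) = (x + axis i (2 * pi * of_int n)) - axis i (2 * pi)"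
      by (simp add: axis_def vec_eq_iff algebra_simps)
    then show ?case using step2(2) by (simp only: m)
  qed
  have "f (x + (\<chi> i. if i \<in> S then 2 * pi * of_int (k i) else 0)) = f x" if "finite S" for S
    using that
  proof (induction S)
    case empty
    have "(\<chi> i. if i \<in> {} then 2 * pi * of_int (k i) else 0) = (0 :: real ^ 'd)" by (simp add: vec_eq_iff)
    then show ?case by (simp only: add_0_right)
  next
    case (insert j S)
    have "x + (\<chi> i. if i \<in> insert j S then 2 * pi * of_int (k i) else 0) =
        (x + (\<chi> i. if i \<in> S then 2 * pi * of_int (k i) else 0)) + axis j (2 * pi * of_int (k j))"
      using insert.hyps by (auto simp: axis_def vec_eq_iff)
    then show ?case using insert.IH by (simp only: one)
  qed
  from this[of UNIV] show ?thesis by simp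
qed

lemma shift_into_cell:
  fixes x :: "real ^ 'd"
  obtains k :: "'d \<Rightarrow> int" where "x + (\<chi> i. 2 * pi * of_int (k i)) \<in> cbox 0 (\<chi> i. 2 * pi)"
proof (rule that[of "\<lambda>i. - \<lfloor>x $ i / (2 * pi)\<rfloor>"])
  show "x + (\<chi> i. 2 * pi * of_int (- \<lfloor>x $ i / (2 * pi)\<rfloor>)) \<in> cbox 0 (\<chi> i. 2 * pi)"
    unfolding mem_box_cart
  proof (intro allI)
    fix i
    have "of_int \<lfloor>x $ i / (2 * pi)\<rfloor> \<le> x $ i / (2 * pi)" "x $ i / (2 * pi) \<le> of_int \<lfloor>x $ i / (2 * pi)\<rfloor> + 1"
      by linarith+
    then have "of_int \<lfloor>x $ i / (2 * pi)\<rfloor> * (2 * pi) \<le> x $ i" "x $ i \<le> (of_int \<lfloor>x $ i / (2 * pi)\<rfloor> + 1) * (2 * pi)"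
      by (simp_all only: pos_le_divide_eq pos_divide_le_eq pi_gt_zero mult_pos_pos zero_less_numeral)
    then show "0 $ i \<le> (x + (\<chi> i. 2 * pi * of_int (- \<lfloor>x $ i / (2 * pi)\<rfloor>))) $ i \<and>
        (x + (\<chi> i. 2 * pi * of_int (- \<lfloor>x $ i / (2 * pi)\<rfloor>))) $ i \<le> (\<chi> i. 2 * pi) $ i"
      by (simp add: algebra_simps)
  qed
qed

lemma periodic_continuous_bounded:
  fixes f :: "real ^ 'd \<Rightarrow> 'b :: real_normed_vector"
  assumes "periodic f" "continuous_on UNIV f"
  obtains K where "0 \<le> K" "\<And>x. norm (f x) \<le> K"
proof -
  have "bounded (f ` cbox 0 (\<chi> i. 2 * pi))"
    by (intro compact_imp_bounded compact_continuous_image continuous_on_subset[OF assms(2)]) auto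
  then obtain K where K: "\<And>x. x \<in> cbox 0 (\<chi> i. 2 * pi) \<Longrightarrow> norm (f x) \<le> K"
    unfolding bounded_iff by blast
  have "norm (f x) \<le> K" for x
  proof -
    obtain k where "x + (\<chi> i. 2 * pi * of_int (k i)) \<in> cbox 0 (\<chi> i. 2 * pi)" by (rule shift_into_cell)
    from K[OF this] show ?thesis using periodic_shift_ints[OF assms(1), of x k] by simp
  qed
  note * = this
  have "0 \<le> K" using order_trans[OF norm_ge_zero *[of 0]] .
  then show thesis using * by (rule that)
qed

lemma periodic_continuous_uniformly:
  fixes f :: "real ^ 'd \<Rightarrow> 'b :: real_normed_vector"
  assumes "periodic f" "continuous_on UNIV f"
  shows "uniformly_continuous_on UNIV f"
  unfolding uniformly_continuous_on_def
proof (intro allI impI ballI)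
  fix e :: real assume e: "e > 0"
  \<comment> \<open>One unit larger than the cell in each direction, so that after shifting
    \<open>x\<close> into the cell any point within distance 1 of it lies in the same compact
    box.\<close>
  let ?B = "cbox (\<chi> i. -1) (\<chi> i. 2 * pi + 1) :: (real ^ 'd) set"
  have "uniformly_continuous_on ?B f"
    by (intro compact_uniformly_continuous continuous_on_subset[OF assms(2)]) auto
  then have "\<exists>d>0. \<forall>x\<in>?B. \<forall>x'\<in>?B. dist x' x < d \<longrightarrow> dist (f x') (f x) < e"
    using e unfolding uniformly_continuous_on_def by simp
  then obtain d where d: "d > 0" "\<And>x y. x \<in> ?B \<Longrightarrow> y \<in> ?B \<Longrightarrow> dist y x < d \<Longrightarrow> dist (f y) (f x) < e"
    by blast
  have "dist (f y) (f x) < e" if xy: "dist y x < min d 1" for x y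
  proof -
    obtain k where k: "x + (\<chi> i. 2 * pi * of_int (k i)) \<in> cbox 0 (\<chi> i. 2 * pi)" by (rule shift_into_cell)
    let ?s = "(\<chi> i. 2 * pi * of_int (k i)) :: real ^ 'd"
    have abs1: "\<bar>(y - x) $ i\<bar> \<le> 1" for i
      using component_le_norm_cart[of "y - x" i] xy by (simp add: dist_norm)
    have yi: "x $ i - 1 \<le> y $ i \<and> y $ i \<le> x $ i + 1" for i
      using abs1[of i] unfolding vector_minus_component by linarith
    have xi: "0 \<le> (x + ?s) $ i \<and> (x + ?s) $ i \<le> 2 * pi" for i using k unfolding mem_box_cart by auto
    have "x + ?s \<in> ?B" unfolding mem_box_cart
    proof
      fix i show "(\<chi> i. - 1) $ i \<le> (x + ?s) $ i \<and> (x + ?s) $ i \<le> (\<chi> i. 2 * pi + 1) $ i"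
        using xi[of i] by simp
    qed
    moreover have "y + ?s \<in> ?B" unfolding mem_box_cart
    proof
      fix i show "(\<chi> i. - 1) $ i \<le> (y + ?s) $ i \<and> (y + ?s) $ i \<le> (\<chi> i. 2 * pi + 1) $ i"
        using xi[of i] yi[of i] by simp
    qed
    moreover have "dist (y + ?s) (x + ?s) < d" using xy by (simp add: dist_norm)
    ultimately have "dist (f (y + ?s)) (f (x + ?s)) < e" by (intro d)
    then show ?thesis by (simp only: periodic_shift_ints[OF assms(1)])
  qed
  then show "\<exists>d>0. \<forall>x\<in>UNIV. \<forall>x'\<in>UNIV. dist x' x < d \<longrightarrow> dist (f x') (f x) < e"
    using d(1) by (intro exI[of _ "min d 1"]) auto
qed

lemma periodic_compose: "periodic f \<Longrightarrow> periodic (\<lambda>x. h (f x))"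
  by (simp add: periodic_def)

lemma periodic_binop: "periodic f \<Longrightarrow> periodic g \<Longrightarrow> periodic (\<lambda>x. h (f x) (g x))"
  by (simp add: periodic_def)

subsection \<open>Continuously differentiable functions\<close>

lemma GDERIV_unique:
  assumes "GDERIV f x :> D" "GDERIV f x :> D'"
  shows "D = D'"
proof -
  have "(\<lambda>h. h \<bullet> D) = (\<lambda>h. h \<bullet> D')"
    using assms unfolding gderiv_def by (rule has_derivative_unique)
  then have "h \<bullet> D = h \<bullet> D'" for h by meson
  then show ?thesis using vector_eq_ldot by blast
qed

lemma grad_eq: "GDERIV f x :> D \<Longrightarrow> grad f x = D"
  unfolding grad_def by (rule the_equality) (auto intro: GDERIV_unique)

lemma C1D:
  assumes "C1 f"
  shows "GDERIV f x :> grad f x" "continuous_on UNIV (grad f)"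
proof -
  obtain G where G: "\<And>x. GDERIV f x :> G x" "continuous_on UNIV G" using assms unfolding C1_def by blast
  have "grad f = G" using grad_eq[OF G(1)] by (rule ext)
  then show "GDERIV f x :> grad f x" "continuous_on UNIV (grad f)" using G by auto
qed

lemma C1I: "(\<And>x. GDERIV f x :> G x) \<Longrightarrow> continuous_on UNIV G \<Longrightarrow> C1 f"
  unfolding C1_def by blast

lemma C1_continuous: "C1 f \<Longrightarrow> continuous_on S f"
  using C1D(1) unfolding gderiv_def
  by (meson continuous_at_imp_continuous_on has_derivative_continuous)

lemma C1_measurable: "C1 f \<Longrightarrow> f \<in> borel_measurable borel"
  by (intro borel_measurable_continuous_onI C1_continuous)

lemma C1_const: "C1 (\<lambda>x. c)"
  by (rule C1I[OF GDERIV_const]) simp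

lemma GDERIV_C1_mult:
  assumes "C1 f" "C1 g"
  shows "GDERIV (\<lambda>x. f x * g x) x :> f x *\<^sub>R grad g x + g x *\<^sub>R grad f x"
  using assms by (intro GDERIV_mult C1D)

lemma C1_mult:
  assumes "C1 f" "C1 g"
  shows "C1 (\<lambda>x. f x * g x)"
  by (rule C1I[OF GDERIV_C1_mult[OF assms]]) (intro continuous_intros C1_continuous C1D(2) assms)

lemma grad_mult: "C1 f \<Longrightarrow> C1 g \<Longrightarrow> grad (\<lambda>x. f x * g x) x = f x *\<^sub>R grad g x + g x *\<^sub>R grad f x"
  by (rule grad_eq[OF GDERIV_C1_mult])

lemma C1_add:
  assumes "C1 f" "C1 g"
  shows "C1 (\<lambda>x. f x + g x)"
  by (rule C1I[OF GDERIV_add[OF C1D(1)[OF assms(1)] C1D(1)[OF assms(2)]]])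
     (intro continuous_intros C1D(2) assms)

lemma C1_compose:
  assumes "C1 f" "\<And>x. (h has_real_derivative h' (f x)) (at (f x))" "continuous_on (range f) h'"
  shows "C1 (\<lambda>x. h (f x))"
proof (rule C1I[OF GDERIV_DERIV_compose[OF C1D(1)[OF assms(1)] assms(2)]])
  show "continuous_on UNIV (\<lambda>x. h' (f x) *\<^sub>R grad f x)"
    by (intro continuous_intros C1D(2) assms(1) continuous_on_compose2[OF assms(3) C1_continuous[OF assms(1)]]) auto
qed

lemma periodic_grad:
  assumes "periodic f"
  shows "periodic (grad f)"
proof -
  have half: "GDERIV f x :> D" if a: "\<And>x. f (x + a) = f x" and D: "GDERIV f (x + a) :> D" for x a D
  proof -
    have "((\<lambda>x. x + a) has_derivative (\<lambda>h. h)) (at x)" by (auto intro!: derivative_eq_intros)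
    from has_derivative_compose[OF this, of f "\<lambda>h. h \<bullet> D"] show ?thesis
      using a D by (simp add: gderiv_def)
  qed
  have "GDERIV f (x + a) :> D \<longleftrightarrow> GDERIV f x :> D" if a: "\<And>x. f (x + a) = f x" for x a D
  proof
    have m: "f (x + - a) = f x" for x using a[of "x - a"] by simp
    show "GDERIV f (x + a) :> D" if "GDERIV f x :> D" by (rule half[of "- a"]) (use m that in auto)
  qed (rule half[OF a])
  then show ?thesis using assms by (simp add: periodic_def grad_def)
qed

lemma C1_grad_bounded:
  assumes "C1 f" "periodic f"
  obtains K where "0 \<le> K" "\<And>x. norm (grad f x) \<le> K"
  using periodic_continuous_bounded[OF periodic_grad[OF assms(2)] C1D(2)[OF assms(1)]] by blast

lemma C1_bounded:
  assumes "C1 f" "periodic f"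
  obtains K where "0 \<le> K" "\<And>x. \<bar>f x\<bar> \<le> K"
  using periodic_continuous_bounded[OF assms(2) C1_continuous[OF assms(1)]] by (metis real_norm_def)

subsection \<open>Integration by parts\<close>

lemma AE_torus_iff: "(AE x in torus. P x) \<longleftrightarrow> (AE x in lborel. x \<in> cbox 0 (\<chi> i. 2 * pi) \<longrightarrow> P x)"
  unfolding torus_def by (subst AE_restrict_space_iff) auto

lemma AE_lborel_component:
  fixes c :: real
  shows "AE x :: real ^ 'd in lborel. x $ i \<noteq> c"
proof -
  have "axis i (1 :: real) \<in> (Basis :: (real ^ 'd) set)" by (simp add: axis_in_Basis_iff)
  from negligible_standard_hyperplane[OF this, of c]
  have "negligible {x :: real ^ 'd. x $ i = c}" by (simp add: cart_eq_inner_axis)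
  then have "AE x :: real ^ 'd in lebesgue. x \<notin> {x. x $ i = c}"
    by (intro AE_not_in) (simp add: negligible_iff_null_sets)
  then show ?thesis by (simp add: AE_completion_iff)
qed

lemma lborel_integral_shift:
  fixes f :: "real ^ 'd \<Rightarrow> real"
  assumes [measurable]: "f \<in> borel_measurable borel"
  shows "(\<integral>x. f (x + a) \<partial>lborel) = (\<integral>x. f x \<partial>lborel)"
proof -
  have "(\<integral>x. f x \<partial>lborel) = (\<integral>x. f x \<partial>distr lborel borel ((+) a))" by (simp add: lborel_distr_plus)
  also have "\<dots> = (\<integral>x. f (a + x) \<partial>lborel)" by (subst integral_distr) auto
  finally show ?thesis by (simp add: add.commute)
qed

text \<open>The shifted cell differs from the cell by a slab that is moved back by one full period.
  Cells are taken half-open in direction \<open>i\<close> so that the pieces are disjoint; the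
  missing face is a null set.\<close>

lemma integral_torus_shift:
  fixes f :: "real ^ 'd \<Rightarrow> real"
  assumes f: "periodic f" "f \<in> borel_measurable borel" "\<And>x. \<bar>f x\<bar> \<le> K" and s: "0 \<le> s" "s \<le> 2 * pi"
  shows "(\<integral>x. f (x + axis i s) \<partial>torus) = (\<integral>x. f x \<partial>torus)"
proof -
  note [measurable] = f(2)
  define D where "D l u = {x :: real ^ 'd. (\<forall>j. j \<noteq> i \<longrightarrow> 0 \<le> x $ j \<and> x $ j \<le> 2 * pi) \<and> l \<le> x $ i \<and> x $ i < u}" for l u
  have Dm [measurable]: "D l u \<in> sets borel" for l u
    unfolding D_def by measurable
  have Dint: "integrable lborel (\<lambda>x. indicator (D l u) x * g x)"
    if "g \<in> borel_measurable borel" "\<And>x. \<bar>g x\<bar> \<le> K" for l u and g :: "real ^ 'd \<Rightarrow> real"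
  proof -
    have "D l u \<subseteq> cbox (\<chi> j. min 0 l) (\<chi> j. max (2 * pi) u)"
      by (auto simp: D_def mem_box_cart) (smt (verit))+
    then have "emeasure lborel (D l u) \<le> emeasure lborel (cbox (\<chi> j. min 0 l) (\<chi> j. max (2 * pi) u) :: (real ^ 'd) set)"
      by (rule emeasure_mono) simp
    also have "\<dots> < \<infinity>"
      using emeasure_lborel_cbox_finite by (simp add: less_top)
    finally have fin: "emeasure lborel (D l u) < \<infinity>" .
    show ?thesis
    proof (rule integrableI_bounded_set[where A = "D l u" and B = K])
      show "emeasure lborel (D l u) < \<infinity>" by (rule fin)
      show "AE x in lborel. x \<in> D l u \<longrightarrow> norm (indicator (D l u) x * g x) \<le> K" using that by auto
    qed (use that(1) in auto)
  qed
  have cell: "(\<integral>x. g x \<partial>torus) = (\<integral>x. indicator (D 0 (2 * pi)) x * g x \<partial>lborel)"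
    if [measurable]: "g \<in> borel_measurable borel" for g :: "real ^ 'd \<Rightarrow> real"
    unfolding integral_torus
  proof (rule integral_cong_AE)
    show "AE x in lborel. indicator (cbox 0 (\<chi> i. 2 * pi)) x * g x = indicator (D 0 (2 * pi)) x * g x"
      using AE_lborel_component[of i "2 * pi"]
    proof eventually_elim
      case (elim x)
      have "x \<in> cbox 0 (\<chi> i. 2 * pi) \<longleftrightarrow> x \<in> D 0 (2 * pi)"
        using elim by (auto simp: D_def mem_box_cart less_le)
      then show ?case by (simp add: indicator_def)
    qed
  qed measurable
  have split: "(\<integral>x. indicator (D l u) x * f x \<partial>lborel) = (\<integral>x. indicator (D l v) x * f x \<partial>lborel) + (\<integral>x. indicator (D v u) x * f x \<partial>lborel)"
    if "l \<le> v" "v \<le> u" for l u v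
  proof -
    have "indicator (D l u) x * f x = indicator (D l v) x * f x + indicator (D v u) x * f x" for x
      using that by (auto simp: D_def indicator_def)
    then show ?thesis using Dint[OF f(2,3)] by (simp add: Bochner_Integration.integral_add)
  qed
  have shift: "indicator (D l u) x = (indicator (D (l + a) (u + a)) (x + axis i a) :: real)" for l u a x
    by (auto simp: D_def indicator_def axis_def)
  have "(\<integral>x. f (x + axis i s) \<partial>torus) = (\<integral>x. indicator (D s (2 * pi + s)) (x + axis i s) * f (x + axis i s) \<partial>lborel)"
    by (subst cell) (auto simp: shift[of 0 _ _ s])
  also have "\<dots> = (\<integral>x. indicator (D s (2 * pi + s)) x * f x \<partial>lborel)"
    by (rule lborel_integral_shift[of "\<lambda>x. indicator (D s (2 * pi + s)) x * f x"]) measurable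
  also have "\<dots> = (\<integral>x. indicator (D s (2 * pi)) x * f x \<partial>lborel) + (\<integral>x. indicator (D (2 * pi) (2 * pi + s)) x * f x \<partial>lborel)"
    using s by (intro split) auto
  also have "(\<integral>x. indicator (D (2 * pi) (2 * pi + s)) x * f x \<partial>lborel) = (\<integral>x. indicator (D 0 s) x * f x \<partial>lborel)"
  proof -
    have "indicator (D 0 s) x * f x = indicator (D (2 * pi) (2 * pi + s)) (x + axis i (2 * pi)) * f (x + axis i (2 * pi))" for x
      using f(1) shift[of 0 s x "2 * pi"] by (simp add: periodic_def add.commute)
    then show ?thesis
      using lborel_integral_shift[of "\<lambda>x. indicator (D (2 * pi) (2 * pi + s)) x * f x" "axis i (2 * pi)"] by simp
  qed
  also have "(\<integral>x. indicator (D s (2 * pi)) x * f x \<partial>lborel) + (\<integral>x. indicator (D 0 s) x * f x \<partial>lborel) = (\<integral>x. f x \<partial>torus)"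
    using split[of 0 s "2 * pi"] s cell[OF f(2)] by simp
  finally show ?thesis .
qed

lemma C1_lipschitz:
  fixes f :: "real ^ 'd \<Rightarrow> real"
  assumes "C1 f" "\<And>x. norm (grad f x) \<le> K"
  shows "\<bar>f y - f x\<bar> \<le> K * norm (y - x)"
proof -
  have "norm (f y - f x) \<le> K * norm (y - x)"
  proof (rule differentiable_bound[of UNIV f "\<lambda>x h. h \<bullet> grad f x"])
    show "(f has_derivative (\<lambda>h. h \<bullet> grad f x)) (at x within UNIV)" for x
      using C1D(1)[OF assms(1)] by (simp add: gderiv_def)
    show "onorm (\<lambda>h. h \<bullet> grad f x) \<le> K" for x
    proof (rule onorm_bound)
      show "norm (h \<bullet> grad f x) \<le> K * norm h" for h
        using Cauchy_Schwarz_ineq2[of h "grad f x"] mult_left_mono[OF assms(2)[of x], of "norm h"]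
        by (simp add: mult.commute)
      show "0 \<le> K" using assms(2) norm_ge_zero order_trans by blast
    qed
  qed auto
  then show ?thesis by simp
qed

text \<open>Difference quotients in direction \<open>i\<close> have integral zero by translation
  invariance, and the Lipschitz bound allows passing to the limit under the integral. This is the
  divergence theorem without boundary behind the integrations by parts below.\<close>

lemma integral_partial_eq_0:
  fixes f :: "real ^ 'd \<Rightarrow> real"
  assumes f: "C1 f" "periodic f"
  shows "(\<integral>x. grad f x $ i \<partial>torus) = 0"
proof -
  obtain K where K: "0 \<le> K" "\<And>x. norm (grad f x) \<le> K" using C1_grad_bounded[OF f] by blast
  obtain K' where K': "\<And>x. \<bar>f x\<bar> \<le> K'" using C1_bounded[OF f] by blast
  have fm [measurable]: "f \<in> borel_measurable borel" by (rule C1_measurable[OF f(1)])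
  define s where "s n = inverse (real (Suc n))" for n
  have s: "0 < s n" "s n \<le> 2 * pi" for n
  proof -
    have "s n \<le> 1" by (simp add: s_def inverse_le_1_iff)
    then show "s n \<le> 2 * pi" using pi_gt3 by linarith
  qed (simp add: s_def)
  have s0: "s \<longlonglongrightarrow> 0" unfolding s_def by (rule LIMSEQ_inverse_real_of_nat)
  have ax: "axis i c = c *\<^sub>R axis i (1 :: real)" for c :: real by (simp add: axis_def vec_eq_iff)
  have nax: "norm (axis i (1 :: real) :: real ^ 'd) = 1" by (simp add: norm_axis_1)
  have "(\<lambda>n. \<integral>x. (f (x + axis i (s n)) - f x) / s n \<partial>torus) \<longlonglongrightarrow> (\<integral>x. grad f x $ i \<partial>torus)"
  proof (rule integral_dominated_convergence[where w = "\<lambda>x. K"])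
    have "(\<lambda>x. grad f x $ i) \<in> borel_measurable borel"
      by (intro borel_measurable_continuous_onI continuous_intros C1D f)
    then show "(\<lambda>x. grad f x $ i) \<in> borel_measurable torus" by measurable
    show "AE x in torus. (\<lambda>n. (f (x + axis i (s n)) - f x) / s n) \<longlonglongrightarrow> grad f x $ i"
    proof (rule AE_I2)
      fix x
      have "(f has_derivative (\<lambda>h. h \<bullet> grad f x)) (at (x + 0 *\<^sub>R axis i 1))"
        using C1D(1)[OF f(1), of x] by (simp add: gderiv_def)
      moreover have "((\<lambda>t. x + t *\<^sub>R axis i 1) has_derivative (\<lambda>t. t *\<^sub>R axis i 1)) (at (0 :: real))"
        by (auto intro!: derivative_eq_intros)
      ultimately have "((\<lambda>t. f (x + t *\<^sub>R axis i 1)) has_derivative (\<lambda>t. (t *\<^sub>R axis i 1) \<bullet> grad f x)) (at 0)"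
        using has_derivative_compose[of "\<lambda>t. x + t *\<^sub>R axis i 1" _ 0 UNIV f] by blast
      then have "((\<lambda>t. f (x + t *\<^sub>R axis i 1)) has_real_derivative grad f x $ i) (at 0)"
        by (simp add: has_field_derivative_def inner_axis' mult_commute_abs)
      then have "((\<lambda>t. (f (x + t *\<^sub>R axis i 1) - f x) / t) \<longlongrightarrow> grad f x $ i) (at 0)"
        by (simp add: DERIV_def)
      moreover have "filterlim s (at 0) sequentially"
      proof (rule filterlim_atI[OF s0])
        show "\<forall>\<^sub>F n in sequentially. s n \<noteq> 0" by (simp add: s_def)
      qed
      ultimately have "((\<lambda>n. (f (x + s n *\<^sub>R axis i 1) - f x) / s n) \<longlonglongrightarrow> grad f x $ i)"
        by (rule filterlim_compose)
      then show "(\<lambda>n. (f (x + axis i (s n)) - f x) / s n) \<longlonglongrightarrow> grad f x $ i" by (simp only: ax[of "s _"])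
    qed
    show "AE x in torus. norm ((f (x + axis i (s n)) - f x) / s n) \<le> K" for n
    proof (rule AE_I2)
      fix x
      have "\<bar>f (x + axis i (s n)) - f x\<bar> \<le> K * s n"
        using C1_lipschitz[OF f(1) K(2), of "x + axis i (s n)" x] s(1)[of n] by (simp add: ax[of "s n"] nax)
      then show "norm ((f (x + axis i (s n)) - f x) / s n) \<le> K" using s(1)[of n] by (simp add: divide_le_eq)
    qed
  qed auto
  moreover have "(\<integral>x. (f (x + axis i (s n)) - f x) / s n \<partial>torus) = 0" for n
  proof -
    have "integrable torus (\<lambda>x. f (x + axis i (s n)))" "integrable torus f"
      using K' by (auto intro!: integrable_torus_bounded)
    then show ?thesis
      using integral_torus_shift[OF f(2) fm K', of "s n" i] s[of n] by (simp add: Bochner_Integration.integral_diff)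
  qed
  ultimately have "(\<lambda>n :: nat. 0 :: real) \<longlonglongrightarrow> (\<integral>x. grad f x $ i \<partial>torus)" by (simp only:)
  then show ?thesis by (simp add: LIMSEQ_const_iff)
qed

lemma C1_L2:
  assumes "C1 f" "periodic f" shows "f \<in> L2"
  using C1_bounded[OF assms] L2_bounded[OF assms(2) C1_measurable[OF assms(1)]] by metis

lemma C1_grad_L2:
  assumes "C1 f" "periodic f" shows "(\<lambda>x. grad f x $ i) \<in> L2"
proof -
  obtain K where K: "0 \<le> K" "\<And>x. norm (grad f x) \<le> K" using C1_grad_bounded[OF assms] by blast
  show ?thesis
  proof (rule L2_bounded)
    show "periodic (\<lambda>x. grad f x $ i)" using periodic_compose[OF periodic_grad[OF assms(2)]] .
    show "(\<lambda>x. grad f x $ i) \<in> borel_measurable borel"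
      by (intro borel_measurable_continuous_onI continuous_intros C1D assms)
    show "\<bar>grad f x $ i\<bar> \<le> K" for x using component_le_norm_cart[of "grad f x" i] K(2)[of x] by linarith
  qed
qed

lemma C1_has_weak_partial:
  assumes f: "C1 f" "periodic f"
  shows "has_weak_partial i f (\<lambda>x. grad f x $ i)"
  unfolding has_weak_partial_def
proof (intro conjI allI impI)
  show "f \<in> L1" "(\<lambda>x. grad f x $ i) \<in> L1" using L2_imp_L1 C1_L2[OF f] C1_grad_L2[OF f] by blast+
  fix \<phi> :: "real ^ 'a \<Rightarrow> real" assume p: "periodic \<phi> \<and> C1 \<phi>"
  have int: "integrable torus (\<lambda>x. f x * grad \<phi> x $ i)" "integrable torus (\<lambda>x. grad f x $ i * \<phi> x)"
    using p f by (auto intro!: L2_integrable_mult C1_L2 C1_grad_L2)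
  have "(\<integral>x. f x * grad \<phi> x $ i \<partial>torus) + (\<integral>x. grad f x $ i * \<phi> x \<partial>torus) = (\<integral>x. f x * grad \<phi> x $ i + grad f x $ i * \<phi> x \<partial>torus)"
    by (rule Bochner_Integration.integral_add[OF int, symmetric])
  also have "\<dots> = (\<integral>x. grad (\<lambda>x. f x * \<phi> x) x $ i \<partial>torus)"
    by (intro Bochner_Integration.integral_cong refl) (subst grad_mult[OF f(1) conjunct2[OF p]], simp)
  also have "\<dots> = 0"
    using p f periodic_binop[of f \<phi> "(*)"] by (intro integral_partial_eq_0 C1_mult) simp_all
  finally show "(\<integral>x. f x * grad \<phi> x $ i \<partial>torus) = - (\<integral>x. grad f x $ i * \<phi> x \<partial>torus)" by simp
qed

subsection \<open>Completeness of the trigonometric system\<close>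

text \<open>The phase covers sines and cosines at once, and differentiation becomes a phase shift by
  \<open>pi / 2\<close>.\<close>

definition trig :: "real ^ 'd \<Rightarrow> real \<Rightarrow> real ^ 'd \<Rightarrow> real" where
  "trig k \<theta> x = cos (k \<bullet> x + \<theta>)"

definition freqs :: "(real ^ 'd) set" where
  "freqs = {k. \<forall>i. k $ i \<in> \<int>}"

lemma periodic_trig:
  assumes "k \<in> freqs" shows "periodic (trig k \<theta>)"
  unfolding periodic_def
proof (intro allI)
  fix x :: "real ^ 'a" and i
  obtain n :: int where n: "k $ i = of_int n" using assms unfolding freqs_def Ints_def by auto
  have eq: "k \<bullet> (x + axis i (2 * pi)) + \<theta> = (k \<bullet> x + \<theta>) + 2 * pi * of_int n"
    by (simp add: inner_add_right inner_axis n)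
  show "trig k \<theta> (x + axis i (2 * pi)) = trig k \<theta> x"
    unfolding trig_def eq cos_add[of "k \<bullet> x + \<theta>" "2 * pi * of_int n"] by (simp add: sin_int_2pin cos_int_2pin)
qed

lemma GDERIV_trig: "GDERIV (trig k \<theta>) x :> trig k (\<theta> + pi / 2) x *\<^sub>R k"
proof -
  have "((\<lambda>x. k \<bullet> x + \<theta>) has_derivative (\<lambda>h. k \<bullet> h)) (at x)"
    by (auto intro!: derivative_eq_intros)
  then have "GDERIV (\<lambda>x. k \<bullet> x + \<theta>) x :> k" unfolding gderiv_def by (simp add: inner_commute)
  from GDERIV_DERIV_compose[OF this DERIV_cos]
  have "GDERIV (\<lambda>x. cos (k \<bullet> x + \<theta>)) x :> (- sin (k \<bullet> x + \<theta>)) *\<^sub>R k" .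
  moreover have "- sin (k \<bullet> x + \<theta>) = trig k (\<theta> + pi / 2) x"
    unfolding trig_def add.assoc[symmetric] cos_add[of _ "pi/2"] by simp
  ultimately show ?thesis by (simp add: trig_def[abs_def])
qed

lemma continuous_trig: "continuous_on S (trig k \<theta>)"
  unfolding trig_def by (intro continuous_intros)

lemma C1_trig: "C1 (trig k \<theta>)"
  by (rule C1I[OF GDERIV_trig]) (intro continuous_intros continuous_trig)

lemma grad_trig: "grad (trig k \<theta>) x = trig k (\<theta> + pi / 2) x *\<^sub>R k"
  by (rule grad_eq[OF GDERIV_trig])

inductive_set trig_polys :: "(real ^ 'd \<Rightarrow> real) set" where
  trig: "k \<in> freqs \<Longrightarrow> trig k \<theta> \<in> trig_polys"
| add: "p \<in> trig_polys \<Longrightarrow> q \<in> trig_polys \<Longrightarrow> (\<lambda>x. p x + q x) \<in> trig_polys"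
| scale: "p \<in> trig_polys \<Longrightarrow> (\<lambda>x. c * p x) \<in> trig_polys"

lemma trig_polys_mult_trig:
  assumes "p \<in> trig_polys" "k \<in> freqs"
  shows "(\<lambda>x. p x * trig k \<theta> x) \<in> trig_polys"
  using assms(1)
proof induction
  case (trig l \<eta>)
  have "(\<lambda>x. trig l \<eta> x * trig k \<theta> x) = (\<lambda>x. (1/2) * trig (l - k) (\<eta> - \<theta>) x + (1/2) * trig (l + k) (\<eta> + \<theta>) x)"
  proof
    fix x
    have eqs: "(l - k) \<bullet> x + (\<eta> - \<theta>) = (l \<bullet> x + \<eta>) - (k \<bullet> x + \<theta>)" "(l + k) \<bullet> x + (\<eta> + \<theta>) = (l \<bullet> x + \<eta>) + (k \<bullet> x + \<theta>)"
      by (simp_all add: inner_diff_left inner_add_left)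
    show "trig l \<eta> x * trig k \<theta> x = (1/2) * trig (l - k) (\<eta> - \<theta>) x + (1/2) * trig (l + k) (\<eta> + \<theta>) x"
      unfolding trig_def eqs by (simp add: cos_times_cos add_divide_distrib)
  qed
  moreover have "l - k \<in> freqs" "l + k \<in> freqs" using trig assms(2) by (auto simp: freqs_def)
  ultimately show ?case by (simp only: trig_polys.intros)
next
  case (add p q)
  from trig_polys.add[OF add.IH] show ?case by (simp add: distrib_right)
next
  case (scale p c)
  from trig_polys.scale[OF scale.IH, of c] show ?case by (simp add: mult.assoc)
qed

lemma trig_polys_mult:
  assumes "p \<in> trig_polys" "q \<in> trig_polys"
  shows "(\<lambda>x. p x * q x) \<in> trig_polys"
  using assms(2)
proof induction
  case (trig k \<theta>)
  then show ?case using trig_polys_mult_trig assms(1) by blast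
next
  case (add q r)
  from trig_polys.add[OF add.IH] show ?case by (simp add: distrib_left)
next
  case (scale q c)
  from trig_polys.scale[OF scale.IH, of c] show ?case by (simp add: mult.left_commute)
qed

lemma trig_polys_const: "(\<lambda>x. c) \<in> trig_polys"
proof -
  have "(\<lambda>x. c * trig 0 0 x) \<in> trig_polys" by (intro trig_polys.intros) (simp add: freqs_def)
  then show ?thesis by (simp add: trig_def)
qed

lemma trig_polys_sum:
  assumes "\<And>i. i \<in> I \<Longrightarrow> p i \<in> trig_polys"
  shows "(\<lambda>x. \<Sum>i\<in>I. p i x) \<in> trig_polys"
  using assms by (induction I rule: infinite_finite_induct) (simp_all add: trig_polys_const trig_polys.add)

lemma trig_polys_coordinates:
  "(\<lambda>x. cos (x $ i)) \<in> trig_polys" "(\<lambda>x. sin (x $ i)) \<in> trig_polys"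
proof -
  have k: "axis i 1 \<in> freqs" by (auto simp: freqs_def axis_def)
  have "(\<lambda>x. cos (x $ i)) = trig (axis i 1) 0" "(\<lambda>x. sin (x $ i)) = trig (axis i 1) (- (pi / 2))"
    by (auto simp: fun_eq_iff trig_def inner_axis' cos_diff)
  then show "(\<lambda>x. cos (x $ i)) \<in> trig_polys" "(\<lambda>x. sin (x $ i)) \<in> trig_polys"
    using trig_polys.trig[OF k] by simp_all
qed

text \<open>Maps the torus into a product of circles in Euclidean space: ordinary polynomials pull
  back to trigonometric polynomials, so the Stone-Weierstrass theorem on a compact box can be
  used.\<close>

definition circles :: "real ^ 'd \<Rightarrow> (real ^ 'd) \<times> (real ^ 'd)" where
  "circles x = ((\<chi> i. cos (x $ i)), (\<chi> i. sin (x $ i)))"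

lemma real_polynomial_function_circles:
  assumes "real_polynomial_function p"
  shows "(\<lambda>x. p (circles x)) \<in> trig_polys"
  using assms
proof induction
  case (linear f)
  interpret bounded_linear f by (rule linear)
  have "f (circles x) = (\<Sum>i\<in>UNIV. f (axis i 1, 0) * cos (x $ i)) + (\<Sum>i\<in>UNIV. f (0, axis i 1) * sin (x $ i))" for x
  proof -
    have v: "(\<chi> i. g i) = (\<Sum>i\<in>UNIV. g i *\<^sub>R axis i 1)" for g :: "'a \<Rightarrow> real"
      by (simp add: vec_eq_iff axis_def if_distrib sum.delta' cong: if_cong)
    have "circles x = (\<Sum>i\<in>UNIV. cos (x $ i) *\<^sub>R (axis i 1, 0)) + (\<Sum>i\<in>UNIV. sin (x $ i) *\<^sub>R (0, axis i 1))"
      unfolding circles_def v by (simp add: prod_eq_iff fst_sum snd_sum)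
    then have "f (circles x) = (\<Sum>i\<in>UNIV. cos (x $ i) * f (axis i 1, 0)) + (\<Sum>i\<in>UNIV. sin (x $ i) * f (0, axis i 1))"
      by (simp only: add sum scaleR real_scaleR_def)
    then show ?thesis by (simp only: mult.commute)
  qed
  then show ?case
    by (auto intro!: trig_polys.add trig_polys_sum trig_polys.scale trig_polys_coordinates)
next
  case (const c)
  show ?case by (rule trig_polys_const)
next
  case (add f g)
  from trig_polys.add[OF add.IH] show ?case .
next
  case (mult f g)
  from trig_polys_mult[OF mult.IH] show ?case .
qed

lemma trig_polys_C1_periodic:
  assumes "p \<in> trig_polys"
  shows "C1 p" "periodic p"
proof -
  have "C1 p \<and> periodic p" using assms
  proof induction
    case (trig k \<theta>) then show ?case using C1_trig periodic_trig by blast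
  next
    case (add p q) then show ?case using C1_add periodic_binop[of p q "(+)"] by blast
  next
    case (scale p c) then show ?case using C1_mult[OF C1_const] periodic_compose[of p "(*) c"] by blast
  qed
  then show "C1 p" "periodic p" by auto
qed

lemma L1_integrable: "f \<in> L1 \<Longrightarrow> integrable torus f"
  by (simp add: L1_def)

lemma integrable_mult_bounded:
  fixes g h :: "real ^ 'd \<Rightarrow> real"
  assumes "integrable torus g" "h \<in> borel_measurable borel" "\<And>x. \<bar>h x\<bar> \<le> K"
  shows "integrable torus (\<lambda>x. g x * h x)"
proof (rule Bochner_Integration.integrable_bound[of _ "\<lambda>x. K * g x"])
  show "integrable torus (\<lambda>x. K * g x)" using assms(1) by simp
  show "(\<lambda>x. g x * h x) \<in> borel_measurable torus"
    using borel_measurable_integrable[OF assms(1)] borel_measurable_torus[OF assms(2)] by (rule borel_measurable_times)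
  show "AE x in torus. norm (g x * h x) \<le> norm (K * g x)"
  proof (rule AE_I2)
    fix x
    have "\<bar>h x\<bar> \<le> \<bar>K\<bar>" using assms(3)[of x] by linarith
    then show "norm (g x * h x) \<le> norm (K * g x)"
      using mult_left_mono[of "\<bar>h x\<bar>" "\<bar>K\<bar>" "\<bar>g x\<bar>"] by (simp add: abs_mult mult.commute)
  qed
qed

section \<open>Uniqueness of Fourier coefficients for integrable functions\<close>

context
  fixes g :: "real ^ 'd \<Rightarrow> real"
  assumes g: "integrable torus g" and gm [measurable]: "g \<in> borel_measurable borel"
    and g0: "\<And>k \<theta>. k \<in> freqs \<Longrightarrow> (\<integral>x. g x * trig k \<theta> x \<partial>torus) = 0"
begin

lemma orthogonal_trig_polys:
  assumes "p \<in> trig_polys" shows "(\<integral>x. g x * p x \<partial>torus) = 0"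
proof -
  have "integrable torus (\<lambda>x. g x * p x) \<and> (\<integral>x. g x * p x \<partial>torus) = 0" using assms
  proof induction
    case (trig k \<theta>)
    have "integrable torus (\<lambda>x. g x * trig k \<theta> x)"
      by (rule integrable_mult_bounded[OF g C1_measurable[OF C1_trig], of _ _ 1]) (simp add: trig_def)
    then show ?case using g0[OF trig] by simp
  next
    case (add p q) then show ?case by (simp add: distrib_left)
  next
    case (scale p c) then show ?case by (simp add: mult.left_commute)
  qed
  then show ?thesis by simp
qed

text \<open>Polynomial approximation is uniform on the image of the torus, and uniform approximation
  is enough against an integrable \<open>g\<close>.\<close>

lemma orthogonal_continuous:
  fixes h :: "(real ^ 'd) \<times> (real ^ 'd) \<Rightarrow> real"
  assumes h: "continuous_on UNIV h"
  shows "(\<integral>x. g x * h (circles x) \<partial>torus) = 0"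
proof -
  let ?S = "cbox (\<chi> i. -1) (\<chi> i. 1) \<times> cbox (\<chi> i. -1) (\<chi> i. 1) :: ((real ^ 'd) \<times> (real ^ 'd)) set"
  have cS: "compact ?S" by (intro compact_Times compact_cbox)
  have inS: "circles x \<in> ?S" for x :: "real ^ 'd" by (simp add: circles_def mem_box_cart)
  have cc: "continuous_on UNIV (circles :: real ^ 'd \<Rightarrow> _)"
    unfolding circles_def by (intro continuous_intros)
  have hm: "(\<lambda>x. h (circles x)) \<in> borel_measurable borel"
    by (intro borel_measurable_continuous_onI continuous_on_compose2[OF h cc]) auto
  have "bounded (h ` ?S)" by (intro compact_imp_bounded compact_continuous_image continuous_on_subset[OF h] cS) auto
  then obtain K where "\<forall>y\<in>h ` ?S. norm y \<le> K" unfolding bounded_iff by blast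
  then have K: "\<bar>h (circles x)\<bar> \<le> K" for x using inS[of x] by (metis imageI real_norm_def)
  have ih: "integrable torus (\<lambda>x. g x * h (circles x))" by (rule integrable_mult_bounded[OF g hm K])
  define G where "G = (\<integral>x. \<bar>g x\<bar> \<partial>torus)"
  have G: "G \<ge> 0" unfolding G_def by simp
  have "\<bar>\<integral>x. g x * h (circles x) \<partial>torus\<bar> \<le> 0 + e" if e: "e > 0" for e
  proof -
    define d where "d = e / (G + 1)"
    have d: "d > 0" using e G by (simp add: d_def)
    obtain p where p: "real_polynomial_function p" "\<And>x. x \<in> ?S \<Longrightarrow> \<bar>h x - p x\<bar> < d"
      using Stone_Weierstrass_real_polynomial_function[OF cS continuous_on_subset[OF h] d] by blast
    have tp: "(\<lambda>x. p (circles x)) \<in> trig_polys" by (rule real_polynomial_function_circles[OF p(1)])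
    note tpm = C1_measurable[OF trig_polys_C1_periodic(1)[OF tp]]
    have pb: "\<bar>p (circles x)\<bar> \<le> K + d" for x using p(2)[OF inS[of x]] K[of x] by linarith
    have ip: "integrable torus (\<lambda>x. g x * p (circles x))" by (rule integrable_mult_bounded[OF g tpm pb])
    have "(\<integral>x. g x * h (circles x) \<partial>torus) = (\<integral>x. g x * h (circles x) - g x * p (circles x) \<partial>torus)"
      using orthogonal_trig_polys[OF tp] ih ip by simp
    also have "\<bar>\<dots>\<bar> \<le> (\<integral>x. \<bar>g x * h (circles x) - g x * p (circles x)\<bar> \<partial>torus)" by (rule integral_abs_bound)
    also have "\<dots> \<le> (\<integral>x. d * \<bar>g x\<bar> \<partial>torus)"
    proof (rule integral_mono)
      show "integrable torus (\<lambda>x. \<bar>g x * h (circles x) - g x * p (circles x)\<bar>)" using ih ip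
        by (intro integrable_abs Bochner_Integration.integrable_diff)
      show "integrable torus (\<lambda>x. d * \<bar>g x\<bar>)" using g by simp
      show "\<bar>g x * h (circles x) - g x * p (circles x)\<bar> \<le> d * \<bar>g x\<bar>" for x
        using mult_left_mono[OF less_imp_le[OF p(2)[OF inS[of x]]], of "\<bar>g x\<bar>"]
        by (simp add: abs_mult mult.commute flip: right_diff_distrib)
    qed
    also have "\<dots> = d * G" by (simp add: G_def)
    also have "\<dots> \<le> d * (G + 1)" using d by (intro mult_left_mono) simp_all
    also have "\<dots> = e" using G by (simp add: d_def)
    finally show ?thesis by simp
  qed
  then have "\<bar>\<integral>x. g x * h (circles x) \<partial>torus\<bar> \<le> 0" by (rule field_le_epsilon)
  then show ?thesis by simp
qed

text \<open>Membership in an arc of half-width \<open>w\<close> expressed by a cosine, hence by a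
  continuous function on the circle. The bound \<open>2 * pi - w\<close> on the distance keeps the
  arc from being met again after a full turn.\<close>

lemma cos_gt_iff:
  fixes y w :: real
  assumes "0 < w" "w \<le> pi" "\<bar>y\<bar> \<le> 2 * pi - w"
  shows "cos y > cos w \<longleftrightarrow> \<bar>y\<bar> < w"
proof
  assume "\<bar>y\<bar> < w"
  then have "cos w < cos \<bar>y\<bar>" using assms by (intro cos_monotone_0_pi) auto
  then show "cos y > cos w" by simp
next
  assume *: "cos y > cos w"
  show "\<bar>y\<bar> < w"
  proof (rule ccontr)
    assume "\<not> \<bar>y\<bar> < w"
    then have yw: "w \<le> \<bar>y\<bar>" by simp
    have "cos \<bar>y\<bar> \<le> cos w"
    proof (cases "\<bar>y\<bar> \<le> pi")
      case True
      then show ?thesis using yw assms by (intro cos_monotone_0_pi_le) auto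
    next
      case False
      have "cos (2 * pi - \<bar>y\<bar>) \<le> cos w" using False yw assms by (intro cos_monotone_0_pi_le) auto
      then show ?thesis by simp
    qed
    with * show False by simp
  qed
qed

text \<open>On the cell the indicator of the box is the pointwise limit of products of clipped
  multiples of \<open>cos (x $ i - a i) - cos (w i)\<close>, where \<open>a i\<close> and
  \<open>w i\<close> are the centre and half-width of each side.\<close>

lemma orthogonal_inner_box:
  assumes lu: "\<And>i. 0 \<le> l $ i" "\<And>i. l $ i < u $ i" "\<And>i. u $ i \<le> 2 * pi"
  shows "(\<integral>x. g x * indicator (box l u) x \<partial>torus) = 0"
proof -
  define a where "a i = (l $ i + u $ i) / 2" for i
  define w where "w i = (u $ i - l $ i) / 2" for i
  have w: "0 < w i" "w i \<le> pi" for i using lu[of i] by (auto simp: w_def)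
  define s where "s n v = min 1 (real n * max 0 v)" for n and v :: real
  define h where "h n y = (\<Prod>i\<in>UNIV. s n (cos (a i) * fst y $ i + sin (a i) * snd y $ i - cos (w i)))" for n and y ::
    "(real ^ 'd) \<times> (real ^ 'd)"
  have s01: "0 \<le> s n v" "s n v \<le> 1" for n v by (auto simp: s_def)
  have hb: "0 \<le> h n y" "h n y \<le> 1" for n y unfolding h_def by (auto intro: prod_nonneg prod_le_1 s01)
  have hc: "continuous_on UNIV (h n)" for n
    unfolding h_def s_def by (intro continuous_intros)
  have hcirc: "h n (circles x) = (\<Prod>i\<in>UNIV. s n (cos (x $ i - a i) - cos (w i)))" for n x
    unfolding h_def circles_def by (simp add: cos_diff mult.commute)
  have slim: "(\<lambda>n. s n v) \<longlonglongrightarrow> (if v > 0 then 1 else 0)" for v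
  proof (cases "v > 0")
    case True
    obtain N :: nat where "1 / v < real N" using reals_Archimedean2 by blast
    then have N: "1 \<le> real N * v" using True by (simp add: field_simps)
    have "s n v = 1" if "n \<ge> N" for n
    proof -
      have "real N * v \<le> real n * v" using that True by (intro mult_right_mono) auto
      with N have "1 \<le> real n * v" by (rule order_trans)
      then show ?thesis using True by (simp add: s_def)
    qed
    then have "\<forall>\<^sub>F n in sequentially. s n v = (if v > 0 then 1 else 0)"
      using True eventually_sequentially by auto
    then show ?thesis by (rule tendsto_eventually)
  qed (simp add: s_def)
  have "(\<lambda>n. \<integral>x. g x * h n (circles x) \<partial>torus) \<longlonglongrightarrow> (\<integral>x. g x * indicator (box l u) x \<partial>torus)"
  proof (rule integral_dominated_convergence[where w = "\<lambda>x. \<bar>g x\<bar>"])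
    have "(\<lambda>x. g x * indicator (box l u) x) \<in> borel_measurable borel" by measurable
    then show "(\<lambda>x. g x * indicator (box l u) x) \<in> borel_measurable torus" by (rule borel_measurable_torus)
    have "continuous_on UNIV (circles :: real ^ 'd \<Rightarrow> _)"
      unfolding circles_def by (intro continuous_intros)
    then have [measurable]: "(\<lambda>x. h n (circles x)) \<in> borel_measurable borel" for n
      by (intro borel_measurable_continuous_onI continuous_on_compose2[OF hc]) auto
    have "(\<lambda>x. g x * h n (circles x)) \<in> borel_measurable borel" for n by measurable
    then show "(\<lambda>x. g x * h n (circles x)) \<in> borel_measurable torus" for n by (rule borel_measurable_torus)
    show "integrable torus (\<lambda>x. \<bar>g x\<bar>)" using g by (rule integrable_abs)
    show "AE x in torus. norm (g x * h n (circles x)) \<le> \<bar>g x\<bar>" for n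
    proof (rule AE_I2)
      fix x show "norm (g x * h n (circles x)) \<le> \<bar>g x\<bar>"
        using hb[of n "circles x"] by (simp add: abs_mult mult_left_le)
    qed
    show "AE x in torus. (\<lambda>n. g x * h n (circles x)) \<longlonglongrightarrow> g x * indicator (box l u) x"
    proof (rule AE_I2)
      fix x :: "real ^ 'd" assume "x \<in> space torus"
      then have x: "0 \<le> x $ i" "x $ i \<le> 2 * pi" for i by (simp_all add: space_torus mem_box_cart)
      have "cos (x $ i - a i) > cos (w i) \<longleftrightarrow> l $ i < x $ i \<and> x $ i < u $ i" for i
      proof -
        have "\<bar>x $ i - a i\<bar> \<le> 2 * pi - w i" using x[of i] lu[of i] unfolding a_def w_def
          by (simp add: abs_le_iff field_simps)
        from cos_gt_iff[OF w this] show ?thesis unfolding a_def w_def by (auto simp: abs_less_iff field_simps)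
      qed
      then have ind: "indicator (box l u) x = (\<Prod>i\<in>UNIV. if cos (x $ i - a i) - cos (w i) > 0 then 1 else 0 :: real)"
        by (auto simp: indicator_def mem_box_cart)
      show "(\<lambda>n. g x * h n (circles x)) \<longlonglongrightarrow> g x * indicator (box l u) x"
        unfolding hcirc ind by (intro tendsto_mult tendsto_const tendsto_prod slim)
    qed
  qed
  then have "(\<lambda>n :: nat. 0 :: real) \<longlonglongrightarrow> (\<integral>x. g x * indicator (box l u) x \<partial>torus)"
    by (simp only: orthogonal_continuous[OF hc])
  then show ?thesis by (simp add: LIMSEQ_const_iff)
qed

lemma AE_torus_interior: "AE x :: real ^ 'd in torus. \<forall>i. 0 < x $ i \<and> x $ i < 2 * pi"
proof -
  have "AE x :: real ^ 'd in lborel. \<forall>i. x $ i \<noteq> 0 \<and> x $ i \<noteq> 2 * pi"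
    unfolding AE_all_countable using AE_lborel_component[of _ 0] AE_lborel_component[of _ "2 * pi"] by auto
  then show ?thesis
    unfolding AE_torus_iff by eventually_elim (auto simp: mem_box_cart less_le)
qed

text \<open>Clipping the box to the cell changes its indicator only on the boundary of the cell, a
  null set.\<close>

lemma orthogonal_box: "(\<integral>x. g x * indicator (box l u) x \<partial>torus) = 0"
proof -
  define l' where "l' = (\<chi> i. max (l $ i) 0)"
  define u' where "u' = (\<chi> i. min (u $ i) (2 * pi))"
  have "(\<integral>x. g x * indicator (box l u) x \<partial>torus) = (\<integral>x. g x * indicator (box l' u') x \<partial>torus)"
  proof (rule integral_cong_AE)
    show "AE x in torus. g x * indicator (box l u) x = g x * indicator (box l' u') x"
      using AE_torus_interior
    proof eventually_elim
      case (elim x)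
      have "x \<in> box l u \<longleftrightarrow> x \<in> box l' u'"
        using elim unfolding mem_box_cart l'_def u'_def by simp
      then show ?case by (simp add: indicator_def)
    qed
  qed (rule borel_measurable_torus, measurable)+
  also have "\<dots> = 0"
  proof (cases "\<forall>i. l' $ i < u' $ i")
    case True
    then show ?thesis by (intro orthogonal_inner_box) (auto simp: l'_def u'_def)
  next
    case False
    then have "box l' u' = {}" unfolding interval_eq_empty_cart by (auto simp: not_less)
    then show ?thesis by simp
  qed
  finally show ?thesis .
qed

text \<open>Dynkin's lemma: open boxes form an intersection-stable generator, and the sets over
  which \<open>g\<close> integrates to zero are closed under complements because frequency 0 gives
  total integral zero.\<close>

lemma orthogonal_set:
  assumes "A \<in> sets borel"
  shows "(\<integral>x. g x * indicator A x \<partial>torus) = 0"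
proof -
  have gi: "integrable torus (\<lambda>x. g x * indicator B x)" if "B \<in> sets borel" for B
    by (rule integrable_mult_bounded[OF g, of _ 1]) (use that in \<open>auto simp: indicator_def\<close>)
  have g_all: "(\<integral>x. g x \<partial>torus) = 0"
    using g0[of 0 0] by (simp add: trig_def freqs_def)
  have "Int_stable (range (\<lambda>(a, b). box a b :: (real ^ 'd) set))"
    
    unfolding Int_stable_def by (auto simp: box_Int_box)
  moreover have "range (\<lambda>(a, b). box a b :: (real ^ 'd) set) \<subseteq> Pow UNIV" by auto
  moreover have "A \<in> sigma_sets UNIV (range (\<lambda>(a, b). box a b :: (real ^ 'd) set))"
    using assms unfolding borel_eq_box by simp
  ultimately show ?thesis
  proof (induction rule: sigma_sets_induct_disjoint)
    case (basic B)
    then show ?case using orthogonal_box by auto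
  next
    case empty
    show ?case by simp
  next
    case (compl B)
    then have B: "B \<in> sets borel" unfolding borel_eq_box by simp
    have "(\<integral>x. g x * indicator (UNIV - B) x \<partial>torus) = (\<integral>x. g x - g x * indicator B x \<partial>torus)"
      by (intro Bochner_Integration.integral_cong refl) (simp add: indicator_def)
    also have "\<dots> = 0" using g gi[OF B] g_all compl by (simp add: Bochner_Integration.integral_diff)
    finally show ?case .
  next
    case (union B)
    then have B: "B i \<in> sets borel" for i unfolding borel_eq_box by auto
    have Bt: "B i \<inter> space torus \<in> sets (torus :: (real ^ 'd) measure)" for i
      using B unfolding torus_def by (auto simp: sets_restrict_space space_restrict_space)
    define B' where "B' i = B i \<inter> space torus" for i
    have ind: "g x * indicator S x = indicator (S \<inter> space torus) x *\<^sub>R g x" if "x \<in> space torus" for x S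
      using that by (simp add: indicator_def)
    have si: "set_integrable torus (\<Union>i. B' i) g"
      unfolding set_integrable_def B'_def using Bt by (intro integrable_mult_indicator g sets.countable_UN) auto
    have "(\<integral>x. g x * indicator (\<Union>i. B i) x \<partial>torus) = (LINT x:(\<Union>i. B' i)|torus. g x)"
      unfolding set_lebesgue_integral_def B'_def
      by (intro Bochner_Integration.integral_cong refl) (auto simp: ind indicator_def)
    also have "\<dots> = (\<Sum>i. (LINT x:(B' i)|torus. g x))"
    proof (rule lebesgue_integral_countable_add[OF _ _ si])
      show "B' i \<in> sets torus" for i using Bt by (simp add: B'_def)
      show "i \<noteq> j \<Longrightarrow> B' i \<inter> B' j = {}" for i j
        using union(1) by (auto simp: B'_def disjoint_family_on_def)
    qed
    also have "\<dots> = (\<Sum>i. 0 :: real)"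
    proof (rule arg_cong[where f = suminf], rule ext)
      fix i
      have "(LINT x:(B' i)|torus. g x) = (\<integral>x. g x * indicator (B i) x \<partial>torus)"
        unfolding set_lebesgue_integral_def B'_def
        by (intro Bochner_Integration.integral_cong refl) (auto simp: indicator_def)
      then show "(LINT x:(B' i)|torus. g x) = 0" using union(3) by simp
    qed
    finally show ?case by simp
  qed
qed

text \<open>Vanishing of the integrals over the set where \<open>g\<close> is positive and over the
  set where it is negative forces both sets to be null.\<close>

lemma orthogonal_trig_imp_AE_0: "AE x in torus. g x = 0"
proof -
  have *: "AE x in torus. indicator {x. s * g x > 0} x * (s * g x) = 0" if s: "s = 1 \<or> s = -1" for s
  proof -
    have m: "{x. s * g x > 0} \<in> sets borel" by measurable
    have int: "integrable torus (\<lambda>x. g x * (s * indicator {x. s * g x > 0} x))"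
    proof (rule integrable_mult_bounded[OF g])
      show "\<bar>s * indicator {x. s * g x > 0} x\<bar> \<le> 1" for x using s by (auto simp: indicator_def)
    qed (use m in measurable)
    have "(\<integral>x. g x * (s * indicator {x. s * g x > 0} x) \<partial>torus) = (\<integral>x. s * (g x * indicator {x. s * g x > 0} x) \<partial>torus)"
      by (simp add: mult.left_commute)
    then have "(\<integral>x. g x * (s * indicator {x. s * g x > 0} x) \<partial>torus) = 0"
      using orthogonal_set[OF m] by simp
    then have "AE x in torus. g x * (s * indicator {x. s * g x > 0} x) = 0"
      using integral_nonneg_eq_0_iff_AE[OF int] by (auto simp: indicator_def mult.commute split: if_splits)
    then show ?thesis by eventually_elim auto
  qed
  show ?thesis using *[OF disjI1[OF refl]] *[OF disjI2[OF refl]]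
  proof eventually_elim
    case (elim x)
    then show ?case by (cases "g x" "0 :: real" rule: linorder_cases) (auto simp: indicator_def)
  qed
qed

end

subsection \<open>Weak derivatives\<close>

lemma L1_add: "f \<in> L1 \<Longrightarrow> g \<in> L1 \<Longrightarrow> (\<lambda>x. f x + g x) \<in> L1"
  by (auto simp: L1_def periodic_def)

lemma L1_scale: "f \<in> L1 \<Longrightarrow> (\<lambda>x. c * f x) \<in> L1"
  by (auto simp: L1_def periodic_def)

lemma L1_mult_bounded:
  assumes f: "f \<in> L1" and g: "periodic g" "g \<in> borel_measurable borel" "\<And>x. \<bar>g x\<bar> \<le> K"
  shows "(\<lambda>x. g x * f x) \<in> L1"
proof -
  have "integrable torus (\<lambda>x. f x * g x)"
    by (rule integrable_mult_bounded[OF L1_integrable[OF f] g(2,3)])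
  then show ?thesis using f g by (auto simp: L1_def periodic_def mult.commute)
qed

lemma L1_mult_C1:
  assumes "f \<in> L1" "C1 g" "periodic g"
  shows "(\<lambda>x. g x * f x) \<in> L1"
proof -
  obtain K where "\<And>x. \<bar>g x\<bar> \<le> K" using C1_bounded[OF assms(2,3)] by blast
  from L1_mult_bounded[OF assms(1,3) C1_measurable[OF assms(2)] this] show ?thesis .
qed

lemma L1_mult_grad:
  assumes "f \<in> L1" "C1 g" "periodic g"
  shows "(\<lambda>x. grad g x $ i * f x) \<in> L1"
proof -
  obtain K where K: "\<And>x. norm (grad g x) \<le> K" using C1_grad_bounded[OF assms(2,3)] by blast
  show ?thesis
  proof (rule L1_mult_bounded[OF assms(1)])
    show "periodic (\<lambda>x. grad g x $ i)" using periodic_compose[OF periodic_grad[OF assms(3)]] .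
    show "(\<lambda>x. grad g x $ i) \<in> borel_measurable borel" using C1_grad_L2[OF assms(2,3)] by (rule L2_measurable)
    show "\<bar>grad g x $ i\<bar> \<le> K" for x using component_le_norm_cart[of "grad g x" i] K[of x] by linarith
  qed
qed

lemma integrable_mult_C1:
  assumes "f \<in> L1" "C1 g" "periodic g"
  shows "integrable torus (\<lambda>x. f x * g x)" "integrable torus (\<lambda>x. f x * grad g x $ i)"
  using L1_integrable[OF L1_mult_C1[OF assms]] L1_integrable[OF L1_mult_grad[OF assms, of i]]
    by (simp_all add: mult.commute)

text \<open>Trigonometric functions are among the test functions, so equal pairings give equal
  Fourier coefficients. This is what makes weak gradients and divergences unique.\<close>

lemma L1_eq_AE_trig:
  assumes "f \<in> L1" "g \<in> L1"
    and "\<And>\<phi>. periodic \<phi> \<Longrightarrow> C1 \<phi> \<Longrightarrow> (\<integral>x. f x * \<phi> x \<partial>torus) = (\<integral>x. g x * \<phi> x \<partial>torus)"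
  shows "AE x in torus. f x = g x"
proof -
  have "AE x in torus. f x - g x = 0"
  proof (rule orthogonal_trig_imp_AE_0)
    show "integrable torus (\<lambda>x. f x - g x)" using assms by (intro Bochner_Integration.integrable_diff L1_integrable)
    show "(\<lambda>x. f x - g x) \<in> borel_measurable borel" using assms L1_measurable by (intro borel_measurable_diff)
    fix k :: "real ^ 'a" and \<theta> assume k: "k \<in> freqs"
    note int = integrable_mult_C1(1)[OF _ C1_trig periodic_trig[OF k]]
    have "(\<integral>x. (f x - g x) * trig k \<theta> x \<partial>torus) = (\<integral>x. f x * trig k \<theta> x - g x * trig k \<theta> x \<partial>torus)"
      by (simp add: left_diff_distrib)
    also have "\<dots> = (\<integral>x. f x * trig k \<theta> x \<partial>torus) - (\<integral>x. g x * trig k \<theta> x \<partial>torus)"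
      by (rule Bochner_Integration.integral_diff[OF int[OF assms(1)] int[OF assms(2)]])
    finally show "(\<integral>x. (f x - g x) * trig k \<theta> x \<partial>torus) = 0" using assms(3)[OF periodic_trig[OF k] C1_trig] by simp
  qed
  then show ?thesis by eventually_elim simp
qed

lemma has_weak_partialD:
  assumes "has_weak_partial i f g"
  shows "f \<in> L1" "g \<in> L1"
    "\<And>\<phi>. periodic \<phi> \<Longrightarrow> C1 \<phi> \<Longrightarrow> (\<integral>x. f x * grad \<phi> x $ i \<partial>torus) = - (\<integral>x. g x * \<phi> x \<partial>torus)"
  using assms by (auto simp: has_weak_partial_def)

lemma has_weak_partial_unique:
  assumes "has_weak_partial i f g" "has_weak_partial i f' g'" "AE x in torus. f x = f' x"
  shows "AE x in torus. g x = g' x"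
proof (rule L1_eq_AE_trig)
  fix \<phi> :: "real ^ 'a \<Rightarrow> real" assume p: "periodic \<phi>" "C1 \<phi>"
  have "(\<integral>x. f x * grad \<phi> x $ i \<partial>torus) = (\<integral>x. f' x * grad \<phi> x $ i \<partial>torus)"
  proof (rule integral_cong_AE)
    show "AE x in torus. f x * grad \<phi> x $ i = f' x * grad \<phi> x $ i" using assms(3) by eventually_elim simp
    show "(\<lambda>x. f x * grad \<phi> x $ i) \<in> borel_measurable torus" "(\<lambda>x. f' x * grad \<phi> x $ i) \<in> borel_measurable torus"
      using integrable_mult_C1(2)[OF has_weak_partialD(1)[OF assms(1)] p(2,1)] integrable_mult_C1(2)[OF has_weak_partialD(1)[OF assms(2)] p(2,1)]
      by (auto intro: borel_measurable_integrable)
  qed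
  then show "(\<integral>x. g x * \<phi> x \<partial>torus) = (\<integral>x. g' x * \<phi> x \<partial>torus)"
    using has_weak_partialD(3)[OF assms(1) p] has_weak_partialD(3)[OF assms(2) p] by simp
qed (use assms has_weak_partialD in blast)+

lemma has_weak_partial_cong:
  assumes "has_weak_partial i f g" "AE x in torus. f x = f' x" "AE x in torus. g x = g' x" "f' \<in> L1" "g' \<in> L1"
  shows "has_weak_partial i f' g'"
  unfolding has_weak_partial_def
proof (intro conjI allI impI)
  fix \<phi> :: "real ^ 'a \<Rightarrow> real" assume p: "periodic \<phi> \<and> C1 \<phi>"
  note fg = has_weak_partialD[OF assms(1)]
  have "(\<integral>x. f' x * grad \<phi> x $ i \<partial>torus) = (\<integral>x. f x * grad \<phi> x $ i \<partial>torus)"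
  proof (rule integral_cong_AE)
    show "AE x in torus. f' x * grad \<phi> x $ i = f x * grad \<phi> x $ i" using assms(2) by eventually_elim simp
  qed (use integrable_mult_C1(2) fg(1) assms(4) p in \<open>blast intro: borel_measurable_integrable\<close>)+
  moreover have "(\<integral>x. g' x * \<phi> x \<partial>torus) = (\<integral>x. g x * \<phi> x \<partial>torus)"
  proof (rule integral_cong_AE)
    show "AE x in torus. g' x * \<phi> x = g x * \<phi> x" using assms(3) by eventually_elim simp
  qed (use integrable_mult_C1(1) fg(2) assms(5) p in \<open>blast intro: borel_measurable_integrable\<close>)+
  ultimately show "(\<integral>x. f' x * grad \<phi> x $ i \<partial>torus) = - (\<integral>x. g' x * \<phi> x \<partial>torus)"
    using fg(3)[of \<phi>] p by simp
qed (rule assms)+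

lemma has_weak_partial_add:
  assumes "has_weak_partial i f f'" "has_weak_partial i g g'"
  shows "has_weak_partial i (\<lambda>x. f x + g x) (\<lambda>x. f' x + g' x)"
  unfolding has_weak_partial_def
proof (intro conjI allI impI)
  note F = has_weak_partialD[OF assms(1)] and G = has_weak_partialD[OF assms(2)]
  show "(\<lambda>x. f x + g x) \<in> L1" "(\<lambda>x. f' x + g' x) \<in> L1" using F G by (auto intro: L1_add)
  fix \<phi> :: "real ^ 'a \<Rightarrow> real" assume "periodic \<phi> \<and> C1 \<phi>"
  then have p: "periodic \<phi>" "C1 \<phi>" by auto
  note int = integrable_mult_C1[OF _ p(2,1)]
  show "(\<integral>x. (f x + g x) * grad \<phi> x $ i \<partial>torus) = - (\<integral>x. (f' x + g' x) * \<phi> x \<partial>torus)"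
    unfolding distrib_right Bochner_Integration.integral_add[OF int(2)[OF F(1)] int(2)[OF G(1)]]
      Bochner_Integration.integral_add[OF int(1)[OF F(2)] int(1)[OF G(2)]]
    using F(3)[OF p] G(3)[OF p] by simp
qed

lemma has_weak_partial_scale:
  assumes "has_weak_partial i f f'"
  shows "has_weak_partial i (\<lambda>x. c * f x) (\<lambda>x. c * f' x)"
  using assms unfolding has_weak_partial_def by (auto intro: L1_scale simp: mult.assoc)

text \<open>The product of \<open>g\<close> with a test function is again a test function, so the
  rule for \<open>f\<close> may be applied to it and the classical product rule does the
  rest.\<close>

lemma has_weak_partial_mult_C1:
  assumes f: "has_weak_partial i f f'" and g: "C1 g" "periodic g"
  shows "has_weak_partial i (\<lambda>x. g x * f x) (\<lambda>x. g x * f' x + grad g x $ i * f x)"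
  unfolding has_weak_partial_def
proof (intro conjI allI impI)
  note F = has_weak_partialD[OF f]
  show gf: "(\<lambda>x. g x * f x) \<in> L1" by (rule L1_mult_C1[OF F(1) g])
  show "(\<lambda>x. g x * f' x + grad g x $ i * f x) \<in> L1"
    by (intro L1_add L1_mult_C1 L1_mult_grad F g)
  fix \<phi> :: "real ^ 'a \<Rightarrow> real" assume p: "periodic \<phi> \<and> C1 \<phi>"
  then have p1: "C1 \<phi>" and p2: "periodic \<phi>" by auto
  have gp: "C1 (\<lambda>x. g x * \<phi> x)" "periodic (\<lambda>x. g x * \<phi> x)"
    using C1_mult[OF g(1) p1] periodic_binop[OF g(2) p2] by auto
  have i1: "integrable torus (\<lambda>x. g x * f x * grad \<phi> x $ i)" by (rule integrable_mult_C1(2)[OF gf p1 p2])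
  have i2: "integrable torus (\<lambda>x. grad g x $ i * f x * \<phi> x)"
    by (rule integrable_mult_C1(1)[OF L1_mult_grad[OF F(1) g] p1 p2])
  have i3: "integrable torus (\<lambda>x. g x * f' x * \<phi> x)"
    by (rule integrable_mult_C1(1)[OF L1_mult_C1[OF F(2) g] p1 p2])
  have "(\<integral>x. g x * f x * grad \<phi> x $ i + grad g x $ i * f x * \<phi> x \<partial>torus) = (\<integral>x. f x * grad (\<lambda>x. g x * \<phi> x) x $ i \<partial>torus)"
    by (intro Bochner_Integration.integral_cong refl) (subst grad_mult[OF g(1) p1], simp add: algebra_simps)
  also have "\<dots> = - (\<integral>x. f' x * (g x * \<phi> x) \<partial>torus)" by (rule F(3)[OF gp(2,1)])
  also have "(\<integral>x. f' x * (g x * \<phi> x) \<partial>torus) = (\<integral>x. g x * f' x * \<phi> x \<partial>torus)" by (simp add: mult_ac)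
  finally have eq: "(\<integral>x. g x * f x * grad \<phi> x $ i \<partial>torus) + (\<integral>x. grad g x $ i * f x * \<phi> x \<partial>torus) = - (\<integral>x. g x * f' x * \<phi> x \<partial>torus)"
    by (simp only: Bochner_Integration.integral_add[OF i1 i2])
  have "(\<integral>x. (g x * f' x + grad g x $ i * f x) * \<phi> x \<partial>torus) = (\<integral>x. g x * f' x * \<phi> x \<partial>torus) + (\<integral>x. grad g x $ i * f x * \<phi> x \<partial>torus)"
    unfolding distrib_right by (rule Bochner_Integration.integral_add[OF i3 i2])
  with eq show "(\<integral>x. g x * f x * grad \<phi> x $ i \<partial>torus) = - (\<integral>x. (g x * f' x + grad g x $ i * f x) * \<phi> x \<partial>torus)"
    by simp
qed

lemma weak_grad_partial:
  assumes "\<And>i. has_weak_partial i f (g i)"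
  shows "has_weak_partial i f (\<lambda>x. weak_grad f x $ i)"
proof -
  have "\<exists>G. \<forall>i. has_weak_partial i f (\<lambda>x. G x $ i)"
    using assms by (intro exI[of _ "\<lambda>x. \<chi> i. g i x"]) simp
  from someI_ex[OF this] show ?thesis unfolding weak_grad_def by blast
qed

lemma weak_grad_AE_eq:
  assumes "\<And>i. has_weak_partial i f (g i)"
  shows "AE x in torus. \<forall>i. weak_grad f x $ i = g i x"
  unfolding AE_all_countable
  using has_weak_partial_unique[OF weak_grad_partial[OF assms] assms] by simp

lemma has_weak_divD:
  assumes "has_weak_div F g"
  shows "\<And>i. (\<lambda>x. F x $ i) \<in> L1" "g \<in> L1"
    "\<And>\<phi>. periodic \<phi> \<Longrightarrow> C1 \<phi> \<Longrightarrow> (\<integral>x. F x \<bullet> grad \<phi> x \<partial>torus) = - (\<integral>x. g x * \<phi> x \<partial>torus)"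
  using assms by (auto simp: has_weak_div_def)

lemma weak_div_AE_eq:
  assumes "has_weak_div F g"
  shows "AE x in torus. weak_div F x = g x"
proof -
  have d: "has_weak_div F (weak_div F)" unfolding weak_div_def by (rule someI[of "has_weak_div F", OF assms])
  show ?thesis
  proof (rule L1_eq_AE_trig[OF has_weak_divD(2)[OF d] has_weak_divD(2)[OF assms]])
    fix \<phi> :: "real ^ 'a \<Rightarrow> real" assume p: "periodic \<phi>" "C1 \<phi>"
    show "(\<integral>x. weak_div F x * \<phi> x \<partial>torus) = (\<integral>x. g x * \<phi> x \<partial>torus)"
      using has_weak_divD(3)[OF d p] has_weak_divD(3)[OF assms p] by simp
  qed
qed

lemma has_weak_div_partials:
  assumes "\<And>i. has_weak_partial i (\<lambda>x. F x $ i) (g i)"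
  shows "has_weak_div F (\<lambda>x. \<Sum>i\<in>UNIV. g i x)"
  unfolding has_weak_div_def
proof (intro conjI allI impI)
  note P = has_weak_partialD[OF assms]
  show "(\<lambda>x. F x $ i) \<in> L1" for i by (rule P(1))
  show "(\<lambda>x. \<Sum>i\<in>UNIV. g i x) \<in> L1"
    using P(2) by (auto simp: L1_def periodic_def intro!: borel_measurable_sum)
  fix \<phi> :: "real ^ 'a \<Rightarrow> real" assume p: "periodic \<phi> \<and> C1 \<phi>"
  have "(\<integral>x. F x \<bullet> grad \<phi> x \<partial>torus) = (\<Sum>i\<in>UNIV. \<integral>x. F x $ i * grad \<phi> x $ i \<partial>torus)"
    unfolding inner_vec_def inner_real_def
    using p integrable_mult_C1(2)[OF P(1)] by (intro Bochner_Integration.integral_sum) simp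
  also have "\<dots> = (\<Sum>i\<in>UNIV. - (\<integral>x. g i x * \<phi> x \<partial>torus))" using P(3) p by simp
  also have "\<dots> = - (\<Sum>i\<in>UNIV. \<integral>x. g i x * \<phi> x \<partial>torus)" by (rule sum_negf)
  also have "(\<Sum>i\<in>UNIV. \<integral>x. g i x * \<phi> x \<partial>torus) = (\<integral>x. (\<Sum>i\<in>UNIV. g i x * \<phi> x) \<partial>torus)"
    using p integrable_mult_C1(1)[OF P(2)] by (intro Bochner_Integration.integral_sum[symmetric]) simp
  finally show "(\<integral>x. F x \<bullet> grad \<phi> x \<partial>torus) = - (\<integral>x. (\<Sum>i\<in>UNIV. g i x) * \<phi> x \<partial>torus)"
    by (simp add: sum_distrib_right)
qed

section \<open>The Sobolev space of order one\<close>

lemma H1_I: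
  assumes "f \<in> L2" "\<And>i. g i \<in> L2" "\<And>i. has_weak_partial i f (g i)"
  shows "f \<in> H1"
  using assms unfolding W1_def by blast

lemma H1_D:
  assumes "f \<in> H1"
  shows "f \<in> L2" "has_weak_partial i f (\<lambda>x. weak_grad f x $ i)" "(\<lambda>x. weak_grad f x $ i) \<in> L2"
proof -
  have "\<forall>i. \<exists>g. g \<in> L2 \<and> has_weak_partial i f g" using assms unfolding W1_def by blast
  from choice[OF this] obtain g where g: "\<And>i. g i \<in> L2" "\<And>i. has_weak_partial i f (g i)" by blast
  show "f \<in> L2" using assms by (simp add: W1_def)
  show w: "has_weak_partial i f (\<lambda>x. weak_grad f x $ i)" by (rule weak_grad_partial[OF g(2)])
  have "(\<lambda>x. weak_grad f x $ i) \<in> L1" using has_weak_partialD(2)[OF w] .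
  then show "(\<lambda>x. weak_grad f x $ i) \<in> L2"
    using L2_cong_AE[OF g(1)[of i], of "\<lambda>x. weak_grad f x $ i"] has_weak_partial_unique[OF g(2)[of i] w]
    by (simp add: L1_def)
qed

lemma C1_H1:
  assumes "C1 f" "periodic f" shows "f \<in> H1"
  by (rule H1_I[OF C1_L2 C1_grad_L2 C1_has_weak_partial]) (rule assms)+

definition grad_cls :: "(real ^ 'd \<Rightarrow> real) \<Rightarrow> 'd l2 ^ 'd" where
  "grad_cls f = (\<chi> i. cls (\<lambda>x. weak_grad f x $ i))"

text \<open>The Sobolev norm becomes the norm of the product, so H1 inherits its Hilbert space
  structure as a closed subspace and no separate type is introduced.\<close>

definition graph :: "(real ^ 'd \<Rightarrow> real) \<Rightarrow> 'd l2 \<times> ('d l2 ^ 'd)" where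
  "graph f = (cls f, grad_cls f)"

definition H1_graph :: "('d l2 \<times> ('d l2 ^ 'd)) set" where
  "H1_graph = graph ` H1"

lemma graph_eqI:
  assumes f: "f \<in> L2" "\<And>i. g i \<in> L2" "\<And>i. has_weak_partial i f (g i)"
  shows "f \<in> H1" "graph f = (cls f, \<chi> i. cls (g i))"
proof -
  show h: "f \<in> H1" by (rule H1_I[OF f])
  have "cls (\<lambda>x. weak_grad f x $ i) = cls (g i)" for i
    unfolding cls_eq_iff[OF H1_D(3)[OF h] f(2)] using weak_grad_AE_eq[of f g, OF f(3)] by eventually_elim simp
  then show "graph f = (cls f, \<chi> i. cls (g i))" by (simp add: graph_def grad_cls_def)
qed

lemma graph_add:
  assumes "f \<in> H1" "g \<in> H1"
  shows "(\<lambda>x. f x + g x) \<in> H1" "graph (\<lambda>x. f x + g x) = graph f + graph g"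
proof -
  note F = H1_D[OF assms(1)] and G = H1_D[OF assms(2)]
  note * = graph_eqI[OF L2_add[OF F(1) G(1)] L2_add[OF F(3) G(3)] has_weak_partial_add[OF F(2) G(2)]]
  show "(\<lambda>x. f x + g x) \<in> H1" by (rule *(1))
  show "graph (\<lambda>x. f x + g x) = graph f + graph g"
    unfolding *(2) by (simp add: graph_def grad_cls_def cls_add F G vec_eq_iff)
qed

lemma graph_scale:
  assumes "f \<in> H1"
  shows "(\<lambda>x. c * f x) \<in> H1" "graph (\<lambda>x. c * f x) = c *\<^sub>R graph f"
proof -
  note F = H1_D[OF assms(1)]
  note * = graph_eqI[OF L2_scale[OF F(1)] L2_scale[OF F(3)] has_weak_partial_scale[OF F(2)]]
  show "(\<lambda>x. c * f x) \<in> H1" by (rule *(1))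
  show "graph (\<lambda>x. c * f x) = c *\<^sub>R graph f"
    unfolding *(2) by (simp add: graph_def grad_cls_def cls_scaleR F vec_eq_iff)
qed

lemma L2_mult_C1:
  assumes "f \<in> L2" "C1 g" "periodic g"
  shows "(\<lambda>x. g x * f x) \<in> L2" "(\<lambda>x. grad g x $ i * f x) \<in> L2"
proof -
  obtain K where "\<And>x. \<bar>g x\<bar> \<le> K" using C1_bounded[OF assms(2,3)] by blast
  from L2_mult_bounded[OF assms(1,3) C1_measurable[OF assms(2)] this] show "(\<lambda>x. g x * f x) \<in> L2" .
  obtain K where K: "\<And>x. norm (grad g x) \<le> K" using C1_grad_bounded[OF assms(2,3)] by blast
  show "(\<lambda>x. grad g x $ i * f x) \<in> L2"
  proof (rule L2_mult_bounded[OF assms(1)])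
    show "periodic (\<lambda>x. grad g x $ i)" using periodic_compose[OF periodic_grad[OF assms(3)]] .
    show "(\<lambda>x. grad g x $ i) \<in> borel_measurable borel" using C1_grad_L2[OF assms(2,3)] by (rule L2_measurable)
    show "\<bar>grad g x $ i\<bar> \<le> K" for x using component_le_norm_cart[of "grad g x" i] K[of x] by linarith
  qed
qed

lemma H1_mult_C1:
  assumes f: "f \<in> H1" and g: "C1 g" "periodic g"
  shows "(\<lambda>x. g x * f x) \<in> H1"
    "AE x in torus. weak_grad (\<lambda>x. g x * f x) x = g x *\<^sub>R weak_grad f x + f x *\<^sub>R grad g x"
proof -
  note F = H1_D[OF f]
  have w: "has_weak_partial i (\<lambda>x. g x * f x) (\<lambda>x. g x * weak_grad f x $ i + grad g x $ i * f x)" for i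
    by (rule has_weak_partial_mult_C1[OF F(2) g])
  show "(\<lambda>x. g x * f x) \<in> H1"
    by (rule H1_I[OF L2_mult_C1(1)[OF F(1) g] L2_add[OF L2_mult_C1(1)[OF F(3) g] L2_mult_C1(2)[OF F(1) g]] w])
  show "AE x in torus. weak_grad (\<lambda>x. g x * f x) x = g x *\<^sub>R weak_grad f x + f x *\<^sub>R grad g x"
    using weak_grad_AE_eq[OF w] by eventually_elim (simp add: vec_eq_iff mult.commute)
qed

lemma subspace_H1_graph: "subspace H1_graph"
proof (rule subspaceI)
  have "graph (\<lambda>x. 0 * (0::real)) = (0 :: 'a l2 \<times> ('a l2 ^ 'a))"
    using graph_scale(2)[OF C1_H1[OF C1_const[of 0] periodic_const], of 0] by simp
  then show "(0 :: 'a l2 \<times> ('a l2 ^ 'a)) \<in> H1_graph"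
    using C1_H1[OF C1_const[of 0] periodic_const] unfolding H1_graph_def by (intro image_eqI[of _ _ "\<lambda>x. 0"]) simp_all
qed (auto simp: H1_graph_def graph_add(2)[symmetric] graph_scale(2)[symmetric] graph_add(1) graph_scale(1))

lemma inner_vec_l2: "(u :: 'd l2 ^ 'd) \<bullet> v = (\<Sum>i\<in>UNIV. u $ i \<bullet> v $ i)"
  by (rule inner_vec_def)

text \<open>Each condition on the right is a continuous linear equation in \<open>(a, b)\<close>,
  which makes the graph space visibly closed.\<close>

lemma H1_graph_iff:
  "(a, b) \<in> H1_graph \<longleftrightarrow>
     (\<forall>\<phi> i. periodic \<phi> \<and> C1 \<phi> \<longrightarrow> a \<bullet> cls (\<lambda>x. grad \<phi> x $ i) + (b $ i) \<bullet> cls \<phi> = 0)"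
proof
  assume "(a, b) \<in> H1_graph"
  then obtain f where f: "f \<in> H1" "a = cls f" "b = grad_cls f" by (auto simp: H1_graph_def graph_def)
  note F = H1_D[OF f(1)]
  show "\<forall>\<phi> i. periodic \<phi> \<and> C1 \<phi> \<longrightarrow> a \<bullet> cls (\<lambda>x. grad \<phi> x $ i) + (b $ i) \<bullet> cls \<phi> = 0"
  proof (intro allI impI)
    fix \<phi> i assume p: "periodic (\<phi> :: real ^ 'a \<Rightarrow> real) \<and> C1 \<phi>"
    then have "\<phi> \<in> L2" "(\<lambda>x. grad \<phi> x $ i) \<in> L2" using C1_L2 C1_grad_L2 by blast+
    then show "a \<bullet> cls (\<lambda>x. grad \<phi> x $ i) + (b $ i) \<bullet> cls \<phi> = 0"
      using has_weak_partialD(3)[OF F(2)] p by (simp add: f grad_cls_def cls_inner F)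
  qed
next
  assume *: "\<forall>\<phi> i. periodic \<phi> \<and> C1 \<phi> \<longrightarrow> a \<bullet> cls (\<lambda>x. grad \<phi> x $ i) + (b $ i) \<bullet> cls \<phi> = 0"
  have w: "has_weak_partial i (rep a) (rep (b $ i))" for i
    unfolding has_weak_partial_def
  proof (intro conjI allI impI)
    show "rep a \<in> L1" "rep (b $ i) \<in> L1" by (auto intro: L2_imp_L1)
    fix \<phi> assume p: "periodic (\<phi> :: real ^ 'a \<Rightarrow> real) \<and> C1 \<phi>"
    then have l: "\<phi> \<in> L2" "(\<lambda>x. grad \<phi> x $ i) \<in> L2" using C1_L2 C1_grad_L2 by blast+
    have "cls (rep a) \<bullet> cls (\<lambda>x. grad \<phi> x $ i) + cls (rep (b $ i)) \<bullet> cls \<phi> = 0" using * p by simp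
    then show "(\<integral>x. rep a x * grad \<phi> x $ i \<partial>torus) = - (\<integral>x. rep (b $ i) x * \<phi> x \<partial>torus)"
      unfolding cls_inner[OF rep_L2 l(1)] cls_inner[OF rep_L2 l(2)] by linarith
  qed
  note g = graph_eqI[OF rep_L2 rep_L2 w]
  have "graph (rep a) = (a, b)" unfolding g(2) by (simp add: vec_eq_iff)
  then show "(a, b) \<in> H1_graph" using g(1) unfolding H1_graph_def by (metis imageI)
qed

lemma closed_H1_graph: "closed (H1_graph :: ('d l2 \<times> ('d l2 ^ 'd)) set)"
proof -
  have eq: "(H1_graph :: ('d l2 \<times> ('d l2 ^ 'd)) set) = (\<Inter>\<phi>\<in>{\<phi>. periodic \<phi> \<and> C1 \<phi>}. \<Inter>i. {u. fst u \<bullet> cls (\<lambda>x. grad \<phi> x $ i) + (snd u $ i) \<bullet> cls \<phi> = 0})"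
  proof (rule set_eqI)
    fix u :: "'d l2 \<times> ('d l2 ^ 'd)"
    obtain a b where u: "u = (a, b)" by (cases u)
    show "u \<in> H1_graph \<longleftrightarrow> u \<in> (\<Inter>\<phi>\<in>{\<phi>. periodic \<phi> \<and> C1 \<phi>}. \<Inter>i. {u. fst u \<bullet> cls (\<lambda>x. grad \<phi> x $ i) + (snd u $ i) \<bullet> cls \<phi> = 0})"
      unfolding u H1_graph_iff by simp
  qed
  have cl: "closed {u :: 'd l2 \<times> ('d l2 ^ 'd). fst u \<bullet> cls (\<lambda>x. grad \<phi> x $ i) + (snd u $ i) \<bullet> cls \<phi> = 0}" for \<phi> i
    by (intro closed_Collect_eq continuous_intros)
  show ?thesis unfolding eq by (intro closed_INT ballI cl)
qed

lemma subspace_closure_real: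
  fixes C :: "'a :: real_normed_vector set"
  assumes "subspace C" shows "subspace (closure C)"
proof (rule subspaceI)
  show "0 \<in> closure C" using subspace_0[OF assms] closure_subset by blast
next
  fix x y assume "x \<in> closure C" "y \<in> closure C"
  then obtain f g where "\<And>n. f n \<in> C" "f \<longlonglongrightarrow> x" "\<And>n. g n \<in> C" "g \<longlonglongrightarrow> y"
    unfolding closure_sequential by blast
  then show "x + y \<in> closure C"
    unfolding closure_sequential
    by (intro exI[of _ "\<lambda>n. f n + g n"] conjI allI tendsto_add subspace_add[OF assms])
next
  fix c x assume "x \<in> closure C"
  then obtain f where "\<And>n. f n \<in> C" "f \<longlonglongrightarrow> x" unfolding closure_sequential by blast
  then show "c *\<^sub>R x \<in> closure C"
    unfolding closure_sequential
    by (intro exI[of _ "\<lambda>n. c *\<^sub>R f n"] conjI allI tendsto_scaleR tendsto_const subspace_scale[OF assms])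
qed

text \<open>A function in the graph space that is orthogonal to all trigonometric functions has vanishing
  Fourier coefficients, because these are eigenfunctions of \<open>1 - \<Delta>\<close>.\<close>

lemma H1_graph_eq_closure: "H1_graph = closure (graph ` {f. C1 f \<and> periodic f})"
proof
  let ?C = "graph ` {f :: real ^ 'a \<Rightarrow> real. C1 f \<and> periodic f}"
  have CH: "?C \<subseteq> H1_graph" using C1_H1 by (auto simp: H1_graph_def)
  then show "closure ?C \<subseteq> H1_graph" by (rule closure_minimal[OF _ closed_H1_graph])
  have sC: "subspace ?C"
  proof (rule subspaceI)
    have "graph (\<lambda>x. 0 * (0::real)) = (0 :: 'a l2 \<times> ('a l2 ^ 'a))"
      using graph_scale(2)[OF C1_H1[OF C1_const[of 0] periodic_const], of 0] by simp
    then show "0 \<in> ?C" using C1_const[of 0] periodic_const[of 0] by (intro image_eqI[of _ _ "\<lambda>x. 0"]) simp_all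
  next
    fix x y assume "x \<in> ?C" "y \<in> ?C"
    then obtain f g where fg: "C1 f" "periodic f" "C1 g" "periodic g" "x = graph f" "y = graph g" by auto
    have "x + y = graph (\<lambda>x. f x + g x)" using fg by (simp add: graph_add(2) C1_H1)
    moreover have "C1 (\<lambda>x. f x + g x)" "periodic (\<lambda>x. f x + g x)" using fg C1_add periodic_binop[of f g "(+)"] by auto
    ultimately show "x + y \<in> ?C" by auto
  next
    fix c x assume "x \<in> ?C"
    then obtain f where f: "C1 f" "periodic f" "x = graph f" by auto
    have "c *\<^sub>R x = graph (\<lambda>x. c * f x)" using f by (simp add: graph_scale(2) C1_H1)
    moreover have "C1 (\<lambda>x. c * f x)" "periodic (\<lambda>x. c * f x)"
      using C1_mult[OF C1_const f(1)] periodic_compose[OF f(2), of "(*) c"] by auto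
    ultimately show "c *\<^sub>R x \<in> ?C" by auto
  qed
  have sU: "subspace (closure ?C)" by (rule subspace_closure_real[OF sC]) 
  show "H1_graph \<subseteq> closure ?C"
  proof
    fix u :: "'a l2 \<times> ('a l2 ^ 'a)" assume u: "u \<in> H1_graph"
    \<comment> \<open>\<open>w\<close> is the orthogonal projection of \<open>u\<close> to the
      closure, found by Riesz representation of the functional given by \<open>u\<close>; what
      remains is that \<open>u - w\<close>, which is orthogonal to the graphs of all C1 functions,
      vanishes.\<close>
    obtain w where w: "w \<in> closure ?C" "\<And>v. v \<in> closure ?C \<Longrightarrow> u \<bullet> v = w \<bullet> v"
      by (rule riesz_representation_subspace[OF sU closed_closure, of "\<lambda>v. u \<bullet> v" "norm u"])
        (auto simp: inner_add_right Cauchy_Schwarz_ineq2)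
    have "w \<in> H1_graph" using w(1) closure_minimal[OF CH closed_H1_graph] by blast
    then have d: "u - w \<in> H1_graph" using u subspace_H1_graph by (intro subspace_diff)
    then obtain f where f: "f \<in> H1" "u - w = graph f" by (auto simp: H1_graph_def)
    note F = H1_D[OF f(1)]
    have "AE x in torus. f x = 0"
    proof (rule orthogonal_trig_imp_AE_0)
      show "integrable torus f" by (rule L2_integrable[OF F(1)])
      show "f \<in> borel_measurable borel" by (rule L2_measurable[OF F(1)])
      fix k :: "real ^ 'a" and \<theta> assume k: "k \<in> freqs"
      let ?e = "trig k \<theta>"
      let ?e' = "trig k (\<theta> + pi/2)"
      have e: "C1 ?e" "periodic ?e" "C1 ?e'" "periodic ?e'" using C1_trig periodic_trig[OF k] by auto
      have ge: "graph ?e = (cls ?e, \<chi> i. (k $ i) *\<^sub>R cls ?e')"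
      proof -
        have "has_weak_partial i ?e (\<lambda>x. k $ i * ?e' x)" for i
          using C1_has_weak_partial[OF e(1,2), of i] by (simp add: grad_trig mult.commute)
        from graph_eqI(2)[OF C1_L2[OF e(1,2)] L2_scale[OF C1_L2[OF e(3,4)]] this]
        show ?thesis by (simp add: cls_scaleR[OF C1_L2[OF e(3,4)]])
      qed
      have "graph f \<bullet> graph ?e = 0"
      proof -
        have "graph ?e \<in> closure ?C" using e closure_subset by fast
        then show ?thesis using w(2) f(2) by (simp add: inner_diff_left flip: f(2))
      qed
      then have "cls f \<bullet> cls ?e + (\<Sum>i\<in>UNIV. k $ i * (cls (\<lambda>x. weak_grad f x $ i) \<bullet> cls ?e')) = 0"
        unfolding ge by (simp add: graph_def grad_cls_def inner_vec_l2)
      moreover have "cls (\<lambda>x. weak_grad f x $ i) \<bullet> cls ?e' = (k $ i) * (cls f \<bullet> cls ?e)" for i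
      proof -
        have s: "?e x = - trig k (\<theta> + pi/2 + pi/2) x" for x
        proof -
          have "k \<bullet> x + (\<theta> + pi/2 + pi/2) = (k \<bullet> x + \<theta>) + pi" by simp
          then show ?thesis unfolding trig_def by (simp only: cos_periodic_pi minus_minus)
        qed
        have "(\<integral>x. weak_grad f x $ i * ?e' x \<partial>torus) = - (\<integral>x. f x * grad ?e' x $ i \<partial>torus)"
          using has_weak_partialD(3)[OF F(2) e(4,3)] by simp
        also have "\<dots> = (\<integral>x. k $ i * (f x * ?e x) \<partial>torus)"
          unfolding grad_trig Bochner_Integration.integral_minus[symmetric]
          by (intro Bochner_Integration.integral_cong refl) (simp add: s)
        finally show ?thesis
          by (simp add: cls_inner F C1_L2[OF e(1,2)] C1_L2[OF e(3,4)])
      qed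
      ultimately have "(cls f \<bullet> cls ?e) * (1 + (\<Sum>i\<in>UNIV. (k $ i)\<^sup>2)) = 0"
        by (simp add: distrib_left sum_distrib_left sum_distrib_right power2_eq_square mult_ac)
      moreover have "1 + (\<Sum>i\<in>UNIV. (k $ i)\<^sup>2) > 0" by (intro add_pos_nonneg sum_nonneg) auto
      ultimately have "cls f \<bullet> cls ?e = 0" by simp
      then show "(\<integral>x. f x * ?e x \<partial>torus) = 0" by (simp add: cls_inner F C1_L2[OF e(1,2)])
    qed
    then have "cls f = 0" using cls_eq_iff[OF F(1) L2_const[of 0]] by (simp add: cls_zero)
    moreover have "cls (\<lambda>x. weak_grad f x $ i) = 0" for i
    proof -
      have "cls (\<lambda>x. weak_grad f x $ i) = cls (\<lambda>x. 0)"
        unfolding cls_eq_iff[OF F(3) L2_const]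
      proof (rule has_weak_partial_unique[OF F(2)])
        have "grad (\<lambda>x. 0) = (\<lambda>x. 0 :: real ^ 'a)" by (rule ext, rule grad_eq[OF GDERIV_const])
        then show "has_weak_partial i (\<lambda>x. 0) (\<lambda>x. 0)" using C1_has_weak_partial[OF C1_const[of 0] periodic_const, of i]
          by simp
      qed (fact \<open>AE x in torus. f x = 0\<close>)
      then show ?thesis by (simp add: cls_zero)
    qed
    ultimately have "u - w = 0" unfolding f(2) graph_def grad_cls_def by (simp add: zero_prod_def zero_vec_def)
    then show "u \<in> closure ?C" using w(1) by simp
  qed
qed

text \<open>\<open>has_weak_div\<close> only tests with C1 functions. Both sides are continuous in
  \<open>graph f\<close>, so the identity defines a closed set and passes to H1 by density.\<close>

lemma H1_integration_by_parts:
  assumes F: "\<And>i. (\<lambda>x. F x $ i) \<in> L2" and g: "g \<in> L2" and d: "has_weak_div F g" and f: "f \<in> H1"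
  shows "(\<integral>x. F x \<bullet> weak_grad f x \<partial>torus) = - (\<integral>x. g x * f x \<partial>torus)"
proof -
  let ?C = "graph ` {f :: real ^ 'a \<Rightarrow> real. C1 f \<and> periodic f}"
  define S where "S = {u :: 'a l2 \<times> ('a l2 ^ 'a). (\<Sum>i\<in>UNIV. cls (\<lambda>x. F x $ i) \<bullet> (snd u $ i)) + cls g \<bullet> fst u = 0}"
  have int: "(\<integral>x. F x \<bullet> G x \<partial>torus) = (\<Sum>i\<in>UNIV. cls (\<lambda>x. F x $ i) \<bullet> cls (\<lambda>x. G x $ i))"
    if "\<And>i. (\<lambda>x. G x $ i) \<in> L2" for G :: "real ^ 'a \<Rightarrow> real ^ 'a"
    unfolding inner_vec_def cls_inner[OF F that] inner_real_def
    by (intro Bochner_Integration.integral_sum L2_integrable_mult F that)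
  have "closed S" unfolding S_def by (auto intro!: closed_Collect_eq continuous_intros)
  moreover have "?C \<subseteq> S"
  proof
    fix u assume "u \<in> ?C"
    then obtain \<phi> where p: "C1 \<phi>" "periodic \<phi>" "u = graph \<phi>" by auto
    have u: "u = (cls \<phi>, \<chi> i. cls (\<lambda>x. grad \<phi> x $ i))"
      unfolding p(3) by (rule graph_eqI(2)[OF C1_L2[OF p(1,2)] C1_grad_L2[OF p(1,2)] C1_has_weak_partial[OF p(1,2)]])
    have "(\<Sum>i\<in>UNIV. cls (\<lambda>x. F x $ i) \<bullet> cls (\<lambda>x. grad \<phi> x $ i)) = (\<integral>x. F x \<bullet> grad \<phi> x \<partial>torus)"
      by (rule int[symmetric, OF C1_grad_L2[OF p(1,2)]])
    also have "\<dots> = - (\<integral>x. g x * \<phi> x \<partial>torus)" by (rule has_weak_divD(3)[OF d p(2,1)])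
    finally show "u \<in> S" unfolding S_def u by (simp add: cls_inner g C1_L2[OF p(1,2)])
  qed
  ultimately have "H1_graph \<subseteq> S" unfolding H1_graph_eq_closure by (intro closure_minimal)
  moreover have "graph f \<in> H1_graph" using f by (simp add: H1_graph_def)
  ultimately have "graph f \<in> S" by blast
  then have "(\<Sum>i\<in>UNIV. cls (\<lambda>x. F x $ i) \<bullet> cls (\<lambda>x. weak_grad f x $ i)) + cls g \<bullet> cls f = 0"
    by (simp add: S_def graph_def grad_cls_def)
  then show ?thesis unfolding int[OF H1_D(3)[OF f], symmetric] cls_inner[OF g H1_D(1)[OF f]] by linarith
qed

section \<open>Convolutions and multiplication operators\<close>

text \<open>The estimates are uniform in \<open>z\<close> because a continuous periodic gradient is
  uniformly continuous. Uniformity is what lets a convolution with a merely integrable function be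
  differentiated.\<close>

lemma C1_remainder:
  fixes k :: "real ^ 'd \<Rightarrow> real"
  assumes k: "C1 k" "periodic k" and e: "e > 0"
  obtains d where "d > 0" "\<And>z h. norm h < d \<Longrightarrow> \<bar>k (z + h) - k z - h \<bullet> grad k z\<bar> \<le> e * norm h"
    "\<And>z h. norm h < d \<Longrightarrow> norm (grad k (z + h) - grad k z) \<le> e"
proof -
  have "uniformly_continuous_on UNIV (grad k)"
    by (rule periodic_continuous_uniformly[OF periodic_grad[OF k(2)] C1D(2)[OF k(1)]])
  then have "\<exists>d>0. \<forall>x\<in>UNIV. \<forall>x'\<in>UNIV. dist x' x < d \<longrightarrow> dist (grad k x') (grad k x) < e"
    using e unfolding uniformly_continuous_on_def by simp
  then obtain d where d: "d > 0" "\<And>x x'. dist x' x < d \<Longrightarrow> dist (grad k x') (grad k x) < e" by blast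
  have g: "norm (grad k (z + h) - grad k z) \<le> e" if "norm h < d" for z h
    using d(2)[of "z + h" z] that by (simp add: dist_norm)
  have "\<bar>k (z + h) - k z - h \<bullet> grad k z\<bar> \<le> e * norm h" if h: "norm h < d" for z h
  proof -
    have "norm ((\<lambda>w. k (z + w) - w \<bullet> grad k z) h - (\<lambda>w. k (z + w) - w \<bullet> grad k z) 0) \<le> e * norm (h - 0)"
    proof (rule differentiable_bound[where f' = "\<lambda>w v. v \<bullet> grad k (z + w) - v \<bullet> grad k z"])
      show "convex (ball (0 :: real ^ 'd) d)" by simp
      fix w :: "real ^ 'd" assume w: "w \<in> ball 0 d"
      have "((\<lambda>w. z + w) has_derivative (\<lambda>h. h)) (at w within ball 0 d)" by (auto intro!: derivative_eq_intros)
      moreover have "(k has_derivative (\<lambda>h. h \<bullet> grad k (z + w))) (at (z + w))"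
        using C1D(1)[OF k(1), of "z + w"] by (simp add: gderiv_def)
      ultimately have "((\<lambda>w. k (z + w)) has_derivative (\<lambda>v. v \<bullet> grad k (z + w))) (at w within ball 0 d)"
        by (rule has_derivative_compose)
      moreover have "((\<lambda>w. w \<bullet> grad k z) has_derivative (\<lambda>v. v \<bullet> grad k z)) (at w within ball 0 d)"
        by (rule bounded_linear_imp_has_derivative[OF bounded_linear_inner_left])
      ultimately show "((\<lambda>w. k (z + w) - w \<bullet> grad k z) has_derivative (\<lambda>v. v \<bullet> grad k (z + w) - v \<bullet> grad k z)) (at w within ball 0 d)"
        by (rule has_derivative_diff)
      show "onorm (\<lambda>v. v \<bullet> grad k (z + w) - v \<bullet> grad k z) \<le> e"
      proof (rule onorm_bound)
        fix v :: "real ^ 'd"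
        have "\<bar>v \<bullet> (grad k (z + w) - grad k z)\<bar> \<le> norm v * norm (grad k (z + w) - grad k z)"
          by (rule Cauchy_Schwarz_ineq2)
        also have "\<dots> \<le> norm v * e" using g[of w z] w by (intro mult_left_mono) simp_all
        finally show "norm (v \<bullet> grad k (z + w) - v \<bullet> grad k z) \<le> e * norm v"
          by (simp add: inner_diff_right mult.commute)
      qed (use e in simp)
    qed (use h d(1) in simp_all)
    then show ?thesis by simp
  qed
  with d(1) g show thesis using that by blast
qed

lemma measurable_translate:
  fixes h :: "real ^ 'd \<Rightarrow> 'b :: {second_countable_topology, real_normed_vector}"
  assumes "continuous_on UNIV h"
  shows "(\<lambda>y. h (x - y)) \<in> borel_measurable borel"
  by (intro borel_measurable_continuous_onI continuous_on_compose2[OF assms]) (auto intro!: continuous_intros)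

section \<open>Differentiability of convolutions with integrable functions\<close>

context
  fixes k :: "real ^ 'd \<Rightarrow> real" and f :: "real ^ 'd \<Rightarrow> real"
  assumes k: "C1 k" "periodic k" and f: "f \<in> L1"
begin

lemma conv_integrable: "integrable torus (\<lambda>y. k (x - y) * f y)"
proof -
  obtain K where K: "\<And>x. \<bar>k x\<bar> \<le> K" using C1_bounded[OF k] by blast
  have "integrable torus (\<lambda>y. f y * k (x - y))"
    by (rule integrable_mult_bounded[OF L1_integrable[OF f] measurable_translate[OF C1_continuous[OF k(1)]] K])
  then show ?thesis by (simp add: mult.commute)
qed

lemma grad_conv_integrable: "integrable torus (\<lambda>y. f y *\<^sub>R grad k (x - y))"
proof -
  obtain K where K: "0 \<le> K" "\<And>x. norm (grad k x) \<le> K" using C1_grad_bounded[OF k] by blast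
  show ?thesis
  proof (rule Bochner_Integration.integrable_bound)
    show "integrable torus (\<lambda>y. K * \<bar>f y\<bar>)" using L1_integrable[OF f] by simp
    have "(\<lambda>y. f y *\<^sub>R grad k (x - y)) \<in> borel_measurable borel"
      by (intro borel_measurable_scaleR L1_measurable f measurable_translate C1D(2) k)
    then show "(\<lambda>y. f y *\<^sub>R grad k (x - y)) \<in> borel_measurable torus" by (rule borel_measurable_torus)
    have "norm (f y *\<^sub>R grad k (x - y)) \<le> norm (K * \<bar>f y\<bar>)" for y
      using mult_right_mono[OF K(2)[of "x - y"], of "\<bar>f y\<bar>"] K(1) by (simp add: abs_mult mult.commute)
    then show "AE y in torus. norm (f y *\<^sub>R grad k (x - y)) \<le> norm (K * \<bar>f y\<bar>)" by simp
  qed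
qed

text \<open>The Taylor remainder of \<open>k\<close> is uniformly small, so its integral against
  \<open>f\<close> is small relative to the increment; the derivative falls on the kernel.\<close>

lemma GDERIV_conv: "GDERIV (conv k f) x :> grad_conv k f x"
proof -
  define I where "I = (\<integral>y. \<bar>f y\<bar> \<partial>torus)"
  have I: "I \<ge> 0" by (simp add: I_def)
  have fi: "integrable torus (\<lambda>y. \<bar>f y\<bar>)" using L1_integrable[OF f] by simp
  show ?thesis
    unfolding gderiv_def has_derivative_at_alt
  proof (intro conjI allI impI)
    show "bounded_linear (\<lambda>h. h \<bullet> grad_conv k f x)" by (rule bounded_linear_inner_left)
    fix e :: real assume e: "e > 0"
    then have e': "e / (I + 1) > 0" using I by simp
    obtain d where d: "d > 0" "\<And>z h. norm h < d \<Longrightarrow> \<bar>k (z + h) - k z - h \<bullet> grad k z\<bar> \<le> e / (I + 1) * norm h"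
      using C1_remainder[OF k e'] by metis
    have "norm (conv k f y - conv k f x - (y - x) \<bullet> grad_conv k f x) \<le> e * norm (y - x)" if y: "norm (y - x) < d" for y
    proof -
      define R where "R u = k (y - u) * f u - k (x - u) * f u - (y - x) \<bullet> (f u *\<^sub>R grad k (x - u))" for u
      have Ri: "integrable torus R"
        unfolding R_def
        by (intro Bochner_Integration.integrable_diff conv_integrable integrable_inner_right grad_conv_integrable)
      have gi: "integrable torus (\<lambda>u. (y - x) \<bullet> (f u *\<^sub>R grad k (x - u)))"
        "(\<integral>u. (y - x) \<bullet> (f u *\<^sub>R grad k (x - u)) \<partial>torus) = (y - x) \<bullet> grad_conv k f x"
        unfolding grad_conv_def
        by (intro integrable_inner_right integral_inner_right grad_conv_integrable)+
      have "(\<integral>u. R u \<partial>torus) = (\<integral>u. k (y - u) * f u - k (x - u) * f u \<partial>torus) - (\<integral>u. (y - x) \<bullet> (f u *\<^sub>R grad k (x - u)) \<partial>torus)"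
        unfolding R_def by (intro Bochner_Integration.integral_diff Bochner_Integration.integrable_diff conv_integrable gi)
      also have "(\<integral>u. k (y - u) * f u - k (x - u) * f u \<partial>torus) = conv k f y - conv k f x"
        unfolding conv_def by (intro Bochner_Integration.integral_diff conv_integrable)
      finally have "conv k f y - conv k f x - (y - x) \<bullet> grad_conv k f x = (\<integral>u. R u \<partial>torus)" by (simp only: gi(2))
      also have "\<bar>\<dots>\<bar> \<le> (\<integral>u. \<bar>R u\<bar> \<partial>torus)" by (rule integral_abs_bound)
      also have "\<dots> \<le> (\<integral>u. (e / (I + 1) * norm (y - x)) * \<bar>f u\<bar> \<partial>torus)"
      proof (rule integral_mono)
        show "\<bar>R u\<bar> \<le> (e / (I + 1) * norm (y - x)) * \<bar>f u\<bar>" for u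
        proof -
          have "R u = (k ((x - u) + (y - x)) - k (x - u) - (y - x) \<bullet> grad k (x - u)) * f u"
            by (simp add: R_def algebra_simps)
          then have "\<bar>R u\<bar> = \<bar>k ((x - u) + (y - x)) - k (x - u) - (y - x) \<bullet> grad k (x - u)\<bar> * \<bar>f u\<bar>"
            by (simp add: abs_mult)
          also have "\<dots> \<le> (e / (I + 1) * norm (y - x)) * \<bar>f u\<bar>" by (intro mult_right_mono d(2) y) simp
          finally show ?thesis .
        qed
      qed (use Ri fi in simp_all)
      also have "\<dots> = (e / (I + 1) * norm (y - x)) * I" by (simp add: I_def)
      also have "\<dots> \<le> (e / (I + 1) * norm (y - x)) * (I + 1)" using e I by (intro mult_left_mono) simp_all
      also have "\<dots> = e * norm (y - x)" using I by simp
      finally show ?thesis by simp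
    qed
    then show "\<exists>d>0. \<forall>y. norm (y - x) < d \<longrightarrow> norm (conv k f y - conv k f x - (y - x) \<bullet> grad_conv k f x) \<le> e * norm (y - x)"
      using d(1) by blast
  qed
qed

lemma continuous_grad_conv: "continuous_on UNIV (grad_conv k f)"
proof -
  define I where "I = (\<integral>y. \<bar>f y\<bar> \<partial>torus)"
  have I: "I \<ge> 0" by (simp add: I_def)
  have fi: "integrable torus (\<lambda>y. \<bar>f y\<bar>)" using L1_integrable[OF f] by simp
  show ?thesis
    unfolding continuous_on_iff
  proof (intro ballI allI impI)
    fix x :: "real ^ 'd" and e :: real assume e: "e > 0"
    then have e': "e / (I + 1) > 0" using I by simp
    obtain d where d: "d > 0" "\<And>z h. norm h < d \<Longrightarrow> norm (grad k (z + h) - grad k z) \<le> e / (I + 1)"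
      using C1_remainder[OF k e'] by metis
    have "dist (grad_conv k f y) (grad_conv k f x) < e" if y: "dist y x < d" for y
    proof -
      define R where "R u = f u *\<^sub>R grad k (y - u) - f u *\<^sub>R grad k (x - u)" for u
      have Ri: "integrable torus R"
        unfolding R_def by (intro Bochner_Integration.integrable_diff grad_conv_integrable)
      have "grad_conv k f y - grad_conv k f x = (\<integral>u. R u \<partial>torus)"
        unfolding grad_conv_def R_def
        by (simp add: Bochner_Integration.integral_diff grad_conv_integrable)
      then have "dist (grad_conv k f y) (grad_conv k f x) = norm (\<integral>u. R u \<partial>torus)" by (simp add: dist_norm)
      also have "\<dots> \<le> (\<integral>u. norm (R u) \<partial>torus)" by (rule integral_norm_bound)
      also have "\<dots> \<le> (\<integral>u. (e / (I + 1)) * \<bar>f u\<bar> \<partial>torus)"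
      proof (rule integral_mono)
        show "norm (R u) \<le> (e / (I + 1)) * \<bar>f u\<bar>" for u
        proof -
          have "R u = f u *\<^sub>R (grad k ((x - u) + (y - x)) - grad k (x - u))" by (simp add: R_def scaleR_diff_right)
          then have "norm (R u) = norm (grad k ((x - u) + (y - x)) - grad k (x - u)) * \<bar>f u\<bar>" by simp
          also have "\<dots> \<le> (e / (I + 1)) * \<bar>f u\<bar>" using y by (intro mult_right_mono d(2)) (simp_all add: dist_norm)
          finally show ?thesis .
        qed
      qed (use Ri fi in simp_all)
      also have "\<dots> = (e / (I + 1)) * I" by (simp add: I_def)
      also have "\<dots> < e" using e I by (simp add: field_simps)
      finally show ?thesis .
    qed
    then show "\<exists>d>0. \<forall>x'\<in>UNIV. dist x' x < d \<longrightarrow> dist (grad_conv k f x') (grad_conv k f x) < e"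
      using d(1) by blast
  qed
qed

lemma C1_conv: "C1 (conv k f)"
  by (rule C1I[OF GDERIV_conv continuous_grad_conv])

lemma periodic_conv: "periodic (conv k f)"
proof -
  have "k (x + a - y) = k (x - y)" if "\<And>x. k (x + a) = k x" for x y a
    using that[of "x - y"] by (simp add: algebra_simps)
  then show ?thesis using k(2) by (simp add: periodic_def conv_def)
qed

lemma conv_bound:
  assumes "\<And>x. \<bar>k x\<bar> \<le> K"
  shows "\<bar>conv k f x\<bar> \<le> K * (\<integral>y. \<bar>f y\<bar> \<partial>torus)"
proof -
  have "\<bar>conv k f x\<bar> \<le> (\<integral>y. \<bar>k (x - y) * f y\<bar> \<partial>torus)" unfolding conv_def by (rule integral_abs_bound)
  also have "\<dots> \<le> (\<integral>y. K * \<bar>f y\<bar> \<partial>torus)"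
  proof (rule integral_mono)
    show "integrable torus (\<lambda>y. \<bar>k (x - y) * f y\<bar>)" by (rule integrable_abs[OF conv_integrable])
    show "integrable torus (\<lambda>y. K * \<bar>f y\<bar>)" using L1_integrable[OF f] by simp
    show "\<bar>k (x - y) * f y\<bar> \<le> K * \<bar>f y\<bar>" for y
      using mult_right_mono[OF assms[of "x - y"], of "\<bar>f y\<bar>"] by (simp add: abs_mult)
  qed
  finally show ?thesis by simp
qed

lemma grad_conv_component: "grad_conv k f x $ i = conv (\<lambda>z. grad k z $ i) f x"
proof -
  have "grad_conv k f x $ i = (\<integral>y. (f y *\<^sub>R grad k (x - y)) $ i \<partial>torus)"
    unfolding grad_conv_def
    by (rule integral_bounded_linear[OF bounded_linear_vec_nth grad_conv_integrable, symmetric])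
  then show ?thesis by (simp add: conv_def mult.commute)
qed

end

lemma conv_cong_AE:
  assumes k: "C1 k" "periodic k" and f: "f \<in> L1" "g \<in> L1" "AE x in torus. f x = g x"
  shows "conv k f x = conv k g x"
  unfolding conv_def
proof (rule integral_cong_AE)
  show "AE y in torus. k (x - y) * f y = k (x - y) * g y" using f(3) by eventually_elim simp
qed (rule borel_measurable_integrable[OF conv_integrable], rule k, rule k, rule f)+

lemma conv_add: "C1 k \<Longrightarrow> periodic k \<Longrightarrow> f \<in> L1 \<Longrightarrow> g \<in> L1 \<Longrightarrow> conv k (\<lambda>x. f x + g x) x = conv k f x + conv k g x"
  unfolding conv_def by (simp add: distrib_left conv_integrable)

lemma conv_scale: "conv k (\<lambda>x. c * f x) x = c * conv k f x"
  unfolding conv_def by (simp add: mult.left_commute)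

text \<open>The bound is asked only almost everywhere, since weak gradients such as those of
  \<alpha> are determined only up to null sets.\<close>

definition multiplier :: "(real ^ 'd \<Rightarrow> real) \<Rightarrow> bool" where
  "multiplier g \<longleftrightarrow> periodic g \<and> g \<in> borel_measurable borel \<and> (\<exists>K. AE x in torus. \<bar>g x\<bar> \<le> K)"

lemma multiplierI:
  assumes "periodic g" "g \<in> borel_measurable borel" "\<And>x. \<bar>g x\<bar> \<le> K"
  shows "multiplier g"
  using assms unfolding multiplier_def by blast

lemma multiplier_C1:
  assumes "C1 g" "periodic g"
  shows "multiplier g" "multiplier (\<lambda>x. grad g x $ i)"
proof -
  show "multiplier g" using C1_bounded[OF assms] multiplierI[OF assms(2) C1_measurable[OF assms(1)]] by metis
  obtain K where K: "\<And>x. norm (grad g x) \<le> K" using C1_grad_bounded[OF assms] by blast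
  show "multiplier (\<lambda>x. grad g x $ i)"
  proof (rule multiplierI)
    show "periodic (\<lambda>x. grad g x $ i)" using periodic_compose[OF periodic_grad[OF assms(2)]] .
    show "(\<lambda>x. grad g x $ i) \<in> borel_measurable borel" using C1_grad_L2[OF assms] by (rule L2_measurable)
    show "\<bar>grad g x $ i\<bar> \<le> K" for x using component_le_norm_cart[of "grad g x" i] K[of x] by linarith
  qed
qed

lemma multiplier_L2:
  assumes g: "multiplier g" and f: "f \<in> L2"
  shows "(\<lambda>x. g x * f x) \<in> L2"
proof -
  obtain K where K: "AE x in torus. \<bar>g x\<bar> \<le> K" using g unfolding multiplier_def by blast
  \<comment> \<open>Truncation replaces the almost everywhere bound by a bound at every
    point.\<close>
  define g' where "g' x = (if \<bar>g x\<bar> \<le> K then g x else 0)" for x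
  have gm [measurable]: "g \<in> borel_measurable borel" using g unfolding multiplier_def by blast
  have "(\<lambda>x. g' x * f x) \<in> L2"
  proof (rule L2_mult_bounded[OF f])
    show "periodic g'" using g unfolding multiplier_def g'_def periodic_def by simp
    show "g' \<in> borel_measurable borel" unfolding g'_def by measurable
    show "\<bar>g' x\<bar> \<le> \<bar>K\<bar>" for x unfolding g'_def by auto
  qed
  moreover have "AE x in torus. g' x * f x = g x * f x"
    using K by eventually_elim (simp add: g'_def)
  moreover have "periodic (\<lambda>x. g x * f x)" using g f periodic_binop[of g f "(*)"] by (simp add: multiplier_def L2_def)
  moreover have "(\<lambda>x. g x * f x) \<in> borel_measurable borel" using L2_measurable[OF f] by measurable
  ultimately show ?thesis by (rule L2_cong_AE)
qed

definition mul :: "(real ^ 'd \<Rightarrow> real) \<Rightarrow> 'd l2 \<Rightarrow> 'd l2" where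
  "mul g a = cls (\<lambda>x. g x * rep a x)"

lemma mul_cls:
  assumes "multiplier g" "f \<in> L2"
  shows "mul g (cls f) = cls (\<lambda>x. g x * f x)"
  unfolding mul_def cls_eq_iff[OF multiplier_L2[OF assms(1) rep_L2] multiplier_L2[OF assms]]
  using rep_cls[OF assms(2)] by eventually_elim simp

lemma norm_mul_le:
  assumes g: "multiplier g" and K: "AE x in torus. \<bar>g x\<bar> \<le> K"
  shows "norm (mul g a) \<le> \<bar>K\<bar> * norm a"
proof -
  have "(\<integral>x. (g x * rep a x)\<^sup>2 \<partial>torus) \<le> (\<integral>x. K\<^sup>2 * (rep a x)\<^sup>2 \<partial>torus)"
  proof (rule integral_mono_AE)
    show "integrable torus (\<lambda>x. (g x * rep a x)\<^sup>2)" using multiplier_L2[OF g rep_L2[of a]] by (simp add: L2_def)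
    show "integrable torus (\<lambda>x. K\<^sup>2 * (rep a x)\<^sup>2)" using rep_L2[of a] by (simp add: L2_def)
    show "AE x in torus. (g x * rep a x)\<^sup>2 \<le> K\<^sup>2 * (rep a x)\<^sup>2"
      using K
    proof eventually_elim
      case (elim x)
      have "\<bar>g x\<bar>\<^sup>2 \<le> K\<^sup>2" using elim by (intro power_mono) simp_all
      then show ?case by (simp add: power_mult_distrib mult_right_mono)
    qed
  qed
  also have "\<dots> = (norm (K *\<^sub>R a))\<^sup>2" using norm_cls[OF rep_L2[of a]] by (simp add: power_mult_distrib)
  finally have "sqrt (\<integral>x. (g x * rep a x)\<^sup>2 \<partial>torus) \<le> sqrt ((norm (K *\<^sub>R a))\<^sup>2)" by (rule real_sqrt_le_mono)
  then show ?thesis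
    unfolding mul_def norm_cls[OF multiplier_L2[OF g rep_L2]] by simp
qed

lemma bounded_linear_mul:
  assumes g: "multiplier g"
  shows "bounded_linear (mul g)"
proof -
  obtain K where K: "AE x in torus. \<bar>g x\<bar> \<le> K" using g unfolding multiplier_def by blast
  show ?thesis
  proof (rule bounded_linear_intro)
    fix a b :: "'a l2" and c :: real
    note M = multiplier_L2[OF g]
    have "mul g (a + b) = mul g (cls (\<lambda>x. rep a x + rep b x))" by (simp add: cls_add)
    also have "\<dots> = cls (\<lambda>x. g x * rep a x + g x * rep b x)"
      by (simp add: mul_cls[OF g L2_add[OF rep_L2 rep_L2]] distrib_left)
    also have "\<dots> = mul g a + mul g b" unfolding mul_def by (rule cls_add[OF M M]) simp_all
    finally show "mul g (a + b) = mul g a + mul g b" .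
    have "mul g (c *\<^sub>R a) = mul g (cls (\<lambda>x. c * rep a x))" by (simp add: cls_scaleR)
    also have "\<dots> = cls (\<lambda>x. c * (g x * rep a x))"
      by (simp add: mul_cls[OF g L2_scale[OF rep_L2]] mult.left_commute)
    also have "\<dots> = c *\<^sub>R mul g a" unfolding mul_def by (rule cls_scaleR[OF M]) simp
    finally show "mul g (c *\<^sub>R a) = c *\<^sub>R mul g a" .
    show "norm (mul g a) \<le> norm a * \<bar>K\<bar>"
      using norm_mul_le[OF g K, of a] by (simp add: mult.commute)
  qed
qed

section \<open>Convolution as a bounded operator on L2\<close>

definition conv_op :: "(real ^ 'd \<Rightarrow> real) \<Rightarrow> 'd l2 \<Rightarrow> 'd l2" where
  "conv_op k a = cls (conv k (rep a))"

lemma conv_L2: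
  assumes "C1 k" "periodic k" "f \<in> L2"
  shows "conv k f \<in> L2"
  using assms C1_conv periodic_conv C1_L2 L2_imp_L1 by blast

lemma conv_op_cls:
  assumes "C1 k" "periodic k" "f \<in> L2"
  shows "conv_op k (cls f) = cls (conv k f)"
proof -
  have "conv k (rep (cls f)) = conv k f"
    by (rule ext, rule conv_cong_AE[OF assms(1,2) L2_imp_L1[OF rep_L2] L2_imp_L1[OF assms(3)] rep_cls[OF assms(3)]])
  then show ?thesis by (simp add: conv_op_def)
qed

text \<open>Convolution turns an L2 function into a bounded one. This keeps the interaction term
  quadratic in the L2 norm of the state, without its gradient.\<close>

lemma conv_bound_norm:
  fixes k :: "real ^ 'd \<Rightarrow> real"
  assumes "C1 k" "periodic k"
  obtains K where "0 \<le> K" "\<And>f x. f \<in> L2 \<Longrightarrow> \<bar>conv k f x\<bar> \<le> K * norm (cls f)"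
proof -
  obtain K where K: "0 \<le> K" "\<And>x. \<bar>k x\<bar> \<le> K" using C1_bounded[OF assms] by blast
  let ?o = "norm (cls (\<lambda>x :: real ^ 'd. 1))"
  have "\<bar>conv k f x\<bar> \<le> (K * ?o) * norm (cls f)" if "f \<in> L2" for f x
  proof -
    have "\<bar>conv k f x\<bar> \<le> K * (\<integral>y. \<bar>f y\<bar> \<partial>torus)" by (rule conv_bound[OF assms L2_imp_L1[OF that] K(2)])
    also have "\<dots> \<le> K * (norm (cls f) * ?o)" by (rule mult_left_mono[OF L1_norm_le[OF that] K(1)])
    finally show ?thesis by (simp add: mult_ac)
  qed
  moreover have "0 \<le> K * ?o" using K by simp
  ultimately show thesis using that by blast
qed

lemma norm_cls_bounded:
  fixes f :: "real ^ 'd \<Rightarrow> real"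
  assumes f: "f \<in> L2" "\<And>x. \<bar>f x\<bar> \<le> K" "0 \<le> K"
  shows "norm (cls f) \<le> K * norm (cls (\<lambda>x :: real ^ 'd. 1))"
proof -
  have "(\<integral>x. (f x)\<^sup>2 \<partial>torus) \<le> (\<integral>x. (K * 1)\<^sup>2 \<partial>(torus :: (real ^ 'd) measure))"
  proof (rule integral_mono)
    show "(f x)\<^sup>2 \<le> (K * 1)\<^sup>2" for x using power_mono[OF f(2)[of x], of 2] by simp
  qed (use f(1) in \<open>simp_all add: L2_def\<close>)
  then have "norm (cls f) \<le> norm (cls (\<lambda>x :: real ^ 'd. K * 1))"
    unfolding norm_cls[OF f(1)] norm_cls[OF L2_const] by (rule real_sqrt_le_mono)
  also have "\<dots> = K * norm (cls (\<lambda>x :: real ^ 'd. 1))"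
    unfolding cls_scaleR[OF L2_const] using f(3) by simp
  finally show ?thesis .
qed

lemma bounded_linear_conv_op:
  fixes k :: "real ^ 'd \<Rightarrow> real"
  assumes k: "C1 k" "periodic k"
  shows "bounded_linear (conv_op k)"
proof -
  obtain K where K: "0 \<le> K" "\<And>f x. f \<in> L2 \<Longrightarrow> \<bar>conv k f x\<bar> \<le> K * norm (cls f)" using conv_bound_norm[OF k] by blast
  show ?thesis
  proof (rule bounded_linear_intro)
    fix a b :: "'d l2" and c :: real
    note C = conv_L2[OF k rep_L2]
    have "conv_op k (a + b) = conv_op k (cls (\<lambda>x. rep a x + rep b x))" by (simp add: cls_add)
    also have "\<dots> = cls (\<lambda>x. conv k (rep a) x + conv k (rep b) x)"
    proof -
      have "conv k (\<lambda>x. rep a x + rep b x) = (\<lambda>x. conv k (rep a) x + conv k (rep b) x)"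
        by (rule ext, rule conv_add[OF k]) (simp_all add: L2_imp_L1)
      then show ?thesis by (simp add: conv_op_cls[OF k L2_add[OF rep_L2 rep_L2]])
    qed
    also have "\<dots> = conv_op k a + conv_op k b" unfolding conv_op_def by (rule cls_add[OF C C])
    finally show "conv_op k (a + b) = conv_op k a + conv_op k b" .
    have "conv_op k (c *\<^sub>R a) = conv_op k (cls (\<lambda>x. c * rep a x))" by (simp add: cls_scaleR)
    also have "\<dots> = cls (\<lambda>x. c * conv k (rep a) x)"
      unfolding conv_op_cls[OF k L2_scale[OF rep_L2]] conv_scale[abs_def] ..
    also have "\<dots> = c *\<^sub>R conv_op k a" unfolding conv_op_def by (rule cls_scaleR[OF C])
    finally show "conv_op k (c *\<^sub>R a) = c *\<^sub>R conv_op k a" .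
    have "norm (conv_op k a) \<le> (K * norm a) * norm (cls (\<lambda>x :: real ^ 'd. 1))"
      unfolding conv_op_def using K(2)[OF rep_L2[of a]] K(1) by (intro norm_cls_bounded[OF C]) simp_all
    then show "norm (conv_op k a) \<le> norm a * (K * norm (cls (\<lambda>x :: real ^ 'd. 1)))" by (simp add: mult_ac)
  qed
qed

lemma Linf_bounded:
  assumes "f \<in> Linf"
  shows "multiplier f"
proof -
  have fm: "f \<in> borel_measurable borel" and p: "periodic f" and e: "esssup torus (\<lambda>x. ereal \<bar>f x\<bar>) < \<infinity>"
    using assms by (auto simp: Linf_def)
  obtain K :: real where K: "esssup torus (\<lambda>x. ereal \<bar>f x\<bar>) \<le> ereal K"
    using e by (cases "esssup torus (\<lambda>x. ereal \<bar>f x\<bar>)") auto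
  have "AE x in torus. ereal \<bar>f x\<bar> \<le> esssup torus (\<lambda>x. ereal \<bar>f x\<bar>)"
    by (rule esssup_AE)
  then have "AE x in torus. \<bar>f x\<bar> \<le> K"
    by eventually_elim (use K order_trans in fastforce)
  then show ?thesis using fm p unfolding multiplier_def by blast
qed

section \<open>The linearised operator as a bilinear form\<close>

lemma C2_imp_C1:
  assumes "C2 f" shows "C1 f" "C1 (\<lambda>x. grad f x $ i)"
proof -
  obtain G where G: "\<And>x. GDERIV f x :> G x" "\<And>i. C1 (\<lambda>x. G x $ i)" using assms unfolding C2_def by blast
  have "grad f = G" using grad_eq[OF G(1)] by (rule ext)
  then show "C1 (\<lambda>x. grad f x $ i)" using G(2) by simp
  have "continuous_on UNIV (\<lambda>x. \<chi> i. G x $ i)" using G(2) by (intro continuous_on_vec_lambda C1_continuous)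
  then show "C1 f" using G(1) by (intro C1I[of f G]) simp_all
qed

lemma bounded_linear_family_bound:
  fixes T :: "'d :: finite \<Rightarrow> 'a :: real_normed_vector \<Rightarrow> 'b :: real_normed_vector"
  assumes "\<And>i. bounded_linear (T i)"
  obtains K where "0 \<le> K" "\<And>i x. norm (T i x) \<le> K * norm x"
proof -
  have "\<forall>i. \<exists>K. 0 \<le> K \<and> (\<forall>x. norm (T i x) \<le> norm x * K)"
    using bounded_linear.nonneg_bounded[OF assms] by blast
  from choice[OF this] obtain K where K: "\<And>i. 0 \<le> K i" "\<And>i x. norm (T i x) \<le> norm x * K i" by blast
  have "norm (T i x) \<le> (\<Sum>i\<in>UNIV. K i) * norm x" for i x
  proof -
    have "norm x * K i \<le> norm x * (\<Sum>i\<in>UNIV. K i)"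
      by (intro mult_left_mono member_le_sum K) simp_all
    with K(2)[of i x] show ?thesis by (simp add: mult.commute)
  qed
  moreover have "0 \<le> (\<Sum>i\<in>UNIV. K i)" by (intro sum_nonneg K)
  ultimately show thesis using that by blast
qed

lemma bounded_linear_form_bound:
  fixes P :: "'i :: finite \<Rightarrow> 'a :: real_normed_vector \<Rightarrow> 'h :: real_inner"
    and Q :: "'i \<Rightarrow> 'b :: real_normed_vector \<Rightarrow> 'h"
  assumes P: "\<And>i. bounded_linear (P i)" and Q: "\<And>i. bounded_linear (Q i)"
  obtains B where "0 \<le> B" "\<And>u v. \<bar>\<Sum>i\<in>UNIV. P i u \<bullet> Q i v\<bar> \<le> B * norm u * norm v"
proof -
  obtain K where K: "0 \<le> K" "\<And>i x. norm (P i x) \<le> K * norm x" using bounded_linear_family_bound[of P, OF P] by blast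
  obtain L where L: "0 \<le> L" "\<And>i x. norm (Q i x) \<le> L * norm x" using bounded_linear_family_bound[of Q, OF Q] by blast
  have "\<bar>\<Sum>i\<in>UNIV. P i u \<bullet> Q i v\<bar> \<le> (\<Sum>i\<in>(UNIV :: 'i set). K * L) * norm u * norm v" for u v
  proof -
    have "\<bar>\<Sum>i\<in>UNIV. P i u \<bullet> Q i v\<bar> \<le> (\<Sum>i\<in>UNIV. \<bar>P i u \<bullet> Q i v\<bar>)" by (rule sum_abs)
    also have "\<dots> \<le> (\<Sum>i\<in>(UNIV :: 'i set). K * L * (norm u * norm v))"
    proof (rule sum_mono)
      fix i
      have "\<bar>P i u \<bullet> Q i v\<bar> \<le> norm (P i u) * norm (Q i v)" by (rule Cauchy_Schwarz_ineq2)
      also have "\<dots> \<le> (K * norm u) * (L * norm v)" using K L by (intro mult_mono) simp_all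
      finally show "\<bar>P i u \<bullet> Q i v\<bar> \<le> K * L * (norm u * norm v)" by (simp add: mult_ac)
    qed
    finally show ?thesis by (simp add: mult_ac)
  qed
  moreover have "0 \<le> (\<Sum>i\<in>(UNIV :: 'i set). K * L)" using K L by (intro sum_nonneg) simp
  ultimately show thesis using that by blast
qed

text \<open>Operators act on representatives and are linear only almost everywhere. The difference
  of \<open>f\<close> and \<open>g\<close> has norm zero, so its image has norm zero by boundedness,
  and linearity transfers this to the images of \<open>f\<close> and \<open>g\<close>.\<close>

lemma bounded_operator_cong:
  assumes T: "bounded_operator \<rho> T" and fg: "f \<in> X0 \<rho>" "g \<in> X0 \<rho>" "AE x in torus. f x = g x"
    and \<rho>: "\<And>x. 0 < \<rho> x" "\<rho> \<in> borel_measurable borel"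
  shows "AE x in torus. T f x = T g x"
proof -
  obtain C where C: "\<And>f. f \<in> X0 \<rho> \<Longrightarrow> X_norm \<rho> (T f) \<le> C * X_norm \<rho> f" using T unfolding bounded_operator_def by blast
  let ?h = "\<lambda>x. 1 * f x + (-1) * g x"
  have lin: "AE x in torus. T ?h x = 1 * T f x + (-1) * T g x" using T fg unfolding bounded_operator_def by blast
  have hm: "?h \<in> borel_measurable borel" using fg by (auto simp: X0_def X_def)
  have h0: "AE x in torus. ?h x = 0" using fg(3) by eventually_elim simp
  have hX: "?h \<in> X0 \<rho>"
  proof -
    have "integrable torus (\<lambda>x. (?h x)\<^sup>2 / \<rho> x) \<longleftrightarrow> integrable torus (\<lambda>x :: real ^ 'a. 0 :: real)"
      using h0 hm \<rho>(2) by (intro integrable_cong_AE) (auto elim!: eventually_mono)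
    moreover have "(\<integral>x. ?h x \<partial>torus) = (\<integral>x. 0 \<partial>(torus :: (real ^ 'a) measure))"
      using h0 hm by (intro integral_cong_AE) auto
    ultimately show ?thesis using fg hm by (auto simp: X0_def X_def periodic_def)
  qed
  have "X_inner \<rho> ?h ?h = (\<integral>x. 0 \<partial>(torus :: (real ^ 'a) measure))"
    unfolding X_inner_def using h0 hm \<rho>(2) by (intro integral_cong_AE) (auto elim!: eventually_mono)
  then have "X_norm \<rho> ?h = 0" by (simp add: X_norm_def)
  then have "X_norm \<rho> (T ?h) \<le> 0" using C[OF hX] by simp
  then have z: "(\<integral>x. T ?h x * T ?h x / \<rho> x \<partial>torus) \<le> 0" unfolding X_norm_def X_inner_def
    by (simp add: real_sqrt_le_0_iff)
  have TX: "T ?h \<in> X0 \<rho>" using T hX unfolding bounded_operator_def by blast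
  then have i: "integrable torus (\<lambda>x. T ?h x * T ?h x / \<rho> x)" by (simp add: X0_def X_def power2_eq_square)
  have nn: "0 \<le> T ?h x * T ?h x / \<rho> x" for x using \<rho>(1)[of x] by simp
  have "AE x in torus. T ?h x * T ?h x / \<rho> x = 0"
  proof (rule integral_nonneg_eq_0_iff_AE[OF i, THEN iffD1])
    show "AE x in torus. 0 \<le> T ?h x * T ?h x / \<rho> x" by (rule AE_I2) (rule nn)
    have "0 \<le> (\<integral>x. T ?h x * T ?h x / \<rho> x \<partial>torus)" by (rule Bochner_Integration.integral_nonneg) (rule nn)
    with z show "(\<integral>x. T ?h x * T ?h x / \<rho> x \<partial>torus) = 0" by (rule antisym)
  qed
  then show ?thesis using lin
  proof eventually_elim
    case (elim x)
    then show ?case using \<rho>(1)[of x] by simp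
  qed
qed

section \<open>The stationary density and conjugation by its square root\<close>

locale mckean_vlasov =
  fixes \<sigma> :: real and V W \<rho> :: "real ^ 'd \<Rightarrow> real"
  assumes \<sigma>: "\<sigma> > 0" and V: "C2 V" "periodic V" and W: "C2 W" "periodic W"
    and stationary: "stationary_state \<sigma> V W \<rho>"
begin

lemmas dV = C2_imp_C1[OF V(1)]
lemmas dW = C2_imp_C1[OF W(1)]

lemma periodic_dV: "periodic (\<lambda>x. grad V x $ i)"
  using periodic_compose[OF periodic_grad[OF V(2)]] .

lemma periodic_dW: "periodic (\<lambda>x. grad W x $ i)"
  using periodic_compose[OF periodic_grad[OF W(2)]] .

lemma \<rho>_L1: "\<rho> \<in> L1"
  using stationary unfolding stationary_state_def probability_density_def by blast

lemma \<rho>_integral: "(\<integral>x. \<rho> x \<partial>torus) = 1"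
  using stationary unfolding stationary_state_def probability_density_def by blast

lemma \<rho>_periodic: "periodic \<rho>"
  using \<rho>_L1 by (simp add: L1_def)

lemma \<rho>_form: obtains c where "c > 0" "\<And>x. \<rho> x = c * exp ((- 1 / \<sigma>) * (V x + conv W \<rho> x))"
proof -
  define Z where "Z = (\<integral>z. exp (- (V z + conv W \<rho> z) / \<sigma>) \<partial>torus)"
  have eq: "\<rho> x = exp (- (V x + conv W \<rho> x) / \<sigma>) / Z" for x
    using stationary unfolding stationary_state_def Z_def by blast
  have "Z \<ge> 0" unfolding Z_def by simp
  moreover have "Z \<noteq> 0"
  proof
    \<comment> \<open>Division by 0 yields 0, so \<rho> would vanish identically, contrary to its
      integral 1.\<close>
    assume "Z = 0"
    then have "\<rho> x = 0" for x using eq[of x] by simp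
    then show False using \<rho>_integral by simp
  qed
  ultimately have "1 / Z > 0" by simp
  moreover have "\<rho> x = 1 / Z * exp ((- 1 / \<sigma>) * (V x + conv W \<rho> x))" for x
  proof -
    have "- (V x + conv W \<rho> x) / \<sigma> = (- 1 / \<sigma>) * (V x + conv W \<rho> x)" using \<sigma> by (simp add: field_simps)
    with eq[of x] show ?thesis by (simp only:) simp
  qed
  ultimately show thesis by (rule that)
qed

lemma \<rho>_pos: "0 < \<rho> x"
  using \<rho>_form by (metis exp_gt_zero mult_pos_pos)

text \<open>The fixed-point equation improves regularity: \<rho> is integrable, convolution with
  \<open>W\<close> then makes the exponent C1, and hence \<rho> itself.\<close>

lemma \<rho>_C1: "C1 \<rho>"
proof -
  obtain c where c: "\<And>x. \<rho> x = c * exp ((- 1 / \<sigma>) * (V x + conv W \<rho> x))" using \<rho>_form by blast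
  have "C1 (\<lambda>x. (- 1 / \<sigma>) * (V x + conv W \<rho> x))"
    by (rule C1_mult[OF C1_const C1_add[OF dV(1) C1_conv[OF dW(1) W(2) \<rho>_L1]]])
  then have "C1 (\<lambda>x. exp ((- 1 / \<sigma>) * (V x + conv W \<rho> x)))"
    by (rule C1_compose[where h = exp and h' = exp]) (auto intro: DERIV_exp continuous_intros)
  then have "C1 (\<lambda>x. c * exp ((- 1 / \<sigma>) * (V x + conv W \<rho> x)))" by (rule C1_mult[OF C1_const])
  moreover have "\<rho> = (\<lambda>x. c * exp ((- 1 / \<sigma>) * (V x + conv W \<rho> x)))" using c by (rule ext)
  ultimately show ?thesis by simp
qed

text \<open>Multiplication by \<open>ir\<close> identifies the weighted space with plain L2, and
  \<open>sr\<close> inverts it; both turn out to be C1 and periodic, so the identification also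
  preserves H1.\<close>

definition sr :: "real ^ 'd \<Rightarrow> real" where "sr x = sqrt (\<rho> x)"
definition ir :: "real ^ 'd \<Rightarrow> real" where "ir x = inverse (sqrt (\<rho> x))"

lemma sr_C1: "C1 sr"
proof -
  have "continuous_on (range \<rho>) (\<lambda>x. inverse (sqrt x) / 2)"
    using \<rho>_pos by (intro continuous_intros) (auto simp: less_imp_neq[THEN not_sym])
  then have "C1 (\<lambda>x. sqrt (\<rho> x))"
    by (intro C1_compose[OF \<rho>_C1, where h = sqrt and h' = "\<lambda>x. inverse (sqrt x) / 2"] DERIV_real_sqrt \<rho>_pos)
  then show ?thesis by (simp add: sr_def[abs_def])
qed

lemma sr_pos: "0 < sr x"
  using \<rho>_pos by (simp add: sr_def)

lemma sr_periodic: "periodic sr"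
  using periodic_compose[OF \<rho>_periodic, of sqrt] by (simp add: sr_def[abs_def])

lemma ir_C1: "C1 ir"
proof -
  have "continuous_on (range sr) (\<lambda>x. - (inverse x ^ Suc (Suc 0)))"
    using sr_pos by (intro continuous_intros) (auto simp: less_imp_neq[THEN not_sym])
  moreover have "(inverse has_real_derivative - (inverse (sr x) ^ Suc (Suc 0))) (at (sr x))" for x
    using sr_pos[of x] by (intro DERIV_inverse) simp
  ultimately have "C1 (\<lambda>x. inverse (sr x))"
    by (intro C1_compose[OF sr_C1, where h = inverse and h' = "\<lambda>x. - (inverse x ^ Suc (Suc 0))"])
  then show ?thesis by (simp add: sr_def[abs_def] ir_def[abs_def])
qed

lemma ir_periodic: "periodic ir"
  using periodic_compose[OF \<rho>_periodic, of "\<lambda>x. inverse (sqrt x)"] by (simp add: ir_def[abs_def])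

lemma sr_ir [simp]: "sr x * ir x = 1" "ir x * sr x = 1" "sr x * (ir x * z) = z" "ir x * (sr x * z) = z"
proof -
  have "sr x \<noteq> 0" using sr_pos[of x] by simp
  then show "sr x * ir x = 1" "ir x * sr x = 1" "sr x * (ir x * z) = z" "ir x * (sr x * z) = z"
    by (simp_all add: ir_def sr_def)
qed

lemma sr_sr: "sr x * sr x = \<rho> x"
  using \<rho>_pos[of x] by (simp add: sr_def)

lemma ir_ir: "ir x * ir x = 1 / \<rho> x"
  using \<rho>_pos[of x] by (simp add: ir_def inverse_eq_divide)

lemmas multiplier_sr = multiplier_C1[OF sr_C1 sr_periodic]
lemmas multiplier_ir = multiplier_C1[OF ir_C1 ir_periodic]
lemmas sr_L2 = C1_L2[OF sr_C1 sr_periodic]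

lemma ir_L2_iff: "(\<lambda>x. ir x * f x) \<in> L2 \<longleftrightarrow> f \<in> L2"
  using multiplier_L2[OF multiplier_ir(1), of f] multiplier_L2[OF multiplier_sr(1), of "\<lambda>x. ir x * f x"] by auto

lemma X_eq_L2: "X \<rho> = L2"
proof -
  have eq: "(ir x * f x)\<^sup>2 = (f x)\<^sup>2 / \<rho> x" for x and f :: "real ^ 'd \<Rightarrow> real"
    using ir_ir[of x] by (simp add: power2_eq_square mult_ac)
  have "f \<in> X \<rho> \<longleftrightarrow> (\<lambda>x. ir x * f x) \<in> L2 \<and> periodic f \<and> f \<in> borel_measurable borel" for f
  proof -
    have "periodic (\<lambda>x. ir x * f x)" if "periodic f" using periodic_binop[OF ir_periodic that] .
    moreover have "(\<lambda>x. ir x * f x) \<in> borel_measurable borel" if "f \<in> borel_measurable borel"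
      using C1_measurable[OF ir_C1] that by (rule borel_measurable_times)
    ultimately show ?thesis unfolding X_def L2_def mem_Collect_eq eq by blast
  qed
  then show ?thesis unfolding ir_L2_iff by (auto simp: L2_def)
qed

lemma X_inner_eq: "f \<in> L2 \<Longrightarrow> g \<in> L2 \<Longrightarrow> X_inner \<rho> f g = cls (\<lambda>x. ir x * f x) \<bullet> cls (\<lambda>x. ir x * g x)"
proof -
  assume fg: "f \<in> L2" "g \<in> L2"
  have "(ir x * f x) * (ir x * g x) = f x * g x / \<rho> x" for x
    using ir_ir[of x] by (simp add: mult_ac)
  then show ?thesis
    unfolding X_inner_def cls_inner[OF ir_L2_iff[THEN iffD2, OF fg(1)] ir_L2_iff[THEN iffD2, OF fg(2)]] by simp
qed

lemma X_norm_eq: "f \<in> L2 \<Longrightarrow> X_norm \<rho> f = norm (cls (\<lambda>x. ir x * f x))"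
  by (simp add: X_norm_def X_inner_eq norm_eq_sqrt_inner)

lemma X0_iff: "f \<in> X0 \<rho> \<longleftrightarrow> f \<in> L2 \<and> cls sr \<bullet> cls (\<lambda>x. ir x * f x) = 0"
  unfolding X0_def X_eq_L2 mem_Collect_eq
  by (auto simp: cls_inner sr_L2 ir_L2_iff)

lemma X0_sr: "a \<bullet> cls sr = 0 \<Longrightarrow> (\<lambda>x. sr x * rep a x) \<in> X0 \<rho>"
  unfolding X0_iff by (simp add: multiplier_L2[OF multiplier_sr(1)] inner_commute)

lemma H1_sharp_iff: "f \<in> H1_sharp \<rho> \<longleftrightarrow> f \<in> H1 \<and> cls f \<bullet> cls sr = 0"
proof -
  have "f \<in> H1 \<Longrightarrow> cls f \<bullet> cls sr = (\<integral>x. f x * sqrt (\<rho> x) \<partial>torus)"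
    using cls_inner[OF H1_D(1) sr_L2] by (simp add: sr_def)
  then show ?thesis by (auto simp: H1_sharp_def)
qed

text \<open>The energy space of the transformed state: the constraint of zero mean has become
  orthogonality to \<open>sr\<close>.\<close>

definition VV :: "('d l2 \<times> ('d l2 ^ 'd)) set" where
  "VV = graph ` H1_sharp \<rho>"

lemma VV_eq: "VV = H1_graph \<inter> {u. fst u \<bullet> cls sr = 0}"
  unfolding VV_def H1_graph_def by (auto simp: H1_sharp_iff graph_def)

lemma closed_VV: "closed VV"
  unfolding VV_eq by (intro closed_Int closed_H1_graph closed_Collect_eq continuous_intros)

lemma subspace_VV: "subspace VV"
  unfolding VV_eq
proof (rule subspace_inter[OF subspace_H1_graph])
  show "subspace {u :: 'd l2 \<times> ('d l2 ^ 'd). fst u \<bullet> cls sr = 0}"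
    by (rule subspaceI) (simp_all add: inner_add_left)
qed

text \<open>States and test functions are transformed in opposite ways, \<open>y = sr * z\<close>
  and \<open>\<phi> = ir * \<zeta>\<close>, so that the integral of \<open>y * \<phi>\<close> equals
  that of \<open>z * \<zeta>\<close>. This is the \<open>i\<close>-th partial derivative of \<phi>
  in terms of the graph of \<zeta>, by the product rule.\<close>

definition grad_part :: "'d \<Rightarrow> 'd l2 \<times> ('d l2 ^ 'd) \<Rightarrow> 'd l2" where
  "grad_part i u = mul ir (snd u $ i) + mul (\<lambda>x. grad ir x $ i) (fst u)"

text \<open>The part of the flux of \<open>y = sr * z\<close> in which \<open>z\<close> is not
  differentiated: the derivative of the weight, the drift by \<open>V\<close>, the drift by the
  stationary interaction, and the interaction created by \<open>y\<close> acting on \<rho>.\<close>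

definition lower_order :: "'d \<Rightarrow> 'd l2 \<Rightarrow> 'd l2" where
  "lower_order i a = \<sigma> *\<^sub>R mul (\<lambda>x. grad sr x $ i) a + mul (\<lambda>x. grad V x $ i) (mul sr a)
     + mul (conv (\<lambda>z. grad W z $ i) \<rho>) (mul sr a) + mul \<rho> (conv_op (\<lambda>z. grad W z $ i) (mul sr a))"

definition flux_part :: "'d \<Rightarrow> 'd l2 \<times> ('d l2 ^ 'd) \<Rightarrow> 'd l2" where
  "flux_part i u = \<sigma> *\<^sub>R mul sr (snd u $ i) + lower_order i (fst u)"

lemma multiplier_dV: "multiplier (\<lambda>x. grad V x $ i)"
  by (rule multiplier_C1(1)[OF dV(2) periodic_dV])

lemma C1_drift: "C1 (conv (\<lambda>z. grad W z $ i) \<rho>)" "periodic (conv (\<lambda>z. grad W z $ i) \<rho>)"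
  by (rule C1_conv[OF dW(2) periodic_dW \<rho>_L1], rule periodic_conv[OF dW(2) periodic_dW \<rho>_L1])

lemmas multiplier_drift = multiplier_C1(1)[OF C1_drift]
lemmas multiplier_\<rho> = multiplier_C1(1)[OF \<rho>_C1 \<rho>_periodic]

lemma bounded_linear_lower_order: "bounded_linear (lower_order i)"
  unfolding lower_order_def[abs_def]
  by (intro bounded_linear_add bounded_linear_compose[OF bounded_linear_scaleR_right]
      bounded_linear_compose[OF bounded_linear_mul[OF multiplier_dV]]
      bounded_linear_compose[OF bounded_linear_mul[OF multiplier_drift]]
      bounded_linear_compose[OF bounded_linear_mul[OF multiplier_\<rho>]]
      bounded_linear_compose[OF bounded_linear_conv_op[OF dW(2) periodic_dW]]
      bounded_linear_mul multiplier_sr)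

lemma bounded_linear_snd_nth: "bounded_linear (\<lambda>u :: 'd l2 \<times> ('d l2 ^ 'd). snd u $ i)"
  by (rule bounded_linear_compose[OF bounded_linear_vec_nth bounded_linear_snd])

lemma bounded_linear_grad_part: "bounded_linear (grad_part i)"
  unfolding grad_part_def[abs_def]
  by (intro bounded_linear_add bounded_linear_compose[OF bounded_linear_mul[OF multiplier_ir(1)] bounded_linear_snd_nth]
      bounded_linear_compose[OF bounded_linear_mul[OF multiplier_ir(2)] bounded_linear_fst])

lemma bounded_linear_flux_part: "bounded_linear (flux_part i)"
  unfolding flux_part_def[abs_def]
  by (intro bounded_linear_add bounded_linear_compose[OF bounded_linear_lower_order bounded_linear_fst]
      bounded_linear_compose[OF bounded_linear_scaleR_right]
      bounded_linear_compose[OF bounded_linear_mul[OF multiplier_sr(1)] bounded_linear_snd_nth])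

text \<open>The opposite weights in state and test function cancel, so the leading term of the form
  is \<sigma> times the plain inner product of gradients.\<close>

lemma mul_sr_mul_ir: "mul sr a \<bullet> mul ir b = a \<bullet> b"
proof -
  have "mul sr a \<bullet> mul ir b = (\<integral>x. (sr x * rep a x) * (ir x * rep b x) \<partial>torus)"
    unfolding mul_def by (rule cls_inner) (intro multiplier_L2 multiplier_sr(1) multiplier_ir(1) rep_L2)+
  also have "\<dots> = (\<integral>x. rep a x * rep b x \<partial>torus)"
  proof (intro Bochner_Integration.integral_cong refl)
    fix x
    have "(sr x * rep a x) * (ir x * rep b x) = (sr x * ir x) * (rep a x * rep b x)" by (simp only: mult_ac)
    then show "(sr x * rep a x) * (ir x * rep b x) = rep a x * rep b x" by simp
  qed
  also have "\<dots> = a \<bullet> b" using cls_inner[OF rep_L2[of a] rep_L2[of b]] by simp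
  finally show ?thesis .
qed

lemma grad_part_graph:
  assumes f: "f \<in> H1"
  shows "cls (\<lambda>x. weak_grad f x $ i) = grad_part i (graph (\<lambda>x. sr x * f x))"
proof -
  define z where "z x = sr x * f x" for x
  have z: "z \<in> H1" using H1_mult_C1(1)[OF f sr_C1 sr_periodic] by (simp add: z_def[abs_def])
  have fz: "f = (\<lambda>x. ir x * z x)" by (simp add: z_def fun_eq_iff)
  note Z = H1_D[OF z]
  note M = multiplier_L2[OF multiplier_ir(1) Z(3)[of i]] multiplier_L2[OF multiplier_ir(2)[of i] Z(1)]
  have "cls (\<lambda>x. weak_grad f x $ i) = cls (\<lambda>x. ir x * weak_grad z x $ i + grad ir x $ i * z x)"
    unfolding cls_eq_iff[OF H1_D(3)[OF f] L2_add[OF M]]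
    using H1_mult_C1(2)[OF z ir_C1 ir_periodic, folded fz] by eventually_elim (simp add: mult.commute)
  also have "\<dots> = grad_part i (graph z)"
    by (simp add: grad_part_def graph_def grad_cls_def cls_add[OF M] mul_cls[OF multiplier_ir(1) Z(3)] mul_cls[OF multiplier_ir(2) Z(1)])
  finally show ?thesis by (simp add: z_def[abs_def])
qed

lemma flux_part_graph:
  assumes y: "y \<in> H1"
  shows "(\<lambda>x. (diffusion_drift_flux \<sigma> V y x + interaction_flux W \<rho> y x) $ i) \<in> L2"
    "cls (\<lambda>x. (diffusion_drift_flux \<sigma> V y x + interaction_flux W \<rho> y x) $ i) = flux_part i (graph (\<lambda>x. ir x * y x))"
proof -
  define z where "z x = ir x * y x" for x
  have z: "z \<in> H1" using H1_mult_C1(1)[OF y ir_C1 ir_periodic] by (simp add: z_def[abs_def])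
  have yz: "y = (\<lambda>x. sr x * z x)" by (simp add: z_def fun_eq_iff)
  note Z = H1_D[OF z] and Y = H1_D[OF y]
  have g: "AE x in torus. weak_grad y x = sr x *\<^sub>R weak_grad z x + z x *\<^sub>R grad sr x"
    using H1_mult_C1(2)[OF z sr_C1 sr_periodic, folded yz] .
  note M1 = multiplier_L2[OF multiplier_sr(1) Z(3)[of i]] and M2 = multiplier_L2[OF multiplier_sr(2)[of i] Z(1)]
    and M3 = multiplier_L2[OF multiplier_dV[of i] Y(1)] and M4 = multiplier_L2[OF multiplier_drift[of i] Y(1)]
    and C = conv_L2[OF dW(2) periodic_dW Y(1), of i]
  note M5 = multiplier_L2[OF multiplier_\<rho> C]
  have flux: "(diffusion_drift_flux \<sigma> V y x + interaction_flux W \<rho> y x) $ i =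
      \<sigma> * weak_grad y x $ i + (grad V x $ i * y x + conv (\<lambda>z. grad W z $ i) \<rho> x * y x + \<rho> x * conv (\<lambda>z. grad W z $ i) y x)" for x
    unfolding diffusion_drift_flux_def interaction_flux_def
    by (simp add: grad_conv_component[OF dW(1) W(2) \<rho>_L1] grad_conv_component[OF dW(1) W(2) L2_imp_L1[OF Y(1)]] mult.commute)
  show L2: "(\<lambda>x. (diffusion_drift_flux \<sigma> V y x + interaction_flux W \<rho> y x) $ i) \<in> L2"
    unfolding flux by (intro L2_add L2_scale M3 M4 M5 Y(3))
  have "cls (\<lambda>x. (diffusion_drift_flux \<sigma> V y x + interaction_flux W \<rho> y x) $ i) =
    \<sigma> *\<^sub>R cls (\<lambda>x. weak_grad y x $ i) + (cls (\<lambda>x. grad V x $ i * y x) + cls (\<lambda>x. conv (\<lambda>z. grad W z $ i) \<rho> x * y x) + cls (\<lambda>x. \<rho> x * conv (\<lambda>z. grad W z $ i) y x))"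
    unfolding flux cls_add[OF L2_scale[OF Y(3)] L2_add[OF L2_add[OF M3 M4] M5]] cls_add[OF L2_add[OF M3 M4] M5] cls_add[OF M3 M4] cls_scaleR[OF Y(3)] ..
  also have "cls (\<lambda>x. weak_grad y x $ i) = cls (\<lambda>x. sr x * weak_grad z x $ i + grad sr x $ i * z x)"
    unfolding cls_eq_iff[OF Y(3) L2_add[OF M1 M2]] using g by eventually_elim (simp add: mult.commute)
  also have "\<dots> = mul sr (cls (\<lambda>x. weak_grad z x $ i)) + mul (\<lambda>x. grad sr x $ i) (cls z)"
    unfolding mul_cls[OF multiplier_sr(1) Z(3)] mul_cls[OF multiplier_sr(2) Z(1)] cls_add[OF M1 M2] ..
  also have "cls (\<lambda>x. grad V x $ i * y x) = mul (\<lambda>x. grad V x $ i) (mul sr (cls z))"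
    unfolding mul_cls[OF multiplier_sr(1) Z(1), folded yz] mul_cls[OF multiplier_dV Y(1)] ..
  also have "cls (\<lambda>x. conv (\<lambda>z. grad W z $ i) \<rho> x * y x) = mul (conv (\<lambda>z. grad W z $ i) \<rho>) (mul sr (cls z))"
    unfolding mul_cls[OF multiplier_sr(1) Z(1), folded yz] mul_cls[OF multiplier_drift Y(1)] ..
  also have "cls (\<lambda>x. \<rho> x * conv (\<lambda>z. grad W z $ i) y x) = mul \<rho> (conv_op (\<lambda>z. grad W z $ i) (mul sr (cls z)))"
    unfolding mul_cls[OF multiplier_sr(1) Z(1), folded yz] conv_op_cls[OF dW(2) periodic_dW Y(1)] mul_cls[OF multiplier_\<rho> C] ..
  finally show "cls (\<lambda>x. (diffusion_drift_flux \<sigma> V y x + interaction_flux W \<rho> y x) $ i) = flux_part i (graph (\<lambda>x. ir x * y x))"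
    unfolding flux_part_def lower_order_def graph_def grad_cls_def
    by (simp add: z_def[abs_def] scaleR_add_right add.assoc)
qed

lemma integral_inner_vec:
  assumes "\<And>i. (\<lambda>x. F x $ i) \<in> L2" "\<And>i. (\<lambda>x. G x $ i) \<in> L2"
  shows "(\<integral>x. F x \<bullet> G x \<partial>torus) = (\<Sum>i\<in>UNIV. cls (\<lambda>x. F x $ i) \<bullet> cls (\<lambda>x. G x $ i))"
  unfolding inner_vec_def cls_inner[OF assms] inner_real_def
  by (intro Bochner_Integration.integral_sum L2_integrable_mult assms)

lemma flux_form:
  assumes "y \<in> H1" "\<phi> \<in> H1"
  shows "(\<integral>x. (diffusion_drift_flux \<sigma> V y x + interaction_flux W \<rho> y x) \<bullet> weak_grad \<phi> x \<partial>torus) =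
    (\<Sum>i\<in>UNIV. flux_part i (graph (\<lambda>x. ir x * y x)) \<bullet> grad_part i (graph (\<lambda>x. sr x * \<phi> x)))"
  unfolding integral_inner_vec[OF flux_part_graph(1)[OF assms(1)] H1_D(3)[OF assms(2)]]
    flux_part_graph(2)[OF assms(1)] grad_part_graph[OF assms(2)] ..

text \<open>The gradient part \<open>b\<close> enters quadratically with factor \<sigma>; every
  other product contains the L2 part \<open>a\<close>. Young's inequality spends half of the
  dissipation on the mixed products.\<close>

lemma flux_form_garding:
  obtains \<kappa> where "0 \<le> \<kappa>"
    "\<And>u. - (\<Sum>i\<in>UNIV. flux_part i u \<bullet> grad_part i u) \<le> - (\<sigma> / 2) * (norm u)\<^sup>2 + \<kappa> * (norm (fst u))\<^sup>2"
proof -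
  obtain R where R: "0 \<le> R" "\<And>i x. norm (lower_order i x) \<le> R * norm x"
    using bounded_linear_family_bound[of lower_order, OF bounded_linear_lower_order] by blast
  obtain T where T: "0 \<le> T" "\<And>i x. norm (mul (\<lambda>x. grad ir x $ i) x) \<le> T * norm x"
    using bounded_linear_family_bound[of "\<lambda>i. mul (\<lambda>x. grad ir x $ i)", OF bounded_linear_mul[OF multiplier_ir(2)]]
      by blast
  obtain S where S: "0 \<le> S" "\<And>x. norm (mul sr x) \<le> S * norm x"
    using bounded_linear.nonneg_bounded[OF bounded_linear_mul[OF multiplier_sr(1)]] by (metis mult.commute)
  obtain I where I: "0 \<le> I" "\<And>x. norm (mul ir x) \<le> I * norm x"
    using bounded_linear.nonneg_bounded[OF bounded_linear_mul[OF multiplier_ir(1)]] by (metis mult.commute)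
  define n where "n = real CARD('d)"
  define C where "C = n * (\<sigma> * S * T + R * I)"
  define D where "D = n * (R * T)"
  have n: "n \<ge> 0" by (simp add: n_def)
  have CD: "C \<ge> 0" "D \<ge> 0" using n R T S I \<sigma> by (simp_all add: C_def D_def)
  \<comment> \<open>In order: the cost of the mixed products with constant \<open>C\<close>, the
    products of order zero with constant \<open>D\<close>, and the L2 part that completes
    \<open>(norm b)\<^sup>2\<close> to the full Sobolev norm.\<close>
  define \<kappa> where "\<kappa> = C\<^sup>2 / (2 * \<sigma>) + D + \<sigma> / 2"
  have "- (\<Sum>i\<in>UNIV. flux_part i u \<bullet> grad_part i u) \<le> - (\<sigma> / 2) * (norm u)\<^sup>2 + \<kappa> * (norm (fst u))\<^sup>2" for u
  proof -
    define a b where "a = fst u" and "b = snd u"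
    let ?a = "norm a" and ?b = "norm b"
    have bi: "norm (b $ i) \<le> ?b" for i by (rule Finite_Cartesian_Product.norm_nth_le)
    have "- (flux_part i u \<bullet> grad_part i u) \<le> - \<sigma> * (b $ i \<bullet> b $ i) + (\<sigma> * S * T + R * I) * (?a * ?b) + R * T * ?a\<^sup>2" for i
    proof -
      let ?R = "lower_order i a" and ?T = "mul (\<lambda>x. grad ir x $ i) a"
      have "flux_part i u \<bullet> grad_part i u = \<sigma> * (b $ i \<bullet> b $ i) + \<sigma> * (mul sr (b $ i) \<bullet> ?T) + ?R \<bullet> mul ir (b $ i) + ?R \<bullet> ?T"
        unfolding flux_part_def grad_part_def a_def b_def
        by (simp add: inner_add_left inner_add_right mul_sr_mul_ir distrib_left)
      moreover have "\<bar>mul sr (b $ i) \<bullet> ?T\<bar> \<le> S * T * (?a * ?b)"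
      proof -
        have "\<bar>mul sr (b $ i) \<bullet> ?T\<bar> \<le> norm (mul sr (b $ i)) * norm ?T" by (rule Cauchy_Schwarz_ineq2)
        also have "\<dots> \<le> (S * ?b) * (T * ?a)"
          using S T order_trans[OF S(2)[of "b $ i"] mult_left_mono[OF bi S(1)]] by (intro mult_mono) simp_all
        finally show ?thesis by (simp add: mult_ac)
      qed
      then have "\<sigma> * (mul sr (b $ i) \<bullet> ?T) \<ge> - (\<sigma> * S * T * (?a * ?b))"
        using \<sigma> mult_left_mono[of "- (S * T * (?a * ?b))" "mul sr (b $ i) \<bullet> ?T" \<sigma>] by (simp add: abs_le_iff mult_ac)
      moreover have "\<bar>?R \<bullet> mul ir (b $ i)\<bar> \<le> R * I * (?a * ?b)"
      proof -
        have "\<bar>?R \<bullet> mul ir (b $ i)\<bar> \<le> norm ?R * norm (mul ir (b $ i))" by (rule Cauchy_Schwarz_ineq2)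
        also have "\<dots> \<le> (R * ?a) * (I * ?b)"
          using R I order_trans[OF I(2)[of "b $ i"] mult_left_mono[OF bi I(1)]] by (intro mult_mono) simp_all
        finally show ?thesis by (simp add: mult_ac)
      qed
      moreover have "\<bar>?R \<bullet> ?T\<bar> \<le> R * T * ?a\<^sup>2"
      proof -
        have "\<bar>?R \<bullet> ?T\<bar> \<le> norm ?R * norm ?T" by (rule Cauchy_Schwarz_ineq2)
        also have "\<dots> \<le> (R * ?a) * (T * ?a)" using R T by (intro mult_mono) simp_all
        finally show ?thesis by (simp add: mult_ac power2_eq_square)
      qed
      ultimately show ?thesis unfolding distrib_right abs_le_iff by argo
    qed
    then have "- (\<Sum>i\<in>UNIV. flux_part i u \<bullet> grad_part i u) \<le>
        (\<Sum>i\<in>(UNIV :: 'd set). - \<sigma> * (b $ i \<bullet> b $ i) + (\<sigma> * S * T + R * I) * (?a * ?b) + R * T * ?a\<^sup>2)"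
      unfolding sum_negf[symmetric] by (rule sum_mono)
    also have "\<dots> = - \<sigma> * (b \<bullet> b) + C * (?a * ?b) + D * ?a\<^sup>2"
      unfolding inner_vec_def[of b b] C_def D_def n_def sum.distrib sum_distrib_left by (simp add: mult_ac)
    also have "\<dots> \<le> - \<sigma> * ?b\<^sup>2 + (\<sigma> / 2 * ?b\<^sup>2 + C\<^sup>2 / (2 * \<sigma>) * ?a\<^sup>2) + D * ?a\<^sup>2"
    proof -
      have "0 \<le> \<sigma> / 2 * (?b - C / \<sigma> * ?a)\<^sup>2" using \<sigma> by simp
      also have "\<dots> = \<sigma> / 2 * ?b\<^sup>2 + C\<^sup>2 / (2 * \<sigma>) * ?a\<^sup>2 - C * (?a * ?b)"
        using \<sigma> by (simp add: power2_eq_square field_simps)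
      finally show ?thesis by (simp add: power2_norm_eq_inner)
    qed
    also have "\<dots> = - (\<sigma> / 2) * (?a\<^sup>2 + ?b\<^sup>2) + \<kappa> * ?a\<^sup>2"
      by (simp add: \<kappa>_def algebra_simps)
    also have "?a\<^sup>2 + ?b\<^sup>2 = (norm u)\<^sup>2" by (simp add: norm_prod_def a_def b_def)
    finally show ?thesis by (simp add: a_def)
  qed
  moreover have "0 \<le> \<kappa>" using CD \<sigma> by (simp add: \<kappa>_def)
  ultimately show thesis using that by blast
qed

end

subsection \<open>Operators on the weighted space\<close>

context mckean_vlasov
begin

definition proj_sr :: "'d l2 \<Rightarrow> 'd l2" where
  "proj_sr a = a - (a \<bullet> cls sr) *\<^sub>R cls sr"

lemma norm_cls_sr: "cls sr \<bullet> cls sr = 1"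
  using \<rho>_integral by (simp add: cls_inner sr_L2 sr_sr)

lemma proj_sr_orth: "proj_sr a \<bullet> cls sr = 0"
  by (simp add: proj_sr_def inner_diff_left norm_cls_sr)

lemma proj_sr_id: "a \<bullet> cls sr = 0 \<Longrightarrow> proj_sr a = a"
  by (simp add: proj_sr_def)

lemma bounded_linear_proj_sr: "bounded_linear proj_sr"
  unfolding proj_sr_def[abs_def]
  by (intro bounded_linear_sub bounded_linear_ident bounded_linear_compose[OF bounded_linear_scaleR_left]
      bounded_linear_inner_left)

text \<open>Together with \<open>to_cls\<close> an isometry between the weighted space and L2; on
  functions the inversion holds only up to null sets, because \<open>from_cls\<close> picks a
  representative.\<close>

definition from_cls :: "'d l2 \<Rightarrow> real ^ 'd \<Rightarrow> real" where
  "from_cls a x = sr x * rep a x"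

definition to_cls :: "(real ^ 'd \<Rightarrow> real) \<Rightarrow> 'd l2" where
  "to_cls f = cls (\<lambda>x. ir x * f x)"

lemma from_cls_L2: "from_cls a \<in> L2"
  unfolding from_cls_def[abs_def] by (rule multiplier_L2[OF multiplier_sr(1) rep_L2])

lemma from_cls_X0: "a \<bullet> cls sr = 0 \<Longrightarrow> from_cls a \<in> X0 \<rho>"
  unfolding from_cls_def[abs_def] by (rule X0_sr)

lemma to_from_cls [simp]: "to_cls (from_cls a) = a"
  by (simp add: to_cls_def from_cls_def)

lemma from_to_cls: "f \<in> L2 \<Longrightarrow> AE x in torus. from_cls (to_cls f) x = f x"
proof -
  assume f: "f \<in> L2"
  show ?thesis
    using rep_cls[OF ir_L2_iff[THEN iffD2, OF f]] unfolding from_cls_def to_cls_def by eventually_elim simp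
qed

lemma X0_L2: "f \<in> X0 \<rho> \<Longrightarrow> f \<in> L2"
  by (simp add: X0_iff)

lemma to_cls_orth: "f \<in> X0 \<rho> \<Longrightarrow> to_cls f \<bullet> cls sr = 0"
  by (simp add: X0_iff to_cls_def inner_commute)

lemma to_cls_add: "f \<in> L2 \<Longrightarrow> g \<in> L2 \<Longrightarrow> to_cls (\<lambda>x. f x + g x) = to_cls f + to_cls g"
  using cls_add[OF ir_L2_iff[THEN iffD2] ir_L2_iff[THEN iffD2]] by (simp add: to_cls_def distrib_left)

lemma to_cls_diff: "f \<in> L2 \<Longrightarrow> g \<in> L2 \<Longrightarrow> to_cls (\<lambda>x. f x - g x) = to_cls f - to_cls g"
  using cls_diff[OF ir_L2_iff[THEN iffD2] ir_L2_iff[THEN iffD2]] by (simp add: to_cls_def right_diff_distrib)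

lemma to_cls_scale: "f \<in> L2 \<Longrightarrow> to_cls (\<lambda>x. c * f x) = c *\<^sub>R to_cls f"
  using cls_scaleR[OF ir_L2_iff[THEN iffD2], of f c] by (simp add: to_cls_def mult.left_commute)

lemma to_cls_cong: "f \<in> L2 \<Longrightarrow> g \<in> L2 \<Longrightarrow> AE x in torus. f x = g x \<Longrightarrow> to_cls f = to_cls g"
proof -
  assume f: "f \<in> L2" and g: "g \<in> L2" and eq: "AE x in torus. f x = g x"
  show ?thesis
    unfolding to_cls_def cls_eq_iff[OF ir_L2_iff[THEN iffD2, OF f] ir_L2_iff[THEN iffD2, OF g]]
    using eq by eventually_elim simp
qed

lemma norm_to_cls: "f \<in> L2 \<Longrightarrow> norm (to_cls f) = X_norm \<rho> f"
  by (simp add: X_norm_eq to_cls_def)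

lemma inner_to_cls: "f \<in> L2 \<Longrightarrow> g \<in> L2 \<Longrightarrow> X_inner \<rho> f g = to_cls f \<bullet> to_cls g"
  by (simp add: X_inner_eq to_cls_def)

lemma integral_to_cls:
  assumes "f \<in> L2" "\<phi> \<in> L2"
  shows "(\<integral>x. f x * \<phi> x \<partial>torus) = to_cls f \<bullet> cls (\<lambda>x. sr x * \<phi> x)"
proof -
  have "to_cls f \<bullet> cls (\<lambda>x. sr x * \<phi> x) = (\<integral>x. (ir x * f x) * (sr x * \<phi> x) \<partial>torus)"
    unfolding to_cls_def by (rule cls_inner[OF ir_L2_iff[THEN iffD2, OF assms(1)] multiplier_L2[OF multiplier_sr(1) assms(2)]])
  also have "\<dots> = (\<integral>x. f x * \<phi> x \<partial>torus)"
  proof (intro Bochner_Integration.integral_cong refl)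
    fix x
    have "(ir x * f x) * (sr x * \<phi> x) = (ir x * sr x) * (f x * \<phi> x)" by (simp only: mult_ac)
    then show "(ir x * f x) * (sr x * \<phi> x) = f x * \<phi> x" by simp
  qed
  finally show ?thesis by simp
qed

text \<open>Operators are controlled only on zero-mean functions. Projecting first extends them to
  all of L2, so that they become total bounded linear maps on a Hilbert space type.\<close>

definition lift :: "'d operator \<Rightarrow> 'd l2 \<Rightarrow> 'd l2" where
  "lift T a = to_cls (T (from_cls (proj_sr a)))"

context
  fixes T :: "'d operator"
  assumes T: "bounded_operator \<rho> T"
begin

lemma T_X0: "f \<in> X0 \<rho> \<Longrightarrow> T f \<in> X0 \<rho>"
  using T by (simp add: bounded_operator_def)

lemma T_cong: "f \<in> X0 \<rho> \<Longrightarrow> g \<in> X0 \<rho> \<Longrightarrow> AE x in torus. f x = g x \<Longrightarrow> to_cls (T f) = to_cls (T g)"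
  by (rule to_cls_cong[OF X0_L2[OF T_X0] X0_L2[OF T_X0] bounded_operator_cong[OF T _ _ _ \<rho>_pos C1_measurable[OF \<rho>_C1]]])

lemma lift_to_cls:
  assumes f: "f \<in> X0 \<rho>"
  shows "lift T (to_cls f) = to_cls (T f)"
  unfolding lift_def proj_sr_id[OF to_cls_orth[OF f]]
  by (rule T_cong[OF from_cls_X0[OF to_cls_orth[OF f]] f from_to_cls[OF X0_L2[OF f]]])

lemma lift_orth: "lift T a \<bullet> cls sr = 0"
  unfolding lift_def by (intro to_cls_orth T_X0 from_cls_X0 proj_sr_orth)

text \<open>Linearity, which holds only almost everywhere for representatives, becomes exact for
  classes.\<close>

lemma bounded_linear_lift: "bounded_linear (lift T)"
proof -
  obtain C where C: "\<And>f. f \<in> X0 \<rho> \<Longrightarrow> X_norm \<rho> (T f) \<le> C * X_norm \<rho> f" using T unfolding bounded_operator_def by blast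
  interpret P: bounded_linear proj_sr by (rule bounded_linear_proj_sr)
  note F = from_cls_X0[OF proj_sr_orth]
  have comb: "lift T (r *\<^sub>R a + s *\<^sub>R b) = r *\<^sub>R lift T a + s *\<^sub>R lift T b" for a b r s
  proof -
    let ?f = "from_cls (proj_sr a)" and ?g = "from_cls (proj_sr b)"
    let ?h = "\<lambda>x. r * ?f x + s * ?g x"
    have tc: "to_cls ?h = proj_sr (r *\<^sub>R a + s *\<^sub>R b)"
      by (simp add: to_cls_add to_cls_scale L2_scale from_cls_L2 P.add P.scale)
    have hL: "?h \<in> L2" by (intro L2_add L2_scale from_cls_L2)
    have hX: "?h \<in> X0 \<rho>"
      using hL tc proj_sr_orth[of "r *\<^sub>R a + s *\<^sub>R b"] unfolding X0_iff to_cls_def by (simp add: inner_commute)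
    have "lift T (r *\<^sub>R a + s *\<^sub>R b) = lift T (to_cls ?h)"
      unfolding tc lift_def by (simp add: proj_sr_id proj_sr_orth)
    also have "\<dots> = to_cls (T ?h)" by (rule lift_to_cls[OF hX])
    also have "\<dots> = to_cls (\<lambda>x. r * T ?f x + s * T ?g x)"
    proof (rule to_cls_cong[OF X0_L2[OF T_X0[OF hX]]])
      show "(\<lambda>x. r * T ?f x + s * T ?g x) \<in> L2" by (intro L2_add L2_scale X0_L2[OF T_X0[OF F]])
      show "AE x in torus. T ?h x = r * T ?f x + s * T ?g x" using T F unfolding bounded_operator_def by blast
    qed
    also have "\<dots> = r *\<^sub>R lift T a + s *\<^sub>R lift T b"
      unfolding lift_def by (simp add: to_cls_add to_cls_scale L2_scale X0_L2[OF T_X0[OF F]])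
    finally show ?thesis .
  qed
  obtain K where K: "\<And>x. norm (proj_sr x) \<le> norm x * K" "0 \<le> K" using P.nonneg_bounded by blast
  show ?thesis
  proof (rule bounded_linear_intro)
    show "lift T (a + b) = lift T a + lift T b" for a b using comb[of 1 a 1 b] by simp
    show "lift T (r *\<^sub>R a) = r *\<^sub>R lift T a" for r a using comb[of r a 0 a] by simp
    fix a
    have "norm (lift T a) \<le> C * norm (proj_sr a)"
      unfolding lift_def using C[OF F[of a]] norm_to_cls[OF X0_L2[OF T_X0[OF F]]] norm_to_cls[OF from_cls_L2[of
        "proj_sr a"]] by simp
    also have "\<dots> \<le> \<bar>C\<bar> * (norm a * K)" using K by (intro mult_mono) simp_all
    finally show "norm (lift T a) \<le> norm a * (\<bar>C\<bar> * K)" by (simp add: mult_ac)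
  qed
qed

end

end

subsection \<open>The closed-loop form\<close>

locale closed_loop_system = mckean_vlasov \<sigma> V W \<rho>
  for \<sigma> :: real and V W \<rho> :: "real ^ 'd \<Rightarrow> real" +
  fixes m :: nat and \<alpha> :: "nat \<Rightarrow> real ^ 'd \<Rightarrow> real" and Ric :: "'d operator"
  assumes multiplier_\<alpha>: "\<And>j i. j < m \<Longrightarrow> multiplier (\<lambda>x. weak_grad (\<alpha> j) x $ i)"
    and control_L2: "\<And>j. j < m \<Longrightarrow> weak_div (\<lambda>z. \<rho> z *\<^sub>R weak_grad (\<alpha> j) z) \<in> L2"
    and Ric: "bounded_operator \<rho> Ric"
begin

definition ctrl :: "nat \<Rightarrow> real ^ 'd \<Rightarrow> real" where
  "ctrl j = weak_div (\<lambda>z. \<rho> z *\<^sub>R weak_grad (\<alpha> j) z)"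

lemma ctrl_L2: "j < m \<Longrightarrow> ctrl j \<in> L2"
  unfolding ctrl_def by (rule control_L2)

lemma op_B_eq: "op_B \<rho> m \<alpha> u x = (\<Sum>j<m. u j * ctrl j x)"
  by (simp add: op_B_def ctrl_def)

lemma op_B_L2: "op_B \<rho> m \<alpha> u \<in> L2"
proof -
  have "(\<lambda>x. \<Sum>j<m. u j * ctrl j x) \<in> L2" by (intro L2_sum L2_scale ctrl_L2) simp
  then show ?thesis by (simp add: op_B_eq[abs_def])
qed

lemma op_B_adj_eq:
  assumes j: "j < m" and f: "f \<in> L2"
  shows "op_B_adj \<rho> m \<alpha> f j = to_cls (ctrl j) \<bullet> to_cls f"
proof -
  have "op_B \<rho> m \<alpha> (\<lambda>i. if i = j then 1 else 0) x = ctrl j x" for x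
    using j by (simp add: op_B_eq if_distrib[of "\<lambda>c. c * _"] sum.delta cong: if_cong)
  then have "op_B \<rho> m \<alpha> (\<lambda>i. if i = j then 1 else 0) = ctrl j" by (rule ext)
  then show ?thesis unfolding op_B_adj_def by (simp add: inner_to_cls ctrl_L2[OF j] f)
qed

text \<open>Minus the \<open>j\<close>-th control amplitude, written as a bounded functional on L2;
  being linear in the state, it makes the bilinear control term quadratic.\<close>

definition feedback :: "nat \<Rightarrow> 'd l2 \<Rightarrow> real" where
  "feedback j a = to_cls (ctrl j) \<bullet> lift Ric a"

lemma bounded_linear_feedback: "bounded_linear (feedback j)"
  unfolding feedback_def[abs_def]
  by (rule bounded_linear_compose[OF bounded_linear_inner_right bounded_linear_lift[OF Ric]])

lemma feedback_to_cls:
  assumes "j < m" "y \<in> X0 \<rho>"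
  shows "op_B_adj \<rho> m \<alpha> (Ric y) j = feedback j (to_cls y)"
  unfolding feedback_def lift_to_cls[OF Ric assms(2)]
  by (rule op_B_adj_eq[OF assms(1) X0_L2[OF T_X0[OF Ric assms(2)]]])

text \<open>The form of the closed-loop operator in the transformed variables, without the shift by
  \<delta>. The operator that generates the semigroup contains the shift, and
  \<open>A_generator\<close> accounts for the difference.\<close>

definition A :: "'d l2 \<times> ('d l2 ^ 'd) \<Rightarrow> 'd l2 \<times> ('d l2 ^ 'd) \<Rightarrow> real" where
  "A u v = - (\<Sum>i\<in>UNIV. flux_part i u \<bullet> grad_part i v) - (\<Sum>j<m. feedback j (fst u) * (to_cls (ctrl j) \<bullet> fst v))"

lemma graph_mult_C1: "fst (graph f) = cls f"
  by (simp add: graph_def)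

lemma integral_op_B:
  assumes "\<phi> \<in> L2"
  shows "(\<integral>x. op_B \<rho> m \<alpha> u x * \<phi> x \<partial>torus) = (\<Sum>j<m. u j * (to_cls (ctrl j) \<bullet> cls (\<lambda>x. sr x * \<phi> x)))"
proof -
  have "(\<integral>x. op_B \<rho> m \<alpha> u x * \<phi> x \<partial>torus) = (\<integral>x. (\<Sum>j<m. u j * (ctrl j x * \<phi> x)) \<partial>torus)"
    by (simp add: op_B_eq sum_distrib_right mult.assoc)
  also have "\<dots> = (\<Sum>j<m. \<integral>x. u j * (ctrl j x * \<phi> x) \<partial>torus)"
    by (intro Bochner_Integration.integral_sum integrable_mult_right L2_integrable_mult ctrl_L2 assms) simp_all
  also have "\<dots> = (\<Sum>j<m. u j * (to_cls (ctrl j) \<bullet> cls (\<lambda>x. sr x * \<phi> x)))"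
    by (intro sum.cong refl) (simp add: integral_to_cls[OF ctrl_L2 assms])
  finally show ?thesis .
qed

lemma A_graph:
  assumes y: "y \<in> H1" "y \<in> X0 \<rho>" and \<phi>: "\<phi> \<in> H1"
  shows "A (graph (\<lambda>x. ir x * y x)) (graph (\<lambda>x. sr x * \<phi> x)) =
    - (\<integral>x. (diffusion_drift_flux \<sigma> V y x + interaction_flux W \<rho> y x) \<bullet> weak_grad \<phi> x \<partial>torus)
    + (\<integral>x. op_B \<rho> m \<alpha> (\<lambda>j. - op_B_adj \<rho> m \<alpha> (Ric y) j) x * \<phi> x \<partial>torus)"
  unfolding A_def flux_form[OF y(1) \<phi>] integral_op_B[OF H1_D(1)[OF \<phi>]] graph_mult_C1
  by (simp add: feedback_to_cls[OF _ y(2)] sum_negf flip: to_cls_def)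

section \<open>Boundedness and coercivity of the closed-loop form, and the quadratic bound on the
  nonlinearity\<close>

lemma bounded_linear_A_left: "bounded_linear (\<lambda>u. A u v)"
  unfolding A_def
  by (intro bounded_linear_sub bounded_linear_minus bounded_linear_sum
      bounded_linear_compose[OF bounded_linear_inner_left bounded_linear_flux_part]
      bounded_linear_compose[OF bounded_linear_mult_left bounded_linear_compose[OF bounded_linear_feedback bounded_linear_fst]])

lemma feedback_form_bound:
  obtains K where "0 \<le> K" "\<And>a b. \<bar>\<Sum>j<m. feedback j a * (to_cls (ctrl j) \<bullet> b)\<bar> \<le> K * norm a * norm b"
proof -
  have "\<forall>j. \<exists>K. 0 \<le> K \<and> (\<forall>a. norm (feedback j a) \<le> norm a * K)"
    using bounded_linear.nonneg_bounded[OF bounded_linear_feedback] by blast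
  from choice[OF this] obtain k where k: "\<And>j. 0 \<le> k j" "\<And>j a. norm (feedback j a) \<le> norm a * k j" by blast
  define K where "K = (\<Sum>j<m. k j * norm (to_cls (ctrl j)))"
  have "\<bar>\<Sum>j<m. feedback j a * (to_cls (ctrl j) \<bullet> b)\<bar> \<le> K * norm a * norm b" for a b
  proof -
    have "\<bar>\<Sum>j<m. feedback j a * (to_cls (ctrl j) \<bullet> b)\<bar> \<le> (\<Sum>j<m. \<bar>feedback j a * (to_cls (ctrl j) \<bullet> b)\<bar>)"
      by (rule sum_abs)
    also have "\<dots> \<le> (\<Sum>j<m. k j * norm (to_cls (ctrl j)) * (norm a * norm b))"
    proof (rule sum_mono)
      fix j
      have "\<bar>feedback j a\<bar> * \<bar>to_cls (ctrl j) \<bullet> b\<bar> \<le> (norm a * k j) * (norm (to_cls (ctrl j)) * norm b)"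
        using k(1)[of j] k(2)[of j a] Cauchy_Schwarz_ineq2[of "to_cls (ctrl j)" b] by (intro mult_mono) simp_all
      then show "\<bar>feedback j a * (to_cls (ctrl j) \<bullet> b)\<bar> \<le> k j * norm (to_cls (ctrl j)) * (norm a * norm b)"
        by (simp add: abs_mult mult_ac)
    qed
    finally show ?thesis by (simp add: K_def sum_distrib_right mult.assoc)
  qed
  moreover have "0 \<le> K" unfolding K_def by (intro sum_nonneg mult_nonneg_nonneg k) simp
  ultimately show thesis using that by blast
qed

lemma norm_fst_le_norm: "norm (fst u) \<le> norm u" for u :: "'d l2 \<times> ('d l2 ^ 'd)"
  by (metis norm_fst_le prod.collapse)

lemma A_bound: obtains B where "0 \<le> B" "\<And>u v. \<bar>A u v\<bar> \<le> B * norm u * norm v"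
proof -
  obtain B where B: "0 \<le> B" "\<And>u v. \<bar>\<Sum>i\<in>UNIV. flux_part i u \<bullet> grad_part i v\<bar> \<le> B * norm u * norm v"
    using bounded_linear_form_bound[of flux_part grad_part, OF bounded_linear_flux_part bounded_linear_grad_part]
      by blast
  obtain K where K: "0 \<le> K" "\<And>a b. \<bar>\<Sum>j<m. feedback j a * (to_cls (ctrl j) \<bullet> b)\<bar> \<le> K * norm a * norm b"
    using feedback_form_bound by blast
  have "\<bar>A u v\<bar> \<le> (B + K) * norm u * norm v" for u v
  proof -
    have "K * norm (fst u) * norm (fst v) \<le> K * norm u * norm v"
      using K(1) by (intro mult_mono norm_fst_le_norm mult_left_mono) simp_all
    then have "\<bar>A u v\<bar> \<le> B * norm u * norm v + K * norm u * norm v"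
      unfolding A_def using B(2)[of u v] K(2)[of "fst u" "fst v"] by linarith
    then show ?thesis by (simp add: distrib_right)
  qed
  moreover have "0 \<le> B + K" using B(1) K(1) by simp
  ultimately show thesis using that by blast
qed

text \<open>The feedback is a finite sum of bounded terms of order zero, so it only enlarges
  \<kappa>.\<close>

lemma A_garding:
  obtains \<kappa> where "0 \<le> \<kappa>" "\<And>u. A u u \<le> - (\<sigma> / 2) * (norm u)\<^sup>2 + \<kappa> * (norm (fst u))\<^sup>2"
proof -
  obtain \<kappa> where \<kappa>: "0 \<le> \<kappa>"
    "\<And>u. - (\<Sum>i\<in>UNIV. flux_part i u \<bullet> grad_part i u) \<le> - (\<sigma> / 2) * (norm u)\<^sup>2 + \<kappa> * (norm (fst u))\<^sup>2"
    using flux_form_garding by blast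
  obtain K where K: "0 \<le> K" "\<And>a b. \<bar>\<Sum>j<m. feedback j a * (to_cls (ctrl j) \<bullet> b)\<bar> \<le> K * norm a * norm b"
    using feedback_form_bound by blast
  have "A u u \<le> - (\<sigma> / 2) * (norm u)\<^sup>2 + (\<kappa> + K) * (norm (fst u))\<^sup>2" for u
  proof -
    have "K * norm (fst u) * norm (fst u) = K * (norm (fst u))\<^sup>2" by (simp add: power2_eq_square)
    then show ?thesis
      unfolding A_def distrib_right using \<kappa>(2)[of u] K(2)[of "fst u" "fst u"] by linarith
  qed
  moreover have "0 \<le> \<kappa> + K" using \<kappa>(1) K(1) by simp
  ultimately show thesis using that by blast
qed

lemma rhs_split:
  "rhs \<sigma> V W \<rho> m \<alpha> u y \<phi> =
    (- (\<integral>x. (diffusion_drift_flux \<sigma> V y x + interaction_flux W \<rho> y x) \<bullet> weak_grad \<phi> x \<partial>torus)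
     + (\<integral>x. op_B \<rho> m \<alpha> u x * \<phi> x \<partial>torus))
    - (\<Sum>j<m. u j * (\<integral>x. (y x *\<^sub>R weak_grad (\<alpha> j) x) \<bullet> weak_grad \<phi> x \<partial>torus))
    - (\<integral>x. (y x *\<^sub>R grad_conv W y x) \<bullet> weak_grad \<phi> x \<partial>torus)"
  by (simp add: rhs_def)

text \<open>The amplitude contributes one factor of the L2 norm of the state. Since the gradient of
  \<alpha> is bounded, the transport term contributes the second one without derivatives of the
  state; the derivative falls on \<phi>.\<close>

lemma nonlinear_control_bound:
  obtains N where "0 \<le> N" "\<And>y \<phi>. y \<in> X0 \<rho> \<Longrightarrow> \<phi> \<in> H1 \<Longrightarrow>
    \<bar>\<Sum>j<m. (- op_B_adj \<rho> m \<alpha> (Ric y) j) * (\<integral>x. (y x *\<^sub>R weak_grad (\<alpha> j) x) \<bullet> weak_grad \<phi> x \<partial>torus)\<bar>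
      \<le> N * (norm (to_cls y))\<^sup>2 * norm (graph (\<lambda>x. sr x * \<phi> x))"
proof -
  have "\<forall>j. \<exists>K. 0 \<le> K \<and> (\<forall>a. norm (feedback j a) \<le> norm a * K)"
    using bounded_linear.nonneg_bounded[OF bounded_linear_feedback] by blast
  from choice[OF this] obtain k where k: "\<And>j. 0 \<le> k j" "\<And>j a. norm (feedback j a) \<le> norm a * k j" by blast
  define P where "P j i a = mul (\<lambda>x. weak_grad (\<alpha> j) x $ i) (mul sr a)" for j i a
  have P: "bounded_linear (P j i)" if "j < m" for j i
    unfolding P_def[abs_def]
    by (intro bounded_linear_compose[OF bounded_linear_mul[OF multiplier_\<alpha>[OF that]]] bounded_linear_mul multiplier_sr(1))
  \<comment> \<open>The bound is guarded by \<open>j < m\<close> so that one choice function covers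
    all indices; the gradients of \<alpha> are controlled only for these.\<close>
  have "\<forall>j. \<exists>B. 0 \<le> B \<and> (j < m \<longrightarrow> (\<forall>u v. \<bar>\<Sum>i\<in>UNIV. P j i u \<bullet> grad_part i v\<bar> \<le> B * norm u * norm v))"
  proof
    fix j
    show "\<exists>B. 0 \<le> B \<and> (j < m \<longrightarrow> (\<forall>u v. \<bar>\<Sum>i\<in>UNIV. P j i u \<bullet> grad_part i v\<bar> \<le> B * norm u * norm v))"
    proof (cases "j < m")
      case True
      obtain B where "0 \<le> B" "\<And>u v. \<bar>\<Sum>i\<in>UNIV. P j i u \<bullet> grad_part i v\<bar> \<le> B * norm u * norm v"
        using bounded_linear_form_bound[of "P j" grad_part, OF P[OF True] bounded_linear_grad_part] by blast
      then show ?thesis by blast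
    qed auto
  qed
  from choice[OF this] obtain B where B: "\<And>j. 0 \<le> B j"
    "\<And>j u v. j < m \<Longrightarrow> \<bar>\<Sum>i\<in>UNIV. P j i u \<bullet> grad_part i v\<bar> \<le> B j * norm u * norm v" by blast
  define N where "N = (\<Sum>j<m. k j * B j)"
  have "\<bar>\<Sum>j<m. (- op_B_adj \<rho> m \<alpha> (Ric y) j) * (\<integral>x. (y x *\<^sub>R weak_grad (\<alpha> j) x) \<bullet> weak_grad \<phi> x \<partial>torus)\<bar>
      \<le> N * (norm (to_cls y))\<^sup>2 * norm (graph (\<lambda>x. sr x * \<phi> x))" if y: "y \<in> X0 \<rho>" and \<phi>: "\<phi> \<in> H1" for y \<phi>
  proof -
    let ?a = "to_cls y" and ?v = "graph (\<lambda>x. sr x * \<phi> x)"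
    have yL: "y \<in> L2" using X0_L2[OF y] .
    have ya: "cls y = mul sr ?a"
      unfolding to_cls_def mul_cls[OF multiplier_sr(1) ir_L2_iff[THEN iffD2, OF yL]] by simp
    have "\<bar>\<Sum>j<m. (- op_B_adj \<rho> m \<alpha> (Ric y) j) * (\<integral>x. (y x *\<^sub>R weak_grad (\<alpha> j) x) \<bullet> weak_grad \<phi> x \<partial>torus)\<bar>
      \<le> (\<Sum>j<m. \<bar>(- op_B_adj \<rho> m \<alpha> (Ric y) j) * (\<integral>x. (y x *\<^sub>R weak_grad (\<alpha> j) x) \<bullet> weak_grad \<phi> x \<partial>torus)\<bar>)"
      by (rule sum_abs)
    also have "\<dots> \<le> (\<Sum>j<m. k j * B j * ((norm ?a)\<^sup>2 * norm ?v))"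
    proof (rule sum_mono)
      fix j assume "j \<in> {..<m}"
      then have j: "j < m" by simp
      have L: "(\<lambda>x. (y x *\<^sub>R weak_grad (\<alpha> j) x) $ i) \<in> L2" for i
        using multiplier_L2[OF multiplier_\<alpha>[OF j] yL] by (simp add: mult.commute)
      have "cls (\<lambda>x. (y x *\<^sub>R weak_grad (\<alpha> j) x) $ i) = P j i ?a" for i
        unfolding P_def ya[symmetric] mul_cls[OF multiplier_\<alpha>[OF j] yL] by (simp add: mult.commute)
      then have I: "(\<integral>x. (y x *\<^sub>R weak_grad (\<alpha> j) x) \<bullet> weak_grad \<phi> x \<partial>torus) = (\<Sum>i\<in>UNIV. P j i ?a \<bullet> grad_part i ?v)"
        using integral_inner_vec[OF L H1_D(3)[OF \<phi>]] grad_part_graph[OF \<phi>] by simp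
      have "\<bar>op_B_adj \<rho> m \<alpha> (Ric y) j\<bar> * \<bar>\<Sum>i\<in>UNIV. P j i ?a \<bullet> grad_part i ?v\<bar> \<le> (norm ?a * k j) * (B j * norm ?a * norm ?v)"
        unfolding feedback_to_cls[OF j y]
        using k(1)[of j] k(2)[of j ?a] B(2)[OF j, of ?a ?v] by (intro mult_mono) simp_all
      then show "\<bar>(- op_B_adj \<rho> m \<alpha> (Ric y) j) * (\<integral>x. (y x *\<^sub>R weak_grad (\<alpha> j) x) \<bullet> weak_grad \<phi> x \<partial>torus)\<bar>
          \<le> k j * B j * ((norm ?a)\<^sup>2 * norm ?v)"
        unfolding I by (simp add: abs_mult power2_eq_square mult_ac)
    qed
    finally show ?thesis by (simp add: N_def sum_distrib_right mult.assoc)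
  qed
  moreover have "0 \<le> N" unfolding N_def by (intro sum_nonneg mult_nonneg_nonneg k B)
  ultimately show thesis using that by blast
qed

text \<open>The interaction field of \<open>y\<close> is bounded by the L2 norm of \<open>y\<close>
  and multiplies \<open>y\<close> itself, which gives the square.\<close>

lemma nonlinear_interaction_bound:
  obtains N where "0 \<le> N" "\<And>y \<phi>. y \<in> X0 \<rho> \<Longrightarrow> \<phi> \<in> H1 \<Longrightarrow>
    \<bar>\<integral>x. (y x *\<^sub>R grad_conv W y x) \<bullet> weak_grad \<phi> x \<partial>torus\<bar> \<le> N * (norm (to_cls y))\<^sup>2 * norm (graph (\<lambda>x. sr x * \<phi> x))"
proof -
  have "\<forall>i. \<exists>K. 0 \<le> K \<and> (\<forall>f x. f \<in> L2 \<longrightarrow> \<bar>conv (\<lambda>z. grad W z $ i) f x\<bar> \<le> K * norm (cls f))"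
  proof
    fix i
    obtain K where "0 \<le> K" "\<And>f x. f \<in> L2 \<Longrightarrow> \<bar>conv (\<lambda>z. grad W z $ i) f x\<bar> \<le> K * norm (cls f)"
      using conv_bound_norm[OF dW(2) periodic_dW] by blast
    then show "\<exists>K. 0 \<le> K \<and> (\<forall>f x. f \<in> L2 \<longrightarrow> \<bar>conv (\<lambda>z. grad W z $ i) f x\<bar> \<le> K * norm (cls f))" by blast
  qed
  from choice[OF this] obtain K where K: "\<And>i. 0 \<le> K i"
    "\<And>i f x. f \<in> L2 \<Longrightarrow> \<bar>conv (\<lambda>z. grad W z $ i) f x\<bar> \<le> K i * norm (cls f)" by blast
  obtain L where L: "0 \<le> L" "\<And>i x. norm (grad_part i x) \<le> L * norm x"
    using bounded_linear_family_bound[of grad_part, OF bounded_linear_grad_part] by blast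
  obtain S where S: "0 \<le> S" "\<And>x. norm (mul sr x) \<le> S * norm x"
    using bounded_linear.nonneg_bounded[OF bounded_linear_mul[OF multiplier_sr(1)]] by (metis mult.commute)
  define N where "N = (\<Sum>i\<in>UNIV. K i * S\<^sup>2 * L)"
  have "\<bar>\<integral>x. (y x *\<^sub>R grad_conv W y x) \<bullet> weak_grad \<phi> x \<partial>torus\<bar> \<le> N * (norm (to_cls y))\<^sup>2 * norm (graph (\<lambda>x. sr x * \<phi> x))"
    if y: "y \<in> X0 \<rho>" and \<phi>: "\<phi> \<in> H1" for y \<phi>
  proof -
    let ?a = "to_cls y" and ?v = "graph (\<lambda>x. sr x * \<phi> x)"
    have yL: "y \<in> L2" using X0_L2[OF y] .
    have "cls y = mul sr ?a"
      unfolding to_cls_def mul_cls[OF multiplier_sr(1) ir_L2_iff[THEN iffD2, OF yL]] by simp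
    then have ny: "norm (cls y) \<le> S * norm ?a" using S(2) by simp
    define c where "c i = conv (\<lambda>z. grad W z $ i) y" for i
    have c: "multiplier (c i)" for i
      unfolding c_def by (rule multiplier_C1(1)[OF C1_conv[OF dW(2) periodic_dW L2_imp_L1[OF yL]] periodic_conv[OF dW(2) periodic_dW L2_imp_L1[OF yL]]])
    have comp: "(y x *\<^sub>R grad_conv W y x) $ i = c i x * y x" for x i
      by (simp add: c_def grad_conv_component[OF dW(1) W(2) L2_imp_L1[OF yL]])
    have Li: "(\<lambda>x. (y x *\<^sub>R grad_conv W y x) $ i) \<in> L2" for i
      unfolding comp by (rule multiplier_L2[OF c yL])
    have "(\<integral>x. (y x *\<^sub>R grad_conv W y x) \<bullet> weak_grad \<phi> x \<partial>torus) = (\<Sum>i\<in>UNIV. mul (c i) (cls y) \<bullet> grad_part i ?v)"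
      using integral_inner_vec[OF Li H1_D(3)[OF \<phi>]] grad_part_graph[OF \<phi>] by (simp only: comp mul_cls[OF c yL])
    also have "\<bar>\<dots>\<bar> \<le> (\<Sum>i\<in>UNIV. \<bar>mul (c i) (cls y) \<bullet> grad_part i ?v\<bar>)" by (rule sum_abs)
    also have "\<dots> \<le> (\<Sum>i\<in>UNIV. K i * S\<^sup>2 * L * ((norm ?a)\<^sup>2 * norm ?v))"
    proof (rule sum_mono)
      fix i
      have kn: "0 \<le> K i * norm (cls y)" using K(1) by simp
      have "norm (mul (c i) (cls y)) \<le> \<bar>K i * norm (cls y)\<bar> * norm (cls y)"
        by (rule norm_mul_le[OF c]) (use K(2)[OF yL] in \<open>simp add: c_def\<close>)
      also have "\<dots> = K i * (norm (cls y))\<^sup>2" using kn by (simp add: power2_eq_square)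
      also have "\<dots> \<le> K i * (S * norm ?a)\<^sup>2" using ny K(1)[of i] by (intro mult_left_mono power_mono) simp_all
      finally have m: "norm (mul (c i) (cls y)) \<le> K i * (S * norm ?a)\<^sup>2" .
      have "\<bar>mul (c i) (cls y) \<bullet> grad_part i ?v\<bar> \<le> norm (mul (c i) (cls y)) * norm (grad_part i ?v)"
        by (rule Cauchy_Schwarz_ineq2)
      also have "\<dots> \<le> (K i * (S * norm ?a)\<^sup>2) * (L * norm ?v)"
        using K(1)[of i] by (intro mult_mono m L) simp_all
      finally show "\<bar>mul (c i) (cls y) \<bullet> grad_part i ?v\<bar> \<le> K i * S\<^sup>2 * L * ((norm ?a)\<^sup>2 * norm ?v)"
        by (simp add: power_mult_distrib mult_ac)
    qed
    finally show ?thesis by (simp add: N_def sum_distrib_right mult.assoc)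
  qed
  moreover have "0 \<le> N" unfolding N_def using K(1) L(1) by (intro sum_nonneg) simp
  ultimately show thesis using that by blast
qed

lemma nonlinear_bound:
  obtains N where "0 \<le> N" "\<And>y \<phi>. y \<in> X0 \<rho> \<Longrightarrow> y \<in> H1 \<Longrightarrow> \<phi> \<in> H1 \<Longrightarrow>
    \<bar>rhs \<sigma> V W \<rho> m \<alpha> (\<lambda>j. - op_B_adj \<rho> m \<alpha> (Ric y) j) y \<phi> - A (graph (\<lambda>x. ir x * y x)) (graph (\<lambda>x. sr x * \<phi> x))\<bar>
      \<le> N * (norm (to_cls y))\<^sup>2 * norm (graph (\<lambda>x. sr x * \<phi> x))"
proof -
  obtain N1 where N1: "0 \<le> N1" "\<And>y \<phi>. y \<in> X0 \<rho> \<Longrightarrow> \<phi> \<in> H1 \<Longrightarrow>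
    \<bar>\<Sum>j<m. (- op_B_adj \<rho> m \<alpha> (Ric y) j) * (\<integral>x. (y x *\<^sub>R weak_grad (\<alpha> j) x) \<bullet> weak_grad \<phi> x \<partial>torus)\<bar>
      \<le> N1 * (norm (to_cls y))\<^sup>2 * norm (graph (\<lambda>x. sr x * \<phi> x))" using nonlinear_control_bound by blast
  obtain N2 where N2: "0 \<le> N2" "\<And>y \<phi>. y \<in> X0 \<rho> \<Longrightarrow> \<phi> \<in> H1 \<Longrightarrow>
    \<bar>\<integral>x. (y x *\<^sub>R grad_conv W y x) \<bullet> weak_grad \<phi> x \<partial>torus\<bar> \<le> N2 * (norm (to_cls y))\<^sup>2 * norm (graph (\<lambda>x. sr x * \<phi> x))"
    using nonlinear_interaction_bound by blast
  have "\<bar>rhs \<sigma> V W \<rho> m \<alpha> (\<lambda>j. - op_B_adj \<rho> m \<alpha> (Ric y) j) y \<phi> - A (graph (\<lambda>x. ir x * y x)) (graph (\<lambda>x. sr x * \<phi> x))\<bar>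
      \<le> (N1 + N2) * (norm (to_cls y))\<^sup>2 * norm (graph (\<lambda>x. sr x * \<phi> x))"
    if y: "y \<in> X0 \<rho>" "y \<in> H1" and \<phi>: "\<phi> \<in> H1" for y \<phi>
    unfolding rhs_split A_graph[OF y(2,1) \<phi>] distrib_right
    using N1(2)[OF y(1) \<phi>] N2(2)[OF y(1) \<phi>] by linarith
  moreover have "0 \<le> N1 + N2" using N1(1) N2(1) by simp
  ultimately show thesis using that by blast
qed

end

section \<open>The linear closed-loop equation\<close>

lemma H1_cong_AE:
  assumes f: "f \<in> H1" and eq: "AE x in torus. f x = g x" and g: "g \<in> L2"
  shows "g \<in> H1" "graph g = graph f"
proof -
  note F = H1_D[OF f]
  have w: "has_weak_partial i g (\<lambda>x. weak_grad f x $ i)" for i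
    by (rule has_weak_partial_cong[OF F(2) eq _ L2_imp_L1[OF g] L2_imp_L1[OF F(3)]]) simp
  note G = graph_eqI[OF g F(3) w]
  show "g \<in> H1" by (rule G(1))
  have "cls g = cls f" unfolding cls_eq_iff[OF g F(1)] using eq by eventually_elim simp
  then show "graph g = graph f" unfolding G(2) by (simp add: graph_def grad_cls_def)
qed

lemma H1_mult_C1': "f \<in> H1 \<Longrightarrow> C1 g \<Longrightarrow> periodic g \<Longrightarrow> (\<lambda>x. f x * g x) \<in> H1"
  using H1_mult_C1(1)[of f g] by (simp add: mult.commute)

lemma weak_div_H1_components:
  assumes F: "\<And>i. (\<lambda>x. F x $ i) \<in> H1"
  shows "weak_div F \<in> L2" "has_weak_div F (weak_div F)"
proof -
  define g where "g i x = weak_grad (\<lambda>x. F x $ i) x $ i" for i x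
  have d: "has_weak_div F (\<lambda>x. \<Sum>i\<in>UNIV. g i x)"
    unfolding g_def by (rule has_weak_div_partials) (rule H1_D(2)[OF F])
  show w: "has_weak_div F (weak_div F)" unfolding weak_div_def by (rule someI[of "has_weak_div F", OF d])
  have gL: "(\<lambda>x. \<Sum>i\<in>UNIV. g i x) \<in> L2" unfolding g_def by (intro L2_sum H1_D(3)[OF F])
  have "AE x in torus. (\<Sum>i\<in>UNIV. g i x) = weak_div F x"
    using weak_div_AE_eq[OF d] by eventually_elim simp
  then show "weak_div F \<in> L2"
    using L2_cong_AE[OF gL] has_weak_divD(2)[OF w] by (simp add: L1_def)
qed

lemma H2_imp_H1:
  assumes "f \<in> H2"
  shows "f \<in> H1" "(\<lambda>x. weak_grad f x $ i) \<in> H1"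
proof -
  have "\<forall>i. \<exists>g. g \<in> H1 \<and> has_weak_partial i f g" using assms unfolding W2_def by blast
  from choice[OF this] obtain g where g: "\<And>i. g i \<in> H1" "\<And>i. has_weak_partial i f (g i)" by blast
  have fL: "f \<in> L2" using assms unfolding W2_def by blast
  show f: "f \<in> H1" by (rule H1_I[OF fL H1_D(1)[OF g(1)] g(2)])
  have "AE x in torus. g i x = weak_grad f x $ i"
    using weak_grad_AE_eq[OF g(2)] by eventually_elim simp
  then show "(\<lambda>x. weak_grad f x $ i) \<in> H1" by (rule H1_cong_AE(1)[OF g(1) _ H1_D(3)[OF f]])
qed

context mckean_vlasov
begin

text \<open>\<open>weak_div\<close> is meaningful only where a divergence exists. For functions in
  H2 the components of both fluxes are in H1, because their coefficients are C1, so the divergences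
  exist in L2 and can be integrated by parts against H1.\<close>

lemma op_L_weak:
  assumes f: "f \<in> H2" and \<phi>: "\<phi> \<in> H1"
  shows "op_L \<sigma> V W \<rho> f \<in> L2"
    "(\<integral>x. op_L \<sigma> V W \<rho> f x * \<phi> x \<partial>torus) =
      - (\<integral>x. (diffusion_drift_flux \<sigma> V f x + interaction_flux W \<rho> f x) \<bullet> weak_grad \<phi> x \<partial>torus)"
proof -
  note f1 = H2_imp_H1(1)[OF f]
  have D: "(\<lambda>x. diffusion_drift_flux \<sigma> V f x $ i) \<in> H1" for i
  proof -
    have "(\<lambda>x. \<sigma> * weak_grad f x $ i + f x * grad V x $ i) \<in> H1"
      by (intro graph_add(1) graph_scale(1) H2_imp_H1(2)[OF f] H1_mult_C1'[OF f1 dV(2) periodic_dV])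
    then show ?thesis by (simp add: diffusion_drift_flux_def)
  qed
  have I: "(\<lambda>x. interaction_flux W \<rho> f x $ i) \<in> H1" for i
  proof -
    note c = C1_conv[OF dW(2) periodic_dW L2_imp_L1[OF H1_D(1)[OF f1]], of i]
      periodic_conv[OF dW(2) periodic_dW L2_imp_L1[OF H1_D(1)[OF f1]], of i]
    have "(\<lambda>x. f x * conv (\<lambda>z. grad W z $ i) \<rho> x + \<rho> x * conv (\<lambda>z. grad W z $ i) f x) \<in> H1"
      by (intro graph_add(1) H1_mult_C1'[OF f1 C1_drift] H1_mult_C1'[OF C1_H1[OF \<rho>_C1 \<rho>_periodic] c])
    then show ?thesis
      by (simp add: interaction_flux_def grad_conv_component[OF dW(1) W(2) \<rho>_L1]
          grad_conv_component[OF dW(1) W(2) L2_imp_L1[OF H1_D(1)[OF f1]]])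
  qed
  note wD = weak_div_H1_components[OF D] and wI = weak_div_H1_components[OF I]
  show "op_L \<sigma> V W \<rho> f \<in> L2"
    unfolding op_L_def[abs_def] by (rule L2_add[OF wD(1) wI(1)])
  note \<phi>L = H1_D(1)[OF \<phi>]
  have "(\<integral>x. op_L \<sigma> V W \<rho> f x * \<phi> x \<partial>torus) =
      (\<integral>x. weak_div (diffusion_drift_flux \<sigma> V f) x * \<phi> x + weak_div (interaction_flux W \<rho> f) x * \<phi> x \<partial>torus)"
    by (simp add: op_L_def distrib_right)
  also have "\<dots> = (\<integral>x. weak_div (diffusion_drift_flux \<sigma> V f) x * \<phi> x \<partial>torus) + (\<integral>x. weak_div (interaction_flux W \<rho> f) x * \<phi> x \<partial>torus)"
    by (rule Bochner_Integration.integral_add[OF L2_integrable_mult[OF wD(1) \<phi>L] L2_integrable_mult[OF wI(1) \<phi>L]])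
  also have "\<dots> = - (\<integral>x. diffusion_drift_flux \<sigma> V f x \<bullet> weak_grad \<phi> x \<partial>torus) - (\<integral>x. interaction_flux W \<rho> f x \<bullet> weak_grad \<phi> x \<partial>torus)"
    using H1_integration_by_parts[OF H1_D(1)[OF D] wD \<phi>] H1_integration_by_parts[OF H1_D(1)[OF I] wI \<phi>] by simp
  also have "\<dots> = - (\<integral>x. (diffusion_drift_flux \<sigma> V f x + interaction_flux W \<rho> f x) \<bullet> weak_grad \<phi> x \<partial>torus)"
  proof -
    have int: "integrable torus (\<lambda>x. F x \<bullet> weak_grad \<phi> x)" if "\<And>i. (\<lambda>x. F x $ i) \<in> H1" for F :: "real ^ 'd \<Rightarrow> real ^ 'd"
      unfolding inner_vec_def inner_real_def
      by (intro Bochner_Integration.integrable_sum L2_integrable_mult H1_D(1)[OF that] H1_D(3)[OF \<phi>])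
    show ?thesis unfolding inner_add_left using int[OF D] int[OF I] by simp
  qed
  finally show "(\<integral>x. op_L \<sigma> V W \<rho> f x * \<phi> x \<partial>torus) =
      - (\<integral>x. (diffusion_drift_flux \<sigma> V f x + interaction_flux W \<rho> f x) \<bullet> weak_grad \<phi> x \<partial>torus)" .
qed

end

text \<open>Averaging an orbit of a semigroup over \<open>[t, t + h]\<close> yields an orbit in the domain of the generator.\<close>

lemma semigroup_average:
  fixes T :: "real \<Rightarrow> 'a :: {real_inner, banach} \<Rightarrow> 'a"
  assumes T: "\<And>t. t \<ge> 0 \<Longrightarrow> bounded_linear (T t)"
    and add: "\<And>s t. s \<ge> 0 \<Longrightarrow> t \<ge> 0 \<Longrightarrow> T (s + t) x = T s (T t x)"
    and zero: "T 0 x = x" and K: "0 \<le> K" "\<And>t y. t \<ge> 0 \<Longrightarrow> norm (T t (T 0 y)) \<le> K * norm (T 0 y)"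
    and lin0: "\<And>t. t \<ge> 0 \<Longrightarrow> T 0 (T t x) = T t x"
    and lim: "((\<lambda>h. T h x) \<longlongrightarrow> x) (at_right 0)" and h: "h > 0"
  defines "p \<equiv> \<lambda>t. (1 / h) *\<^sub>R integral {t..t+h} (\<lambda>s. T s x)"
  shows "continuous_on {0..} (\<lambda>t. T t x)"
    and "\<And>t. t \<ge> 0 \<Longrightarrow> (p has_vector_derivative (1 / h) *\<^sub>R (T (t + h) x - T t x)) (at t within {0..})"
    and "\<And>s t. s \<ge> 0 \<Longrightarrow> t \<ge> 0 \<Longrightarrow> T s (p t) = p (s + t)"
proof -
  have diff: "norm (T t x - T s x) \<le> K * norm (T (t - s) x - x)" if "0 \<le> s" "s \<le> t" for s t
  proof -
    interpret Ts: bounded_linear "T s" by (rule T[OF that(1)])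
    interpret T0: bounded_linear "T 0" by (rule T) simp
    \<comment> \<open>In the application \<open>T 0\<close> is a projection and not the identity on
      all of L2, so the bound \<open>K\<close> is available only on its range; this difference lies
      there.\<close>
    have z: "T 0 (T (t - s) x - x) = T (t - s) x - x"
      using lin0[of "t - s"] zero that by (simp add: T0.diff)
    have "T t x - T s x = T s (T (t - s) x - x)"
      using add[of s "t - s"] that by (simp add: Ts.diff)
    then show ?thesis using K(2)[OF that(1), of "T (t - s) x - x"] z by simp
  qed
  show cont: "continuous_on {0..} (\<lambda>t. T t x)"
    unfolding continuous_on_iff
  proof (intro ballI allI impI)
    fix t e :: real assume t: "t \<in> {0..}" and e: "e > 0"
    have "((\<lambda>h. norm (T h x - x)) \<longlongrightarrow> 0) (at_right 0)" using lim by (simp add: tendsto_norm_zero LIM_zero)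
    then have "\<forall>\<^sub>F h in at_right 0. norm (T h x - x) < e / (K + 1)"
      using e K(1) by (intro order_tendstoD(2)) auto
    then obtain d where d: "d > 0" "\<And>h. 0 < h \<Longrightarrow> h < d \<Longrightarrow> norm (T h x - x) < e / (K + 1)"
      unfolding eventually_at_right_field by auto
    have key: "norm (T b x - T a x) < e" if ab: "0 \<le> a" "a \<le> b" "b - a < d" for a b
    proof (cases "a = b")
      case False
      then have "norm (T (b - a) x - x) \<le> e / (K + 1)" using d(2)[of "b - a"] ab by simp
      then have "norm (T b x - T a x) \<le> K * (e / (K + 1))"
        using order_trans[OF diff[OF ab(1,2)] mult_left_mono[OF _ K(1)]] by blast
      also have "\<dots> < e" using e K(1) by (simp add: field_simps)
      finally show ?thesis .
    qed (use e in simp)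
    show "\<exists>d>0. \<forall>s\<in>{0..}. dist s t < d \<longrightarrow> dist (T s x) (T t x) < e"
    proof (intro exI[of _ d] conjI ballI impI d(1))
      fix s assume s: "s \<in> {0..}" "dist s t < d"
      show "dist (T s x) (T t x) < e"
      proof (cases "s \<le> t")
        case True
        then show ?thesis using key[of s t] s by (simp add: dist_norm norm_minus_commute)
      next
        case False
        then show ?thesis using key[of t s] s t by (simp add: dist_norm)
      qed
    qed
  qed
  have int: "(\<lambda>s. T s x) integrable_on {a..b}" if "0 \<le> a" for a b
    by (intro integrable_continuous_interval continuous_on_subset[OF cont]) (use that in auto)
  define I where "I t = integral {0..t} (\<lambda>s. T s x)" for t
  have pI: "p t = (1 / h) *\<^sub>R (I (t + h) - I t)" if "t \<ge> 0" for t
  proof -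
    have "integral {0..t} (\<lambda>s. T s x) + integral {t..t+h} (\<lambda>s. T s x) = integral {0..t+h} (\<lambda>s. T s x)"
      using that h by (intro Henstock_Kurzweil_Integration.integral_combine int) auto
    then have "integral {t..t+h} (\<lambda>s. T s x) = I (t + h) - I t" unfolding I_def by (simp add: algebra_simps)
    then show ?thesis by (simp add: p_def)
  qed
  have Id: "(I has_vector_derivative T t x) (at t within {0..})" if t: "t \<ge> 0" for t
  proof -
    have "(I has_vector_derivative T t x) (at t within {0..t+1})"
      unfolding I_def using t by (intro integral_has_vector_derivative continuous_on_subset[OF cont]) auto
    moreover have "at t within {0..t+1} = at t within {0..}"
      using t by (intro at_within_nhd[of _ "{..<t+1}"]) auto
    ultimately show ?thesis by simp
  qed
  show "(p has_vector_derivative (1 / h) *\<^sub>R (T (t + h) x - T t x)) (at t within {0..})" if t: "t \<ge> 0" for t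
  proof -
    have "((\<lambda>t. t + h) has_vector_derivative 1) (at t within {0..})"
      by (auto intro!: derivative_eq_intros simp: has_vector_derivative_def)
    moreover have "(I has_vector_derivative T (t + h) x) (at (t + h) within (\<lambda>t. t + h) ` {0..})"
      using t h by (intro has_vector_derivative_within_subset[OF Id]) auto
    ultimately have "((\<lambda>t. I (t + h)) has_vector_derivative T (t + h) x) (at t within {0..})"
      using vector_diff_chain_within[of "\<lambda>t. t + h" 1 t "{0..}" I "T (t+h) x"] by (simp add: o_def)
    then have "((\<lambda>t. (1 / h) *\<^sub>R (I (t + h) - I t)) has_vector_derivative (1 / h) *\<^sub>R (T (t + h) x - T t x)) (at t within {0..})"
      using bounded_linear.has_vector_derivative[OF bounded_linear_scaleR_right has_vector_derivative_diff[OF _ Id[OF t]]] by blast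
    then show ?thesis using t by (intro has_vector_derivative_transform[of t "{0..}" p]) (auto simp: pI)
  qed
  show "T s (p t) = p (s + t)" if st: "s \<ge> 0" "t \<ge> 0" for s t
  proof -
    interpret Ts: bounded_linear "T s" by (rule T[OF st(1)])
    have "T s (p t) = (1 / h) *\<^sub>R T s (integral {t..t+h} (\<lambda>s. T s x))" by (simp add: p_def Ts.scaleR)
    also have "T s (integral {t..t+h} (\<lambda>s. T s x)) = integral {t..t+h} (\<lambda>r. T s (T r x))"
      using integral_linear[OF int[OF st(2)] Ts.bounded_linear_axioms, of "t+h"] by (simp add: o_def)
    also have "\<dots> = integral {t..t+h} (\<lambda>r. T (s + r) x)"
      using st by (intro Henstock_Kurzweil_Integration.integral_cong) (simp add: add)
    also have "\<dots> = integral {s+t..s+t+h} (\<lambda>r. T r x)"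
      using integral_shift_Icc_real[of t "t + h" "\<lambda>r. T r x" s] by (simp add: o_def add_ac)
    finally show ?thesis by (simp add: p_def add.assoc)
  qed
qed

context closed_loop_system
begin

lemma op_B_minus: "op_B \<rho> m \<alpha> (\<lambda>j. - u j) x = - op_B \<rho> m \<alpha> u x"
  by (simp add: op_B_eq sum_negf)

lemma ir_from_cls: "(\<lambda>x. ir x * from_cls a x) = rep a"
  by (simp add: from_cls_def fun_eq_iff)

text \<open>On the domain of the generator the form is represented by an L2 element:
  \<open>b\<close> is the image of \<open>a\<close> under the shifted closed-loop operator, and
  removing the shift leaves \<open>b - \<delta> *\<^sub>R a\<close>.\<close>

lemma A_generator:
  assumes a: "a \<bullet> cls sr = 0" and dom: "from_cls a \<in> dom_L \<rho>"
    and eq: "AE x in torus. from_cls b x = closed_loop \<sigma> V W \<rho> \<delta> m \<alpha> Ric (from_cls a) x"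
    and u: "u \<in> VV"
  shows "graph (rep a) \<in> VV" "A (graph (rep a)) u = (b - \<delta> *\<^sub>R a) \<bullet> fst u"
proof -
  let ?f = "from_cls a"
  have f2: "?f \<in> H2" and fX: "?f \<in> X0 \<rho>" using dom by (simp_all add: dom_L_def)
  have f1: "?f \<in> H1" by (rule H2_imp_H1(1)[OF f2])
  have "rep a \<in> H1" using H1_mult_C1(1)[OF f1 ir_C1 ir_periodic] by (simp add: ir_from_cls)
  then show "graph (rep a) \<in> VV" unfolding VV_def using a by (intro imageI) (simp add: H1_sharp_iff)
  obtain \<zeta> where z: "\<zeta> \<in> H1_sharp \<rho>" "u = graph \<zeta>" using u by (auto simp: VV_def)
  define \<phi> where "\<phi> x = ir x * \<zeta> x" for x
  have zH: "\<zeta> \<in> H1" using z(1) by (simp add: H1_sharp_iff)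
  have \<phi>: "\<phi> \<in> H1" using H1_mult_C1(1)[OF zH ir_C1 ir_periodic] by (simp add: \<phi>_def[abs_def])
  have sphi: "(\<lambda>x. sr x * \<phi> x) = \<zeta>" by (simp add: \<phi>_def fun_eq_iff)
  note \<phi>L = H1_D(1)[OF \<phi>] and fL = H1_D(1)[OF f1] and opL = op_L_weak[OF f2 \<phi>]
  let ?B = "op_B \<rho> m \<alpha> (op_B_adj \<rho> m \<alpha> (Ric ?f))"
  have BL: "?B \<in> L2" by (rule op_B_L2)
  have "b \<bullet> cls \<zeta> = (\<integral>x. from_cls b x * \<phi> x \<partial>torus)"
    using integral_to_cls[OF from_cls_L2[of b] \<phi>L] by (simp add: sphi)
  also have "\<dots> = (\<integral>x. (op_L \<sigma> V W \<rho> ?f x * \<phi> x + \<delta> * (?f x * \<phi> x)) - ?B x * \<phi> x \<partial>torus)"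
  proof (rule integral_cong_AE)
    show "AE x in torus. from_cls b x * \<phi> x = (op_L \<sigma> V W \<rho> ?f x * \<phi> x + \<delta> * (?f x * \<phi> x)) - ?B x * \<phi> x"
      using eq
    proof eventually_elim
      case (elim x)
      show ?case unfolding elim closed_loop_def by (simp add: algebra_simps)
    qed
    show "(\<lambda>x. from_cls b x * \<phi> x) \<in> borel_measurable torus"
      by (rule borel_measurable_integrable[OF L2_integrable_mult[OF from_cls_L2 \<phi>L]])
    show "(\<lambda>x. (op_L \<sigma> V W \<rho> ?f x * \<phi> x + \<delta> * (?f x * \<phi> x)) - ?B x * \<phi> x) \<in> borel_measurable torus"
      by (intro borel_measurable_integrable Bochner_Integration.integrable_diff Bochner_Integration.integrable_add
          integrable_mult_right L2_integrable_mult opL(1) fL \<phi>L BL)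
  qed
  also have "\<dots> = ((\<integral>x. op_L \<sigma> V W \<rho> ?f x * \<phi> x \<partial>torus) + \<delta> * (\<integral>x. ?f x * \<phi> x \<partial>torus)) - (\<integral>x. ?B x * \<phi> x \<partial>torus)"
    using L2_integrable_mult[OF opL(1) \<phi>L] L2_integrable_mult[OF fL \<phi>L] L2_integrable_mult[OF BL \<phi>L] by simp
  also have "(\<integral>x. ?f x * \<phi> x \<partial>torus) = a \<bullet> cls \<zeta>"
    using integral_to_cls[OF from_cls_L2[of a] \<phi>L] by (simp add: sphi)
  finally have "(b - \<delta> *\<^sub>R a) \<bullet> cls \<zeta> = (\<integral>x. op_L \<sigma> V W \<rho> ?f x * \<phi> x \<partial>torus) - (\<integral>x. ?B x * \<phi> x \<partial>torus)"
    by (simp add: inner_diff_left)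
  also have "\<dots> = A (graph (\<lambda>x. ir x * ?f x)) (graph (\<lambda>x. sr x * \<phi> x))"
    unfolding A_graph[OF f1 fX \<phi>] opL(2) by (simp add: op_B_minus)
  finally show "A (graph (rep a)) u = (b - \<delta> *\<^sub>R a) \<bullet> fst u"
    by (simp add: ir_from_cls sphi z(2) graph_def)
qed

text \<open>Arbitrary data need not lie in the domain of the generator, but short averages of their
  orbits do, at every time, and start within \<open>e\<close> of the datum. Multiplication by
  \<open>exp (- \<delta> * t)\<close> undoes the shift, which raises the decay rate \<omega> of the
  semigroup to \<open>\<delta> + \<omega>\<close>.\<close>

lemma strong_solutions_dense:
  assumes gen: "generates_exp_stable_semigroup \<rho> (dom_L \<rho>) (closed_loop \<sigma> V W \<rho> \<delta> m \<alpha> Ric)"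
  obtains K \<omega> where "0 \<le> K" "0 < \<omega>"
    "\<And>x e. x \<bullet> cls sr = 0 \<Longrightarrow> 0 < e \<Longrightarrow> \<exists>v v' w.
      (\<forall>t\<ge>0. (v has_vector_derivative v' t) (at t within {0..}) \<and> w t \<in> VV \<and> fst (w t) = v t \<and> (\<forall>u\<in>VV. v' t \<bullet> fst u = A (w t) u))
      \<and> norm (v 0 - x) \<le> e \<and> (\<forall>t\<ge>0. norm (v t) \<le> K * exp (- (\<delta> + \<omega>) * t) * (norm x + e))"
proof -
  obtain S where C0: "C0_semigroup \<rho> S"
    and G0: "\<forall>f \<in> X0 \<rho>. \<forall>g \<in> X0 \<rho>. generator_graph \<rho> S f g \<longleftrightarrow>
        f \<in> dom_L \<rho> \<and> (AE x in torus. g x = closed_loop \<sigma> V W \<rho> \<delta> m \<alpha> Ric f x)"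
    and E0: "\<exists>K \<omega>. 0 < \<omega> \<and> (\<forall>t\<ge>0. \<forall>f \<in> X0 \<rho>. X_norm \<rho> (S t f) \<le> K * exp (- \<omega> * t) * X_norm \<rho> f)"
    using gen unfolding generates_exp_stable_semigroup_def
    by - (erule exE, (erule conjE)+, rule that)
  have G: "f \<in> dom_L \<rho> \<and> (AE x in torus. g x = closed_loop \<sigma> V W \<rho> \<delta> m \<alpha> Ric f x)"
    if "f \<in> X0 \<rho>" "g \<in> X0 \<rho>" "generator_graph \<rho> S f g" for f g
    using bspec[OF bspec[OF G0 that(1)] that(2)] that(3) by (rule iffD1)
  obtain K0 \<omega> where \<omega>: "0 < \<omega>" and bd: "\<And>t f. t \<ge> 0 \<Longrightarrow> f \<in> X0 \<rho> \<Longrightarrow> X_norm \<rho> (S t f) \<le> K0 * exp (- \<omega> * t) * X_norm \<rho> f"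
    using E0 by auto
  note C0' = C0[unfolded C0_semigroup_def]
  have S: "bounded_operator \<rho> (S t)" if "t \<ge> 0" for t
    using C0' that by simp
  have S0: "AE x in torus. S 0 f x = f x" if "f \<in> X0 \<rho>" for f
    using conjunct1[OF conjunct2[OF C0']] that by (rule bspec)
  have Sadd: "AE x in torus. S (s + t) f x = S s (S t f) x" if "f \<in> X0 \<rho>" "s \<ge> 0" "t \<ge> 0" for f s t
    using bspec[OF conjunct1[OF conjunct2[OF conjunct2[OF C0']]] that(1)] that(2,3) by simp
  have Slim: "((\<lambda>t. X_norm \<rho> (\<lambda>x. S t f x - f x)) \<longlongrightarrow> 0) (at_right 0)" if "f \<in> X0 \<rho>" for f
    using conjunct2[OF conjunct2[OF conjunct2[OF C0']]] that by (rule bspec)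
  define T where "T t = lift (S t)" for t
  define K where "K = \<bar>K0\<bar>"
  \<comment> \<open>The lifted semigroup starts from the projection, since functions with nonzero
    mean are projected before the operators act.\<close>
  have T0: "T 0 a = proj_sr a" for a
  proof -
    note F = from_cls_X0[OF proj_sr_orth[of a]]
    have "T 0 a = to_cls (from_cls (proj_sr a))"
      unfolding T_def lift_def by (rule to_cls_cong[OF X0_L2[OF T_X0[OF S F]] X0_L2[OF F] S0[OF F]]) simp
    then show ?thesis by simp
  qed
  have T_eq: "T t a = to_cls (S t (from_cls a))" if "a \<bullet> cls sr = 0" for t a
    unfolding T_def lift_def proj_sr_id[OF that] ..
  have T_orth: "T t a \<bullet> cls sr = 0" if "t \<ge> 0" for t a
    unfolding T_def by (rule lift_orth[OF S[OF that]])
  have T_bound: "norm (T t a) \<le> K * exp (- \<omega> * t) * norm a" if t: "t \<ge> 0" and a: "a \<bullet> cls sr = 0" for t a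
  proof -
    note F = from_cls_X0[OF a]
    have "norm (T t a) = X_norm \<rho> (S t (from_cls a))" unfolding T_eq[OF a]
      by (rule norm_to_cls[OF X0_L2[OF T_X0[OF S[OF t] F]]])
    also have "\<dots> \<le> K0 * exp (- \<omega> * t) * X_norm \<rho> (from_cls a)" by (rule bd[OF t F])
    also have "X_norm \<rho> (from_cls a) = norm a" using norm_to_cls[OF from_cls_L2[of a]] by simp
    also have "K0 * exp (- \<omega> * t) * norm a \<le> K * exp (- \<omega> * t) * norm a"
      unfolding K_def by (intro mult_right_mono) simp_all
    finally show ?thesis .
  qed
  have T_add: "T (s + t) a = T s (T t a)" if s: "s \<ge> 0" and t: "t \<ge> 0" and a: "a \<bullet> cls sr = 0" for s t a
  proof -
    note F = from_cls_X0[OF a]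
    have st: "s + t \<ge> 0" using s t by simp
    have "T (s + t) a = to_cls (S s (S t (from_cls a)))"
      unfolding T_eq[OF a]
      by (rule to_cls_cong[OF X0_L2[OF T_X0[OF S[OF st] F]] X0_L2[OF T_X0[OF S[OF s] T_X0[OF S[OF t] F]]] Sadd[OF F s t]])
    also have "\<dots> = lift (S s) (to_cls (S t (from_cls a)))"
      by (rule lift_to_cls[OF S[OF s] T_X0[OF S[OF t] F], symmetric])
    finally show ?thesis unfolding T_eq[OF a] T_def[of s] .
  qed
  have T_lim: "((\<lambda>h. T h a) \<longlongrightarrow> a) (at_right 0)" if a: "a \<bullet> cls sr = 0" for a
  proof -
    note F = from_cls_X0[OF a]
    have "\<forall>\<^sub>F h in at_right 0. X_norm \<rho> (\<lambda>x. S h (from_cls a) x - from_cls a x) = norm (T h a - a)"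
      using eventually_at_right_less[of "0 :: real"]
    proof eventually_elim
      case (elim h)
      note L = X0_L2[OF T_X0[OF S[OF less_imp_le[OF elim]] F]]
      show ?case
        unfolding norm_to_cls[OF L2_diff[OF L from_cls_L2], symmetric] to_cls_diff[OF L from_cls_L2] T_eq[OF a] by simp
    qed
    then have "((\<lambda>h. norm (T h a - a)) \<longlongrightarrow> 0) (at_right 0)" using Slim[OF F] by (simp add: tendsto_cong)
    then show ?thesis by (rule LIM_zero_cancel[OF tendsto_norm_zero_cancel])
  qed
  have K: "K \<ge> 0" by (simp add: K_def)
  have main: "\<exists>v v' w.
      (\<forall>t\<ge>0. (v has_vector_derivative v' t) (at t within {0..}) \<and> w t \<in> VV \<and> fst (w t) = v t \<and> (\<forall>u\<in>VV. v' t \<bullet> fst u = A (w t) u))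
      \<and> norm (v 0 - x) \<le> e \<and> (\<forall>t\<ge>0. norm (v t) \<le> K * exp (- (\<delta> + \<omega>) * t) * (norm x + e))"
    if x: "x \<bullet> cls sr = 0" and e: "0 < e" for x e
  proof -
    have "\<forall>\<^sub>F h in at_right 0. dist (T h x) x < e" by (rule tendstoD[OF T_lim[OF x] e])
    then obtain d where d: "d > 0" "\<And>h. 0 < h \<Longrightarrow> h < d \<Longrightarrow> dist (T h x) x < e"
      unfolding eventually_at_right_field by auto
    define h where "h = d / 2"
    have h: "h > 0" "h < d" using d(1) by (simp_all add: h_def)
    define p where "p t = (1 / h) *\<^sub>R integral {t..t+h} (\<lambda>s. T s x)" for t
    define g where "g t = (1 / h) *\<^sub>R (T (t + h) x - T t x)" for t
    have lin: "bounded_linear (T t)" if "t \<ge> 0" for t unfolding T_def by (rule bounded_linear_lift[OF S[OF that]])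
    have T0x: "T 0 x = x" unfolding T0 by (rule proj_sr_id[OF x])
    have T0T: "T 0 (T t x) = T t x" if "t \<ge> 0" for t unfolding T0 by (rule proj_sr_id[OF T_orth[OF that]])
    have Tb: "norm (T t (T 0 y)) \<le> K * norm (T 0 y)" if t: "t \<ge> 0" for t y
    proof -
      have o: "T 0 y \<bullet> cls sr = 0" by (rule T_orth) simp
      have "K * exp (- \<omega> * t) * norm (T 0 y) \<le> K * 1 * norm (T 0 y)"
        using K t \<omega> by (intro mult_right_mono mult_left_mono) simp_all
      with T_bound[OF t o] show ?thesis by simp
    qed
    note prems = lin T_add[OF _ _ x] T0x K Tb T0T T_lim[OF x] h(1)
    have orbit: "continuous_on {0..} (\<lambda>t. T t x)"
      by (rule semigroup_average(1)[of T x K h]) (use prems in simp_all)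
    have p_deriv: "(p has_vector_derivative g t) (at t within {0..})" if "t \<ge> 0" for t
      unfolding p_def[abs_def] g_def
      by (rule semigroup_average(2)[of T x K h]) (use prems that in simp_all)
    have p_eq: "T s (p t) = p (s + t)" if "s \<ge> 0" "t \<ge> 0" for s t
      unfolding p_def
      by (rule semigroup_average(3)[of T x K h]) (use prems that in simp_all)
    have p_orth: "p t \<bullet> cls sr = 0" if "t \<ge> 0" for t
      using T_orth[of 0 "p t"] p_eq[of 0 t] that by simp
    have g_orth: "g t \<bullet> cls sr = 0" if "t \<ge> 0" for t
      using T_orth[of t x] T_orth[of "t + h" x] that h by (simp add: g_def inner_diff_left)
    \<comment> \<open>The orbit property \<open>T s (p t) = p (s + t)\<close> turns the difference
      quotient of the semigroup at \<open>p t\<close> into that of the path \<open>p\<close>, whose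
      derivative is known; so the pair lies in the graph of the generator.\<close>
    have gen_t: "from_cls (p t) \<in> dom_L \<rho> \<and> (AE x in torus. from_cls (g t) x = closed_loop \<sigma> V W \<rho> \<delta> m \<alpha> Ric (from_cls (p t)) x)"
      if t: "t \<ge> 0" for t
    proof (rule G)
      note Fp = from_cls_X0[OF p_orth[OF t]] and Fg = from_cls_X0[OF g_orth[OF t]]
      show "from_cls (p t) \<in> X0 \<rho>" "from_cls (g t) \<in> X0 \<rho>" by (rule Fp, rule Fg)
      have "(p has_vector_derivative g t) (at_right t)"
        using has_vector_derivative_within_subset[OF p_deriv[OF t], of "{t..}"] t by (simp add: at_within_Ici_at_right)
      then have "((\<lambda>\<tau>. (1 / \<tau>) *\<^sub>R (p (t + \<tau>) - p t)) \<longlongrightarrow> g t) (at_right 0)" by (rule has_vector_derivative_slope_right)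
      then have "((\<lambda>\<tau>. norm ((1 / \<tau>) *\<^sub>R (p (t + \<tau>) - p t) - g t)) \<longlongrightarrow> 0) (at_right 0)"
        by (intro tendsto_norm_zero LIM_zero)
      moreover have "\<forall>\<^sub>F \<tau> in at_right 0. X_norm \<rho> (\<lambda>x. (S \<tau> (from_cls (p t)) x - from_cls (p t) x) / \<tau> - from_cls (g t) x)
          = norm ((1 / \<tau>) *\<^sub>R (p (t + \<tau>) - p t) - g t)"
        using eventually_at_right_less[of "0 :: real"]
      proof eventually_elim
        case (elim \<tau>)
        note L = X0_L2[OF T_X0[OF S[OF less_imp_le[OF elim]] Fp]]
        note L1 = L2_diff[OF L from_cls_L2[of "p t"]]
        note L2 = L2_scale[OF L1, of "1 / \<tau>"]
        have "(\<lambda>x. (S \<tau> (from_cls (p t)) x - from_cls (p t) x) / \<tau> - from_cls (g t) x)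
            = (\<lambda>x. 1 / \<tau> * (S \<tau> (from_cls (p t)) x - from_cls (p t) x) - from_cls (g t) x)" by simp
        then have "X_norm \<rho> (\<lambda>x. (S \<tau> (from_cls (p t)) x - from_cls (p t) x) / \<tau> - from_cls (g t) x)
            = norm (to_cls (\<lambda>x. 1 / \<tau> * (S \<tau> (from_cls (p t)) x - from_cls (p t) x) - from_cls (g t) x))"
          by (simp only: norm_to_cls[OF L2_diff[OF L2 from_cls_L2]])
        also have "\<dots> = norm ((1 / \<tau>) *\<^sub>R (T \<tau> (p t) - p t) - g t)"
          unfolding to_cls_diff[OF L2 from_cls_L2] to_cls_scale[OF L1] to_cls_diff[OF L from_cls_L2] T_eq[OF p_orth[OF t]] by simp
        also have "T \<tau> (p t) = p (t + \<tau>)" using p_eq[of \<tau> t] elim t by (simp add: add.commute)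
        finally show ?case .
      qed
      ultimately have "((\<lambda>\<tau>. X_norm \<rho> (\<lambda>x. (S \<tau> (from_cls (p t)) x - from_cls (p t) x) / \<tau> - from_cls (g t) x)) \<longlongrightarrow> 0) (at_right 0)"
        by (simp only: tendsto_cong)
      then show "generator_graph \<rho> S (from_cls (p t)) (from_cls (g t))"
        unfolding generator_graph_def using Fp Fg by blast
    qed
    define v where "v t = exp (- \<delta> * t) *\<^sub>R p t" for t
    define v' where "v' t = exp (- \<delta> * t) *\<^sub>R (g t - \<delta> *\<^sub>R p t)" for t
    define w where "w t = exp (- \<delta> * t) *\<^sub>R graph (rep (p t))" for t
    have v_deriv: "(v has_vector_derivative v' t) (at t within {0..})" if t: "t \<ge> 0" for t
    proof -
      have "((\<lambda>t. exp (- \<delta> * t)) has_real_derivative - \<delta> * exp (- \<delta> * t)) (at t within {0..})"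
        by (auto intro!: derivative_eq_intros)
      note D = has_vector_derivative_scaleR[OF this p_deriv[OF t]]
      have eq: "exp (- \<delta> * t) *\<^sub>R g t + (- \<delta> * exp (- \<delta> * t)) *\<^sub>R p t = v' t"
        by (simp add: v'_def scaleR_diff_right mult.commute)
      show ?thesis using D unfolding eq v_def[abs_def] .
    qed
    have fst_w: "fst (w t) = v t" for t by (simp add: w_def v_def graph_def)
    have VV0: "0 \<in> VV" by (rule subspace_0[OF subspace_VV])
    have w_VV: "w t \<in> VV" if t: "t \<ge> 0" for t
      unfolding w_def using A_generator(1)[OF p_orth[OF t] conjunct1[OF gen_t[OF t]] conjunct2[OF gen_t[OF t]] VV0]
      by (rule subspace_scale[OF subspace_VV])
    have v_weak: "v' t \<bullet> fst u = A (w t) u" if t: "t \<ge> 0" and u: "u \<in> VV" for t u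
    proof -
      have "A (w t) u = exp (- \<delta> * t) * A (graph (rep (p t))) u"
        using linear_scale[OF bounded_linear.linear[OF bounded_linear_A_left], of _ _ u] by (simp add: w_def)
      also have "A (graph (rep (p t))) u = (g t - \<delta> *\<^sub>R p t) \<bullet> fst u"
        by (rule A_generator(2)[OF p_orth[OF t] conjunct1[OF gen_t[OF t]] conjunct2[OF gen_t[OF t]] u])
      finally show ?thesis by (simp add: v'_def)
    qed
    \<comment> \<open>The average at time 0 deviates from \<open>x\<close> by no more than the orbit
      does on \<open>{0..h}\<close>, which the choice of \<open>h\<close> keeps below
      \<open>e\<close>.\<close>
    have v0: "norm (v 0 - x) \<le> e"
    proof -
      have c: "continuous_on {0..h} (\<lambda>s. T s x)" by (rule continuous_on_subset[OF orbit]) auto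
      have "norm (integral {0..h} (\<lambda>s. T s x - x)) \<le> e * (h - 0)"
      proof (rule integral_bound)
        show "continuous_on {0..h} (\<lambda>s. T s x - x)" by (intro continuous_intros c)
        show "norm (T s x - x) \<le> e" if "s \<in> {0..h}" for s
        proof (cases "s = 0")
          case False
          then show ?thesis using d(2)[of s] that h by (simp add: dist_norm)
        qed (use T0x e in simp)
      qed (use h in simp)
      moreover have "integral {0..h} (\<lambda>s. T s x - x) = h *\<^sub>R (v 0 - x)"
      proof -
        have "integral {0..h} (\<lambda>s. T s x - x) = integral {0..h} (\<lambda>s. T s x) - integral {0..h} (\<lambda>s. x)"
          by (intro Henstock_Kurzweil_Integration.integral_diff integrable_continuous_interval c) simp
        then show ?thesis using h by (simp add: v_def p_def scaleR_diff_right)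
      qed
      ultimately have "h * norm (v 0 - x) \<le> h * e" using h by (simp add: mult.commute)
      then show ?thesis using h by simp
    qed
    have v_bound: "norm (v t) \<le> K * exp (- (\<delta> + \<omega>) * t) * (norm x + e)" if t: "t \<ge> 0" for t
    proof -
      have "norm (p 0) \<le> norm x + e"
        using v0 norm_triangle_sub[of "p 0" x] by (simp add: v_def)
      moreover have "norm (p t) \<le> K * exp (- \<omega> * t) * norm (p 0)"
        using T_bound[OF t p_orth[of 0]] p_eq[OF t, of 0] by simp
      moreover have "0 \<le> K * exp (- \<omega> * t)" using K by simp
      ultimately have "norm (p t) \<le> K * exp (- \<omega> * t) * (norm x + e)"
        by (meson mult_left_mono order_trans)
      then have "exp (- \<delta> * t) * norm (p t) \<le> exp (- \<delta> * t) * (K * exp (- \<omega> * t) * (norm x + e))"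
        by (rule mult_left_mono) simp
      also have "\<dots> = K * (exp (- \<delta> * t) * exp (- \<omega> * t)) * (norm x + e)" by (simp only: mult_ac)
      also have "exp (- \<delta> * t) * exp (- \<omega> * t) = exp (- (\<delta> + \<omega>) * t)"
      proof -
        have "- (\<delta> + \<omega>) * t = - \<delta> * t + - \<omega> * t" by (simp add: algebra_simps)
        then show ?thesis by (simp only: exp_add)
      qed
      finally show ?thesis by (simp add: v_def)
    qed
    show ?thesis
      by (intro exI[of _ v] exI[of _ v'] exI[of _ w] conjI allI impI ballI v0)
        (assumption | rule v_deriv w_VV fst_w v_weak v_bound)+
  qed
  show thesis by (rule that[OF K \<omega> main])
qed

end

section \<open>Decay of the nonlinear closed-loop solutions\<close>

lemma H1_inner_graph:
  assumes "f \<in> H1" "g \<in> H1"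
  shows "H1_inner f g = graph f \<bullet> graph g"
proof -
  note F = H1_D[OF assms(1)] and G = H1_D[OF assms(2)]
  have i: "integrable torus (\<lambda>x. weak_grad f x \<bullet> weak_grad g x)"
    unfolding inner_vec_def inner_real_def
    by (intro Bochner_Integration.integrable_sum L2_integrable_mult F(3) G(3))
  have "(\<integral>x. weak_grad f x \<bullet> weak_grad g x \<partial>torus) = (\<Sum>i\<in>UNIV. cls (\<lambda>x. weak_grad f x $ i) \<bullet> cls (\<lambda>x. weak_grad g x $ i))"
    unfolding inner_vec_def inner_real_def cls_inner[OF F(3) G(3)]
    by (intro Bochner_Integration.integral_sum L2_integrable_mult F(3) G(3))
  then show ?thesis
    unfolding H1_inner_def Bochner_Integration.integral_add[OF L2_integrable_mult[OF F(1) G(1)] i]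
    by (simp add: graph_def grad_cls_def inner_vec_l2 cls_inner[OF F(1) G(1)])
qed

lemma H1_norm_graph: "f \<in> H1 \<Longrightarrow> H1_norm f = norm (graph f)"
  by (simp add: H1_norm_def H1_inner_graph norm_eq_sqrt_inner)

text \<open>Modifying a function on a null set preserves measurability because Lebesgue measure is
  complete.\<close>

lemma borel_measurable_halfline_AE:
  fixes f g :: "real \<Rightarrow> real"
  assumes f: "f \<in> borel_measurable halfline" and eq: "AE t in halfline. f t = g t"
  shows "g \<in> borel_measurable halfline"
proof -
  have S: "{0 :: real<..} \<inter> space lebesgue \<in> sets lebesgue" by simp
  have "(\<lambda>t. indicator {0<..} t *\<^sub>R f t) \<in> borel_measurable lebesgue"
    using f borel_measurable_restrict_space_iff[OF S, of f] by simp
  moreover have "AE t in lebesgue. indicator {0<..} t *\<^sub>R f t = indicator {0<..} t *\<^sub>R g t"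
    using eq by (simp add: AE_restrict_space_iff) (elim eventually_mono, simp add: indicator_def)
  ultimately have "(\<lambda>t. indicator {0<..} t *\<^sub>R g t) \<in> borel_measurable lebesgue"
    by (rule borel_measurable_AE)
  then show ?thesis using borel_measurable_restrict_space_iff[OF S, of g] by simp
qed

lemma integrable_halfline_imp_Icc:
  fixes f :: "real \<Rightarrow> real"
  assumes "integrable halfline f" "0 < a"
  shows "integrable (lebesgue_on {a..b}) f"
proof -
  have "set_integrable lebesgue {0<..} f"
    using assms(1) by (simp add: set_integrable_def integrable_restrict_space)
  then have "set_integrable lebesgue {a..b} f"
    by (rule set_integrable_subset) (use assms(2) in auto)
  then show ?thesis by (simp add: set_integrable_def integrable_restrict_space)
qed

lemma weak_time_deriv_cong:
  assumes w: "weak_time_deriv f g" and eq: "\<And>t. t > 0 \<Longrightarrow> f t = f' t"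
  shows "weak_time_deriv f' g"
proof -
  have int: "integrable halfline (\<lambda>t. f t * h t) = integrable halfline (\<lambda>t. f' t * h t)"
    "(\<integral>t. f t * h t \<partial>halfline) = (\<integral>t. f' t * h t \<partial>halfline)" for h
    by (intro Bochner_Integration.integrable_cong Bochner_Integration.integral_cong refl; simp add: space_restrict_space eq)+
  show ?thesis using w unfolding weak_time_deriv_def int .
qed

lemma has_weak_div_weak_div: "has_weak_div F g \<Longrightarrow> has_weak_div F (weak_div F)"
  unfolding weak_div_def by (rule someI[of "has_weak_div F"])

context closed_loop_system
begin

lemma rep_VV:
  assumes "u \<in> VV"
  shows "rep (fst u) \<in> H1" "graph (rep (fst u)) = u"
proof -
  obtain f where f: "f \<in> H1" "u = graph f" using assms unfolding VV_def H1_sharp_iff by (auto simp: H1_sharp_iff)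
  have "AE x in torus. f x = rep (fst u) x"
    using rep_cls[OF H1_D(1)[OF f(1)]] unfolding f(2) graph_def fst_conv by eventually_elim simp
  note C = H1_cong_AE[OF f(1) this rep_L2]
  show "rep (fst u) \<in> H1" by (rule C(1))
  show "graph (rep (fst u)) = u" using C(2) by (simp only: f(2))
qed

text \<open>All constants of the abstract theorem depend on the system only and are fixed before a
  solution is considered. What remains is to see that the state divided by the root of \<rho> is a
  weak solution in the abstract sense.\<close>

lemma closed_loop_solution_decay:
  assumes \<delta>: "0 < \<delta>"
    and gen: "generates_exp_stable_semigroup \<rho> (dom_L \<rho>) (closed_loop \<sigma> V W \<rho> \<delta> m \<alpha> Ric)"
  shows "\<exists>\<epsilon>>0. \<exists>C>0. \<forall>y\<^sub>0 y. closed_loop_solution \<sigma> V W \<rho> \<delta> m \<alpha> Ric y\<^sub>0 y \<and> X_norm \<rho> (y 0) \<le> \<epsilon> \<longrightarrow>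
           (\<forall>t\<ge>0. X_norm \<rho> (y t) \<le> C * exp (- \<delta> * t))"
proof -
  obtain B where B: "0 \<le> B" "\<And>u v. \<bar>A u v\<bar> \<le> B * norm u * norm v" using A_bound by blast
  obtain \<kappa> where \<kappa>: "0 \<le> \<kappa>" "\<And>u. A u u \<le> - (\<sigma> / 2) * (norm u)\<^sup>2 + \<kappa> * (norm (fst u))\<^sup>2" using A_garding by blast
  obtain N where N: "0 \<le> N" "\<And>y \<phi>. y \<in> X0 \<rho> \<Longrightarrow> y \<in> H1 \<Longrightarrow> \<phi> \<in> H1 \<Longrightarrow>
    \<bar>rhs \<sigma> V W \<rho> m \<alpha> (\<lambda>j. - op_B_adj \<rho> m \<alpha> (Ric y) j) y \<phi> - A (graph (\<lambda>x. ir x * y x)) (graph (\<lambda>x. sr x * \<phi> x))\<bar>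
      \<le> N * (norm (to_cls y))\<^sup>2 * norm (graph (\<lambda>x. sr x * \<phi> x))" using nonlinear_bound by blast
  interpret E: evolution VV fst A "\<sigma> / 2" \<kappa> B N
  proof (rule evolution.intro)
    show "subspace VV" "closed VV" by (rule subspace_VV, rule closed_VV)
    show "A (x + y) u = A x u + A y u" for x y u
      using linear_add[OF bounded_linear.linear[OF bounded_linear_A_left], of x y u] .
    show "A (r *\<^sub>R x) u = r * A x u" for r x u
      using linear_scale[OF bounded_linear.linear[OF bounded_linear_A_left], of r x u] by simp
  qed (use B \<kappa> N \<sigma> in \<open>simp_all add: bounded_linear_fst\<close>)
  obtain K \<omega> where K: "0 \<le> K" "0 < \<omega>" and dense: "\<And>x e. x \<bullet> cls sr = 0 \<Longrightarrow> 0 < e \<Longrightarrow> \<exists>v v' w.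
      (\<forall>t\<ge>0. (v has_vector_derivative v' t) (at t within {0..}) \<and> w t \<in> VV \<and> fst (w t) = v t \<and> (\<forall>u\<in>VV. v' t \<bullet> fst u = A (w t) u))
      \<and> norm (v 0 - x) \<le> e \<and> (\<forall>t\<ge>0. norm (v t) \<le> K * exp (- (\<delta> + \<omega>) * t) * (norm x + e))"
    by (rule strong_solutions_dense[OF gen]) blast
  have weak: "E.weak_solution (\<lambda>t. to_cls (y t))" if sol: "closed_loop_solution \<sigma> V W \<rho> \<delta> m \<alpha> Ric y\<^sub>0 y" for y\<^sub>0 y
  proof -
    \<comment> \<open>The solution class speaks about the state weighted by
      \<open>exp (\<delta> * t)\<close>; its energy bound passes to the unweighted state because
      \<open>exp (- \<delta> * t)\<close> is at most 1 for positive times.\<close>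
    define Y where "Y t x = exp (\<delta> * t) * y t x / sqrt (\<rho> x)" for t x
    have X: "\<And>t. t \<ge> 0 \<Longrightarrow> y t \<in> X0 \<rho>"
      and cont: "\<And>s. s \<ge> 0 \<Longrightarrow> ((\<lambda>t. X_norm \<rho> (\<lambda>x. y t x - y s x)) \<longlongrightarrow> 0) (at s within {0..})"
      and cl: "L2_time_H1_sharp \<rho> Y"
      and eqn: "\<And>\<phi>. \<phi> \<in> H1 \<Longrightarrow> weak_time_deriv (\<lambda>t. \<integral>x. y t x * \<phi> x \<partial>torus)
        (\<lambda>t. rhs \<sigma> V W \<rho> m \<alpha> (\<lambda>j. - op_B_adj \<rho> m \<alpha> (Ric (y t)) j) (y t) \<phi>)"
      using sol unfolding closed_loop_solution_def solution_class_def Y_def[abs_def] by blast+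
    have Y1: "AE t in halfline. Y t \<in> H1_sharp \<rho>"
      and Y2: "\<And>\<phi>. \<phi> \<in> H1_sharp \<rho> \<Longrightarrow> (\<lambda>t. H1_inner (Y t) \<phi>) \<in> borel_measurable halfline"
      and Y3: "integrable halfline (\<lambda>t. (H1_norm (Y t))\<^sup>2)"
      using cl unfolding L2_time_H1_sharp_def by blast+
    define w where "w t = graph (\<lambda>x. ir x * y t x)" for t
    \<comment> \<open>\<open>1 + x\<^sup>2\<close> dominates \<open>x\<close>, so square
      integrability in time gives an integrable majorant on bounded intervals.\<close>
    define n where "n t = 1 + (H1_norm (Y t))\<^sup>2" for t
    have yY: "(\<lambda>x. ir x * y t x) = (\<lambda>x. exp (- \<delta> * t) * Y t x)" for t
    proof
      fix x
      have "exp (- \<delta> * t) * Y t x = (exp (- \<delta> * t) * exp (\<delta> * t)) * (y t x / sqrt (\<rho> x))" by (simp add: Y_def)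
      also have "exp (- \<delta> * t) * exp (\<delta> * t) = 1" by (simp flip: exp_add)
      finally show "ir x * y t x = exp (- \<delta> * t) * Y t x" by (simp add: ir_def divide_inverse mult.commute)
    qed
    have wY: "w t = exp (- \<delta> * t) *\<^sub>R graph (Y t)" "w t \<in> VV" if "Y t \<in> H1_sharp \<rho>" for t
    proof -
      have YH: "Y t \<in> H1" using that by (simp add: H1_sharp_iff)
      show eq: "w t = exp (- \<delta> * t) *\<^sub>R graph (Y t)" unfolding w_def yY by (rule graph_scale(2)[OF YH])
      show "w t \<in> VV" unfolding eq using that by (intro subspace_scale[OF subspace_VV]) (simp add: VV_def)
    qed
    have fst_w: "fst (w t) = to_cls (y t)" for t by (simp add: w_def graph_def to_cls_def)
    have pos: "AE t in halfline. t > 0" by (rule AE_I2) (simp add: space_restrict_space)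
    have "continuous_on {0..} (\<lambda>t. to_cls (y t))"
      unfolding continuous_on_def
    proof
      fix s :: real assume s: "s \<in> {0..}"
      have "\<forall>\<^sub>F t in at s within {0..}. X_norm \<rho> (\<lambda>x. y t x - y s x) = norm (to_cls (y t) - to_cls (y s))"
        unfolding eventually_at_filter
      proof (rule always_eventually, intro allI impI)
        fix t :: real assume "t \<in> {0..}"
        then have "y t \<in> L2" "y s \<in> L2" using X[THEN X0_L2] s by auto
        then show "X_norm \<rho> (\<lambda>x. y t x - y s x) = norm (to_cls (y t) - to_cls (y s))"
          using norm_to_cls[OF L2_diff[of "y t" "y s"]] by (simp add: to_cls_diff)
      qed
      then have "((\<lambda>t. norm (to_cls (y t) - to_cls (y s))) \<longlongrightarrow> 0) (at s within {0..})"
        by (rule tendsto_cong[THEN iffD1]) (use cont[of s] s in simp)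
      then show "((\<lambda>t. to_cls (y t)) \<longlongrightarrow> to_cls (y s)) (at s within {0..})"
        by (rule LIM_zero_cancel[OF tendsto_norm_zero_cancel])
    qed
    moreover have "AE s in halfline. w s \<in> VV \<and> fst (w s) = to_cls (y s) \<and> norm (w s) \<le> n s"
      using Y1 pos
    proof eventually_elim
      case (elim s)
      have YH: "Y s \<in> H1" using elim(1) by (simp add: H1_sharp_iff)
      have "norm (w s) = exp (- \<delta> * s) * norm (graph (Y s))" by (simp add: wY(1)[OF elim(1)])
      also have "\<dots> \<le> 1 * norm (graph (Y s))" using \<delta> elim(2) by (intro mult_right_mono) simp_all
      also have "\<dots> \<le> 1 + (norm (graph (Y s)))\<^sup>2"
      proof -
        have "0 \<le> (norm (graph (Y s)) - 1)\<^sup>2" by simp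
        then have "2 * norm (graph (Y s)) \<le> 1 + (norm (graph (Y s)))\<^sup>2" by (simp add: power2_diff)
        then show ?thesis using norm_ge_zero[of "graph (Y s)"] by linarith
      qed
      finally show ?case using wY(2)[OF elim(1)] fst_w by (simp add: n_def H1_norm_graph[OF YH])
    qed
    moreover have "\<forall>u\<in>VV. (\<lambda>s. u \<bullet> w s) \<in> borel_measurable halfline"
    proof
      fix u assume "u \<in> VV"
      then obtain \<zeta> where z: "\<zeta> \<in> H1_sharp \<rho>" "u = graph \<zeta>" by (auto simp: VV_def)
      have "(\<lambda>s :: real. exp (- \<delta> * s)) \<in> borel_measurable halfline"
        by (intro measurable_restrict_space1 measurable_completion) simp
      then have "(\<lambda>s. exp (- \<delta> * s) * H1_inner (Y s) \<zeta>) \<in> borel_measurable halfline"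
        using Y2[OF z(1)] by (rule borel_measurable_times)
      moreover have "AE s in halfline. exp (- \<delta> * s) * H1_inner (Y s) \<zeta> = u \<bullet> w s"
        using Y1
      proof eventually_elim
        case (elim s)
        have "Y s \<in> H1" "\<zeta> \<in> H1" using elim z(1) by (simp_all add: H1_sharp_iff)
        then show ?case by (simp add: wY(1)[OF elim] z(2) H1_inner_graph inner_commute)
      qed
      ultimately show "(\<lambda>s. u \<bullet> w s) \<in> borel_measurable halfline" by (rule borel_measurable_halfline_AE)
    qed
    moreover have "\<forall>a b. 0 < a \<longrightarrow> integrable (lebesgue_on {a..b}) n"
    proof (intro allI impI)
      fix a b :: real assume a: "0 < a"
      have "integrable (lebesgue_on {a..b}) (\<lambda>t. (H1_norm (Y t))\<^sup>2)" by (rule integrable_halfline_imp_Icc[OF Y3 a])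
      moreover have "integrable (lebesgue_on {a..b}) (\<lambda>t. 1 :: real)" by (intro continuous_imp_integrable_real) auto
      ultimately show "integrable (lebesgue_on {a..b}) n" unfolding n_def[abs_def]
        by (intro Bochner_Integration.integrable_add)
    qed
    moreover have "\<exists>g. \<forall>u\<in>VV. weak_time_deriv (\<lambda>t. to_cls (y t) \<bullet> fst u) (g u) \<and>
        (AE s in halfline. \<bar>g u s - A (w s) u\<bar> \<le> N * (norm (to_cls (y s)))\<^sup>2 * norm u)"
    proof (intro exI ballI)
      fix u assume u: "u \<in> VV"
      \<comment> \<open>The H1 test function that the transformation by \<open>sr\<close> carries to
        the given element \<open>u\<close> of the energy space.\<close>
      define \<phi> where "\<phi> x = ir x * rep (fst u) x" for x
      have \<phi>: "\<phi> \<in> H1" using H1_mult_C1(1)[OF rep_VV(1)[OF u] ir_C1 ir_periodic] by (simp add: \<phi>_def[abs_def])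
      have sphi: "(\<lambda>x. sr x * \<phi> x) = rep (fst u)" by (simp add: \<phi>_def fun_eq_iff)
      let ?r = "\<lambda>t. rhs \<sigma> V W \<rho> m \<alpha> (\<lambda>j. - op_B_adj \<rho> m \<alpha> (Ric (y t)) j) (y t) \<phi>"
      have "weak_time_deriv (\<lambda>t. to_cls (y t) \<bullet> fst u) ?r"
      proof (rule weak_time_deriv_cong[OF eqn[OF \<phi>]])
        fix t :: real assume "t > 0"
        then have "y t \<in> L2" using X[THEN X0_L2] by simp
        then show "(\<integral>x. y t x * \<phi> x \<partial>torus) = to_cls (y t) \<bullet> fst u"
          using integral_to_cls[OF _ H1_D(1)[OF \<phi>]] by (simp add: sphi)
      qed
      moreover have "AE s in halfline. \<bar>?r s - A (w s) u\<bar> \<le> N * (norm (to_cls (y s)))\<^sup>2 * norm u"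
        using Y1 pos
      proof eventually_elim
        case (elim s)
        have YH: "Y s \<in> H1" using elim(1) by (simp add: H1_sharp_iff)
        have "y s = (\<lambda>x. sr x * (ir x * y s x))" by simp
        also have "\<dots> = (\<lambda>x. sr x * (exp (- \<delta> * s) * Y s x))" using yY[of s] by (simp add: fun_eq_iff)
        finally have "y s \<in> H1" using H1_mult_C1(1)[OF graph_scale(1)[OF YH] sr_C1 sr_periodic] by metis
        from N(2)[OF X this \<phi>] elim(2) show ?case
          unfolding sphi rep_VV(2)[OF u] w_def by simp
      qed
      ultimately show "weak_time_deriv (\<lambda>t. to_cls (y t) \<bullet> fst u) ((\<lambda>u t. rhs \<sigma> V W \<rho> m \<alpha> (\<lambda>j. - op_B_adj \<rho> m \<alpha> (Ric (y t)) j) (y t) (\<lambda>x. ir x * rep (fst u) x)) u) \<and>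
          (AE s in halfline. \<bar>(\<lambda>u t. rhs \<sigma> V W \<rho> m \<alpha> (\<lambda>j. - op_B_adj \<rho> m \<alpha> (Ric (y t)) j) (y t) (\<lambda>x. ir x * rep (fst u) x)) u s - A (w s) u\<bar>
            \<le> N * (norm (to_cls (y s)))\<^sup>2 * norm u)"
        by (simp add: \<phi>_def[abs_def])
    qed
    ultimately show ?thesis unfolding E.weak_solution_def by blast
  qed
  \<comment> \<open>Linear comparison orbits are available only for data orthogonal to
    \<open>sr\<close>; the zero mean of \<open>y t\<close> keeps the solution in this set at all
    times.\<close>
  have "\<exists>\<epsilon>>0. \<exists>C>0. \<forall>z. E.weak_solution z \<and> (\<forall>t\<ge>0. z t \<in> {a. a \<bullet> cls sr = 0}) \<and> norm (z 0) \<le> \<epsilon> \<longrightarrow>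
           (\<forall>t\<ge>0. norm (z t) \<le> C * exp (- \<delta> * t))"
  proof (rule E.exponential_decay[OF \<delta>, of "\<delta> + \<omega>" K])
    fix x and e :: real assume x: "x \<in> {a. a \<bullet> cls sr = 0}" and e: "0 < e"
    obtain v v' w where "\<forall>t\<ge>0. (v has_vector_derivative v' t) (at t within {0..}) \<and> w t \<in> VV \<and> fst (w t) = v t \<and> (\<forall>u\<in>VV. v' t \<bullet> fst u = A (w t) u)"
      and v: "norm (v 0 - x) \<le> e" "\<forall>t\<ge>0. norm (v t) \<le> K * exp (- (\<delta> + \<omega>) * t) * (norm x + e)"
      using dense[of x e] x e by blast
    then have "E.strong_solution 0 v" unfolding E.strong_solution_def by blast
    with v show "\<exists>v. E.strong_solution 0 v \<and> norm (v 0 - x) \<le> e \<and> (\<forall>t\<ge>0. norm (v t) \<le> K * exp (- (\<delta> + \<omega>) * t) * (norm x + e))"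
      by blast
  qed (use K in simp_all)
  then obtain \<epsilon> C where eC: "\<epsilon> > 0" "C > 0"
    "\<And>z t. E.weak_solution z \<Longrightarrow> (\<forall>t\<ge>0. z t \<in> {a. a \<bullet> cls sr = 0}) \<Longrightarrow> norm (z 0) \<le> \<epsilon> \<Longrightarrow> t \<ge> 0 \<Longrightarrow> norm (z t) \<le> C * exp (- \<delta> * t)"
    by blast
  have "X_norm \<rho> (y t) \<le> C * exp (- \<delta> * t)"
    if sol: "closed_loop_solution \<sigma> V W \<rho> \<delta> m \<alpha> Ric y\<^sub>0 y" and small: "X_norm \<rho> (y 0) \<le> \<epsilon>" and t: "t \<ge> 0" for y\<^sub>0 y t
  proof -
    have X: "\<And>t. t \<ge> 0 \<Longrightarrow> y t \<in> X0 \<rho>" using sol unfolding closed_loop_solution_def by blast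
    have "norm (to_cls (y t)) \<le> C * exp (- \<delta> * t)"
      by (rule eC(3)[OF weak[OF sol] _ _ t]) (use X small in \<open>simp_all add: to_cls_orth norm_to_cls X0_L2\<close>)
    then show ?thesis by (simp add: norm_to_cls[OF X0_L2[OF X[OF t]]])
  qed
  with eC(1,2) show ?thesis by blast
qed

end

theorem corollary3p7:
  fixes \<sigma> \<delta> \<epsilon>' p :: real
    and V W \<mu>bar :: "real ^ 'd \<Rightarrow> real"
    and m :: nat
    and l :: "nat \<Rightarrow> complex"
    and \<psi> \<alpha> :: "nat \<Rightarrow> real ^ 'd \<Rightarrow> real"
    and M Ric :: "'d operator"
  assumes "\<sigma> > 0" and "\<delta> > 0"
    and "\<epsilon>' > 0" and "p = max (real CARD('d)) (2 + \<epsilon>')"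
    and "V \<in> W1 Linf \<inter> W2 (Lp p)" and "C2 V"
    and "W \<in> W2 Linf" and "C2 W" and "even_each_coordinate W"
    and "H_stable W \<or> esssup torus (\<lambda>x. ereal \<bar>W x\<bar>) < ereal \<sigma>"
    and "stationary_state \<sigma> V W \<mu>bar"
    and "all_eigenpairs \<sigma> V W \<mu>bar \<delta> m l \<psi>"
    and "\<forall>j<m. \<alpha> j \<in> W1 Linf \<inter> W2 (Lp p) \<and>
           has_weak_div (\<lambda>x. \<mu>bar x *\<^sub>R weak_grad (\<alpha> j) x) (\<psi> j)"
    and "bounded_operator \<mu>bar M" and "self_adjoint \<mu>bar M" and "positive_definite \<mu>bar M"
    and "riccati_solution \<sigma> V W \<mu>bar \<delta> m \<alpha> M Ric"
    and "\<forall>P. riccati_solution \<sigma> V W \<mu>bar \<delta> m \<alpha> M P \<longrightarrow>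
           (\<forall>f \<in> X0 \<mu>bar. AE x in torus. P f x = Ric f x)"
    and "generates_exp_stable_semigroup \<mu>bar (dom_L \<mu>bar) (closed_loop \<sigma> V W \<mu>bar \<delta> m \<alpha> Ric)"
  shows "\<exists>\<epsilon>>0. \<exists>C>0. \<forall>\<mu>\<^sub>0 y.
           probability_density \<mu>\<^sub>0 \<and>
           closed_loop_solution \<sigma> V W \<mu>bar \<delta> m \<alpha> Ric (proj \<mu>bar \<mu>\<^sub>0) y \<and>
           X_norm \<mu>bar (y 0) \<le> \<epsilon> \<longrightarrow>
           (\<forall>t\<ge>0. X_norm \<mu>bar (y t) \<le> C * exp (- \<delta> * t))"
proof -
  interpret mckean_vlasov \<sigma> V W \<mu>bar
  proof
    show "periodic V" "periodic W" using assms(5,7) by (simp_all add: W1_def W2_def Linf_def)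
  qed (use assms in simp_all)
  interpret closed_loop_system \<sigma> V W \<mu>bar m \<alpha> Ric
  proof
    show "bounded_operator \<mu>bar Ric" using assms(17) by (simp add: riccati_solution_def)
    fix j assume j: "j < m"
    have \<alpha>j: "\<alpha> j \<in> W1 Linf" and d: "has_weak_div (\<lambda>x. \<mu>bar x *\<^sub>R weak_grad (\<alpha> j) x) (\<psi> j)"
      using assms(13)[rule_format, OF j] by simp_all
    \<comment> \<open>The hypothesis on \<alpha> gives some bounded weak derivatives; uniqueness
      transfers the bound to the representative chosen by \<open>weak_grad\<close>.\<close>
    have "\<forall>i. \<exists>g. g \<in> Linf \<and> has_weak_partial i (\<alpha> j) g" using \<alpha>j unfolding W1_def by blast
    from choice[OF this] obtain g where g: "\<And>i. g i \<in> Linf" "\<And>i. has_weak_partial i (\<alpha> j) (g i)" by blast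
    show "multiplier (\<lambda>x. weak_grad (\<alpha> j) x $ i)" for i
    proof -
      obtain K where K: "AE x in torus. \<bar>g i x\<bar> \<le> K" using Linf_bounded[OF g(1)[of i]] unfolding multiplier_def by blast
      have "AE x in torus. \<bar>weak_grad (\<alpha> j) x $ i\<bar> \<le> K"
        using K weak_grad_AE_eq[OF g(2)] by eventually_elim simp
      moreover have "(\<lambda>x. weak_grad (\<alpha> j) x $ i) \<in> L1"
        by (rule has_weak_partialD(2)[OF weak_grad_partial[OF g(2)]])
      ultimately show ?thesis unfolding multiplier_def L1_def by blast
    qed
    \<comment> \<open>The control fields agree with the eigenfunctions \<psi> up to null sets, and
      these are in L2 as elements of the domain of the linearised operator.\<close>
    have "\<forall>j<m. eigenpair \<sigma> V W \<mu>bar (l j) (\<lambda>x. complex_of_real (\<psi> j x)) \<and> - \<delta> \<le> Re (l j)"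
      using assms(12) unfolding all_eigenpairs_def by (rule conjunct1)
    then have "eigenpair \<sigma> V W \<mu>bar (l j) (\<lambda>x. complex_of_real (\<psi> j x))" using j by simp
    then have "\<psi> j \<in> L2" by (simp add: eigenpair_def dom_L_def W2_def)
    moreover have "AE x in torus. \<psi> j x = weak_div (\<lambda>z. \<mu>bar z *\<^sub>R weak_grad (\<alpha> j) z) x"
      using weak_div_AE_eq[OF d] by eventually_elim simp
    moreover have "weak_div (\<lambda>z. \<mu>bar z *\<^sub>R weak_grad (\<alpha> j) z) \<in> L1"
      by (rule has_weak_divD(2)[OF has_weak_div_weak_div[OF d]])
    then have "periodic (weak_div (\<lambda>z. \<mu>bar z *\<^sub>R weak_grad (\<alpha> j) z))"
      "weak_div (\<lambda>z. \<mu>bar z *\<^sub>R weak_grad (\<alpha> j) z) \<in> borel_measurable borel"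
      unfolding L1_def by blast+
    ultimately show "weak_div (\<lambda>z. \<mu>bar z *\<^sub>R weak_grad (\<alpha> j) z) \<in> L2" by (rule L2_cong_AE)
  qed
  \<comment> \<open>A logical weakening that keeps \<epsilon> and \<open>C\<close> in front of the
    quantifiers over initial densities and solutions.\<close>
  have *: "\<exists>\<epsilon>>0. \<exists>C>0. \<forall>x y. Q x y \<and> P x y \<and> R \<epsilon> y \<longrightarrow> S C y"
    if "\<exists>\<epsilon>>0. \<exists>C>0. \<forall>y\<^sub>0 y. P' y\<^sub>0 y \<and> R \<epsilon> y \<longrightarrow> S C y" "\<And>x y. P x y \<Longrightarrow> P' (g x) y"
    for P Q :: "'x \<Rightarrow> 'y \<Rightarrow> bool" and P' :: "'z \<Rightarrow> 'y \<Rightarrow> bool" and R S :: "real \<Rightarrow> 'y \<Rightarrow> bool" and g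
    using that by blast
  show ?thesis by (rule *[OF closed_loop_solution_decay[OF assms(2,19)]])
qed

end
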